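(* Let $(R,* )$ be a ring with involution in one of the following cases: (i) $R$ is a $*$-local ring; or (ii) $R$ is the ring of adèles $\mathbb{A}_F$ of a global field $F$, with trivial involution; or (iii) $R = \mathbb{A}_E$, where $E/F$ is a separable quadratic extension of global fields, with the involution induced by the non-trivial element of $\mathrm{Gal}(E/F)$; or (iv) $R = \mathbb{A}_{\mathbb{H}}$, where $\mathbb{H}$ is a quaternion algebra over a global field $F$ with $\mathrm{char}(F) = 2$. Let $n\ge 1$ and let $A = \mathrm{M}(n,R)$, with the involution $(a_{ij})^* = (a_{ji}^* )$ induced from that of $R$. Then the group $\mathrm{SL}_*(2,A)$ is generated by the Bruhat elements $h_a$ ($a\in A^\times$), $u_b$ ($b\in A^{\mathrm{sym}}$) and $\omega$.
   Context: All rings are associative with identity, not necessarily commutative. A ring with involution $(R,* )$ is a ring with an anti-automorphism $r\mapsto r^*$ satisfying $(r^* )^*=r$ (the identity map is allowed when $R$ is commutative). For a ring with involution $A$: $A^\times$ is the group of units and $A^{\mathrm{sym}}=\{a\in A: a^*=a\}$. $*$-local rings: a ring is $l$-maximal if every maximal left ideal is a two-sided ideal. An ideal $\mathfrak{a}$ of a ring with involution is stable if $\mathfrak{a}^*=\mathfrak{a}$. A $*$-local ring is an $l$-maximal ring with involution having a unique stable maximal ideal, i.e. a unique ideal that is maximal among proper stable (two-sided) ideals. A global field is a number field or a function field in one variable over a finite field. $\mathbb{A}_F$ is the adèle ring of $F$. In (iii), $\mathbb{A}_E = E\otimes_F\mathbb{A}_F$ has the involution $\alpha\otimes \mathrm{id}$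 with $\alpha$ the non-trivial element of $\mathrm{Gal}(E/F)$. In (iv), a quaternion algebra $\mathbb{H}$ over $F$ is either $\mathrm{M}(2,F)$ or a (4-dimensional central) quaternion division algebra, with its quaternionic (canonical) involution; in the split case $\mathbb{H}=\mathrm{M}(2,F)$ it is $h^*=Jh^tJ^{-1}$, $J=\begin{pmatrix}0&1\\-1&0\end{pmatrix}$. The adèlic quaternions are $\mathbb{A}_{\mathbb{H}}=\mathbb{H}\otimes_F\mathbb{A}_F$ with the involution obtained from that of $\mathbb{H}$ (at each place $v$, the quaternionic involution of $\mathbb{H}_v=\mathbb{H}\otimes_F F_v$). $\mathrm{SL}_*(2,A)$ is the group of matrices $\begin{pmatrix} a&b\\c&d\end{pmatrix}$ with $a,b,c,d\in A$ such that $ad^*-bc^*=a^*d-c^*b=1$ and $ab^*,\,cd^*,\,a^*c,\,b^*d\in A^{\mathrm{sym}}$. Bruhat elements of $\mathrm{SL}_*(2,A)$: $h_a=\begin{pmatrix}a^*&0\\0&a^{-1}\end{pmatrix}$ for $a\in A^\times$, $u_b=\begin{pmatrix}1&b\\0&1\end{pmatrix}$ for $b\in A^{\mathrm{sym}}$, and $\omega=\begin{pmatrix}0&1\\-1&0\end{pmatrix}$. *)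

theory Defs
  imports "Jordan_Normal_Form.Matrix" "HOL-Algebra.Algebra"
begin

section \<open>Rings with involution\<close>

locale involution_ring = ring R for R (structure) +
  fixes star :: "'a \<Rightarrow> 'a"
  assumes star_closed: "x \<in> carrier R \<Longrightarrow> star x \<in> carrier R"
    and star_add: "\<lbrakk>x \<in> carrier R; y \<in> carrier R\<rbrakk> \<Longrightarrow> star (x \<oplus> y) = star x \<oplus> star y"
    and star_mult: "\<lbrakk>x \<in> carrier R; y \<in> carrier R\<rbrakk> \<Longrightarrow> star (x \<otimes> y) = star y \<otimes> star x"
    and star_star: "x \<in> carrier R \<Longrightarrow> star (star x) = x"

definition sym_elements :: "('a, 'm) ring_scheme \<Rightarrow> ('a \<Rightarrow> 'a) \<Rightarrow> 'a set" where
  "sym_elements R star = {a \<in> carrier R. star a = a}"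

definition involution_ring_iso ::
  "('a, 'm) ring_scheme \<Rightarrow> ('a \<Rightarrow> 'a) \<Rightarrow> ('b, 'n) ring_scheme \<Rightarrow> ('b \<Rightarrow> 'b) \<Rightarrow> bool" where
  "involution_ring_iso R star S star' \<longleftrightarrow>
     (\<exists>\<phi> \<in> ring_iso R S. \<forall>x \<in> carrier R. \<phi> (star x) = star' (\<phi> x))"


section \<open>\<open>*\<close>-local rings\<close>

definition left_ideal :: "'a set \<Rightarrow> ('a, 'm) ring_scheme \<Rightarrow> bool" where
  "left_ideal I R \<longleftrightarrow>
     additive_subgroup I R \<and> (\<forall>x \<in> carrier R. \<forall>a \<in> I. x \<otimes>\<^bsub>R\<^esub> a \<in> I)"

definition maximal_left_ideal :: "'a set \<Rightarrow> ('a, 'm) ring_scheme \<Rightarrow> bool" where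
  "maximal_left_ideal I R \<longleftrightarrow> left_ideal I R \<and> I \<noteq> carrier R \<and>
     (\<forall>J. left_ideal J R \<and> I \<subseteq> J \<longrightarrow> J = I \<or> J = carrier R)"

definition l_maximal :: "('a, 'm) ring_scheme \<Rightarrow> bool" where
  "l_maximal R \<longleftrightarrow> (\<forall>I. maximal_left_ideal I R \<longrightarrow> ideal I R)"

definition stable_ideal :: "'a set \<Rightarrow> ('a, 'm) ring_scheme \<Rightarrow> ('a \<Rightarrow> 'a) \<Rightarrow> bool" where
  "stable_ideal I R star \<longleftrightarrow> ideal I R \<and> star ` I = I"

definition stable_maximal_ideal :: "'a set \<Rightarrow> ('a, 'm) ring_scheme \<Rightarrow> ('a \<Rightarrow> 'a) \<Rightarrow> bool" where
  "stable_maximal_ideal I R star \<longleftrightarrow> stable_ideal I R star \<and> I \<noteq> carrier R \<and>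
     (\<forall>J. stable_ideal J R star \<and> I \<subseteq> J \<longrightarrow> J = I \<or> J = carrier R)"

definition star_local_ring :: "('a, 'm) ring_scheme \<Rightarrow> ('a \<Rightarrow> 'a) \<Rightarrow> bool" where
  "star_local_ring R star \<longleftrightarrow>
     involution_ring R star \<and> l_maximal R \<and> (\<exists>!I. stable_maximal_ideal I R star)"


section \<open>Matrix rings\<close>

text \<open>The ring operations that the type of matrices already carries come from the type class
  operations of the entries; here they have to come from the ring record \<open>R\<close>.\<close>

definition matrix_ring :: "nat \<Rightarrow> ('a, 'm) ring_scheme \<Rightarrow> 'a mat ring" where
  "matrix_ring n R =
     \<lparr>carrier = {a \<in> carrier_mat n n. elements_mat a \<subseteq> carrier R},
      mult = (\<lambda>a b. mat n n (\<lambda>(i, j). \<Oplus>\<^bsub>R\<^esub>k \<in> {..<n}. a $$ (i, k) \<otimes>\<^bsub>R\<^esub> b $$ (k, j))),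
      one = mat n n (\<lambda>(i, j). if i = j then \<one>\<^bsub>R\<^esub> else \<zero>\<^bsub>R\<^esub>),
      ring.zero = mat n n (\<lambda>_. \<zero>\<^bsub>R\<^esub>),
      add = (\<lambda>a b. mat n n (\<lambda>(i, j). a $$ (i, j) \<oplus>\<^bsub>R\<^esub> b $$ (i, j)))\<rparr>"

definition scalar_matrix :: "nat \<Rightarrow> ('a, 'm) ring_scheme \<Rightarrow> 'a \<Rightarrow> 'a mat" where
  "scalar_matrix n R c = mat n n (\<lambda>(i, j). if i = j then c else \<zero>\<^bsub>R\<^esub>)"

definition matrix_star :: "('a \<Rightarrow> 'a) \<Rightarrow> 'a mat \<Rightarrow> 'a mat" where
  "matrix_star star a = map_mat star (transpose_mat a)"

definition mat2 :: "'a \<Rightarrow> 'a \<Rightarrow> 'a \<Rightarrow> 'a \<Rightarrow> 'a mat" where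
  "mat2 a b c d = mat 2 2 (\<lambda>(i, j). if i = 0 then (if j = 0 then a else b)
                                      else (if j = 0 then c else d))"


section \<open>The group \<open>SL\<^sub>*(2,A)\<close> and its Bruhat elements\<close>

definition SL_star :: "('a, 'm) ring_scheme \<Rightarrow> ('a \<Rightarrow> 'a) \<Rightarrow> 'a mat monoid" where
  "SL_star A star =
     \<lparr>carrier = {mat2 a b c d | a b c d.
        {a, b, c, d} \<subseteq> carrier A \<and>
        a \<otimes>\<^bsub>A\<^esub> star d \<ominus>\<^bsub>A\<^esub> b \<otimes>\<^bsub>A\<^esub> star c = \<one>\<^bsub>A\<^esub> \<and>
        star a \<otimes>\<^bsub>A\<^esub> d \<ominus>\<^bsub>A\<^esub> star c \<otimes>\<^bsub>A\<^esub> b = \<one>\<^bsub>A\<^esub> \<and>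
        {a \<otimes>\<^bsub>A\<^esub> star b, c \<otimes>\<^bsub>A\<^esub> star d, star a \<otimes>\<^bsub>A\<^esub> c, star b \<otimes>\<^bsub>A\<^esub> d} \<subseteq> sym_elements A star},
      mult = monoid.mult (matrix_ring 2 A),
      one = monoid.one (matrix_ring 2 A)\<rparr>"

definition bruhat_h :: "('a, 'm) ring_scheme \<Rightarrow> ('a \<Rightarrow> 'a) \<Rightarrow> 'a \<Rightarrow> 'a mat" where
  "bruhat_h A star a = mat2 (star a) \<zero>\<^bsub>A\<^esub> \<zero>\<^bsub>A\<^esub> (inv\<^bsub>A\<^esub> a)"

definition bruhat_u :: "('a, 'm) ring_scheme \<Rightarrow> 'a \<Rightarrow> 'a mat" where
  "bruhat_u A b = mat2 \<one>\<^bsub>A\<^esub> b \<zero>\<^bsub>A\<^esub> \<one>\<^bsub>A\<^esub>"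

definition bruhat_omega :: "('a, 'm) ring_scheme \<Rightarrow> 'a mat" where
  "bruhat_omega A = mat2 \<zero>\<^bsub>A\<^esub> \<one>\<^bsub>A\<^esub> (\<ominus>\<^bsub>A\<^esub> \<one>\<^bsub>A\<^esub>) \<zero>\<^bsub>A\<^esub>"

definition bruhat_elements :: "('a, 'm) ring_scheme \<Rightarrow> ('a \<Rightarrow> 'a) \<Rightarrow> 'a mat set" where
  "bruhat_elements A star =
     bruhat_h A star ` Units A \<union> bruhat_u A ` sym_elements A star \<union> {bruhat_omega A}"


section \<open>Global fields\<close>

definition rat_ring :: "rat ring" where
  "rat_ring = \<lparr>carrier = UNIV, mult = (*), one = 1, ring.zero = 0, add = (+)\<rparr>"

definition number_field :: "('a, 'm) ring_scheme \<Rightarrow> bool" where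
  "number_field F \<longleftrightarrow>
     field F \<and> (\<exists>\<iota> \<in> ring_hom rat_ring F. ring.finite_dimension F (range \<iota>) (carrier F))"

definition finite_function_field :: "('a, 'm) ring_scheme \<Rightarrow> bool" where
  "finite_function_field F \<longleftrightarrow> field F \<and>
     (\<exists>k t. subfield k F \<and> finite k \<and> t \<in> carrier F \<and> ring.transcendental F k t \<and>
            ring.finite_dimension F (generate_field F (insert t k)) (carrier F))"

definition global_field :: "('a, 'm) ring_scheme \<Rightarrow> bool" where
  "global_field F \<longleftrightarrow> number_field F \<or> finite_function_field F"

definition ring_characteristic :: "('a, 'm) ring_scheme \<Rightarrow> nat" where
  "ring_characteristic R = Gcd {k :: nat. add_pow R k \<one>\<^bsub>R\<^esub> = \<zero>\<^bsub>R\<^esub>}"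


section \<open>Places and completions\<close>

definition nontrivial_abs_value :: "('a, 'm) ring_scheme \<Rightarrow> ('a \<Rightarrow> real) \<Rightarrow> bool" where
  "nontrivial_abs_value F a \<longleftrightarrow>
     (\<forall>x \<in> carrier F. a x \<ge> 0 \<and> (a x = 0 \<longleftrightarrow> x = \<zero>\<^bsub>F\<^esub>)) \<and>
     (\<forall>x \<in> carrier F. \<forall>y \<in> carrier F. a (x \<otimes>\<^bsub>F\<^esub> y) = a x * a y) \<and>
     (\<forall>x \<in> carrier F. \<forall>y \<in> carrier F. a (x \<oplus>\<^bsub>F\<^esub> y) \<le> a x + a y) \<and>
     (\<exists>x \<in> carrier F. x \<noteq> \<zero>\<^bsub>F\<^esub> \<and> a x \<noteq> 1)"

definition abs_value_equiv :: "('a, 'm) ring_scheme \<Rightarrow> (('a \<Rightarrow> real) \<times> ('a \<Rightarrow> real)) set" where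
  "abs_value_equiv F = {(a, b). nontrivial_abs_value F a \<and> nontrivial_abs_value F b \<and>
     (\<exists>s > 0. \<forall>x \<in> carrier F. b x = a x powr s)}"

definition places :: "('a, 'm) ring_scheme \<Rightarrow> ('a \<Rightarrow> real) set set" where
  "places F = Collect (nontrivial_abs_value F) // abs_value_equiv F"

text \<open>Everything below that mentions \<open>place_abs v\<close> (nonarchimedean, Cauchy and null sequences, the
  valuation ring) does not depend on the representative chosen.\<close>

definition place_abs :: "('a \<Rightarrow> real) set \<Rightarrow> 'a \<Rightarrow> real" where
  "place_abs v = (SOME a. a \<in> v)"

definition nonarchimedean :: "('a, 'm) ring_scheme \<Rightarrow> ('a \<Rightarrow> real) \<Rightarrow> bool" where
  "nonarchimedean F a \<longleftrightarrow>
     (\<forall>x \<in> carrier F. \<forall>y \<in> carrier F. a (x \<oplus>\<^bsub>F\<^esub> y) \<le> max (a x) (a y))"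

definition cauchy_ring :: "('a, 'm) ring_scheme \<Rightarrow> ('a \<Rightarrow> real) \<Rightarrow> (nat \<Rightarrow> 'a) ring" where
  "cauchy_ring F a =
     \<lparr>carrier = {s. range s \<subseteq> carrier F \<and>
        (\<forall>\<epsilon> > 0. \<exists>N. \<forall>m \<ge> N. \<forall>n \<ge> N. a (s m \<ominus>\<^bsub>F\<^esub> s n) < \<epsilon>)},
      mult = (\<lambda>s t n. s n \<otimes>\<^bsub>F\<^esub> t n),
      one = (\<lambda>_. \<one>\<^bsub>F\<^esub>),
      ring.zero = (\<lambda>_. \<zero>\<^bsub>F\<^esub>),
      add = (\<lambda>s t n. s n \<oplus>\<^bsub>F\<^esub> t n)\<rparr>"

definition null_sequences :: "('a, 'm) ring_scheme \<Rightarrow> ('a \<Rightarrow> real) \<Rightarrow> (nat \<Rightarrow> 'a) set" where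
  "null_sequences F a = {s \<in> carrier (cauchy_ring F a). (\<lambda>n. a (s n)) \<longlonglongrightarrow> 0}"

definition completion :: "('a, 'm) ring_scheme \<Rightarrow> ('a \<Rightarrow> real) \<Rightarrow> (nat \<Rightarrow> 'a) set ring" where
  "completion F a = cauchy_ring F a Quot null_sequences F a"

definition completion_embed ::
  "('a, 'm) ring_scheme \<Rightarrow> ('a \<Rightarrow> real) \<Rightarrow> 'a \<Rightarrow> (nat \<Rightarrow> 'a) set" where
  "completion_embed F a x = null_sequences F a +>\<^bsub>cauchy_ring F a\<^esub> (\<lambda>_. x)"

definition completion_abs :: "('a \<Rightarrow> real) \<Rightarrow> (nat \<Rightarrow> 'a) set \<Rightarrow> real" where
  "completion_abs a Z = lim (\<lambda>n. a ((SOME s. s \<in> Z) n))"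

definition completion_integers ::
  "('a, 'm) ring_scheme \<Rightarrow> ('a \<Rightarrow> real) \<Rightarrow> (nat \<Rightarrow> 'a) set set" where
  "completion_integers F a = {Z \<in> carrier (completion F a). completion_abs a Z \<le> 1}"


section \<open>Adeles\<close>

type_synonym 'a adele = "('a \<Rightarrow> real) set \<Rightarrow> (nat \<Rightarrow> 'a) set"

definition adele_ring :: "('a, 'm) ring_scheme \<Rightarrow> 'a adele ring" where
  "adele_ring F =
     \<lparr>carrier = {x \<in> (\<Pi>\<^sub>E v \<in> places F. carrier (completion F (place_abs v))).
        finite {v \<in> places F. nonarchimedean F (place_abs v) \<and>
                              x v \<notin> completion_integers F (place_abs v)}},
      mult = (\<lambda>x y. \<lambda>v \<in> places F. x v \<otimes>\<^bsub>completion F (place_abs v)\<^esub> y v),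
      one = (\<lambda>v \<in> places F. \<one>\<^bsub>completion F (place_abs v)\<^esub>),
      ring.zero = (\<lambda>v \<in> places F. \<zero>\<^bsub>completion F (place_abs v)\<^esub>),
      add = (\<lambda>x y. \<lambda>v \<in> places F. x v \<oplus>\<^bsub>completion F (place_abs v)\<^esub> y v)\<rparr>"

definition principal_adele :: "('a, 'm) ring_scheme \<Rightarrow> 'a \<Rightarrow> 'a adele" where
  "principal_adele F x = (\<lambda>v \<in> places F. completion_embed F (place_abs v) x)"


section \<open>Tensor products of algebras\<close>

text \<open>An algebra over a commutative ring \<open>F\<close> is given by a homomorphism from \<open>F\<close> into the centre.
  The tensor product of \<open>B\<close> (via \<open>\<iota>\<close>) and \<open>C\<close> (via \<open>\<kappa>\<close>) over \<open>F\<close> is the free abelian group on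
  \<open>B \<times> C\<close>, with the multiplication extending that of \<open>B \<times> C\<close> biadditively, modulo the ideal generated
  by the bilinearity relations. That ideal is no larger than the additive subgroup generated by these
  relations, since multiplying a relation by a pair gives a relation again.\<close>

definition center :: "('a, 'm) ring_scheme \<Rightarrow> 'a set" where
  "center R = {z \<in> carrier R. \<forall>x \<in> carrier R. z \<otimes>\<^bsub>R\<^esub> x = x \<otimes>\<^bsub>R\<^esub> z}"

definition algebra_map :: "('f, 'l) ring_scheme \<Rightarrow> ('a, 'm) ring_scheme \<Rightarrow> ('f \<Rightarrow> 'a) \<Rightarrow> bool" where
  "algebra_map F B \<iota> \<longleftrightarrow> \<iota> \<in> ring_hom F B \<and> \<iota> ` carrier F \<subseteq> center B"

definition pair_ring ::
  "('b, 'm) ring_scheme \<Rightarrow> ('c, 'n) ring_scheme \<Rightarrow> (('b \<times> 'c) \<Rightarrow>\<^sub>0 int) ring" where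
  "pair_ring B C =
     \<lparr>carrier = carrier (free_Abelian_group (carrier B \<times> carrier C)),
      mult = (\<lambda>x y. frag_extend (\<lambda>(b, c). frag_extend
                (\<lambda>(b', c'). frag_of (b \<otimes>\<^bsub>B\<^esub> b', c \<otimes>\<^bsub>C\<^esub> c')) y) x),
      one = frag_of (\<one>\<^bsub>B\<^esub>, \<one>\<^bsub>C\<^esub>),
      ring.zero = 0,
      add = (+)\<rparr>"

definition tensor_relations ::
  "('f, 'l) ring_scheme \<Rightarrow> ('b, 'm) ring_scheme \<Rightarrow> ('f \<Rightarrow> 'b) \<Rightarrow> ('c, 'n) ring_scheme \<Rightarrow> ('f \<Rightarrow> 'c)
     \<Rightarrow> (('b \<times> 'c) \<Rightarrow>\<^sub>0 int) set" where
  "tensor_relations F B \<iota> C \<kappa> =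
     {frag_of (b \<oplus>\<^bsub>B\<^esub> b', c) - frag_of (b, c) - frag_of (b', c) | b b' c.
        b \<in> carrier B \<and> b' \<in> carrier B \<and> c \<in> carrier C} \<union>
     {frag_of (b, c \<oplus>\<^bsub>C\<^esub> c') - frag_of (b, c) - frag_of (b, c') | b c c'.
        b \<in> carrier B \<and> c \<in> carrier C \<and> c' \<in> carrier C} \<union>
     {frag_of (\<iota> r \<otimes>\<^bsub>B\<^esub> b, c) - frag_of (b, \<kappa> r \<otimes>\<^bsub>C\<^esub> c) | r b c.
        r \<in> carrier F \<and> b \<in> carrier B \<and> c \<in> carrier C}"

definition tensor_ideal ::
  "('f, 'l) ring_scheme \<Rightarrow> ('b, 'm) ring_scheme \<Rightarrow> ('f \<Rightarrow> 'b) \<Rightarrow> ('c, 'n) ring_scheme \<Rightarrow> ('f \<Rightarrow> 'c)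
     \<Rightarrow> (('b \<times> 'c) \<Rightarrow>\<^sub>0 int) set" where
  "tensor_ideal F B \<iota> C \<kappa> = Idl\<^bsub>pair_ring B C\<^esub> (tensor_relations F B \<iota> C \<kappa>)"

definition tensor_ring ::
  "('f, 'l) ring_scheme \<Rightarrow> ('b, 'm) ring_scheme \<Rightarrow> ('f \<Rightarrow> 'b) \<Rightarrow> ('c, 'n) ring_scheme \<Rightarrow> ('f \<Rightarrow> 'c)
     \<Rightarrow> (('b \<times> 'c) \<Rightarrow>\<^sub>0 int) set ring" where
  "tensor_ring F B \<iota> C \<kappa> = pair_ring B C Quot tensor_ideal F B \<iota> C \<kappa>"

text \<open>The map \<open>\<sigma> \<otimes> id\<close>, for an \<open>F\<close>-linear map \<open>\<sigma>\<close> on \<open>B\<close>; the union is over the representatives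
  of the coset \<open>Z\<close>, which all give the same coset.\<close>

definition tensor_map ::
  "('f, 'l) ring_scheme \<Rightarrow> ('b, 'm) ring_scheme \<Rightarrow> ('f \<Rightarrow> 'b) \<Rightarrow> ('c, 'n) ring_scheme \<Rightarrow> ('f \<Rightarrow> 'c)
     \<Rightarrow> ('b \<Rightarrow> 'b) \<Rightarrow> (('b \<times> 'c) \<Rightarrow>\<^sub>0 int) set \<Rightarrow> (('b \<times> 'c) \<Rightarrow>\<^sub>0 int) set" where
  "tensor_map F B \<iota> C \<kappa> \<sigma> Z =
     (\<Union>x \<in> Z. tensor_ideal F B \<iota> C \<kappa> +>\<^bsub>pair_ring B C\<^esub>
                 frag_extend (\<lambda>(b, c). frag_of (\<sigma> b, c)) x)"

definition adele_algebra ::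
  "('f, 'l) ring_scheme \<Rightarrow> ('b, 'm) ring_scheme \<Rightarrow> ('f \<Rightarrow> 'b)
     \<Rightarrow> (('b \<times> 'f adele) \<Rightarrow>\<^sub>0 int) set ring" where
  "adele_algebra F B \<iota> = tensor_ring F B \<iota> (adele_ring F) (principal_adele F)"

definition adele_algebra_star ::
  "('f, 'l) ring_scheme \<Rightarrow> ('b, 'm) ring_scheme \<Rightarrow> ('f \<Rightarrow> 'b) \<Rightarrow> ('b \<Rightarrow> 'b)
     \<Rightarrow> (('b \<times> 'f adele) \<Rightarrow>\<^sub>0 int) set \<Rightarrow> (('b \<times> 'f adele) \<Rightarrow>\<^sub>0 int) set" where
  "adele_algebra_star F B \<iota> \<sigma> = tensor_map F B \<iota> (adele_ring F) (principal_adele F) \<sigma>"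


section \<open>Separable quadratic extensions\<close>

text \<open>Polynomials are lists of coefficients, the leading one first.\<close>

definition formal_derivative :: "('a, 'm) ring_scheme \<Rightarrow> 'a list \<Rightarrow> 'a list" where
  "formal_derivative R p =
     ring.normalize R (map (\<lambda>i. add_pow R i (ring.coeff R p i)) (rev [1..<length p]))"

definition separable_poly :: "('a, 'm) ring_scheme \<Rightarrow> 'a set \<Rightarrow> 'a list \<Rightarrow> bool" where
  "separable_poly R K p \<longleftrightarrow> p \<in> carrier (K[X]\<^bsub>R\<^esub>) \<and>
     (\<forall>d \<in> carrier (K[X]\<^bsub>R\<^esub>). d divides\<^bsub>K[X]\<^bsub>R\<^esub>\<^esub> p \<and> d divides\<^bsub>K[X]\<^bsub>R\<^esub>\<^esub> formal_derivative R p
        \<longrightarrow> d \<in> Units (K[X]\<^bsub>R\<^esub>))"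

definition separable_quadratic_extension ::
  "('f, 'l) ring_scheme \<Rightarrow> ('e, 'm) ring_scheme \<Rightarrow> ('f \<Rightarrow> 'e) \<Rightarrow> bool" where
  "separable_quadratic_extension F E \<iota> \<longleftrightarrow>
     field F \<and> field E \<and> \<iota> \<in> ring_hom F E \<and>
     ring.dimension E 2 (\<iota> ` carrier F) (carrier E) \<and>
     (\<forall>x \<in> carrier E. separable_poly E (\<iota> ` carrier F) (ring.Irr E (\<iota> ` carrier F) x))"

definition galois_group ::
  "('f, 'l) ring_scheme \<Rightarrow> ('e, 'm) ring_scheme \<Rightarrow> ('f \<Rightarrow> 'e) \<Rightarrow> ('e \<Rightarrow> 'e) set" where
  "galois_group F E \<iota> = {\<alpha> \<in> ring_iso E E. \<forall>c \<in> carrier F. \<alpha> (\<iota> c) = \<iota> c}"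


section \<open>Quaternion algebras\<close>

definition split_by ::
  "('f, 'l) ring_scheme \<Rightarrow> ('h, 'm) ring_scheme \<Rightarrow> ('f \<Rightarrow> 'h) \<Rightarrow> ('h \<Rightarrow> 'f mat) \<Rightarrow> bool" where
  "split_by F H \<iota> \<phi> \<longleftrightarrow> \<phi> \<in> ring_iso H (matrix_ring 2 F) \<and>
     (\<forall>c \<in> carrier F. \<phi> (\<iota> c) = scalar_matrix 2 F c)"

definition quaternion_division_algebra ::
  "('f, 'l) ring_scheme \<Rightarrow> ('h, 'm) ring_scheme \<Rightarrow> ('f \<Rightarrow> 'h) \<Rightarrow> bool" where
  "quaternion_division_algebra F H \<iota> \<longleftrightarrow>
     Units H = carrier H - {\<zero>\<^bsub>H\<^esub>} \<and> \<iota> ` carrier F = center H \<and>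
     ring.dimension H 4 (\<iota> ` carrier F) (carrier H)"

definition quaternion_algebra ::
  "('f, 'l) ring_scheme \<Rightarrow> ('h, 'm) ring_scheme \<Rightarrow> ('f \<Rightarrow> 'h) \<Rightarrow> bool" where
  "quaternion_algebra F H \<iota> \<longleftrightarrow> field F \<and> ring H \<and> algebra_map F H \<iota> \<and>
     ((\<exists>\<phi>. split_by F H \<iota> \<phi>) \<or> quaternion_division_algebra F H \<iota>)"

definition split_star :: "('f, 'l) ring_scheme \<Rightarrow> 'f mat \<Rightarrow> 'f mat" where
  "split_star F h =
     (let J = mat2 \<zero>\<^bsub>F\<^esub> \<one>\<^bsub>F\<^esub> (\<ominus>\<^bsub>F\<^esub> \<one>\<^bsub>F\<^esub>) \<zero>\<^bsub>F\<^esub>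
      in J \<otimes>\<^bsub>matrix_ring 2 F\<^esub> transpose_mat h \<otimes>\<^bsub>matrix_ring 2 F\<^esub> inv\<^bsub>matrix_ring 2 F\<^esub> J)"

text \<open>On a division algebra the canonical involution is the standard involution: the \<open>F\<close>-linear
  involution whose traces \<open>h + h\<^sup>*\<close> and norms \<open>h h\<^sup>*\<close> lie in \<open>F\<close>. It is unique.\<close>

definition quaternionic_involution ::
  "('f, 'l) ring_scheme \<Rightarrow> ('h, 'm) ring_scheme \<Rightarrow> ('f \<Rightarrow> 'h) \<Rightarrow> ('h \<Rightarrow> 'h) \<Rightarrow> bool" where
  "quaternionic_involution F H \<iota> star \<longleftrightarrow>
     involution_ring H star \<and> (\<forall>c \<in> carrier F. star (\<iota> c) = \<iota> c) \<and>
     (quaternion_division_algebra F H \<iota> \<longrightarrow>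
        (\<forall>h \<in> carrier H. h \<oplus>\<^bsub>H\<^esub> star h \<in> \<iota> ` carrier F \<and> h \<otimes>\<^bsub>H\<^esub> star h \<in> \<iota> ` carrier F)) \<and>
     (\<forall>\<phi>. split_by F H \<iota> \<phi> \<longrightarrow> (\<forall>h \<in> carrier H. \<phi> (star h) = split_star F (\<phi> h)))"

end

theory Submission
  imports Defs
begin

text \<open>
  Write \<open>A = M(n,R)\<close>. An element of \<open>SL\<^sub>*(2,A)\<close> is determined by its first column \<open>(a,c)\<close> up to a right
  factor \<open>u\<^sub>b\<close>. In a first column, \<open>a\<^sup>*c\<close> is symmetric and \<open>Aa + Ac = A\<close>. So it has to be shown that
  every pair with these two properties lies in the orbit of \<open>(1,0)\<close> under the group that the Bruhat
  elements generate (\<open>bruhat_generation\<close>).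

  This is Gaussian elimination. The Bruhat elements provide the moves \<open>(a,c) \<mapsto> (ga, g\<^sup>-\<^sup>*c)\<close>,
  \<open>(a + bc, c)\<close> and \<open>(a, c + ba)\<close> with symmetric \<open>b\<close>, and column operations \<open>(ag, cg)\<close> are harmless as
  well. Once a diagonal entry of \<open>a\<close> is invertible, the rest of its row and column can be cleared, in
  \<open>c\<close> as well as in \<open>a\<close> (\<open>split_off_pivot\<close>). In all columns but the last, an invertible entry is
  produced with off-diagonal entries of \<open>b\<close>, which are arbitrary, so that only a condition on the
  generation of left ideals is needed (\<open>pivot_column\<close>); for the last column there is only the
  case \<open>n = 1\<close>. The conditions on \<open>R\<close> that make this work are collected in the locale
  \<open>local_pivoting\<close>. They refer to a left ideal \<open>J\<close> that plays the role of a radical.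

  For a star-local ring, \<open>J\<close> is the stable maximal ideal. Modulo \<open>J\<close> the ring is a division ring or a
  product \<open>D \<times> D\<^sup>o\<^sup>p\<close> with the two factors exchanged, and a pivot is easy to find
  (\<open>star_local_pivoting\<close>).

  The adelic rings have no such ideal, but they contain a central subring \<open>S\<close> that the involution
  fixes, the image of the adele ring of \<open>F\<close>, and \<open>S\<close> is an exchange ring: for every \<open>x\<close> there is an
  idempotent \<open>e\<close> in \<open>xS\<close> with \<open>1 - e\<close> in \<open>(1 - x)S\<close>. At a place, \<open>e\<close> can be taken to be \<open>0\<close> or \<open>1\<close>, and
  integral witnesses can be found at the nonarchimedean places (\<open>adele_exchange_ring\<close>). Over an
  exchange ring, elimination can be carried out at each maximal ideal \<open>M\<close> of \<open>S\<close>: an element that is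
  invertible at \<open>M\<close> is invertible over an idempotent outside \<open>M\<close>, and the results over finitely many
  idempotents can be patched (\<open>bruhat_column_patch\<close>). This settles the case of trivial involution.

  In the quadratic and the quaternionic case, the traces \<open>x + x\<^sup>*\<close> and the norms \<open>N(x) = xx\<^sup>*\<close> lie in \<open>S\<close>,
  and \<open>1\<close> is a trace. An element is invertible at \<open>M\<close> if and only if its norm lies outside \<open>M\<close>, and pivots
  are found by means of the formula \<open>N(x + ty) = N(x) + N(t)N(y) + tr(tyx\<^sup>*)\<close>. In the last column, where
  \<open>t\<close> has to be symmetric, the quaternionic case depends on characteristic 2: then every
  element of trace \<open>0\<close> is symmetric, and there are enough symmetric elements
  (\<open>quadratic_isotropic_pivot\<close>).
\<close>

section \<open>Rings with involution and their matrix rings\<close>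

context involution_ring
begin

lemma star_zero [simp]: "star \<zero> = \<zero>"
proof -
  have "star \<zero> \<oplus> star \<zero> = star \<zero>"
    using star_add[of \<zero> \<zero>] by simp
  then show ?thesis
    using star_closed[OF zero_closed] by (metis add.l_cancel_one')
qed

lemma star_one [simp]: "star \<one> = \<one>"
  using star_mult[of "star \<one>" \<one>] star_star[of \<one>] star_closed[OF one_closed] by simp

lemma star_uminus: "x \<in> carrier R \<Longrightarrow> star (\<ominus> x) = \<ominus> star x"
  by (metis add.inv_closed r_neg star_zero star_add star_closed add.inv_equality a_comm)

lemma star_minus: "\<lbrakk>x \<in> carrier R; y \<in> carrier R\<rbrakk> \<Longrightarrow> star (x \<ominus> y) = star x \<ominus> star y"
  by (simp add: minus_eq star_add star_uminus)

lemma star_finsum: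
  assumes "f \<in> A \<rightarrow> carrier R"
  shows "star (finsum R f A) = (\<Oplus>i\<in>A. star (f i))"
  using assms
proof (induction A rule: infinite_finite_induct)
  case (insert x A)
  then show ?case
    by (subst finsum_insert; simp add: star_add Pi_iff star_closed)
qed (simp_all)

lemma star_unit:
  assumes "x \<in> Units R"
  shows "star x \<in> Units R" "star (inv x) = inv (star x)"
proof -
  have x: "x \<in> carrier R" "inv x \<in> carrier R" "x \<otimes> inv x = \<one>" "inv x \<otimes> x = \<one>"
    using assms by auto
  have *: "star x \<otimes> star (inv x) = \<one>" "star (inv x) \<otimes> star x = \<one>"
    using x by (metis star_mult star_one)+
  then show "star x \<in> Units R"
    using x star_closed unfolding Units_def by blast
  show "star (inv x) = inv (star x)"
    using * x star_closed by (metis inv_char)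
qed

lemma sym_elementsI: "\<lbrakk>x \<in> carrier R; star x = x\<rbrakk> \<Longrightarrow> x \<in> sym_elements R star"
  by (simp add: sym_elements_def)

lemma sym_elementsD: "x \<in> sym_elements R star \<Longrightarrow> x \<in> carrier R" "x \<in> sym_elements R star \<Longrightarrow> star x = x"
  by (simp_all add: sym_elements_def)

end

lemma (in abelian_monoid) finsum_finsum_swap:
  assumes "finite A" "\<And>i j. i \<in> A \<Longrightarrow> j \<in> B \<Longrightarrow> f i j \<in> carrier G"
  shows "(\<Oplus>i\<in>A. \<Oplus>j\<in>B. f i j) = (\<Oplus>j\<in>B. \<Oplus>i\<in>A. f i j)"
  using assms
proof (induction A)
  case empty
  then show ?case by (simp add: finsum_zero)
next
  case (insert x A)
  then have "(\<Oplus>j\<in>B. \<Oplus>i\<in>insert x A. f i j) = (\<Oplus>j\<in>B. f x j \<oplus> (\<Oplus>i\<in>A. f i j))"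
    by (intro finsum_cong') (auto intro!: finsum_insert finsum_closed)
  also have "\<dots> = (\<Oplus>j\<in>B. f x j) \<oplus> (\<Oplus>j\<in>B. \<Oplus>i\<in>A. f i j)"
    using insert by (intro finsum_addf) (auto intro!: finsum_closed)
  finally show ?case
    using insert by (subst finsum_insert) (auto intro!: finsum_closed)
qed

lemma (in abelian_monoid) finsum_delta:
  assumes "finite A" "k \<in> A" "f k \<in> carrier G"
  shows "(\<Oplus>i\<in>A. if i = k then f i else \<zero>) = f k"
proof -
  have "(\<Oplus>i\<in>A. if i = k then f i else \<zero>) = (\<Oplus>i\<in>A. if k = i then f k else \<zero>)"
    by (intro finsum_cong') (use assms in auto)
  also have "\<dots> = f k"
    using add.finprod_singleton[of k A "\<lambda>_. f k"] assms by (simp add: Pi_iff)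
  finally show ?thesis .
qed

lemma matrix_ring_carrier_iff:
  "a \<in> carrier (matrix_ring n R) \<longleftrightarrow>
     a \<in> carrier_mat n n \<and> (\<forall>i<n. \<forall>j<n. a $$ (i, j) \<in> carrier R)"
  by (fastforce simp: matrix_ring_def elements_mat_def)

lemma matrix_ring_entry_closed:
  "\<lbrakk>a \<in> carrier (matrix_ring n R); i < n; j < n\<rbrakk> \<Longrightarrow> a $$ (i, j) \<in> carrier R"
  by (simp add: matrix_ring_carrier_iff)

lemma matrix_ring_eqI:
  "\<lbrakk>a \<in> carrier (matrix_ring n R); b \<in> carrier (matrix_ring n R);
    \<And>i j. i < n \<Longrightarrow> j < n \<Longrightarrow> a $$ (i, j) = b $$ (i, j)\<rbrakk> \<Longrightarrow> a = b"
  by (auto simp: matrix_ring_carrier_iff intro!: eq_matI)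

lemma mat_in_matrix_ring:
  "(\<And>i j. i < n \<Longrightarrow> j < n \<Longrightarrow> f (i, j) \<in> carrier R) \<Longrightarrow> mat n n f \<in> carrier (matrix_ring n R)"
  by (simp add: matrix_ring_carrier_iff)

lemma matrix_ring_entry:
  assumes "i < n" "j < n"
  shows "(a \<otimes>\<^bsub>matrix_ring n R\<^esub> b) $$ (i, j) = (\<Oplus>\<^bsub>R\<^esub>k\<in>{..<n}. a $$ (i, k) \<otimes>\<^bsub>R\<^esub> b $$ (k, j))"
    and "(a \<oplus>\<^bsub>matrix_ring n R\<^esub> b) $$ (i, j) = a $$ (i, j) \<oplus>\<^bsub>R\<^esub> b $$ (i, j)"
    and "\<zero>\<^bsub>matrix_ring n R\<^esub> $$ (i, j) = \<zero>\<^bsub>R\<^esub>"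
    and "\<one>\<^bsub>matrix_ring n R\<^esub> $$ (i, j) = (if i = j then \<one>\<^bsub>R\<^esub> else \<zero>\<^bsub>R\<^esub>)"
  using assms by (simp_all add: matrix_ring_def)

context ring
begin

lemma matrix_mult_entry:
  assumes "i < n" "j < n"
    and "\<And>k. k < n \<Longrightarrow> a $$ (i, k) = f k" "\<And>k. k < n \<Longrightarrow> b $$ (k, j) = g k"
    and "\<And>k. k < n \<Longrightarrow> f k \<in> carrier R" "\<And>k. k < n \<Longrightarrow> g k \<in> carrier R"
  shows "(a \<otimes>\<^bsub>matrix_ring n R\<^esub> b) $$ (i, j) = (\<Oplus>k\<in>{..<n}. f k \<otimes> g k)"
  using assms by (simp add: matrix_ring_entry) (intro finsum_cong'; simp)

lemma matrix_mult_closed: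
  assumes "a \<in> carrier (matrix_ring n R)" "b \<in> carrier (matrix_ring n R)"
  shows "a \<otimes>\<^bsub>matrix_ring n R\<^esub> b \<in> carrier (matrix_ring n R)"
  using assms unfolding matrix_ring_carrier_iff
  by (auto simp: matrix_ring_def intro!: finsum_closed)

lemma matrix_one_closed: "\<one>\<^bsub>matrix_ring n R\<^esub> \<in> carrier (matrix_ring n R)"
  by (simp add: matrix_ring_carrier_iff) (simp add: matrix_ring_def)

lemma matrix_zero_closed: "\<zero>\<^bsub>matrix_ring n R\<^esub> \<in> carrier (matrix_ring n R)"
  by (simp add: matrix_ring_carrier_iff) (simp add: matrix_ring_def)

lemma matrix_add_closed:
  assumes "a \<in> carrier (matrix_ring n R)" "b \<in> carrier (matrix_ring n R)"
  shows "a \<oplus>\<^bsub>matrix_ring n R\<^esub> b \<in> carrier (matrix_ring n R)"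
  using assms unfolding matrix_ring_carrier_iff by (auto simp: matrix_ring_def)

lemma matrix_mult_assoc:
  assumes a: "a \<in> carrier (matrix_ring n R)" and b: "b \<in> carrier (matrix_ring n R)"
    and c: "c \<in> carrier (matrix_ring n R)"
  shows "a \<otimes>\<^bsub>matrix_ring n R\<^esub> b \<otimes>\<^bsub>matrix_ring n R\<^esub> c = a \<otimes>\<^bsub>matrix_ring n R\<^esub> (b \<otimes>\<^bsub>matrix_ring n R\<^esub> c)"
proof (rule matrix_ring_eqI[where n = n and R = R])
  fix i j assume ij: "i < n" "j < n"
  note cl = matrix_ring_entry_closed[OF a] matrix_ring_entry_closed[OF b] matrix_ring_entry_closed[OF c]
  have "(\<Oplus>k\<in>{..<n}. (\<Oplus>l\<in>{..<n}. a $$ (i, l) \<otimes> b $$ (l, k)) \<otimes> c $$ (k, j)) =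
        (\<Oplus>k\<in>{..<n}. \<Oplus>l\<in>{..<n}. a $$ (i, l) \<otimes> (b $$ (l, k) \<otimes> c $$ (k, j)))"
    using ij cl by (intro finsum_cong' refl)
      (auto simp: finsum_ldistr m_assoc Pi_iff intro!: finsum_closed finsum_cong')
  also have "\<dots> = (\<Oplus>l\<in>{..<n}. \<Oplus>k\<in>{..<n}. a $$ (i, l) \<otimes> (b $$ (l, k) \<otimes> c $$ (k, j)))"
    using ij cl by (intro finsum_finsum_swap) auto
  also have "\<dots> = (\<Oplus>l\<in>{..<n}. a $$ (i, l) \<otimes> (\<Oplus>k\<in>{..<n}. b $$ (l, k) \<otimes> c $$ (k, j)))"
    using ij cl by (intro finsum_cong' refl)
      (auto simp: finsum_rdistr Pi_iff intro!: finsum_closed finsum_cong')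
  also have "(\<Oplus>k\<in>{..<n}. (\<Oplus>l\<in>{..<n}. a $$ (i, l) \<otimes> b $$ (l, k)) \<otimes> c $$ (k, j)) =
      (a \<otimes>\<^bsub>matrix_ring n R\<^esub> b \<otimes>\<^bsub>matrix_ring n R\<^esub> c) $$ (i, j)"
    by (rule matrix_mult_entry[symmetric, OF ij])
      (use ij cl in \<open>auto simp: matrix_ring_entry intro!: finsum_closed\<close>)
  also have "(\<Oplus>l\<in>{..<n}. a $$ (i, l) \<otimes> (\<Oplus>k\<in>{..<n}. b $$ (l, k) \<otimes> c $$ (k, j))) =
      (a \<otimes>\<^bsub>matrix_ring n R\<^esub> (b \<otimes>\<^bsub>matrix_ring n R\<^esub> c)) $$ (i, j)"
    by (rule matrix_mult_entry[symmetric, OF ij])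
      (use ij cl in \<open>auto simp: matrix_ring_entry intro!: finsum_closed\<close>)
  finally show "(a \<otimes>\<^bsub>matrix_ring n R\<^esub> b \<otimes>\<^bsub>matrix_ring n R\<^esub> c) $$ (i, j) =
      (a \<otimes>\<^bsub>matrix_ring n R\<^esub> (b \<otimes>\<^bsub>matrix_ring n R\<^esub> c)) $$ (i, j)" .
qed (use assms in \<open>simp_all add: matrix_mult_closed\<close>)

lemma matrix_ring_ring: "ring (matrix_ring n R)"
proof (rule ringI)
  let ?M = "matrix_ring n R"
  show "abelian_group ?M"
  proof (rule abelian_groupI)
    fix x assume x: "x \<in> carrier ?M"
    let ?y = "mat n n (\<lambda>(i, j). \<ominus> x $$ (i, j))"
    have y: "?y \<in> carrier ?M"
      using x by (auto intro!: mat_in_matrix_ring simp: matrix_ring_entry_closed)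
    have "?y \<oplus>\<^bsub>?M\<^esub> x = \<zero>\<^bsub>?M\<^esub>"
      by (rule matrix_ring_eqI[OF matrix_add_closed[OF y x] matrix_zero_closed])
        (use x in \<open>simp add: matrix_ring_entry matrix_ring_entry_closed l_neg\<close>)
    with y show "\<exists>y\<in>carrier ?M. y \<oplus>\<^bsub>?M\<^esub> x = \<zero>\<^bsub>?M\<^esub>" by blast
  qed (auto simp: matrix_add_closed matrix_zero_closed matrix_ring_entry matrix_ring_entry_closed
      a_ac intro!: matrix_ring_eqI[where n = n and R = R])
  show "monoid ?M"
  proof (rule monoidI)
    fix x assume x: "x \<in> carrier ?M"
    note cl = matrix_ring_entry_closed[OF x]
    have 1: "(\<Oplus>k\<in>{..<n}. (if i = k then \<one> else \<zero>) \<otimes> x $$ (k, j)) = x $$ (i, j)"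
      if "i < n" "j < n" for i j
    proof -
      have "(\<Oplus>k\<in>{..<n}. (if i = k then \<one> else \<zero>) \<otimes> x $$ (k, j)) =
            (\<Oplus>k\<in>{..<n}. if k = i then x $$ (k, j) else \<zero>)"
        using that cl by (intro finsum_cong') auto
      then show ?thesis using that cl by (simp add: finsum_delta)
    qed
    have 2: "(\<Oplus>k\<in>{..<n}. x $$ (i, k) \<otimes> (if k = j then \<one> else \<zero>)) = x $$ (i, j)"
      if "i < n" "j < n" for i j
    proof -
      have "(\<Oplus>k\<in>{..<n}. x $$ (i, k) \<otimes> (if k = j then \<one> else \<zero>)) =
            (\<Oplus>k\<in>{..<n}. if k = j then x $$ (i, k) else \<zero>)"
        using that cl by (intro finsum_cong') auto
      then show ?thesis using that cl by (simp add: finsum_delta)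
    qed
    have "(\<one>\<^bsub>?M\<^esub> \<otimes>\<^bsub>?M\<^esub> x) $$ (i, j) = x $$ (i, j)" if "i < n" "j < n" for i j
      by (rule trans[OF matrix_mult_entry[OF that] 1[OF that]]) (use that cl in \<open>auto simp: matrix_ring_entry\<close>)
    then show "\<one>\<^bsub>?M\<^esub> \<otimes>\<^bsub>?M\<^esub> x = x"
      using x by (intro matrix_ring_eqI[where n = n and R = R] matrix_mult_closed matrix_one_closed)
    have "(x \<otimes>\<^bsub>?M\<^esub> \<one>\<^bsub>?M\<^esub>) $$ (i, j) = x $$ (i, j)" if "i < n" "j < n" for i j
      by (rule trans[OF matrix_mult_entry[OF that] 2[OF that]]) (use that cl in \<open>auto simp: matrix_ring_entry\<close>)
    then show "x \<otimes>\<^bsub>?M\<^esub> \<one>\<^bsub>?M\<^esub> = x"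
      using x by (intro matrix_ring_eqI[where n = n and R = R] matrix_mult_closed matrix_one_closed)
  qed (simp_all add: matrix_mult_closed matrix_one_closed matrix_mult_assoc)
next
  let ?M = "matrix_ring n R"
  fix x y z assume xyz: "x \<in> carrier ?M" "y \<in> carrier ?M" "z \<in> carrier ?M"
  note cl = matrix_ring_entry_closed[OF xyz(1)] matrix_ring_entry_closed[OF xyz(2)]
    matrix_ring_entry_closed[OF xyz(3)]
  show "(x \<oplus>\<^bsub>?M\<^esub> y) \<otimes>\<^bsub>?M\<^esub> z = x \<otimes>\<^bsub>?M\<^esub> z \<oplus>\<^bsub>?M\<^esub> y \<otimes>\<^bsub>?M\<^esub> z"
  proof (rule matrix_ring_eqI[where n = n and R = R])
    fix i j assume ij: "i < n" "j < n"
    have "(\<Oplus>k\<in>{..<n}. (x $$ (i, k) \<oplus> y $$ (i, k)) \<otimes> z $$ (k, j)) =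
       (\<Oplus>k\<in>{..<n}. x $$ (i, k) \<otimes> z $$ (k, j)) \<oplus> (\<Oplus>k\<in>{..<n}. y $$ (i, k) \<otimes> z $$ (k, j))"
      using ij cl by (intro trans[OF finsum_cong'[OF refl] finsum_addf]) (auto simp: l_distr)
    then show "((x \<oplus>\<^bsub>?M\<^esub> y) \<otimes>\<^bsub>?M\<^esub> z) $$ (i, j) = (x \<otimes>\<^bsub>?M\<^esub> z \<oplus>\<^bsub>?M\<^esub> y \<otimes>\<^bsub>?M\<^esub> z) $$ (i, j)"
      using ij cl by (subst matrix_mult_entry[OF ij]) (auto simp: matrix_ring_entry)
  qed (use xyz in \<open>simp_all add: matrix_mult_closed matrix_add_closed\<close>)
  show "z \<otimes>\<^bsub>?M\<^esub> (x \<oplus>\<^bsub>?M\<^esub> y) = z \<otimes>\<^bsub>?M\<^esub> x \<oplus>\<^bsub>?M\<^esub> z \<otimes>\<^bsub>?M\<^esub> y"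
  proof (rule matrix_ring_eqI[where n = n and R = R])
    fix i j assume ij: "i < n" "j < n"
    have "(\<Oplus>k\<in>{..<n}. z $$ (i, k) \<otimes> (x $$ (k, j) \<oplus> y $$ (k, j))) =
       (\<Oplus>k\<in>{..<n}. z $$ (i, k) \<otimes> x $$ (k, j)) \<oplus> (\<Oplus>k\<in>{..<n}. z $$ (i, k) \<otimes> y $$ (k, j))"
      using ij cl by (intro trans[OF finsum_cong'[OF refl] finsum_addf]) (auto simp: r_distr)
    then show "(z \<otimes>\<^bsub>?M\<^esub> (x \<oplus>\<^bsub>?M\<^esub> y)) $$ (i, j) = (z \<otimes>\<^bsub>?M\<^esub> x \<oplus>\<^bsub>?M\<^esub> z \<otimes>\<^bsub>?M\<^esub> y) $$ (i, j)"
      using ij cl by (subst matrix_mult_entry[OF ij]) (auto simp: matrix_ring_entry)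
  qed (use xyz in \<open>simp_all add: matrix_mult_closed matrix_add_closed\<close>)
qed

lemma matrix_uminus_entry:
  assumes "a \<in> carrier (matrix_ring n R)" "i < n" "j < n"
  shows "(\<ominus>\<^bsub>matrix_ring n R\<^esub> a) $$ (i, j) = \<ominus> a $$ (i, j)"
proof -
  interpret M: ring "matrix_ring n R" by (rule matrix_ring_ring)
  have "(\<ominus>\<^bsub>matrix_ring n R\<^esub> a \<oplus>\<^bsub>matrix_ring n R\<^esub> a) $$ (i, j) = \<zero>"
    using assms by (simp add: M.l_neg matrix_ring_entry)
  then have "(\<ominus>\<^bsub>matrix_ring n R\<^esub> a) $$ (i, j) \<oplus> a $$ (i, j) = \<zero>"
    using assms by (simp add: matrix_ring_entry)
  then show ?thesis
    using assms matrix_ring_entry_closed M.a_inv_closed by (metis minus_equality)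
qed

lemma matrix_minus_entry:
  assumes "a \<in> carrier (matrix_ring n R)" "b \<in> carrier (matrix_ring n R)" "i < n" "j < n"
  shows "(a \<ominus>\<^bsub>matrix_ring n R\<^esub> b) $$ (i, j) = a $$ (i, j) \<ominus> b $$ (i, j)"
  using assms by (simp add: a_minus_def matrix_ring_entry matrix_uminus_entry)

end

context involution_ring
begin

lemma matrix_star_entry:
  assumes "a \<in> carrier (matrix_ring n R)" "i < n" "j < n"
  shows "matrix_star star a $$ (i, j) = star (a $$ (j, i))"
  using assms by (auto simp: matrix_star_def matrix_ring_carrier_iff)

lemma matrix_star_closed:
  "a \<in> carrier (matrix_ring n R) \<Longrightarrow> matrix_star star a \<in> carrier (matrix_ring n R)"
  by (auto simp: matrix_star_def matrix_ring_carrier_iff star_closed)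

lemma matrix_involution_ring: "involution_ring (matrix_ring n R) (matrix_star star)"
proof -
  interpret M: ring "matrix_ring n R" by (rule matrix_ring_ring)
  show ?thesis
  proof
    fix x y assume xy: "x \<in> carrier (matrix_ring n R)" "y \<in> carrier (matrix_ring n R)"
    note cl = matrix_ring_entry_closed[OF xy(1)] matrix_ring_entry_closed[OF xy(2)]
    show "matrix_star star (x \<oplus>\<^bsub>matrix_ring n R\<^esub> y) = matrix_star star x \<oplus>\<^bsub>matrix_ring n R\<^esub> matrix_star star y"
      using xy cl by (intro matrix_ring_eqI[where n = n and R = R] matrix_star_closed M.a_closed)
        (simp_all add: matrix_star_entry[OF M.a_closed] matrix_star_entry matrix_ring_entry star_add)
    show "matrix_star star (x \<otimes>\<^bsub>matrix_ring n R\<^esub> y) = matrix_star star y \<otimes>\<^bsub>matrix_ring n R\<^esub> matrix_star star x"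
    proof (rule matrix_ring_eqI[where n = n and R = R])
      fix i j assume ij: "i < n" "j < n"
      have "star (\<Oplus>k\<in>{..<n}. x $$ (j, k) \<otimes> y $$ (k, i)) = (\<Oplus>k\<in>{..<n}. star (y $$ (k, i)) \<otimes> star (x $$ (j, k)))"
        using ij cl by (subst star_finsum) (auto simp: star_mult star_closed intro!: finsum_cong')
      also have "\<dots> = (\<Oplus>k\<in>{..<n}. matrix_star star y $$ (i, k) \<otimes> matrix_star star x $$ (k, j))"
        using ij xy cl by (intro finsum_cong') (auto simp: matrix_star_entry star_closed)
      finally show "matrix_star star (x \<otimes>\<^bsub>matrix_ring n R\<^esub> y) $$ (i, j) =
          (matrix_star star y \<otimes>\<^bsub>matrix_ring n R\<^esub> matrix_star star x) $$ (i, j)"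
        using ij xy by (simp add: matrix_star_entry[OF M.m_closed] matrix_ring_entry)
    qed (use xy in \<open>simp_all add: matrix_star_closed\<close>)
  next
    fix x assume x: "x \<in> carrier (matrix_ring n R)"
    then show "matrix_star star (matrix_star star x) = x"
      by (intro matrix_ring_eqI[where n = n and R = R] matrix_star_closed)
        (simp_all add: matrix_star_entry[OF matrix_star_closed] matrix_star_entry matrix_star_closed
          star_star matrix_ring_entry_closed)
  qed (simp add: matrix_star_closed)
qed

end

section \<open>The group \<open>SL\<^sub>*(2,A)\<close>\<close>

lemma mat2_inject [simp]: "mat2 a b c d = mat2 a' b' c' d' \<longleftrightarrow> a = a' \<and> b = b' \<and> c = c' \<and> d = d'"
proof
  assume eq: "mat2 a b c d = mat2 a' b' c' d'"
  have "mat2 a b c d $$ (i, j) = mat2 a' b' c' d' $$ (i, j)" for i j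
    by (simp add: eq)
  from this[of 0 0] this[of 0 1] this[of 1 0] this[of 1 1]
  show "a = a' \<and> b = b' \<and> c = c' \<and> d = d'" by (simp add: mat2_def)
qed simp

lemma mat2_entry [simp]:
  "mat2 a b c d $$ (0, 0) = a" "mat2 a b c d $$ (0, Suc 0) = b"
  "mat2 a b c d $$ (Suc 0, 0) = c" "mat2 a b c d $$ (Suc 0, Suc 0) = d"
  by (simp_all add: mat2_def)

lemma mat2_carrier_mat: "mat2 a b c d \<in> carrier_mat 2 2"
  by (simp add: mat2_def)

lemma all_less_2: "(\<forall>i<2::nat. P i) \<longleftrightarrow> P 0 \<and> P (Suc 0)"
  using less_2_cases_iff by auto

lemma mat2_closed_iff:
  "mat2 a b c d \<in> carrier (matrix_ring 2 R) \<longleftrightarrow>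
     a \<in> carrier R \<and> b \<in> carrier R \<and> c \<in> carrier R \<and> d \<in> carrier R"
  unfolding matrix_ring_carrier_iff all_less_2 by (simp add: mat2_carrier_mat)

lemma eq_mat2I:
  assumes "g \<in> carrier_mat 2 2" "g $$ (0, 0) = a" "g $$ (0, Suc 0) = b" "g $$ (Suc 0, 0) = c"
    "g $$ (Suc 0, Suc 0) = d"
  shows "g = mat2 a b c d"
proof (rule eq_matI)
  fix i j assume "i < dim_row (mat2 a b c d)" "j < dim_col (mat2 a b c d)"
  then have "i = 0 \<or> i = Suc 0" "j = 0 \<or> j = Suc 0" by (auto simp: mat2_def)
  then show "g $$ (i, j) = mat2 a b c d $$ (i, j)" using assms(2-) by auto
qed (use assms(1) in \<open>simp_all add: mat2_def\<close>)

lemma mat2_cases: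
  assumes "g \<in> carrier (matrix_ring 2 R)"
  obtains a b c d where "g = mat2 a b c d" "a \<in> carrier R" "b \<in> carrier R" "c \<in> carrier R" "d \<in> carrier R"
proof
  show "g = mat2 (g $$ (0, 0)) (g $$ (0, Suc 0)) (g $$ (Suc 0, 0)) (g $$ (Suc 0, Suc 0))"
    using assms by (intro eq_mat2I) (simp_all add: matrix_ring_carrier_iff)
qed (use assms in \<open>simp_all add: matrix_ring_carrier_iff\<close>)

lemma mat2_one: "\<one>\<^bsub>matrix_ring 2 R\<^esub> = mat2 \<one>\<^bsub>R\<^esub> \<zero>\<^bsub>R\<^esub> \<zero>\<^bsub>R\<^esub> \<one>\<^bsub>R\<^esub>"
  by (rule eq_mat2I) (simp_all add: matrix_ring_def)

lemma (in ring) mat2_mult: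
  assumes "a \<in> carrier R" "b \<in> carrier R" "c \<in> carrier R" "d \<in> carrier R"
    "a' \<in> carrier R" "b' \<in> carrier R" "c' \<in> carrier R" "d' \<in> carrier R"
  shows "mat2 a b c d \<otimes>\<^bsub>matrix_ring 2 R\<^esub> mat2 a' b' c' d' =
    mat2 (a \<otimes> a' \<oplus> b \<otimes> c') (a \<otimes> b' \<oplus> b \<otimes> d') (c \<otimes> a' \<oplus> d \<otimes> c') (c \<otimes> b' \<oplus> d \<otimes> d')"
proof -
  have "{..<2::nat} = {0, Suc 0}" by auto
  then show ?thesis
    using assms by (intro eq_mat2I) (simp_all add: matrix_ring_def)
qed

context involution_ring
begin

abbreviation SL where "SL \<equiv> SL_star R star"

abbreviation bruhat_group where "bruhat_group \<equiv> generate SL (bruhat_elements R star)"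

text \<open>The conditions that define \<open>SL\<^sub>*(2,A)\<close> say that this anti-automorphism of \<open>M(2,A)\<close> inverts the
  matrix; this is what makes \<open>SL\<^sub>*(2,A)\<close> a group.\<close>

definition sharp :: "'a mat \<Rightarrow> 'a mat" where
  "sharp g = mat2 (star (g $$ (1, 1))) (\<ominus> star (g $$ (0, 1))) (\<ominus> star (g $$ (1, 0))) (star (g $$ (0, 0)))"

lemma sharp_mat2: "sharp (mat2 a b c d) = mat2 (star d) (\<ominus> star b) (\<ominus> star c) (star a)"
  by (simp add: sharp_def)

lemma SL_mat2_iff:
  "mat2 a b c d \<in> carrier SL \<longleftrightarrow>
     a \<in> carrier R \<and> b \<in> carrier R \<and> c \<in> carrier R \<and> d \<in> carrier R \<and>
     a \<otimes> star d \<ominus> b \<otimes> star c = \<one> \<and> star a \<otimes> d \<ominus> star c \<otimes> b = \<one> \<and>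
     a \<otimes> star b \<in> sym_elements R star \<and> c \<otimes> star d \<in> sym_elements R star \<and>
     star a \<otimes> c \<in> sym_elements R star \<and> star b \<otimes> d \<in> sym_elements R star"
  by (auto simp: SL_star_def)

lemma SL_subset: "carrier SL \<subseteq> carrier (matrix_ring 2 R)"
  by (auto simp: SL_star_def mat2_closed_iff)

lemma SL_cases:
  assumes "g \<in> carrier SL"
  obtains a b c d where "g = mat2 a b c d" "a \<in> carrier R" "b \<in> carrier R" "c \<in> carrier R" "d \<in> carrier R"
  using mat2_cases assms SL_subset by blast

lemma SL_mult: "x \<otimes>\<^bsub>SL\<^esub> y = x \<otimes>\<^bsub>matrix_ring 2 R\<^esub> y"
  by (simp add: SL_star_def)

lemma SL_one: "\<one>\<^bsub>SL\<^esub> = \<one>\<^bsub>matrix_ring 2 R\<^esub>"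
  by (simp add: SL_star_def)

lemma sharp_closed: "g \<in> carrier (matrix_ring 2 R) \<Longrightarrow> sharp g \<in> carrier (matrix_ring 2 R)"
  by (erule mat2_cases) (simp add: sharp_mat2 mat2_closed_iff star_closed)

lemma sharp_sharp: "g \<in> carrier (matrix_ring 2 R) \<Longrightarrow> sharp (sharp g) = g"
  by (erule mat2_cases) (simp add: sharp_mat2 star_closed star_star star_uminus)

lemma sharp_mult:
  assumes "g \<in> carrier (matrix_ring 2 R)" "h \<in> carrier (matrix_ring 2 R)"
  shows "sharp (g \<otimes>\<^bsub>matrix_ring 2 R\<^esub> h) = sharp h \<otimes>\<^bsub>matrix_ring 2 R\<^esub> sharp g"
proof -
  obtain a b c d where g: "g = mat2 a b c d" "a \<in> carrier R" "b \<in> carrier R" "c \<in> carrier R" "d \<in> carrier R"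
    using assms(1) by (rule mat2_cases)
  obtain a' b' c' d' where h: "h = mat2 a' b' c' d'" "a' \<in> carrier R" "b' \<in> carrier R" "c' \<in> carrier R" "d' \<in> carrier R"
    using assms(2) by (rule mat2_cases)
  show ?thesis
    using g(2-) h(2-) unfolding g(1) h(1)
    by (simp add: sharp_mat2 mat2_mult star_closed star_add star_mult l_minus r_minus minus_add a_comm)
qed

lemma sum_zero_iff:
  assumes "x \<in> carrier R" "y \<in> carrier R"
  shows "\<ominus> x \<oplus> y = \<zero> \<longleftrightarrow> y = x" "x \<oplus> \<ominus> y = \<zero> \<longleftrightarrow> y = x"
  using assms by (metis add.inv_closed minus_equality minus_minus r_neg l_neg)+

lemma SL_iff_sharp_inverse:
  "g \<in> carrier SL \<longleftrightarrow> g \<in> carrier (matrix_ring 2 R) \<and>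
     g \<otimes>\<^bsub>matrix_ring 2 R\<^esub> sharp g = \<one>\<^bsub>matrix_ring 2 R\<^esub> \<and> sharp g \<otimes>\<^bsub>matrix_ring 2 R\<^esub> g = \<one>\<^bsub>matrix_ring 2 R\<^esub>"
proof (cases "g \<in> carrier (matrix_ring 2 R)")
  case True
  then obtain a b c d where g: "g = mat2 a b c d" and cl: "a \<in> carrier R" "b \<in> carrier R" "c \<in> carrier R" "d \<in> carrier R"
    by (rule mat2_cases)
  note cls = cl star_closed[OF cl(1)] star_closed[OF cl(2)] star_closed[OF cl(3)] star_closed[OF cl(4)]
  have flip: "x \<otimes> star y \<ominus> z \<otimes> star w = \<one> \<longleftrightarrow> y \<otimes> star x \<ominus> w \<otimes> star z = \<one>"
    if "x \<in> carrier R" "y \<in> carrier R" "z \<in> carrier R" "w \<in> carrier R" for x y z w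
  proof -
    have "star (x \<otimes> star y \<ominus> z \<otimes> star w) = y \<otimes> star x \<ominus> w \<otimes> star z"
      using that by (simp add: star_minus star_mult star_closed star_star)
    then show ?thesis
      using that by (metis star_one star_star star_closed m_closed minus_closed)
  qed
  note f1 = flip[of a d b c, OF cl(1,4,2,3)]
    and f2 = flip[of "star a" "star d" "star c" "star b", OF cls(5,8,7,6), unfolded star_star[OF cl(1)]
        star_star[OF cl(2)] star_star[OF cl(3)] star_star[OF cl(4)]]
  have right: "g \<otimes>\<^bsub>matrix_ring 2 R\<^esub> sharp g = \<one>\<^bsub>matrix_ring 2 R\<^esub> \<longleftrightarrow>
      a \<otimes> star d \<ominus> b \<otimes> star c = \<one> \<and> b \<otimes> star a = a \<otimes> star b \<and>
      d \<otimes> star c = c \<otimes> star d \<and> d \<otimes> star a \<ominus> c \<otimes> star b = \<one>"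
    unfolding g sharp_mat2 mat2_one
    using cls by (simp add: mat2_mult r_minus sum_zero_iff) (simp add: minus_eq a_comm eq_commute)
  have left: "sharp g \<otimes>\<^bsub>matrix_ring 2 R\<^esub> g = \<one>\<^bsub>matrix_ring 2 R\<^esub> \<longleftrightarrow>
      star d \<otimes> a \<ominus> star b \<otimes> c = \<one> \<and> star d \<otimes> b = star b \<otimes> d \<and>
      star a \<otimes> c = star c \<otimes> a \<and> star a \<otimes> d \<ominus> star c \<otimes> b = \<one>"
    unfolding g sharp_mat2 mat2_one
    using cls by (simp add: mat2_mult l_minus sum_zero_iff) (simp add: minus_eq a_comm eq_commute)
  have sym: "x \<otimes> star y \<in> sym_elements R star \<longleftrightarrow> y \<otimes> star x = x \<otimes> star y"
    "star x \<otimes> y \<in> sym_elements R star \<longleftrightarrow> star y \<otimes> x = star x \<otimes> y"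
    if "x \<in> carrier R" "y \<in> carrier R" for x y
    using that by (simp_all add: sym_elements_def star_mult star_closed star_star)
  show ?thesis
    unfolding left right unfolding g SL_mat2_iff mat2_closed_iff
    using cl f1 f2 sym[OF cl(1,2)] sym[OF cl(3,4)] sym[OF cl(1,3)] sym[OF cl(2,4)] by metis
next
  case False
  then show ?thesis using SL_subset by blast
qed

lemma SL_group: "group SL"
proof -
  interpret M: ring "matrix_ring 2 R" by (rule matrix_ring_ring)
  show ?thesis
  proof (rule groupI)
    fix x y assume x: "x \<in> carrier SL" and y: "y \<in> carrier SL"
    then have cl: "x \<in> carrier (matrix_ring 2 R)" "y \<in> carrier (matrix_ring 2 R)" using SL_subset by auto
    note cl' = cl sharp_closed[OF cl(1)] sharp_closed[OF cl(2)]
    let ?m = "mult (matrix_ring 2 R)"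
    have "?m (?m x y) (?m (sharp y) (sharp x)) = ?m x (?m (?m y (sharp y)) (sharp x))"
      using cl' by (simp add: M.m_assoc)
    moreover have "?m (?m (sharp y) (sharp x)) (?m x y) = ?m (sharp y) (?m (?m (sharp x) x) y)"
      using cl' by (simp add: M.m_assoc)
    ultimately show "x \<otimes>\<^bsub>SL\<^esub> y \<in> carrier SL"
      using x y cl' by (simp add: SL_mult SL_iff_sharp_inverse sharp_mult)
  next
    show "\<one>\<^bsub>SL\<^esub> \<in> carrier SL"
      unfolding SL_one mat2_one by (simp add: SL_mat2_iff sym_elements_def minus_eq)
  next
    fix x assume x: "x \<in> carrier SL"
    then have cl: "x \<in> carrier (matrix_ring 2 R)" using SL_subset by auto
    have "sharp x \<in> carrier SL" "sharp x \<otimes>\<^bsub>SL\<^esub> x = \<one>\<^bsub>SL\<^esub>"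
      using x sharp_closed[OF cl] sharp_sharp[OF cl] by (simp_all add: SL_iff_sharp_inverse SL_mult SL_one)
    then show "\<exists>y\<in>carrier SL. y \<otimes>\<^bsub>SL\<^esub> x = \<one>\<^bsub>SL\<^esub>" by blast
    show "\<one>\<^bsub>SL\<^esub> \<otimes>\<^bsub>SL\<^esub> x = x" using cl by (simp add: SL_mult SL_one)
  next
    fix x y z assume "x \<in> carrier SL" "y \<in> carrier SL" "z \<in> carrier SL"
    then have "x \<in> carrier (matrix_ring 2 R)" "y \<in> carrier (matrix_ring 2 R)" "z \<in> carrier (matrix_ring 2 R)"
      using SL_subset by auto
    then show "x \<otimes>\<^bsub>SL\<^esub> y \<otimes>\<^bsub>SL\<^esub> z = x \<otimes>\<^bsub>SL\<^esub> (y \<otimes>\<^bsub>SL\<^esub> z)" by (simp add: SL_mult M.m_assoc)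
  qed
qed

lemma SL_inv: "g \<in> carrier SL \<Longrightarrow> inv\<^bsub>SL\<^esub> g = sharp g"
  using SL_iff_sharp_inverse[of g] SL_iff_sharp_inverse[of "sharp g"] sharp_sharp sharp_closed
  by (intro group.inv_equality[OF SL_group]) (auto simp: SL_mult SL_one)


section \<open>The Bruhat group\<close>

lemma bruhat_elements_in_SL: "bruhat_elements R star \<subseteq> carrier SL"
proof -
  have "bruhat_h R star a \<in> carrier SL" if "a \<in> Units R" for a
    using that star_unit[OF that]
    by (simp add: bruhat_h_def SL_mat2_iff sym_elements_def star_closed star_star minus_eq Units_inv_closed Units_closed)
  moreover have "bruhat_u R b \<in> carrier SL" if "b \<in> sym_elements R star" for b
    using that by (auto simp: bruhat_u_def SL_mat2_iff sym_elements_def minus_eq)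
  moreover have "bruhat_omega R \<in> carrier SL"
    by (simp add: bruhat_omega_def SL_mat2_iff sym_elements_def minus_eq star_uminus r_minus l_minus)
  ultimately show ?thesis by (auto simp: bruhat_elements_def)
qed

lemma bruhat_group_subgroup: "subgroup bruhat_group SL"
  by (rule group.generate_is_subgroup[OF SL_group bruhat_elements_in_SL])

lemma bruhat_group_in_SL: "bruhat_group \<subseteq> carrier SL"
  using bruhat_group_subgroup by (rule subgroup.subset)

lemma bruhat_group_mult:
  "\<lbrakk>g \<in> bruhat_group; h \<in> bruhat_group\<rbrakk> \<Longrightarrow> g \<otimes>\<^bsub>matrix_ring 2 R\<^esub> h \<in> bruhat_group"
  using subgroup.m_closed[OF bruhat_group_subgroup] by (simp add: SL_mult)

lemma bruhat_group_sharp: "g \<in> bruhat_group \<Longrightarrow> sharp g \<in> bruhat_group"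
  using subgroup.m_inv_closed[OF bruhat_group_subgroup] SL_inv bruhat_group_in_SL by (metis subsetD)

lemma bruhat_group_one: "mat2 \<one> \<zero> \<zero> \<one> \<in> bruhat_group"
  using subgroup.one_closed[OF bruhat_group_subgroup] by (simp add: SL_one mat2_one)

lemma upper_in_bruhat_group: "b \<in> sym_elements R star \<Longrightarrow> mat2 \<one> b \<zero> \<one> \<in> bruhat_group"
  by (rule generate.incl) (auto simp: bruhat_elements_def bruhat_u_def)

lemma diagonal_in_bruhat_group:
  assumes "a \<in> Units R"
  shows "mat2 a \<zero> \<zero> (star (inv a)) \<in> bruhat_group"
proof -
  have "bruhat_h R star (star a) \<in> bruhat_group"
    using star_unit(1)[OF assms] by (intro generate.incl) (simp add: bruhat_elements_def)
  then show ?thesis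
    using assms by (simp add: bruhat_h_def star_unit Units_closed star_star)
qed

lemma lower_in_bruhat_group:
  assumes b: "b \<in> sym_elements R star"
  shows "mat2 \<one> \<zero> b \<one> \<in> bruhat_group"
proof -
  have cl: "b \<in> carrier R" using b by (rule sym_elementsD)
  have "\<ominus> b \<in> sym_elements R star"
    using b by (simp add: sym_elements_def star_uminus)
  then have u: "mat2 \<one> (\<ominus> b) \<zero> \<one> \<in> bruhat_group" by (rule upper_in_bruhat_group)
  have w: "mat2 \<zero> \<one> (\<ominus> \<one>) \<zero> \<in> bruhat_group"
    by (rule generate.incl) (auto simp: bruhat_elements_def bruhat_omega_def)
  have "sharp (mat2 \<zero> \<one> (\<ominus> \<one>) \<zero>) \<otimes>\<^bsub>matrix_ring 2 R\<^esub> mat2 \<one> (\<ominus> b) \<zero> \<one> \<otimes>\<^bsub>matrix_ring 2 R\<^esub> mat2 \<zero> \<one> (\<ominus> \<one>) \<zero>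
      = mat2 \<one> \<zero> b \<one>"
    using cl by (simp add: sharp_mat2 mat2_mult star_uminus l_minus r_minus)
  then show ?thesis
    using bruhat_group_mult[OF bruhat_group_mult[OF bruhat_group_sharp[OF w] u] w] by simp
qed

text \<open>The pairs \<open>(a, c)\<close> in the orbit of \<open>(1, 0)\<close> under the Bruhat group. Deciding membership in the
  group can be done on first columns, since the stabiliser of \<open>(1, 0)\<close> in \<open>SL\<^sub>*(2,A)\<close> consists of
  the \<open>u\<^sub>b\<close>.\<close>

definition bruhat_column :: "'a \<Rightarrow> 'a \<Rightarrow> bool" where
  "bruhat_column a c \<longleftrightarrow> (\<exists>b d. mat2 a b c d \<in> bruhat_group)"

lemma bruhat_column_one: "bruhat_column \<one> \<zero>"
  using bruhat_group_one by (auto simp: bruhat_column_def)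

lemma bruhat_column_mult:
  assumes g: "mat2 p q r s \<in> bruhat_group" and "bruhat_column a c"
  shows "bruhat_column (p \<otimes> a \<oplus> q \<otimes> c) (r \<otimes> a \<oplus> s \<otimes> c)"
proof -
  obtain b d where h: "mat2 a b c d \<in> bruhat_group"
    using assms(2) by (auto simp: bruhat_column_def)
  have "p \<in> carrier R" "q \<in> carrier R" "r \<in> carrier R" "s \<in> carrier R"
    "a \<in> carrier R" "b \<in> carrier R" "c \<in> carrier R" "d \<in> carrier R"
    using g h bruhat_group_in_SL by (auto simp: SL_mat2_iff)
  then show ?thesis
    using bruhat_group_mult[OF g h] by (auto simp: mat2_mult bruhat_column_def)
qed

lemma bruhat_column_unit:
  assumes "bruhat_column a c" "w \<in> Units R"
  shows "bruhat_column (a \<otimes> w) (c \<otimes> w)"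
proof -
  obtain b d where h: "mat2 a b c d \<in> bruhat_group"
    using assms(1) by (auto simp: bruhat_column_def)
  have "a \<in> carrier R" "b \<in> carrier R" "c \<in> carrier R" "d \<in> carrier R"
    using h bruhat_group_in_SL by (auto simp: SL_mat2_iff)
  then show ?thesis
    using bruhat_group_mult[OF h diagonal_in_bruhat_group[OF assms(2)]] assms(2)
    by (auto simp: mat2_mult bruhat_column_def star_closed Units_closed)
qed

lemma in_bruhat_group_if_column:
  assumes g: "mat2 a b c d \<in> carrier SL" and col: "bruhat_column a c"
  shows "mat2 a b c d \<in> bruhat_group"
proof -
  interpret G: group SL by (rule SL_group)
  obtain b' d' where h: "mat2 a b' c d' \<in> bruhat_group"
    using col by (auto simp: bruhat_column_def)
  let ?h = "mat2 a b' c d'" and ?g = "mat2 a b c d"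
  have hS: "?h \<in> carrier SL" using h bruhat_group_in_SL by blast
  have cl: "a \<in> carrier R" "b \<in> carrier R" "c \<in> carrier R" "d \<in> carrier R" "b' \<in> carrier R" "d' \<in> carrier R"
    using g hS by (auto simp: SL_mat2_iff)
  define k where "k = inv\<^bsub>SL\<^esub> ?h \<otimes>\<^bsub>SL\<^esub> ?g"
  have kS: "k \<in> carrier SL" using hS g by (simp add: k_def)
  then obtain p q r s where k: "k = mat2 p q r s" by (rule SL_cases)
  have "sharp ?h \<otimes>\<^bsub>matrix_ring 2 R\<^esub> ?h = \<one>\<^bsub>matrix_ring 2 R\<^esub>"
    using hS by (simp add: SL_iff_sharp_inverse)
  then have pr: "p = \<one>" "r = \<zero>"
    using k cl unfolding k_def SL_inv[OF hS] SL_mult by (simp_all add: sharp_mat2 mat2_mult star_closed mat2_one)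
  have qs: "q \<in> carrier R" "s \<in> carrier R" using kS by (auto simp: k SL_mat2_iff)
  have "s = \<one>" "star q = q"
    using kS qs star_closed star_star by (auto simp: k pr SL_mat2_iff minus_eq sym_elements_def)
  then have "k \<in> bruhat_group"
    unfolding k pr using upper_in_bruhat_group qs by (simp add: sym_elements_def)
  then have "?h \<otimes>\<^bsub>SL\<^esub> k \<in> bruhat_group"
    using h by (simp add: bruhat_group_mult SL_mult)
  then show ?thesis
    using hS g by (simp add: k_def G.m_assoc[symmetric])
qed

end

section \<open>Localisation at central projections\<close>

context involution_ring
begin

definition central_projection :: "'a \<Rightarrow> bool" where
  "central_projection e \<longleftrightarrow> e \<in> carrier R \<and> e \<otimes> e = e \<and> star e = e \<and> (\<forall>x\<in>carrier R. x \<otimes> e = e \<otimes> x)"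

text \<open>For a central projection \<open>e\<close> the ring is the product of \<open>eA\<close> and \<open>(1 - e)A\<close>; the component of
  \<open>x\<close> in the second factor is replaced by \<open>1\<close>.\<close>

definition localise :: "'a \<Rightarrow> 'a \<Rightarrow> 'a" where
  "localise e x = e \<otimes> x \<oplus> (\<one> \<ominus> e)"

lemma central_projectionD:
  assumes "central_projection e"
  shows "e \<in> carrier R" "e \<otimes> e = e" "star e = e" "\<And>x. x \<in> carrier R \<Longrightarrow> x \<otimes> e = e \<otimes> x"
  using assms by (auto simp: central_projection_def)

lemma central_projection_one: "central_projection \<one>"
  by (simp add: central_projection_def)

context
  fixes e assumes e: "central_projection e"
begin

lemmas eD = central_projectionD(1-3)[OF e]

lemma projection_comm: "x \<in> carrier R \<Longrightarrow> x \<otimes> e = e \<otimes> x"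
  by (rule central_projectionD(4)[OF e])

lemma projection_mult: "\<lbrakk>x \<in> carrier R; y \<in> carrier R\<rbrakk> \<Longrightarrow> (e \<otimes> x) \<otimes> (e \<otimes> y) = e \<otimes> (x \<otimes> y)"
  using eD projection_comm by (metis m_assoc m_closed)

lemma complement_mult: 
  "x \<in> carrier R \<Longrightarrow> (\<one> \<ominus> e) \<otimes> (e \<otimes> x) = \<zero>"
  "x \<in> carrier R \<Longrightarrow> (e \<otimes> x) \<otimes> (\<one> \<ominus> e) = \<zero>"
  "(\<one> \<ominus> e) \<otimes> (\<one> \<ominus> e) = \<one> \<ominus> e"
proof -
  have 1: "(\<one> \<ominus> e) \<otimes> e = \<zero>" "e \<otimes> (\<one> \<ominus> e) = \<zero>"
    using eD by (simp_all add: minus_eq l_distr r_distr l_minus r_minus r_neg)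
  show "(\<one> \<ominus> e) \<otimes> (e \<otimes> x) = \<zero>" if "x \<in> carrier R"
    using 1 eD that by (simp add: m_assoc[symmetric])
  show "(e \<otimes> x) \<otimes> (\<one> \<ominus> e) = \<zero>" if "x \<in> carrier R"
    using 1 eD projection_comm that by (metis m_assoc minus_closed one_closed r_null)
  show "(\<one> \<ominus> e) \<otimes> (\<one> \<ominus> e) = \<one> \<ominus> e"
    using 1 eD by (subst (2) minus_eq) (simp add: r_distr r_minus)
qed

lemma localise_closed [simp]: "x \<in> carrier R \<Longrightarrow> localise e x \<in> carrier R"
  using eD by (simp add: localise_def)

lemma localise_one [simp]: "localise e \<one> = \<one>"
  using eD(1) unfolding localise_def r_one[OF eD(1)] by algebra

lemma localise_mult: "\<lbrakk>x \<in> carrier R; y \<in> carrier R\<rbrakk> \<Longrightarrow> localise e x \<otimes> localise e y = localise e (x \<otimes> y)"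
  using eD unfolding localise_def
  by (simp add: l_distr r_distr complement_mult projection_mult)

lemma localise_mult_left: "\<lbrakk>x \<in> carrier R; y \<in> carrier R\<rbrakk> \<Longrightarrow> localise e x \<otimes> (e \<otimes> y) = e \<otimes> (x \<otimes> y)"
  using eD unfolding localise_def
  by (simp add: l_distr complement_mult projection_mult)

lemma localise_mult_right: "\<lbrakk>x \<in> carrier R; y \<in> carrier R\<rbrakk> \<Longrightarrow> (e \<otimes> x) \<otimes> localise e y = e \<otimes> (x \<otimes> y)"
  using eD unfolding localise_def
  by (simp add: r_distr complement_mult projection_mult)

lemma localise_add: "\<lbrakk>x \<in> carrier R; y \<in> carrier R\<rbrakk> \<Longrightarrow> localise e x \<oplus> e \<otimes> y = localise e (x \<oplus> y)"
  using eD unfolding localise_def by (simp add: r_distr a_ac)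

lemma localise_star: "x \<in> carrier R \<Longrightarrow> star (localise e x) = localise e (star x)"
  using eD unfolding localise_def by (simp add: star_add star_minus star_mult star_closed projection_comm[OF star_closed])

lemma projection_star: "x \<in> carrier R \<Longrightarrow> star (e \<otimes> x) = e \<otimes> star x"
  using eD by (simp add: star_mult star_closed projection_comm[OF star_closed])

lemma projection_sym: "x \<in> sym_elements R star \<Longrightarrow> e \<otimes> x \<in> sym_elements R star"
  using eD by (simp add: sym_elements_def projection_star)

lemma localise_unit:
  assumes "x \<in> Units R"
  shows "localise e x \<in> Units R" "inv (localise e x) = localise e (inv x)"
proof -
  have *: "localise e x \<otimes> localise e (inv x) = \<one>" "localise e (inv x) \<otimes> localise e x = \<one>"
    using assms by (simp_all add: localise_mult Units_closed)
  moreover have "localise e x \<in> carrier R" "localise e (inv x) \<in> carrier R"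
    using assms by (simp_all add: Units_closed)
  ultimately show "localise e x \<in> Units R"
    unfolding Units_def by blast
  show "inv (localise e x) = localise e (inv x)"
    using * assms by (metis inv_char localise_closed Units_closed Units_inv_closed)
qed

lemma localise_localise:
  assumes f: "central_projection f" and x: "x \<in> carrier R"
  shows "localise e (localise f x) = localise (e \<otimes> f) x"
proof -
  note fD = central_projectionD(1)[OF f]
  have "localise e (localise f x) = (e \<otimes> (f \<otimes> x) \<oplus> (e \<ominus> e \<otimes> f)) \<oplus> (\<one> \<ominus> e)"
    using eD fD x by (simp add: localise_def r_distr minus_eq r_minus)
  also have "\<dots> = e \<otimes> f \<otimes> x \<oplus> ((e \<ominus> e \<otimes> f) \<oplus> (\<one> \<ominus> e))"
    using eD fD x by (simp add: m_assoc a_assoc)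
  also have "(e \<ominus> e \<otimes> f) \<oplus> (\<one> \<ominus> e) = \<one> \<ominus> e \<otimes> f"
    using eD(1) fD x by algebra
  finally show ?thesis by (simp add: localise_def)
qed

lemma central_projection_mult:
  assumes "central_projection f"
  shows "central_projection (e \<otimes> f)"
proof -
  note fD = central_projectionD[OF assms]
  have "(e \<otimes> f) \<otimes> (e \<otimes> f) = e \<otimes> f" using projection_mult[of f f] fD(1,2) by simp
  moreover have "x \<otimes> (e \<otimes> f) = (e \<otimes> f) \<otimes> x" if "x \<in> carrier R" for x
    using eD fD that projection_comm by (metis m_assoc)
  ultimately show ?thesis
    using eD fD(1-3) projection_comm[of f] by (metis central_projection_def m_closed star_mult)
qed

lemma central_projection_complement: "central_projection (\<one> \<ominus> e)"
proof -
  have "x \<otimes> (\<one> \<ominus> e) = (\<one> \<ominus> e) \<otimes> x" if "x \<in> carrier R" for x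
    using that eD by (simp add: minus_eq l_distr r_distr l_minus r_minus projection_comm[OF that])
  moreover have "star (\<one> \<ominus> e) = \<one> \<ominus> e" using eD by (simp add: star_minus)
  ultimately show ?thesis
    using eD(1) complement_mult(3) unfolding central_projection_def by blast
qed

text \<open>The embedding of \<open>SL\<^sub>*(2,eA)\<close> into \<open>SL\<^sub>*(2,A)\<close> maps Bruhat elements to Bruhat elements, with
  the exception of \<open>\<omega>\<close>, whose image is a product of three unipotent elements.\<close>

lemma localise_bruhat_group:
  assumes "mat2 a b c d \<in> bruhat_group"
  shows "mat2 (localise e a) (e \<otimes> b) (e \<otimes> c) (localise e d) \<in> bruhat_group"
proof -
  define \<phi> where "\<phi> g = mat2 (localise e (g $$ (0, 0))) (e \<otimes> g $$ (0, Suc 0)) (e \<otimes> g $$ (Suc 0, 0))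
    (localise e (g $$ (Suc 0, Suc 0)))" for g
  have \<phi>: "\<phi> (mat2 a b c d) = mat2 (localise e a) (e \<otimes> b) (e \<otimes> c) (localise e d)" for a b c d
    by (simp add: \<phi>_def)
  have \<phi>_closed: "\<phi> g \<in> carrier (matrix_ring 2 R)" if "g \<in> carrier (matrix_ring 2 R)" for g
    using that by (rule mat2_cases) (simp add: \<phi> mat2_closed_iff eD)
  have \<phi>_mult: "\<phi> (g \<otimes>\<^bsub>matrix_ring 2 R\<^esub> h) = \<phi> g \<otimes>\<^bsub>matrix_ring 2 R\<^esub> \<phi> h"
    if g: "g \<in> carrier (matrix_ring 2 R)" and h: "h \<in> carrier (matrix_ring 2 R)" for g h
  proof -
    obtain a b c d where g: "g = mat2 a b c d" "a \<in> carrier R" "b \<in> carrier R" "c \<in> carrier R" "d \<in> carrier R"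
      using g by (rule mat2_cases)
    obtain a' b' c' d' where h: "h = mat2 a' b' c' d'" "a' \<in> carrier R" "b' \<in> carrier R" "c' \<in> carrier R" "d' \<in> carrier R"
      using h by (rule mat2_cases)
    have 1: "e \<otimes> x \<oplus> localise e y = localise e (x \<oplus> y)" if "x \<in> carrier R" "y \<in> carrier R" for x y
      using localise_add[of y x] that eD by (simp add: a_comm)
    show ?thesis
      using g(2-) h(2-) eD unfolding g(1) h(1)
      by (simp add: \<phi> mat2_mult localise_mult localise_mult_left localise_mult_right localise_add 1
          projection_mult r_distr)
  qed
  have \<phi>_sharp: "\<phi> (sharp g) = sharp (\<phi> g)" if "g \<in> carrier (matrix_ring 2 R)" for g
    using that
    by (rule mat2_cases) (simp add: \<phi> sharp_mat2 eD localise_star projection_star star_closed r_minus)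
  have \<phi>_one: "\<phi> \<one>\<^bsub>matrix_ring 2 R\<^esub> = \<one>\<^bsub>matrix_ring 2 R\<^esub>"
    by (simp add: mat2_one \<phi> eD)
  have \<phi>_SL: "\<phi> g \<in> carrier SL" if "g \<in> carrier SL" for g
    using that SL_subset \<phi>_mult[of g "sharp g"] \<phi>_mult[of "sharp g" g] \<phi>_one sharp_closed \<phi>_closed
    by (auto simp: SL_iff_sharp_inverse \<phi>_sharp)
  have hom: "group_hom SL SL \<phi>"
    unfolding group_hom_def group_hom_axioms_def hom_def
    using SL_group \<phi>_SL \<phi>_mult SL_subset by (auto simp: SL_mult subset_iff)
  have "\<phi> ` bruhat_elements R star \<subseteq> bruhat_group"
  proof -
    have "\<phi> (bruhat_h R star a) \<in> bruhat_group" if a: "a \<in> Units R" for a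
    proof -
      have "\<phi> (bruhat_h R star a) = bruhat_h R star (localise e a)"
        using a eD localise_unit[OF a] by (simp add: \<phi> bruhat_h_def localise_star Units_closed)
      then show ?thesis
        using localise_unit[OF a] by (auto simp: bruhat_elements_def intro!: generate.incl)
    qed
    moreover have "\<phi> (bruhat_u R b) \<in> bruhat_group" if b: "b \<in> sym_elements R star" for b
      using upper_in_bruhat_group[OF projection_sym[OF b]] eD by (simp add: bruhat_u_def \<phi>)
    moreover have "\<phi> (bruhat_omega R) \<in> bruhat_group"
    proof -
      have u: "mat2 \<one> e \<zero> \<one> \<in> bruhat_group"
        using eD by (intro upper_in_bruhat_group sym_elementsI)
      have l: "mat2 \<one> \<zero> (\<ominus> e) \<one> \<in> bruhat_group"
        using eD by (intro lower_in_bruhat_group sym_elementsI) (simp_all add: star_uminus)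
      have "mat2 \<one> e \<zero> \<one> \<otimes>\<^bsub>matrix_ring 2 R\<^esub> mat2 \<one> \<zero> (\<ominus> e) \<one> \<otimes>\<^bsub>matrix_ring 2 R\<^esub> mat2 \<one> e \<zero> \<one>
        = \<phi> (bruhat_omega R)"
        using eD
        by (simp add: \<phi> bruhat_omega_def mat2_mult localise_def minus_eq r_minus l_minus l_distr a_comm l_neg r_neg a_assoc)
      then show ?thesis
        using bruhat_group_mult[OF bruhat_group_mult[OF u l] u] by simp
    qed
    ultimately show ?thesis by (auto simp: bruhat_elements_def)
  qed
  then have "\<phi> ` bruhat_group \<subseteq> bruhat_group"
    using group_hom.generate_img[OF hom bruhat_elements_in_SL]
      group.generate_subgroup_incl[OF SL_group _ bruhat_group_subgroup] by metis
  then show ?thesis using assms \<phi> by force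
qed

end


section \<open>Moves on first columns\<close>

text \<open>The first columns of elements of \<open>SL\<^sub>*(2,A)\<close> satisfy these conditions.\<close>

definition isotropic :: "'a \<Rightarrow> 'a \<Rightarrow> bool" where
  "isotropic a c \<longleftrightarrow> a \<in> carrier R \<and> c \<in> carrier R \<and> star a \<otimes> c \<in> sym_elements R star \<and>
     (\<exists>u\<in>carrier R. \<exists>v\<in>carrier R. u \<otimes> a \<oplus> v \<otimes> c = \<one>)"

lemma isotropicI:
  assumes "a \<in> carrier R" "c \<in> carrier R" "star (star a \<otimes> c) = star a \<otimes> c"
    "u \<in> carrier R" "v \<in> carrier R" "u \<otimes> a \<oplus> v \<otimes> c = \<one>"
  shows "isotropic a c"
  using assms star_closed unfolding isotropic_def sym_elements_def by blast

text \<open>The first four moves multiply by Bruhat elements, from the left or from the right. The last one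
  restricts attention to the factor \<open>eA\<close> of the ring.\<close>

inductive move :: "'a set \<Rightarrow> 'a \<times> 'a \<Rightarrow> 'a \<times> 'a \<Rightarrow> bool" for E where
  upper: "b \<in> sym_elements R star \<Longrightarrow> move E (a, c) (a \<oplus> b \<otimes> c, c)"
| lower: "b \<in> sym_elements R star \<Longrightarrow> move E (a, c) (a, c \<oplus> b \<otimes> a)"
| left: "g \<in> Units R \<Longrightarrow> move E (a, c) (g \<otimes> a, star (inv g) \<otimes> c)"
| right: "g \<in> Units R \<Longrightarrow> move E (a, c) (a \<otimes> g, c \<otimes> g)"
| local: "e \<in> E \<Longrightarrow> move E (a, c) (localise e a, e \<otimes> c)"

lemma isotropic_move:
  assumes "move E (a, c) (a', c')" "isotropic a c" "\<And>e. e \<in> E \<Longrightarrow> central_projection e"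
  shows "isotropic a' c'"
proof -
  obtain u v where cl: "a \<in> carrier R" "c \<in> carrier R" and sym: "star (star a \<otimes> c) = star a \<otimes> c"
    and uv: "u \<in> carrier R" "v \<in> carrier R" "u \<otimes> a \<oplus> v \<otimes> c = \<one>"
    using assms(2) by (auto simp: isotropic_def sym_elements_def)
  have sym': "star c \<otimes> a = star a \<otimes> c"
    using sym cl by (simp add: star_mult star_closed star_star)
  show ?thesis
    using assms(1)
  proof cases
    case (upper b)
    have b: "b \<in> carrier R" "star b = b" using upper(3) by (simp_all add: sym_elements_def)
    have "u \<otimes> (a \<oplus> b \<otimes> c) \<oplus> (v \<ominus> u \<otimes> b) \<otimes> c = \<one>"
      using cl uv(1,2) b unfolding uv(3)[symmetric] by algebra
    moreover have "star (a \<oplus> b \<otimes> c) \<otimes> c \<in> sym_elements R star"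
      using cl b sym' by (auto simp: sym_elements_def star_add star_mult star_closed star_star l_distr m_assoc)
    ultimately show ?thesis
      using upper(1,2) cl b uv(1,2) unfolding isotropic_def by (metis m_closed a_closed minus_closed)
  next
    case (lower b)
    have b: "b \<in> carrier R" "star b = b" using lower(3) by (simp_all add: sym_elements_def)
    have "(u \<ominus> v \<otimes> b) \<otimes> a \<oplus> v \<otimes> (c \<oplus> b \<otimes> a) = \<one>"
      using cl uv(1,2) b unfolding uv(3)[symmetric] by algebra
    moreover have "star a \<otimes> (c \<oplus> b \<otimes> a) \<in> sym_elements R star"
      using cl b sym' by (auto simp: sym_elements_def star_add star_mult star_closed star_star r_distr m_assoc)
    ultimately show ?thesis
      using lower(1,2) cl b uv(1,2) unfolding isotropic_def by (metis m_closed a_closed minus_closed)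
  next
    case (left g)
    have g: "g \<in> carrier R" "inv g \<in> carrier R" "inv g \<otimes> g = \<one>" "g \<otimes> inv g = \<one>"
      using left(3) by auto
    have sg: "star g \<otimes> star (inv g) = \<one>" using g by (metis star_mult star_one)
    have "(u \<otimes> inv g) \<otimes> (g \<otimes> a) = u \<otimes> ((inv g \<otimes> g) \<otimes> a)"
      using cl g(1,2) uv by (simp only: m_assoc m_closed)
    moreover have "(v \<otimes> star g) \<otimes> (star (inv g) \<otimes> c) = v \<otimes> ((star g \<otimes> star (inv g)) \<otimes> c)"
      using cl g(1,2) uv by (simp only: m_assoc m_closed star_closed)
    ultimately have "(u \<otimes> inv g) \<otimes> (g \<otimes> a) \<oplus> (v \<otimes> star g) \<otimes> (star (inv g) \<otimes> c) = \<one>"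
      using cl g uv sg by simp
    moreover have "star (g \<otimes> a) \<otimes> (star (inv g) \<otimes> c) = star a \<otimes> ((star g \<otimes> star (inv g)) \<otimes> c)"
      using cl g(1,2) by (simp add: star_mult m_assoc star_closed)
    moreover have "star a \<otimes> ((star g \<otimes> star (inv g)) \<otimes> c) = star a \<otimes> c"
      using sg cl by simp
    ultimately show ?thesis
      unfolding left(1,2) using cl g(1,2) uv(1,2) sym
      by (intro isotropicI[of _ _ "u \<otimes> inv g" "v \<otimes> star g"]) (simp_all only: m_closed star_closed)
  next
    case (right g)
    have g: "g \<in> carrier R" "inv g \<in> carrier R" "inv g \<otimes> g = \<one>" "g \<otimes> inv g = \<one>"
      using right(3) by auto
    have "(inv g \<otimes> u) \<otimes> (a \<otimes> g) \<oplus> (inv g \<otimes> v) \<otimes> (c \<otimes> g) = inv g \<otimes> ((u \<otimes> a \<oplus> v \<otimes> c) \<otimes> g)"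
      using cl g(1,2) uv(1,2) by algebra
    then have "(inv g \<otimes> u) \<otimes> (a \<otimes> g) \<oplus> (inv g \<otimes> v) \<otimes> (c \<otimes> g) = \<one>"
      using g uv by simp
    moreover have "star (a \<otimes> g) \<otimes> (c \<otimes> g) = star g \<otimes> (star a \<otimes> c) \<otimes> g"
      using cl g(1,2) by (simp add: star_mult star_closed m_assoc)
    moreover have "star (star g \<otimes> (star a \<otimes> c) \<otimes> g) = star g \<otimes> (star a \<otimes> c) \<otimes> g"
      using cl g(1,2) sym' by (simp add: star_mult star_closed star_star m_assoc)
    ultimately show ?thesis
      unfolding right(1,2) using cl g(1,2) uv(1,2)
      by (intro isotropicI[of _ _ "inv g \<otimes> u" "inv g \<otimes> v"]) (simp_all only: m_closed star_closed)
  next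
    case (local e)
    have e: "central_projection e" using local(3) assms(3) by blast
    have "localise e u \<otimes> localise e a \<oplus> (e \<otimes> v) \<otimes> (e \<otimes> c) = \<one>"
      using cl uv central_projectionD(1-3)[OF e] by (simp add: localise_mult[OF e] projection_mult[OF e] localise_add[OF e] localise_one[OF e])
    moreover have "star (localise e a) \<otimes> (e \<otimes> c) = e \<otimes> (star a \<otimes> c)"
      using cl e by (simp add: localise_star localise_mult_left star_closed)
    ultimately show ?thesis
      unfolding local(1,2) using cl e uv(1,2) sym central_projectionD(1)[OF e]
      by (intro isotropicI[of _ _ "localise e u" "e \<otimes> v"]) (simp_all add: projection_star star_closed)
  qed
qed

lemma isotropic_moves:
  assumes "(move E)\<^sup>*\<^sup>* (a, c) (a', c')" "isotropic a c" "\<And>e. e \<in> E \<Longrightarrow> central_projection e"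
  shows "isotropic a' c'"
  using assms(1,2) by (induction rule: rtranclp_induct2) (use isotropic_move assms(3) in blast)+

lemma bruhat_column_move:
  assumes "move E (a, c) (a', c')" "a \<in> carrier R" "c \<in> carrier R" "f \<in> E"
    and f_col: "bruhat_column (localise f a') (f \<otimes> c')"
    and E: "\<And>e. e \<in> E \<Longrightarrow> central_projection e" "\<And>e f. e \<in> E \<Longrightarrow> f \<in> E \<Longrightarrow> e \<otimes> f \<in> E"
  shows "\<exists>f\<in>E. bruhat_column (localise f a) (f \<otimes> c)"
  using assms(1)
proof cases
  note cl = assms(2,3)
  have f: "central_projection f" using E assms(4) by blast
  note fc = central_projectionD(1)[OF f]
  {
    case (upper b)
    have b: "b \<in> carrier R" using upper(3) by (rule sym_elementsD)
    have "bruhat_column (\<one> \<otimes> localise f (a \<oplus> b \<otimes> c) \<oplus> (f \<otimes> (\<ominus> b)) \<otimes> (f \<otimes> c)) (\<zero> \<otimes> localise f (a \<oplus> b \<otimes> c) \<oplus> \<one> \<otimes> (f \<otimes> c))"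
      using upper f_col by (intro bruhat_column_mult upper_in_bruhat_group projection_sym[OF f])
        (auto simp: sym_elements_def star_uminus)
    also have "\<one> \<otimes> localise f (a \<oplus> b \<otimes> c) \<oplus> (f \<otimes> (\<ominus> b)) \<otimes> (f \<otimes> c) = localise f (a \<oplus> b \<otimes> c \<oplus> (\<ominus> b) \<otimes> c)"
      using f cl b by (simp add: projection_mult localise_add)
    also have "a \<oplus> b \<otimes> c \<oplus> (\<ominus> b) \<otimes> c = a"
      using cl b by algebra
    finally show ?thesis using f fc cl b assms(4) by auto
  next
    case (lower b)
    have b: "b \<in> carrier R" using lower(3) by (rule sym_elementsD)
    have "bruhat_column (\<one> \<otimes> localise f a \<oplus> \<zero> \<otimes> (f \<otimes> (c \<oplus> b \<otimes> a))) ((f \<otimes> (\<ominus> b)) \<otimes> localise f a \<oplus> \<one> \<otimes> (f \<otimes> (c \<oplus> b \<otimes> a)))"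
      using lower f_col by (intro bruhat_column_mult lower_in_bruhat_group projection_sym[OF f])
        (auto simp: sym_elements_def star_uminus)
    also have "(f \<otimes> (\<ominus> b)) \<otimes> localise f a \<oplus> \<one> \<otimes> (f \<otimes> (c \<oplus> b \<otimes> a)) = f \<otimes> ((\<ominus> b) \<otimes> a \<oplus> (c \<oplus> b \<otimes> a))"
      using f cl b fc by (simp add: localise_mult_right r_distr)
    also have "(\<ominus> b) \<otimes> a \<oplus> (c \<oplus> b \<otimes> a) = c"
      using cl b by algebra
    finally show ?thesis using f fc cl b assms(4) by auto
  next
    case (left g)
    have g: "g \<in> carrier R" "inv g \<in> carrier R" "inv g \<otimes> g = \<one>" "g \<otimes> inv g = \<one>" "inv g \<in> Units R" "inv (inv g) = g"
      using left(3) by auto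
    have sg: "star g \<otimes> star (inv g) = \<one>" using g by (metis star_mult star_one)
    note lu = localise_unit[OF f g(5), unfolded g(6)]
    have "bruhat_column (localise f (inv g) \<otimes> localise f (g \<otimes> a) \<oplus> \<zero> \<otimes> (f \<otimes> (star (inv g) \<otimes> c)))
        (\<zero> \<otimes> localise f (g \<otimes> a) \<oplus> localise f (star g) \<otimes> (f \<otimes> (star (inv g) \<otimes> c)))"
      using left f_col diagonal_in_bruhat_group[OF lu(1)] g f
      by (intro bruhat_column_mult) (simp_all add: lu localise_star)
    moreover have "inv g \<otimes> (g \<otimes> a) = a" "star g \<otimes> (star (inv g) \<otimes> c) = c"
      using g cl sg by (simp_all add: m_assoc[symmetric] star_closed)
    ultimately show ?thesis
      using f fc cl g assms(4) by (auto simp: localise_mult localise_mult_left star_closed)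
  next
    case (right g)
    have g: "g \<in> carrier R" "inv g \<in> carrier R" "inv g \<otimes> g = \<one>" "g \<otimes> inv g = \<one>" "inv g \<in> Units R"
      using right(3) by auto
    have "bruhat_column (localise f (a \<otimes> g) \<otimes> localise f (inv g)) (f \<otimes> (c \<otimes> g) \<otimes> localise f (inv g))"
      using right f_col localise_unit(1)[OF f g(5)] by (intro bruhat_column_unit) auto
    moreover have "a \<otimes> g \<otimes> inv g = a" "c \<otimes> g \<otimes> inv g = c"
      using cl g by (simp_all add: m_assoc)
    ultimately show ?thesis
      using f cl g(1,2) assms(4) by (auto simp: localise_mult localise_mult_right)
  next
    case (local e)
    have e: "central_projection e" using local(3) E by blast
    show ?thesis
      using f_col local(1,2) e f cl central_projectionD(1)[OF e] fc
      by (intro bexI[OF _ E(2)[OF assms(4) local(3)]]) (simp add: localise_localise m_assoc)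
  }
qed

text \<open>A chain of moves that ends in the orbit is undone step by step. Every restriction to a factor of the
  ring that occurs on the way multiplies the idempotent for which a conclusion is possible.\<close>

lemma bruhat_column_moves:
  assumes "(move E)\<^sup>*\<^sup>* (a, c) (a', c')" "isotropic a c"
    and "\<exists>f\<in>E. bruhat_column (localise f a') (f \<otimes> c')"
    and E: "\<And>e. e \<in> E \<Longrightarrow> central_projection e" "\<And>e f. e \<in> E \<Longrightarrow> f \<in> E \<Longrightarrow> e \<otimes> f \<in> E"
  shows "\<exists>f\<in>E. bruhat_column (localise f a) (f \<otimes> c)"
  using assms(1,2)
proof (induction rule: converse_rtranclp_induct2)
  case refl
  then show ?case using assms(3) by blast
next
  case (step a c a' c')
  then show ?case
    using isotropic_move[OF step(1,4) E(1)] bruhat_column_move[OF step(1) _ _ _ _ E]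
    by (auto simp: isotropic_def)
qed

end

section \<open>Splitting off a pivot\<close>

context involution_ring
begin

lemma unipotent_unit:
  assumes "N \<in> carrier R" "N \<otimes> N = \<zero>"
  shows "\<one> \<oplus> N \<in> Units R" "inv (\<one> \<oplus> N) = \<one> \<ominus> N"
proof -
  have 1: "(\<one> \<oplus> N) \<otimes> (\<one> \<ominus> N) = \<one>" "(\<one> \<ominus> N) \<otimes> (\<one> \<oplus> N) = \<one>"
    using assms by (simp_all add: minus_eq l_distr r_distr l_minus r_minus a_assoc r_neg l_neg)
  then show "\<one> \<oplus> N \<in> Units R"
    unfolding Units_def using assms by blast
  show "inv (\<one> \<oplus> N) = \<one> \<ominus> N"
    using 1 assms by (intro inv_char) auto
qed

lemma move_unipotent_left:
  assumes N: "N \<in> carrier R" "N \<otimes> N = \<zero>" and cl: "a \<in> carrier R" "c \<in> carrier R"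
  shows "move E (a, c) (a \<oplus> N \<otimes> a, c \<ominus> star N \<otimes> c)"
proof -
  have "move E (a, c) ((\<one> \<oplus> N) \<otimes> a, star (inv (\<one> \<oplus> N)) \<otimes> c)"
    by (rule move.left[OF unipotent_unit(1)[OF N]])
  then show ?thesis
    using N(1) cl
    by (simp add: unipotent_unit[OF N] star_minus l_distr star_closed) (simp add: minus_eq l_distr l_minus star_closed)
qed

lemma move_unipotent_left':
  assumes N: "N \<in> carrier R" "N \<otimes> N = \<zero>" and cl: "a \<in> carrier R" "c \<in> carrier R"
  shows "move E (a, c) (a \<ominus> star N \<otimes> a, c \<oplus> N \<otimes> c)"
proof -
  have "\<ominus> star N \<otimes> \<ominus> star N = star (N \<otimes> N)"
    using N(1) by (simp add: star_mult star_closed l_minus r_minus)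
  then show ?thesis
    using move_unipotent_left[of "\<ominus> star N" a c E] N cl
    by (simp add: star_closed star_uminus star_star l_minus minus_eq)
qed

lemma move_unipotent_right:
  assumes N: "N \<in> carrier R" "N \<otimes> N = \<zero>" and cl: "a \<in> carrier R" "c \<in> carrier R"
  shows "move E (a, c) (a \<oplus> a \<otimes> N, c \<oplus> c \<otimes> N)"
  using move.right[OF unipotent_unit(1)[OF N], of E a c] N cl by (simp add: r_distr)

lemma zero_mult_left: "\<lbrakk>u \<otimes> v = \<zero>; u \<in> carrier R; v \<in> carrier R; x \<in> carrier R\<rbrakk> \<Longrightarrow> u \<otimes> (v \<otimes> x) = \<zero>"
  by (simp add: m_assoc[symmetric])

lemma zero_mult_right: "\<lbrakk>v \<otimes> w = \<zero>; v \<in> carrier R; w \<in> carrier R; x \<in> carrier R\<rbrakk> \<Longrightarrow> x \<otimes> v \<otimes> w = \<zero>"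
  by (simp add: m_assoc)

text \<open>With respect to the idempotent \<open>f\<close>, the pair \<open>(a, c)\<close> is the direct sum of \<open>(f, 0)\<close> and a pair
  over the complementary corner ring.\<close>

definition split_off :: "'a \<Rightarrow> 'a \<Rightarrow> 'a \<Rightarrow> bool" where
  "split_off f a c \<longleftrightarrow> f \<otimes> a = f \<and> a \<otimes> f = f \<and> f \<otimes> c = \<zero> \<and> c \<otimes> f = \<zero>"

context
  fixes f a c
  assumes f: "f \<in> carrier R" "star f = f" and cl: "a \<in> carrier R" "c \<in> carrier R"
    and so: "split_off f a c"
begin

lemmas so' = so[unfolded split_off_def]

lemma split_off_unipotent_left:
  assumes N: "N \<in> carrier R" "f \<otimes> N = \<zero>" "N \<otimes> f = \<zero>"
  shows "split_off f (a \<oplus> N \<otimes> a) (c \<ominus> star N \<otimes> c)" "split_off f (a \<ominus> star N \<otimes> a) (c \<oplus> N \<otimes> c)"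
proof -
  have S: "f \<otimes> star N = \<zero>" "star N \<otimes> f = \<zero>"
    using N f by (metis star_mult star_zero)+
  have "f \<otimes> (M \<otimes> x) = \<zero>" "M \<otimes> a \<otimes> f = \<zero>" "M \<otimes> c \<otimes> f = \<zero>"
    if "f \<otimes> M = \<zero>" "M \<otimes> f = \<zero>" "M \<in> carrier R" "x \<in> carrier R" for M x
    using that f cl so' by (simp_all add: m_assoc[symmetric]) (simp_all add: m_assoc)
  note this[OF N(2,3,1)] this[OF S star_closed[OF N(1)]]
  then show "split_off f (a \<oplus> N \<otimes> a) (c \<ominus> star N \<otimes> c)" "split_off f (a \<ominus> star N \<otimes> a) (c \<oplus> N \<otimes> c)"
    unfolding split_off_def using f cl N so' star_closed[OF N(1)]
    by (simp_all add: minus_eq l_distr r_distr l_minus r_minus)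
qed

lemma split_off_unipotent_right:
  assumes N: "N \<in> carrier R" "f \<otimes> N = \<zero>" "N \<otimes> f = \<zero>"
  shows "split_off f (a \<oplus> a \<otimes> N) (c \<oplus> c \<otimes> N)"
proof -
  have "f \<otimes> (a \<otimes> N) = \<zero>" "f \<otimes> (c \<otimes> N) = \<zero>" "a \<otimes> N \<otimes> f = \<zero>" "c \<otimes> N \<otimes> f = \<zero>"
    using N f cl so' by (simp_all add: m_assoc[symmetric]) (simp_all add: m_assoc)
  then show ?thesis
    unfolding split_off_def using f cl N so' by (simp add: l_distr r_distr)
qed

lemma split_off_upper_lower:
  assumes b: "b \<in> carrier R" "f \<otimes> b = \<zero>" "b \<otimes> f = \<zero>"
  shows "split_off f (a \<oplus> b \<otimes> c) c" "split_off f a (c \<oplus> b \<otimes> a)"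
proof -
  have "f \<otimes> (b \<otimes> a) = \<zero>" "f \<otimes> (b \<otimes> c) = \<zero>" "b \<otimes> a \<otimes> f = \<zero>" "b \<otimes> c \<otimes> f = \<zero>"
    using b f cl so' by (simp_all add: m_assoc[symmetric]) (simp_all add: m_assoc)
  then show "split_off f (a \<oplus> b \<otimes> c) c" "split_off f a (c \<oplus> b \<otimes> a)"
    unfolding split_off_def using f cl b so' by (simp_all add: l_distr r_distr)
qed

lemma split_off_localise:
  assumes e: "central_projection e"
  shows "split_off f (localise e a) (e \<otimes> c)"
proof -
  note eD = central_projectionD(1)[OF e]
  have fe: "f \<otimes> e = e \<otimes> f" using central_projectionD(4)[OF e f(1)] .
  have "f \<otimes> (e \<otimes> a) = e \<otimes> f" "f \<otimes> (e \<otimes> c) = \<zero>" "e \<otimes> a \<otimes> f = e \<otimes> f" "e \<otimes> c \<otimes> f = \<zero>"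
    using f(1) cl so' eD by (simp_all add: m_assoc[symmetric] fe) (simp_all add: m_assoc)
  moreover have "e \<otimes> f \<oplus> (f \<ominus> e \<otimes> f) = f" using eD f(1) by algebra
  moreover have "f \<otimes> (\<one> \<ominus> e) = f \<ominus> e \<otimes> f" "(\<one> \<ominus> e) \<otimes> f = f \<ominus> e \<otimes> f"
    using eD f(1) fe by (simp_all add: minus_eq l_distr r_distr l_minus r_minus)
  ultimately show ?thesis
    unfolding split_off_def localise_def using f(1) cl so' eD by (simp add: l_distr r_distr)
qed

end

context
  fixes E f p
  assumes E: "\<And>e. e \<in> E \<Longrightarrow> central_projection e"
    and f: "f \<in> carrier R" "star f = f"
    and p: "p \<in> carrier R" "p \<otimes> p = p" "star p = p" "f \<otimes> p = \<zero>" "p \<otimes> f = \<zero>"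
begin

lemma split_off_add:
  assumes "split_off f a c" "p \<otimes> a = p" "a \<otimes> p = p" "p \<otimes> c = \<zero>" "c \<otimes> p = \<zero>" "a \<in> carrier R" "c \<in> carrier R"
  shows "split_off (f \<oplus> p) a c"
  using assms f(1) p(1) by (simp add: split_off_def l_distr r_distr)

lemma clear_column_above:
  assumes iso: "isotropic a c" and so: "split_off f a c" and pap: "p \<otimes> a \<otimes> p = p"
  shows "\<exists>a' c'. move E (a, c) (a', c') \<and> split_off f a' c' \<and> a' \<otimes> p = p"
proof -
  have cl: "a \<in> carrier R" "c \<in> carrier R" using iso by (auto simp: isotropic_def)
  \<comment> \<open>The unipotent row operation with the column \<open>ap\<close> of \<open>a\<close>; \<open>N\<close> has square zero because \<open>pap = p\<close>.\<close>
  define N where "N = p \<ominus> a \<otimes> p"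
  have N: "N \<in> carrier R" using cl p by (simp add: N_def)
  have pap': "p \<otimes> (a \<otimes> p) = p" "a \<otimes> p \<otimes> (a \<otimes> p) = a \<otimes> p" "a \<otimes> p \<otimes> p = a \<otimes> p"
    using pap p cl by (simp_all add: m_assoc)
  have "N \<otimes> N = (p \<otimes> p \<ominus> p \<otimes> (a \<otimes> p)) \<ominus> (a \<otimes> p \<otimes> p \<ominus> a \<otimes> p \<otimes> (a \<otimes> p))"
    using cl p(1) unfolding N_def by algebra
  then have NN: "N \<otimes> N = \<zero>"
    using cl p by (simp add: pap' r_neg minus_eq)
  have "f \<otimes> N = f \<otimes> p \<ominus> f \<otimes> a \<otimes> p" "N \<otimes> f = p \<otimes> f \<ominus> a \<otimes> (p \<otimes> f)"
    using cl p(1) f(1) unfolding N_def by (simp_all add: ring_simprules)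
  then have fN: "f \<otimes> N = \<zero>" "N \<otimes> f = \<zero>"
    using cl p f so by (simp_all add: split_off_def minus_eq)
  have "(a \<oplus> N \<otimes> a) \<otimes> p = a \<otimes> p \<oplus> (p \<otimes> a \<otimes> p \<ominus> a \<otimes> (p \<otimes> a \<otimes> p))"
    using cl p(1) unfolding N_def by algebra
  also have "\<dots> = p"
    unfolding pap using cl p(1) by algebra
  finally have "(a \<oplus> N \<otimes> a) \<otimes> p = p" .
  with move_unipotent_left[OF N NN cl] split_off_unipotent_left(1)[OF f cl so N fN] show ?thesis
    by blast
qed

lemma clear_column_below:
  assumes iso: "isotropic a c" and so: "split_off f a c" and ap: "a \<otimes> p = p"
  shows "\<exists>c'. move E (a, c) (a, c') \<and> split_off f a c' \<and> c' \<otimes> p = \<zero>"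
proof -
  have cl: "a \<in> carrier R" "c \<in> carrier R" using iso by (auto simp: isotropic_def)
  note cls = star_closed[OF cl(1)] star_closed[OF cl(2)]
  have sym: "star c \<otimes> a = star a \<otimes> c"
    using iso cl cls by (auto simp: isotropic_def sym_elements_def star_mult star_star)
  have pa: "p \<otimes> star a = p"
    using arg_cong[OF ap, of star] cl p by (simp add: star_mult)
  have pcp: "p \<otimes> star c \<otimes> p = p \<otimes> c \<otimes> p"
  proof -
    have "p \<otimes> star c \<otimes> p = p \<otimes> (star c \<otimes> a) \<otimes> p"
      using cl cls p(1) ap by (simp add: m_assoc)
    also have "\<dots> = p \<otimes> star a \<otimes> c \<otimes> p"
      using cl cls p(1) by (simp add: sym m_assoc)
    finally show ?thesis by (simp add: pa)
  qed
  \<comment> \<open>A symmetric \<open>b\<close> with \<open>bp = -cp\<close>: the term \<open>pcp\<close>, which is symmetric, makes up for counting the corner twice.\<close>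
  define b where "b = p \<otimes> c \<otimes> p \<ominus> c \<otimes> p \<ominus> p \<otimes> star c"
  have b: "b \<in> carrier R" using cl cls p by (simp add: b_def)
  have "star b = p \<otimes> star c \<otimes> p \<ominus> p \<otimes> star c \<ominus> c \<otimes> p"
    using cl cls p by (simp add: b_def star_minus star_mult star_star m_assoc)
  also have "\<dots> = b"
    unfolding b_def pcp using cl cls p(1) by algebra
  finally have sb: "b \<in> sym_elements R star" using b by (simp add: sym_elements_def)
  have "f \<otimes> star c = \<zero>" "star c \<otimes> f = \<zero>"
    using so f cl unfolding split_off_def by (metis star_mult star_zero)+
  moreover have "f \<otimes> b = f \<otimes> p \<otimes> c \<otimes> p \<ominus> f \<otimes> c \<otimes> p \<ominus> f \<otimes> p \<otimes> star c"
    "b \<otimes> f = p \<otimes> c \<otimes> (p \<otimes> f) \<ominus> c \<otimes> (p \<otimes> f) \<ominus> p \<otimes> (star c \<otimes> f)"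
    unfolding b_def using cl cls p(1) f(1) by (simp_all add: ring_simprules)
  ultimately have fb: "f \<otimes> b = \<zero>" "b \<otimes> f = \<zero>"
    using so cl cls p f by (simp_all add: split_off_def minus_eq)
  have "b \<otimes> p = p \<otimes> c \<otimes> (p \<otimes> p) \<ominus> c \<otimes> (p \<otimes> p) \<ominus> p \<otimes> star c \<otimes> p"
    unfolding b_def using cl cls p(1) by algebra
  then have bp: "b \<otimes> p = \<ominus> (c \<otimes> p)"
    unfolding p(2) pcp using cl p(1) by algebra
  have "(c \<oplus> b \<otimes> a) \<otimes> p = c \<otimes> p \<oplus> b \<otimes> (a \<otimes> p)"
    using cl b p(1) by algebra
  then have "(c \<oplus> b \<otimes> a) \<otimes> p = \<zero>"
    using cl p(1) by (simp add: ap bp r_neg)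
  with move.lower[OF sb, of E a c] split_off_upper_lower(2)[OF f cl so b fb] show ?thesis
    by blast
qed

lemma clear_row:
  assumes iso: "isotropic a c" and so: "split_off f a c" and ap: "a \<otimes> p = p" and cp: "c \<otimes> p = \<zero>"
  shows "\<exists>a'. move E (a, c) (a', c) \<and> split_off (f \<oplus> p) a' c"
proof -
  have cl: "a \<in> carrier R" "c \<in> carrier R" using iso by (auto simp: isotropic_def)
  note cls = star_closed[OF cl(1)] star_closed[OF cl(2)]
  have sym: "star c \<otimes> a = star a \<otimes> c"
    using iso cl cls by (auto simp: isotropic_def sym_elements_def star_mult star_star)
  have pa: "p \<otimes> star a = p"
    using arg_cong[OF ap, of star] cl p by (simp add: star_mult)
  have pc': "p \<otimes> star c = \<zero>"
    using arg_cong[OF cp, of star] cl p by (simp add: star_mult)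
  \<comment> \<open>The symmetry of \<open>a\<^sup>*c\<close> clears the row of \<open>c\<close>, so that a column operation on \<open>a\<close> suffices.\<close>
  have "p \<otimes> c = p \<otimes> (star a \<otimes> c)"
    using cl cls p(1) by (simp add: m_assoc[symmetric] pa)
  also have "\<dots> = p \<otimes> star c \<otimes> a"
    using cl cls p(1) by (simp add: sym[symmetric] m_assoc)
  finally have pc: "p \<otimes> c = \<zero>" using cl by (simp add: pc')
  define N where "N = p \<ominus> p \<otimes> a"
  have N: "N \<in> carrier R" using cl p by (simp add: N_def)
  have "N \<otimes> N = (p \<otimes> p \<ominus> p \<otimes> p \<otimes> a) \<ominus> (p \<otimes> (a \<otimes> p) \<ominus> p \<otimes> (a \<otimes> p) \<otimes> a)"
    using cl p(1) unfolding N_def by algebra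
  then have NN: "N \<otimes> N = \<zero>"
    using cl p by (simp add: ap r_neg minus_eq)
  have "f \<otimes> N = f \<otimes> p \<ominus> f \<otimes> p \<otimes> a" "N \<otimes> f = p \<otimes> f \<ominus> p \<otimes> (a \<otimes> f)"
    using cl p(1) f(1) unfolding N_def by (simp_all add: ring_simprules)
  then have fN: "f \<otimes> N = \<zero>" "N \<otimes> f = \<zero>"
    using cl p f so by (simp_all add: split_off_def minus_eq)
  let ?a = "a \<oplus> a \<otimes> N"
  have "c \<oplus> c \<otimes> N = c \<oplus> (c \<otimes> p \<ominus> c \<otimes> p \<otimes> a)"
    using cl p(1) unfolding N_def by algebra
  then have c: "c \<oplus> c \<otimes> N = c"
    using cl p by (simp add: cp minus_eq)
  have a: "?a = a \<oplus> (a \<otimes> p \<ominus> a \<otimes> p \<otimes> a)"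
    using cl p(1) unfolding N_def by algebra
  have a': "?a = a \<oplus> (p \<ominus> p \<otimes> a)" using a by (simp only: ap)
  have "p \<otimes> ?a = p \<otimes> a \<oplus> (p \<otimes> p \<ominus> p \<otimes> p \<otimes> a)"
    unfolding a' using cl p(1) by algebra
  also have "\<dots> = p" unfolding p(2) using cl p(1) by algebra
  finally have pa': "p \<otimes> ?a = p" .
  have "?a \<otimes> p = a \<otimes> p \<oplus> (p \<otimes> p \<ominus> p \<otimes> (a \<otimes> p))"
    unfolding a' using cl p(1) by algebra
  also have "\<dots> = p" unfolding ap p(2) using p(1) by algebra
  finally have ap': "?a \<otimes> p = p" .
  have "split_off f ?a c"
    using split_off_unipotent_right[OF f cl so N fN] by (simp add: c)
  then have "split_off (f \<oplus> p) ?a c"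
    using pa' ap' pc cp cl N p by (intro split_off_add) simp_all
  with move_unipotent_right[OF N NN cl, of E] show ?thesis
    by (auto simp: c)
qed

text \<open>Once the corner \<open>pap\<close> is invertible, it is normalised to \<open>p\<close> and the rest of its row and column
  is cleared. The block of \<open>c\<close> in the row of \<open>p\<close> vanishes by itself, since \<open>a\<^sup>*c\<close> is symmetric.\<close>

lemma split_off_pivot:
  assumes iso: "isotropic a c" and so: "split_off f a c"
    and v: "v \<in> carrier R" "p \<otimes> v = v" "v \<otimes> p = v" "v \<otimes> (p \<otimes> a \<otimes> p) = p" "(p \<otimes> a \<otimes> p) \<otimes> v = p"
  shows "\<exists>a' c'. (move E)\<^sup>*\<^sup>* (a, c) (a', c') \<and> split_off (f \<oplus> p) a' c'"
proof -
  have cl: "a \<in> carrier R" "c \<in> carrier R" using iso by (auto simp: isotropic_def)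
  define x where "x = p \<otimes> a \<otimes> p"
  have x: "x \<in> carrier R" "p \<otimes> x = x" "x \<otimes> p = x" "v \<otimes> x = p" "x \<otimes> v = p"
  proof -
    show "x \<in> carrier R" "v \<otimes> x = p" "x \<otimes> v = p" using cl p(1) v by (simp_all add: x_def)
    have "p \<otimes> x = (p \<otimes> p) \<otimes> a \<otimes> p" using cl p(1) by (simp add: x_def m_assoc)
    then show "p \<otimes> x = x" by (simp add: p(2) x_def)
    have "x \<otimes> p = p \<otimes> a \<otimes> (p \<otimes> p)" using cl p(1) by (simp add: x_def m_assoc)
    then show "x \<otimes> p = x" by (simp add: p(2) x_def)
  qed
  \<comment> \<open>The inverse \<open>v\<close> of \<open>x\<close> in the corner ring extends to a unit of the ring.\<close>
  define g h where "g = (\<one> \<ominus> p) \<oplus> v" and "h = (\<one> \<ominus> p) \<oplus> x"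
  have gh: "g \<in> carrier R" "h \<in> carrier R" using p v x by (simp_all add: g_def h_def)
  have "g \<otimes> h = (\<one> \<ominus> p \<ominus> p \<oplus> p \<otimes> p) \<oplus> (x \<ominus> p \<otimes> x) \<oplus> (v \<ominus> v \<otimes> p) \<oplus> v \<otimes> x"
    "h \<otimes> g = (\<one> \<ominus> p \<ominus> p \<oplus> p \<otimes> p) \<oplus> (v \<ominus> p \<otimes> v) \<oplus> (x \<ominus> x \<otimes> p) \<oplus> x \<otimes> v"
    unfolding g_def h_def using p(1) v(1) x(1)
    by (simp_all add: minus_eq l_distr r_distr l_minus r_minus minus_add a_ac)
  moreover have "\<one> \<ominus> p \<ominus> p \<oplus> p \<oplus> (x \<ominus> x) \<oplus> (v \<ominus> v) \<oplus> p = \<one>" "\<one> \<ominus> p \<ominus> p \<oplus> p \<oplus> (v \<ominus> v) \<oplus> (x \<ominus> x) \<oplus> p = \<one>"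
    using p(1) v(1) x(1) by (simp_all add: minus_eq a_assoc r_neg l_neg)
  ultimately have gh1: "g \<otimes> h = \<one>" "h \<otimes> g = \<one>" by (simp_all add: p(2) v x)
  then have gU: "g \<in> Units R" using gh unfolding Units_def by blast
  have m1: "move E (a, c) (a \<otimes> g, c \<otimes> g)" by (rule move.right[OF gU])
  have fv: "f \<otimes> v = \<zero>" "v \<otimes> f = \<zero>"
    using zero_mult_left[OF p(4) f(1) p(1) v(1)] zero_mult_right[OF p(5,1) f(1) v(1)] v(2,3) by simp_all
  have "f \<otimes> g = f \<ominus> f \<otimes> p \<oplus> f \<otimes> v" "g \<otimes> f = f \<ominus> p \<otimes> f \<oplus> v \<otimes> f"
    using p(1) v(1) f(1) unfolding g_def by (simp_all add: minus_eq l_distr r_distr l_minus r_minus)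
  then have fg: "f \<otimes> g = f" "g \<otimes> f = f" using p f fv by (simp_all add: minus_eq)
  have so1: "split_off f (a \<otimes> g) (c \<otimes> g)"
  proof -
    have "f \<otimes> (a \<otimes> g) = f \<otimes> a \<otimes> g" "a \<otimes> g \<otimes> f = a \<otimes> (g \<otimes> f)"
      "f \<otimes> (c \<otimes> g) = f \<otimes> c \<otimes> g" "c \<otimes> g \<otimes> f = c \<otimes> (g \<otimes> f)"
      using f(1) cl gh(1) by (simp_all add: m_assoc)
    then show ?thesis
      using so gh(1) by (simp add: split_off_def fg)
  qed
  have "g \<otimes> p = p \<ominus> p \<otimes> p \<oplus> v \<otimes> p"
    using p(1) v(1) unfolding g_def by (simp add: minus_eq l_distr l_minus)
  then have gp: "g \<otimes> p = v" using p v by (simp add: r_neg minus_eq)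
  have "p \<otimes> (a \<otimes> g) \<otimes> p = p \<otimes> a \<otimes> (p \<otimes> v)"
    using p(1) cl gh v by (simp add: m_assoc gp)
  also have "\<dots> = p" using v(5) p(1) v(1) cl by (simp add: m_assoc)
  finally have pap: "p \<otimes> (a \<otimes> g) \<otimes> p = p" .
  have iso1: "isotropic (a \<otimes> g) (c \<otimes> g)" by (rule isotropic_move[OF m1 iso E])
  obtain a2 c2 where m2: "move E (a \<otimes> g, c \<otimes> g) (a2, c2)" and so2: "split_off f a2 c2" "a2 \<otimes> p = p"
    using clear_column_above[OF iso1 so1 pap] by blast
  have iso2: "isotropic a2 c2" by (rule isotropic_move[OF m2 iso1 E])
  obtain c3 where m3: "move E (a2, c2) (a2, c3)" and so3: "split_off f a2 c3" "c3 \<otimes> p = \<zero>"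
    using clear_column_below[OF iso2 so2] by blast
  have iso3: "isotropic a2 c3" by (rule isotropic_move[OF m3 iso2 E])
  obtain a4 where "move E (a2, c3) (a4, c3)" "split_off (f \<oplus> p) a4 c3"
    using clear_row[OF iso3 so3(1) so2(2) so3(2)] by blast
  with m1 m2 m3 show ?thesis
    by (meson converse_rtranclp_into_rtranclp rtranclp.rtrancl_refl)
qed

end

end

section \<open>Elimination in matrix rings\<close>

lemma (in abelian_monoid) finsum_single:
  assumes "finite A" "k \<in> A" "\<And>i. i \<in> A \<Longrightarrow> i \<noteq> k \<Longrightarrow> f i = \<zero>" "f k \<in> carrier G"
  shows "finsum G f A = f k"
proof -
  have "finsum G f A = (\<Oplus>i\<in>A. if i = k then f i else \<zero>)"
    using assms by (intro finsum_cong') auto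
  then show ?thesis using assms by (simp add: finsum_delta)
qed

text \<open>The left ideal \<open>J\<close> stands for the radical of a local ring, and \<open>E\<close> for the idempotents that are
  invertible in that local ring. An element with a left inverse modulo \<open>J\<close> has to become invertible
  in the factor of the ring that belongs to some \<open>e\<close> in \<open>E\<close>. The condition \<open>common_generator\<close> is a
  stable range condition modulo \<open>J\<close>, and \<open>isotropic_pivot\<close> is the case of a single row and column.\<close>

locale local_pivoting = involution_ring R star for R (structure) and star +
  fixes J E :: "'a set"
  assumes J_closed: "x \<in> J \<Longrightarrow> x \<in> carrier R"
    and J_zero: "\<zero> \<in> J"
    and J_add: "\<lbrakk>x \<in> J; y \<in> J\<rbrakk> \<Longrightarrow> x \<oplus> y \<in> J"
    and J_left: "\<lbrakk>r \<in> carrier R; x \<in> J\<rbrakk> \<Longrightarrow> r \<otimes> x \<in> J"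
    and E_projection: "e \<in> E \<Longrightarrow> central_projection e"
    and E_one: "\<one> \<in> E"
    and E_mult: "\<lbrakk>e \<in> E; f \<in> E\<rbrakk> \<Longrightarrow> e \<otimes> f \<in> E"
    and local_inverse: "\<lbrakk>z \<in> carrier R; w \<in> carrier R; w \<otimes> z \<ominus> \<one> \<in> J\<rbrakk> \<Longrightarrow>
      \<exists>e\<in>E. \<exists>z'\<in>carrier R. z \<otimes> z' = e \<and> z' \<otimes> z = e"
    and common_generator: "\<lbrakk>x \<in> carrier R; y \<in> carrier R\<rbrakk> \<Longrightarrow>
      \<exists>t\<in>carrier R. \<exists>r\<in>carrier R. y \<ominus> r \<otimes> (x \<oplus> t \<otimes> y) \<in> J"
    and isotropic_pivot: "isotropic x y \<Longrightarrow>
      (\<exists>s\<in>sym_elements R star. \<exists>w\<in>carrier R. w \<otimes> (x \<oplus> s \<otimes> y) \<ominus> \<one> \<in> J) \<or>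
      (\<exists>w\<in>carrier R. w \<otimes> y \<ominus> \<one> \<in> J)"
begin

lemma J_uminus: "x \<in> J \<Longrightarrow> \<ominus> x \<in> J"
  using J_left[of "\<ominus> \<one>" x] J_closed[of x] by (simp add: l_minus)

lemma J_minus: "\<lbrakk>x \<in> J; y \<in> J\<rbrakk> \<Longrightarrow> x \<ominus> y \<in> J"
  by (simp add: minus_eq J_add J_uminus)

text \<open>The left ideal \<open>Rz + J\<close>.\<close>

definition gen :: "'a \<Rightarrow> 'a set" where
  "gen z = {x \<in> carrier R. \<exists>r\<in>carrier R. x \<ominus> r \<otimes> z \<in> J}"

lemma genI: "\<lbrakk>x \<in> carrier R; r \<in> carrier R; x \<ominus> r \<otimes> z \<in> J\<rbrakk> \<Longrightarrow> x \<in> gen z"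
  by (auto simp: gen_def)

lemma genE:
  assumes "x \<in> gen z"
  obtains r where "x \<in> carrier R" "r \<in> carrier R" "x \<ominus> r \<otimes> z \<in> J"
  using assms by (auto simp: gen_def)

context
  fixes z assumes z: "z \<in> carrier R"
begin

lemma gen_self: "z \<in> gen z"
  using z J_zero by (intro genI[of _ \<one>]) (simp_all add: r_neg minus_eq)

lemma gen_J: "x \<in> J \<Longrightarrow> x \<in> gen z"
  using z J_closed[of x] by (intro genI[of _ \<zero>]) (simp_all add: minus_eq)

lemma gen_add: assumes "x \<in> gen z" "y \<in> gen z" shows "x \<oplus> y \<in> gen z"
proof -
  obtain r where r: "x \<in> carrier R" "r \<in> carrier R" "x \<ominus> r \<otimes> z \<in> J" using assms(1) by (rule genE)
  obtain s where s: "y \<in> carrier R" "s \<in> carrier R" "y \<ominus> s \<otimes> z \<in> J" using assms(2) by (rule genE)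
  have "x \<oplus> y \<ominus> (r \<oplus> s) \<otimes> z = (x \<ominus> r \<otimes> z) \<oplus> (y \<ominus> s \<otimes> z)"
    using r(1,2) s(1,2) z by algebra
  then show ?thesis using r s J_add by (intro genI[of _ "r \<oplus> s"]) auto
qed

lemma gen_left: assumes "x \<in> gen z" "t \<in> carrier R" shows "t \<otimes> x \<in> gen z"
proof -
  obtain r where r: "x \<in> carrier R" "r \<in> carrier R" "x \<ominus> r \<otimes> z \<in> J" using assms(1) by (rule genE)
  have "t \<otimes> x \<ominus> (t \<otimes> r) \<otimes> z = t \<otimes> (x \<ominus> r \<otimes> z)"
    using r(1,2) assms(2) z by algebra
  then show ?thesis using r assms J_left by (intro genI[of _ "t \<otimes> r"]) auto
qed

lemma gen_minus: "\<lbrakk>x \<in> gen z; y \<in> gen z\<rbrakk> \<Longrightarrow> x \<ominus> y \<in> gen z"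
  using gen_add[of x "\<ominus> \<one> \<otimes> y"] gen_left[of y "\<ominus> \<one>"]
  by (auto simp: minus_eq l_minus gen_def)

lemma gen_finsum: "(\<And>i. i \<in> K \<Longrightarrow> f i \<in> gen z) \<Longrightarrow> finsum R f K \<in> gen z"
proof (induction K rule: infinite_finite_induct)
  case (insert i K)
  then have "f \<in> K \<rightarrow> carrier R" "f i \<in> carrier R" by (auto elim!: genE)
  then show ?case using insert by (simp add: gen_add)
qed (simp_all add: gen_J J_zero)

end

lemma gen_trans:
  assumes "x \<in> gen y" "y \<in> gen z" "z \<in> carrier R"
  shows "x \<in> gen z"
proof -
  obtain r where r: "x \<in> carrier R" "r \<in> carrier R" "x \<ominus> r \<otimes> y \<in> J" using assms(1) by (rule genE)
  have y: "y \<in> carrier R" using assms(2) by (auto elim: genE)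
  have "x = (x \<ominus> r \<otimes> y) \<oplus> r \<otimes> y" using r(1,2) y by algebra
  then show ?thesis
    using gen_add[OF assms(3) gen_J[OF assms(3) r(3)] gen_left[OF assms(3,2) r(2)]] by simp
qed

lemma gen_one_inverse: "\<lbrakk>\<one> \<in> gen z; z \<in> carrier R\<rbrakk> \<Longrightarrow> \<exists>w\<in>carrier R. w \<otimes> z \<ominus> \<one> \<in> J"
proof (erule genE)
  fix w assume "z \<in> carrier R" and w: "w \<in> carrier R" "\<one> \<ominus> w \<otimes> z \<in> J"
  then show ?thesis
    using J_uminus[OF w(2)] by (intro bexI[OF _ w(1)]) (simp add: minus_eq minus_add a_comm)
qed

text \<open>Finitely many elements generate, modulo \<open>J\<close>, a left ideal with a generator of a special form:
  \<^term>\<open>common_generator\<close> is applied to one element after the other.\<close>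

lemma common_generator_family:
  assumes K: "finite K" "I \<subseteq> K" and y: "\<And>i. i \<in> K \<Longrightarrow> y i \<in> carrier R" and x: "x \<in> carrier R"
  shows "\<exists>t. (\<forall>i. t i \<in> carrier R) \<and> (\<forall>i. i \<notin> I \<longrightarrow> t i = \<zero>) \<and>
    x \<in> gen (x \<oplus> (\<Oplus>i\<in>K. t i \<otimes> y i)) \<and> (\<forall>i\<in>I. y i \<in> gen (x \<oplus> (\<Oplus>i\<in>K. t i \<otimes> y i)))"
  using finite_subset[OF K(2,1)] K(2)
proof (induction I)
  case empty
  have "(\<Oplus>i\<in>K. \<zero> \<otimes> y i) = \<zero>"
    using y by (intro add.finprod_one_eqI) simp
  then show ?case
    using x gen_self by (intro exI[of _ "\<lambda>_. \<zero>"]) simp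
next
  case (insert j I)
  have "I \<subseteq> K" using insert.prems by simp
  from insert.IH[OF this] obtain t where t0: "(\<forall>i. t i \<in> carrier R) \<and> (\<forall>i. i \<notin> I \<longrightarrow> t i = \<zero>) \<and>
      x \<in> gen (x \<oplus> (\<Oplus>i\<in>K. t i \<otimes> y i)) \<and> (\<forall>i\<in>I. y i \<in> gen (x \<oplus> (\<Oplus>i\<in>K. t i \<otimes> y i)))"
    ..
  have t: "\<And>i. t i \<in> carrier R" "\<And>i. i \<notin> I \<Longrightarrow> t i = \<zero>"
    "x \<in> gen (x \<oplus> (\<Oplus>i\<in>K. t i \<otimes> y i))" "\<And>i. i \<in> I \<Longrightarrow> y i \<in> gen (x \<oplus> (\<Oplus>i\<in>K. t i \<otimes> y i))"
    using t0 by blast+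
  define z where "z = x \<oplus> (\<Oplus>i\<in>K. t i \<otimes> y i)"
  have z: "z \<in> carrier R" using x t(1) y by (auto simp: z_def intro!: finsum_closed)
  have yj: "y j \<in> carrier R" using insert y by auto
  obtain s r where s: "s \<in> carrier R" "r \<in> carrier R" "y j \<ominus> r \<otimes> (z \<oplus> s \<otimes> y j) \<in> J"
    using common_generator[OF z yj] by blast
  define z' where "z' = z \<oplus> s \<otimes> y j"
  have z': "z' \<in> carrier R" using z s yj by (simp add: z'_def)
  have yj': "y j \<in> gen z'" using s yj by (auto simp: z'_def intro: genI)
  have "z = z' \<ominus> s \<otimes> y j" unfolding z'_def using z s(1) yj by algebra
  then have zz': "z \<in> gen z'"
    using gen_minus[OF z' gen_self[OF z'] gen_left[OF z' yj' s(1)]] by simp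
  define t' where "t' = t(j := s)"
  have "(\<Oplus>i\<in>K. t' i \<otimes> y i) = (\<Oplus>i\<in>K. t i \<otimes> y i \<oplus> (if i = j then s \<otimes> y i else \<zero>))"
    using t(1) t(2)[of j] insert y s by (intro finsum_cong') (auto simp: t'_def)
  also have "\<dots> = (\<Oplus>i\<in>K. t i \<otimes> y i) \<oplus> (\<Oplus>i\<in>K. if i = j then s \<otimes> y i else \<zero>)"
    using t(1) y s by (intro finsum_addf) auto
  also have "(\<Oplus>i\<in>K. if i = j then s \<otimes> y i else \<zero>) = s \<otimes> y j"
    using K insert s yj by (intro finsum_delta) auto
  finally have "x \<oplus> (\<Oplus>i\<in>K. t' i \<otimes> y i) = z'"
    unfolding z'_def z_def using x s yj t(1) y by (simp add: a_assoc)
  moreover have "x \<in> gen z'" "\<And>i. i \<in> I \<Longrightarrow> y i \<in> gen z'"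
    using t(3,4) zz' z' gen_trans unfolding z_def[symmetric] by blast+
  ultimately show ?case
    using t s yj' by (intro exI[of _ t']) (auto simp: t'_def)
qed

end

definition row_mat :: "('a, 'm) ring_scheme \<Rightarrow> nat \<Rightarrow> nat \<Rightarrow> (nat \<Rightarrow> 'a) \<Rightarrow> 'a mat" where
  "row_mat R n l t = mat n n (\<lambda>(i, j). if i = l then t j else \<zero>\<^bsub>R\<^esub>)"

definition col_mat :: "('a, 'm) ring_scheme \<Rightarrow> nat \<Rightarrow> nat \<Rightarrow> (nat \<Rightarrow> 'a) \<Rightarrow> 'a mat" where
  "col_mat R n l t = mat n n (\<lambda>(i, j). if j = l then t i else \<zero>\<^bsub>R\<^esub>)"

definition initial_mat :: "('a, 'm) ring_scheme \<Rightarrow> nat \<Rightarrow> nat \<Rightarrow> 'a mat" where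
  "initial_mat R n k = mat n n (\<lambda>(i, j). if i = j \<and> i < k then \<one>\<^bsub>R\<^esub> else \<zero>\<^bsub>R\<^esub>)"

definition entry_mat :: "('a, 'm) ring_scheme \<Rightarrow> nat \<Rightarrow> nat \<Rightarrow> 'a \<Rightarrow> 'a mat" where
  "entry_mat R n k r = mat n n (\<lambda>(i, j). if i = k \<and> j = k then r else \<zero>\<^bsub>R\<^esub>)"

context involution_ring
begin

context
  fixes n :: nat
begin

lemma elementary_closed:
  "(\<And>i. t i \<in> carrier R) \<Longrightarrow> row_mat R n l t \<in> carrier (matrix_ring n R)"
  "(\<And>i. t i \<in> carrier R) \<Longrightarrow> col_mat R n l t \<in> carrier (matrix_ring n R)"
  "initial_mat R n k \<in> carrier (matrix_ring n R)"
  "r \<in> carrier R \<Longrightarrow> entry_mat R n k r \<in> carrier (matrix_ring n R)"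
  "r \<in> carrier R \<Longrightarrow> scalar_matrix n R r \<in> carrier (matrix_ring n R)"
  by (auto simp: row_mat_def col_mat_def initial_mat_def entry_mat_def scalar_matrix_def intro!: mat_in_matrix_ring)

lemma elementary_entry:
  assumes "i < n" "j < n"
  shows "row_mat R n l t $$ (i, j) = (if i = l then t j else \<zero>)"
    "col_mat R n l t $$ (i, j) = (if j = l then t i else \<zero>)"
    "initial_mat R n k $$ (i, j) = (if i = j \<and> i < k then \<one> else \<zero>)"
    "entry_mat R n k r $$ (i, j) = (if i = k \<and> j = k then r else \<zero>)"
    "scalar_matrix n R r $$ (i, j) = (if i = j then r else \<zero>)"
  using assms by (simp_all add: row_mat_def col_mat_def initial_mat_def entry_mat_def scalar_matrix_def)

lemma elementary_star:
  "(\<And>i. t i \<in> carrier R) \<Longrightarrow> matrix_star star (row_mat R n l t) = col_mat R n l (\<lambda>i. star (t i))"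
  "(\<And>i. t i \<in> carrier R) \<Longrightarrow> matrix_star star (col_mat R n l t) = row_mat R n l (\<lambda>i. star (t i))"
  "matrix_star star (initial_mat R n k) = initial_mat R n k"
  "r \<in> carrier R \<Longrightarrow> matrix_star star (entry_mat R n k r) = entry_mat R n k (star r)"
  "r \<in> carrier R \<Longrightarrow> matrix_star star (scalar_matrix n R r) = scalar_matrix n R (star r)"
  by (auto intro!: matrix_ring_eqI[where n = n and R = R]
      simp: matrix_star_closed elementary_closed elementary_entry star_closed elementary_closed[THEN matrix_star_entry])

context
  fixes a i j
  assumes a: "a \<in> carrier (matrix_ring n R)" and ij: "i < n" "j < n"
begin

lemma row_mat_mult_entry:
  assumes "\<And>i. t i \<in> carrier R"
  shows "(row_mat R n l t \<otimes>\<^bsub>matrix_ring n R\<^esub> a) $$ (i, j) =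
    (if i = l then \<Oplus>m\<in>{..<n}. t m \<otimes> a $$ (m, j) else \<zero>)"
proof -
  have "(row_mat R n l t \<otimes>\<^bsub>matrix_ring n R\<^esub> a) $$ (i, j) =
      (\<Oplus>m\<in>{..<n}. (if i = l then t m else \<zero>) \<otimes> a $$ (m, j))"
    using a ij assms
    by (intro matrix_mult_entry) (simp_all add: elementary_entry matrix_ring_entry_closed)
  also have "\<dots> = (if i = l then \<Oplus>m\<in>{..<n}. t m \<otimes> a $$ (m, j) else \<zero>)"
    using a ij by (auto simp: matrix_ring_entry_closed intro!: add.finprod_one_eqI)
  finally show ?thesis .
qed

lemma col_mat_mult_entry:
  assumes "\<And>i. t i \<in> carrier R" "l < n"
  shows "(col_mat R n l t \<otimes>\<^bsub>matrix_ring n R\<^esub> a) $$ (i, j) = t i \<otimes> a $$ (l, j)"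
proof -
  have "(col_mat R n l t \<otimes>\<^bsub>matrix_ring n R\<^esub> a) $$ (i, j) =
      (\<Oplus>m\<in>{..<n}. (if m = l then t i else \<zero>) \<otimes> a $$ (m, j))"
    using a ij assms
    by (intro matrix_mult_entry) (simp_all add: elementary_entry matrix_ring_entry_closed)
  also have "\<dots> = (if l = l then t i else \<zero>) \<otimes> a $$ (l, j)"
    using a ij assms by (intro finsum_single) (auto simp: matrix_ring_entry_closed)
  finally show ?thesis by simp
qed

lemma initial_mat_mult_entry:
  "(initial_mat R n k \<otimes>\<^bsub>matrix_ring n R\<^esub> a) $$ (i, j) = (if i < k then a $$ (i, j) else \<zero>)"
  "(a \<otimes>\<^bsub>matrix_ring n R\<^esub> initial_mat R n k) $$ (i, j) = (if j < k then a $$ (i, j) else \<zero>)"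
proof -
  have "(initial_mat R n k \<otimes>\<^bsub>matrix_ring n R\<^esub> a) $$ (i, j) =
      (\<Oplus>m\<in>{..<n}. (if i = m \<and> i < k then \<one> else \<zero>) \<otimes> a $$ (m, j))"
    using a ij by (intro matrix_mult_entry) (simp_all add: elementary_entry matrix_ring_entry_closed)
  also have "\<dots> = (if i = i \<and> i < k then \<one> else \<zero>) \<otimes> a $$ (i, j)"
    using a ij by (intro finsum_single) (auto simp: matrix_ring_entry_closed)
  finally show "(initial_mat R n k \<otimes>\<^bsub>matrix_ring n R\<^esub> a) $$ (i, j) = (if i < k then a $$ (i, j) else \<zero>)"
    using a ij by (simp add: matrix_ring_entry_closed)
  have "(a \<otimes>\<^bsub>matrix_ring n R\<^esub> initial_mat R n k) $$ (i, j) =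
      (\<Oplus>m\<in>{..<n}. a $$ (i, m) \<otimes> (if m = j \<and> m < k then \<one> else \<zero>))"
    using a ij by (intro matrix_mult_entry) (simp_all add: elementary_entry matrix_ring_entry_closed)
  also have "\<dots> = a $$ (i, j) \<otimes> (if j = j \<and> j < k then \<one> else \<zero>)"
    using a ij by (intro finsum_single) (auto simp: matrix_ring_entry_closed)
  finally show "(a \<otimes>\<^bsub>matrix_ring n R\<^esub> initial_mat R n k) $$ (i, j) = (if j < k then a $$ (i, j) else \<zero>)"
    using a ij by (simp add: matrix_ring_entry_closed)
qed

lemma entry_mat_mult_entry:
  assumes "r \<in> carrier R" "k < n"
  shows "(entry_mat R n k r \<otimes>\<^bsub>matrix_ring n R\<^esub> a) $$ (i, j) = (if i = k then r \<otimes> a $$ (k, j) else \<zero>)"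
    "(a \<otimes>\<^bsub>matrix_ring n R\<^esub> entry_mat R n k r) $$ (i, j) = (if j = k then a $$ (i, k) \<otimes> r else \<zero>)"
proof -
  have "(entry_mat R n k r \<otimes>\<^bsub>matrix_ring n R\<^esub> a) $$ (i, j) =
      (\<Oplus>m\<in>{..<n}. (if i = k \<and> m = k then r else \<zero>) \<otimes> a $$ (m, j))"
    using a ij assms by (intro matrix_mult_entry) (simp_all add: elementary_entry matrix_ring_entry_closed)
  also have "\<dots> = (if i = k \<and> k = k then r else \<zero>) \<otimes> a $$ (k, j)"
    using a ij assms by (intro finsum_single) (auto simp: matrix_ring_entry_closed)
  finally show "(entry_mat R n k r \<otimes>\<^bsub>matrix_ring n R\<^esub> a) $$ (i, j) = (if i = k then r \<otimes> a $$ (k, j) else \<zero>)"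
    using a ij assms by (simp add: matrix_ring_entry_closed)
  have "(a \<otimes>\<^bsub>matrix_ring n R\<^esub> entry_mat R n k r) $$ (i, j) =
      (\<Oplus>m\<in>{..<n}. a $$ (i, m) \<otimes> (if m = k \<and> j = k then r else \<zero>))"
    using a ij assms by (intro matrix_mult_entry) (simp_all add: elementary_entry matrix_ring_entry_closed)
  also have "\<dots> = a $$ (i, k) \<otimes> (if k = k \<and> j = k then r else \<zero>)"
    using a ij assms by (intro finsum_single) (auto simp: matrix_ring_entry_closed)
  finally show "(a \<otimes>\<^bsub>matrix_ring n R\<^esub> entry_mat R n k r) $$ (i, j) = (if j = k then a $$ (i, k) \<otimes> r else \<zero>)"
    using a ij assms by (simp add: matrix_ring_entry_closed)
qed

lemma scalar_matrix_mult_entry: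
  assumes "r \<in> carrier R"
  shows "(scalar_matrix n R r \<otimes>\<^bsub>matrix_ring n R\<^esub> a) $$ (i, j) = r \<otimes> a $$ (i, j)"
    "(a \<otimes>\<^bsub>matrix_ring n R\<^esub> scalar_matrix n R r) $$ (i, j) = a $$ (i, j) \<otimes> r"
proof -
  have "(scalar_matrix n R r \<otimes>\<^bsub>matrix_ring n R\<^esub> a) $$ (i, j) =
      (\<Oplus>m\<in>{..<n}. (if i = m then r else \<zero>) \<otimes> a $$ (m, j))"
    using a ij assms by (intro matrix_mult_entry) (simp_all add: elementary_entry matrix_ring_entry_closed)
  also have "\<dots> = (if i = i then r else \<zero>) \<otimes> a $$ (i, j)"
    using a ij assms by (intro finsum_single) (auto simp: matrix_ring_entry_closed)
  finally show "(scalar_matrix n R r \<otimes>\<^bsub>matrix_ring n R\<^esub> a) $$ (i, j) = r \<otimes> a $$ (i, j)" by simp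
  have "(a \<otimes>\<^bsub>matrix_ring n R\<^esub> scalar_matrix n R r) $$ (i, j) =
      (\<Oplus>m\<in>{..<n}. a $$ (i, m) \<otimes> (if m = j then r else \<zero>))"
    using a ij assms by (intro matrix_mult_entry) (simp_all add: elementary_entry matrix_ring_entry_closed)
  also have "\<dots> = a $$ (i, j) \<otimes> (if j = j then r else \<zero>)"
    using a ij assms by (intro finsum_single) (auto simp: matrix_ring_entry_closed)
  finally show "(a \<otimes>\<^bsub>matrix_ring n R\<^esub> scalar_matrix n R r) $$ (i, j) = a $$ (i, j) \<otimes> r" by simp
qed

end

interpretation A: involution_ring "matrix_ring n R" "matrix_star star"
  by (rule matrix_involution_ring)

lemma scalar_matrix_mult:
  "\<lbrakk>r \<in> carrier R; s \<in> carrier R\<rbrakk> \<Longrightarrow>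
    scalar_matrix n R r \<otimes>\<^bsub>matrix_ring n R\<^esub> scalar_matrix n R s = scalar_matrix n R (r \<otimes> s)"
  by (rule matrix_ring_eqI[where n = n and R = R])
    (simp_all add: elementary_closed scalar_matrix_mult_entry elementary_entry)

lemma scalar_matrix_one: "scalar_matrix n R \<one> = \<one>\<^bsub>matrix_ring n R\<^esub>"
  by (rule matrix_ring_eqI[where n = n and R = R])
    (simp_all add: elementary_closed elementary_entry matrix_ring_entry(2-))

lemma scalar_matrix_projection:
  assumes e: "central_projection e"
  shows "A.central_projection (scalar_matrix n R e)"
proof -
  note eD = central_projectionD(1-3)[OF e]
  have "x \<otimes>\<^bsub>matrix_ring n R\<^esub> scalar_matrix n R e = scalar_matrix n R e \<otimes>\<^bsub>matrix_ring n R\<^esub> x"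
    if x: "x \<in> carrier (matrix_ring n R)" for x
  proof (rule matrix_ring_eqI[where n = n and R = R])
    fix i j assume ij: "i < n" "j < n"
    show "(x \<otimes>\<^bsub>matrix_ring n R\<^esub> scalar_matrix n R e) $$ (i, j) = (scalar_matrix n R e \<otimes>\<^bsub>matrix_ring n R\<^esub> x) $$ (i, j)"
      unfolding scalar_matrix_mult_entry[OF x ij eD(1)]
      by (rule central_projectionD(4)[OF e matrix_ring_entry_closed[OF x ij]])
  qed (use x eD(1) in \<open>simp_all add: elementary_closed\<close>)
  moreover have "scalar_matrix n R e \<in> carrier (matrix_ring n R)"
    "scalar_matrix n R e \<otimes>\<^bsub>matrix_ring n R\<^esub> scalar_matrix n R e = scalar_matrix n R e"
    "matrix_star star (scalar_matrix n R e) = scalar_matrix n R e"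
    using eD by (simp_all add: elementary_closed scalar_matrix_mult elementary_star)
  ultimately show ?thesis
    unfolding A.central_projection_def by blast
qed

lemma localise_scalar_entry:
  assumes "e \<in> carrier R" "a \<in> carrier (matrix_ring n R)" "k < n"
  shows "A.localise (scalar_matrix n R e) a $$ (k, k) = localise e (a $$ (k, k))"
  using assms
  by (simp add: A.localise_def localise_def matrix_ring_entry(2-) scalar_matrix_mult_entry
      matrix_minus_entry elementary_closed elementary_entry)

lemma split_off_entry:
  assumes "A.split_off (initial_mat R n k) a c" "a \<in> carrier (matrix_ring n R)" "c \<in> carrier (matrix_ring n R)"
    "i < n" "j < n" "i < k \<or> j < k"
  shows "a $$ (i, j) = (if i = j then \<one> else \<zero>)" "c $$ (i, j) = \<zero>"
proof -
  note so = assms(1)[unfolded A.split_off_def]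
  show "a $$ (i, j) = (if i = j then \<one> else \<zero>)"
  proof (cases "i < k")
    case True
    have "(initial_mat R n k \<otimes>\<^bsub>matrix_ring n R\<^esub> a) $$ (i, j) = initial_mat R n k $$ (i, j)" using so by simp
    then show ?thesis using True assms by (simp add: initial_mat_mult_entry elementary_entry)
  next
    case False
    have "(a \<otimes>\<^bsub>matrix_ring n R\<^esub> initial_mat R n k) $$ (i, j) = initial_mat R n k $$ (i, j)" using so by simp
    then show ?thesis using False assms by (auto simp: initial_mat_mult_entry elementary_entry)
  qed
  show "c $$ (i, j) = \<zero>"
  proof (cases "i < k")
    case True
    have "(initial_mat R n k \<otimes>\<^bsub>matrix_ring n R\<^esub> c) $$ (i, j) = \<zero>" using so assms by (simp add: matrix_ring_entry(2-))
    then show ?thesis using True assms by (simp add: initial_mat_mult_entry elementary_entry)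
  next
    case False
    have "(c \<otimes>\<^bsub>matrix_ring n R\<^esub> initial_mat R n k) $$ (i, j) = \<zero>" using so assms by (simp add: matrix_ring_entry(2-))
    then show ?thesis using False assms by (auto simp: initial_mat_mult_entry elementary_entry)
  qed
qed

lemma row_mat_nilpotent:
  assumes "\<And>i. t i \<in> carrier R" "t l = \<zero>"
  shows "row_mat R n l t \<otimes>\<^bsub>matrix_ring n R\<^esub> row_mat R n l t = \<zero>\<^bsub>matrix_ring n R\<^esub>"
proof (rule matrix_ring_eqI[where n = n and R = R])
  fix i j assume ij: "i < n" "j < n"
  have "(\<Oplus>m\<in>{..<n}. t m \<otimes> row_mat R n l t $$ (m, j)) = \<zero>"
    using assms ij by (intro add.finprod_one_eqI) (simp add: elementary_entry)
  then show "(row_mat R n l t \<otimes>\<^bsub>matrix_ring n R\<^esub> row_mat R n l t) $$ (i, j) = \<zero>\<^bsub>matrix_ring n R\<^esub> $$ (i, j)"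
    using assms ij by (simp add: row_mat_mult_entry elementary_closed matrix_ring_entry(2-))
qed (use assms in \<open>simp_all add: elementary_closed\<close>)

lemma initial_mat_orthogonal:
  assumes a: "a \<in> carrier (matrix_ring n R)"
    and "\<And>i j. i < n \<Longrightarrow> j < n \<Longrightarrow> i < k \<or> j < k \<Longrightarrow> a $$ (i, j) = \<zero>"
  shows "initial_mat R n k \<otimes>\<^bsub>matrix_ring n R\<^esub> a = \<zero>\<^bsub>matrix_ring n R\<^esub>"
    "a \<otimes>\<^bsub>matrix_ring n R\<^esub> initial_mat R n k = \<zero>\<^bsub>matrix_ring n R\<^esub>"
  using assms by (auto intro!: matrix_ring_eqI[where n = n and R = R]
    simp: elementary_closed initial_mat_mult_entry matrix_ring_entry(2-))

end

end

context local_pivoting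
begin

context
  fixes n :: nat
begin

interpretation A: involution_ring "matrix_ring n R" "matrix_star star"
  by (rule matrix_involution_ring)

abbreviation M where "M \<equiv> matrix_ring n R"

definition scalars :: "'a mat set" where
  "scalars = scalar_matrix n R ` E"

lemma scalars_projection: "e \<in> scalars \<Longrightarrow> A.central_projection e"
  by (auto simp: scalars_def scalar_matrix_projection E_projection)

lemma scalars_one: "\<one>\<^bsub>M\<^esub> \<in> scalars"
  using E_one scalar_matrix_one unfolding scalars_def by (metis imageI)

lemma scalars_mult: "\<lbrakk>e \<in> scalars; f \<in> scalars\<rbrakk> \<Longrightarrow> e \<otimes>\<^bsub>M\<^esub> f \<in> scalars"
  using E_mult central_projectionD(1)[OF E_projection] by (auto simp: scalars_def scalar_matrix_mult)

lemma isotropic_closed: "A.isotropic a c \<Longrightarrow> a \<in> carrier M" "A.isotropic a c \<Longrightarrow> c \<in> carrier M"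
  by (simp_all add: A.isotropic_def)

context
  fixes a c k
  assumes iso: "A.isotropic a c" and so: "A.split_off (initial_mat R n k) a c" and k: "k < n"
begin

lemmas ac = isotropic_closed[OF iso]

lemmas initial = elementary_closed(3)[of n k] elementary_star(3)[of n k]

lemma row_move:
  assumes t: "\<And>i. t i \<in> carrier R" "t l = \<zero>" "\<forall>i<k. t i = \<zero>" and l: "k \<le> l"
  shows "A.move scalars (a, c) (a \<oplus>\<^bsub>M\<^esub> row_mat R n l t \<otimes>\<^bsub>M\<^esub> a, c \<ominus>\<^bsub>M\<^esub> col_mat R n l (\<lambda>i. star (t i)) \<otimes>\<^bsub>M\<^esub> c)"
    "A.split_off (initial_mat R n k) (a \<oplus>\<^bsub>M\<^esub> row_mat R n l t \<otimes>\<^bsub>M\<^esub> a) (c \<ominus>\<^bsub>M\<^esub> col_mat R n l (\<lambda>i. star (t i)) \<otimes>\<^bsub>M\<^esub> c)"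
    "A.move scalars (a, c) (a \<ominus>\<^bsub>M\<^esub> col_mat R n l (\<lambda>i. star (t i)) \<otimes>\<^bsub>M\<^esub> a, c \<oplus>\<^bsub>M\<^esub> row_mat R n l t \<otimes>\<^bsub>M\<^esub> c)"
    "A.split_off (initial_mat R n k) (a \<ominus>\<^bsub>M\<^esub> col_mat R n l (\<lambda>i. star (t i)) \<otimes>\<^bsub>M\<^esub> a) (c \<oplus>\<^bsub>M\<^esub> row_mat R n l t \<otimes>\<^bsub>M\<^esub> c)"
proof -
  let ?N = "row_mat R n l t"
  have N: "?N \<in> carrier M" using t by (simp add: elementary_closed)
  have N0: "?N $$ (i, j) = \<zero>" if "i < n" "j < n" "i < k \<or> j < k" for i j
    using that l t by (auto simp: elementary_entry)
  have NN: "?N \<otimes>\<^bsub>M\<^esub> ?N = \<zero>\<^bsub>M\<^esub>" by (rule row_mat_nilpotent[where t = t, OF t(1,2)])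
  have S: "matrix_star star ?N = col_mat R n l (\<lambda>i. star (t i))" by (rule elementary_star(1)[where t = t, OF t(1)])
  note o = initial_mat_orthogonal[OF N N0]
  show "A.move scalars (a, c) (a \<oplus>\<^bsub>M\<^esub> ?N \<otimes>\<^bsub>M\<^esub> a, c \<ominus>\<^bsub>M\<^esub> col_mat R n l (\<lambda>i. star (t i)) \<otimes>\<^bsub>M\<^esub> c)"
    using A.move_unipotent_left[OF N NN ac] by (simp add: S)
  show "A.move scalars (a, c) (a \<ominus>\<^bsub>M\<^esub> col_mat R n l (\<lambda>i. star (t i)) \<otimes>\<^bsub>M\<^esub> a, c \<oplus>\<^bsub>M\<^esub> ?N \<otimes>\<^bsub>M\<^esub> c)"
    using A.move_unipotent_left'[OF N NN ac] by (simp add: S)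
  show "A.split_off (initial_mat R n k) (a \<oplus>\<^bsub>M\<^esub> ?N \<otimes>\<^bsub>M\<^esub> a) (c \<ominus>\<^bsub>M\<^esub> col_mat R n l (\<lambda>i. star (t i)) \<otimes>\<^bsub>M\<^esub> c)"
    "A.split_off (initial_mat R n k) (a \<ominus>\<^bsub>M\<^esub> col_mat R n l (\<lambda>i. star (t i)) \<otimes>\<^bsub>M\<^esub> a) (c \<oplus>\<^bsub>M\<^esub> ?N \<otimes>\<^bsub>M\<^esub> c)"
    using A.split_off_unipotent_left[OF initial ac so N o] by (simp_all add: S)
qed

lemma upper_move:
  assumes b: "b \<in> carrier M" "matrix_star star b = b" "\<forall>i<n. \<forall>j<n. i < k \<or> j < k \<longrightarrow> b $$ (i, j) = \<zero>"
  shows "A.move scalars (a, c) (a \<oplus>\<^bsub>M\<^esub> b \<otimes>\<^bsub>M\<^esub> c, c)" "A.split_off (initial_mat R n k) (a \<oplus>\<^bsub>M\<^esub> b \<otimes>\<^bsub>M\<^esub> c) c"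
    "A.move scalars (a, c) (a, c \<oplus>\<^bsub>M\<^esub> b \<otimes>\<^bsub>M\<^esub> a)" "A.split_off (initial_mat R n k) a (c \<oplus>\<^bsub>M\<^esub> b \<otimes>\<^bsub>M\<^esub> a)"
  using A.move.upper[OF A.sym_elementsI[OF b(1,2)]] A.move.lower[OF A.sym_elementsI[OF b(1,2)]]
    A.split_off_upper_lower[OF initial ac so b(1) initial_mat_orthogonal[OF b(1)]] b(3) by auto

text \<open>In the last column a single entry of \<open>a\<close> and of \<open>c\<close> is left, and they form an isotropic pair
  over \<open>R\<close>.\<close>

lemma last_column_isotropic:
  assumes last: "Suc k = n"
  shows "isotropic (a $$ (k, k)) (c $$ (k, k))"
proof -
  have z: "a $$ (m, k) = \<zero>" "c $$ (m, k) = \<zero>" if "m < n" "m \<noteq> k" for m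
    using split_off_entry[OF so ac, of m k] that k last by auto
  have cl: "a $$ (i, j) \<in> carrier R" "c $$ (i, j) \<in> carrier R" if "i < n" "j < n" for i j
    using ac that by (auto simp: matrix_ring_entry_closed)
  have col: "(w \<otimes>\<^bsub>M\<^esub> a) $$ (k, k) = w $$ (k, k) \<otimes> a $$ (k, k)"
     "(w \<otimes>\<^bsub>M\<^esub> c) $$ (k, k) = w $$ (k, k) \<otimes> c $$ (k, k)" if w: "w \<in> carrier M" for w
  proof -
    show "(w \<otimes>\<^bsub>M\<^esub> a) $$ (k, k) = w $$ (k, k) \<otimes> a $$ (k, k)"
      unfolding matrix_ring_entry(1)[OF k k] using z k cl matrix_ring_entry_closed[OF w]
      by (intro finsum_single) auto
    show "(w \<otimes>\<^bsub>M\<^esub> c) $$ (k, k) = w $$ (k, k) \<otimes> c $$ (k, k)"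
      unfolding matrix_ring_entry(1)[OF k k] using z k cl matrix_ring_entry_closed[OF w]
      by (intro finsum_single) auto
  qed
  obtain u v where uv: "u \<in> carrier M" "v \<in> carrier M" "u \<otimes>\<^bsub>M\<^esub> a \<oplus>\<^bsub>M\<^esub> v \<otimes>\<^bsub>M\<^esub> c = \<one>\<^bsub>M\<^esub>"
    using iso by (auto simp: A.isotropic_def)
  have "u $$ (k, k) \<otimes> a $$ (k, k) \<oplus> v $$ (k, k) \<otimes> c $$ (k, k) = (u \<otimes>\<^bsub>M\<^esub> a \<oplus>\<^bsub>M\<^esub> v \<otimes>\<^bsub>M\<^esub> c) $$ (k, k)"
    using k uv(1,2) by (simp add: matrix_ring_entry(2) col)
  also have "\<dots> = \<one>"
    unfolding uv(3) using k by (simp add: matrix_ring_entry(4))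
  finally have "u $$ (k, k) \<otimes> a $$ (k, k) \<oplus> v $$ (k, k) \<otimes> c $$ (k, k) = \<one>" .
  moreover have "star (a $$ (k, k)) \<otimes> c $$ (k, k) = (matrix_star star a \<otimes>\<^bsub>M\<^esub> c) $$ (k, k)"
    unfolding col(2)[OF A.star_closed[OF ac(1)]] using k ac by (simp add: matrix_star_entry)
  moreover have "star ((matrix_star star a \<otimes>\<^bsub>M\<^esub> c) $$ (k, k)) = (matrix_star star a \<otimes>\<^bsub>M\<^esub> c) $$ (k, k)"
    using iso k ac matrix_star_entry[of "matrix_star star a \<otimes>\<^bsub>M\<^esub> c" n k k]
    by (simp add: A.isotropic_def sym_elements_def)
  ultimately show ?thesis
    using cl k matrix_ring_entry_closed[OF uv(1)] matrix_ring_entry_closed[OF uv(2)]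
    by (intro isotropicI[of _ _ "u $$ (k, k)" "v $$ (k, k)"]) simp_all
qed

end

lemma entry_add:
  "\<lbrakk>i < n; j < n\<rbrakk> \<Longrightarrow> (x \<oplus>\<^bsub>M\<^esub> y) $$ (i, j) = x $$ (i, j) \<oplus> y $$ (i, j)"
  by (rule matrix_ring_entry(2))

text \<open>Making the diagonal entry in the last column invertible modulo \<open>J\<close>: the isotropic pair
  \<open>(x, y)\<close> becomes \<open>(x + sy, y)\<close>, or else \<open>(y, -x)\<close>.\<close>

lemma pivot_last_column:
  assumes iso: "A.isotropic a c" and so: "A.split_off (initial_mat R n k) a c" and last: "Suc k = n"
  shows "\<exists>a' c'. (A.move scalars)\<^sup>*\<^sup>* (a, c) (a', c') \<and> A.split_off (initial_mat R n k) a' c' \<and>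
    (\<exists>w\<in>carrier R. w \<otimes> a' $$ (k, k) \<ominus> \<one> \<in> J)"
proof -
  have k: "k < n" using last by simp
  note ac = isotropic_closed[OF iso]
  let ?x = "a $$ (k, k)" and ?y = "c $$ (k, k)"
  have xy: "?x \<in> carrier R" "?y \<in> carrier R" using ac k by (simp_all add: matrix_ring_entry_closed)
  have b: "entry_mat R n k s \<in> carrier M" "matrix_star star (entry_mat R n k s) = entry_mat R n k s"
    "\<forall>i<n. \<forall>j<n. i < k \<or> j < k \<longrightarrow> entry_mat R n k s $$ (i, j) = \<zero>"
    if "s \<in> carrier R" "star s = s" for s
    using that by (auto simp: elementary_closed elementary_star elementary_entry)
  from isotropic_pivot[OF last_column_isotropic[OF iso so k last]] show ?thesis
  proof
    assume "\<exists>s\<in>sym_elements R star. \<exists>w\<in>carrier R. w \<otimes> (?x \<oplus> s \<otimes> ?y) \<ominus> \<one> \<in> J"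
    then obtain s w where s: "s \<in> carrier R" "star s = s" and w: "w \<in> carrier R" "w \<otimes> (?x \<oplus> s \<otimes> ?y) \<ominus> \<one> \<in> J"
      by (auto simp: sym_elements_def)
    have "(a \<oplus>\<^bsub>M\<^esub> entry_mat R n k s \<otimes>\<^bsub>M\<^esub> c) $$ (k, k) = ?x \<oplus> s \<otimes> ?y"
      using k ac s by (simp add: entry_add entry_mat_mult_entry)
    with w upper_move(1,2)[OF iso so k b[OF s]] show ?thesis
      by (intro exI[of _ "a \<oplus>\<^bsub>M\<^esub> entry_mat R n k s \<otimes>\<^bsub>M\<^esub> c"] exI[of _ c]) auto
  next
    assume "\<exists>w\<in>carrier R. w \<otimes> ?y \<ominus> \<one> \<in> J"
    then obtain w where w: "w \<in> carrier R" "w \<otimes> ?y \<ominus> \<one> \<in> J" by blast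
    \<comment> \<open>Three unipotent moves multiply the last coordinates by \<open>\<omega>\<close>.\<close>
    let ?b = "entry_mat R n k"
    have "\<ominus> \<one> \<in> carrier R" "star (\<ominus> \<one>) = \<ominus> \<one>" by (simp_all add: star_uminus)
    note b1 = b[OF one_closed star_one] and b2 = b[OF this]
    define a1 where "a1 = a \<oplus>\<^bsub>M\<^esub> ?b \<one> \<otimes>\<^bsub>M\<^esub> c"
    define c1 where "c1 = c \<oplus>\<^bsub>M\<^esub> ?b (\<ominus> \<one>) \<otimes>\<^bsub>M\<^esub> a1"
    define a2 where "a2 = a1 \<oplus>\<^bsub>M\<^esub> ?b \<one> \<otimes>\<^bsub>M\<^esub> c1"
    note 1 = upper_move(1,2)[OF iso so k b1, folded a1_def]
    have iso1: "A.isotropic a1 c" by (rule A.isotropic_move[OF 1(1) iso scalars_projection])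
    note 2 = upper_move(3,4)[OF iso1 1(2) k b2, folded c1_def]
    have iso2: "A.isotropic a1 c1" by (rule A.isotropic_move[OF 2(1) iso1 scalars_projection])
    note 3 = upper_move(1,2)[OF iso2 2(2) k b1, folded a2_def]
    note cl = isotropic_closed[OF iso1] isotropic_closed[OF iso2]
    have "a1 $$ (k, k) = ?x \<oplus> ?y"
      using k ac xy by (simp add: a1_def entry_add entry_mat_mult_entry)
    moreover have "c1 $$ (k, k) = ?y \<ominus> a1 $$ (k, k)"
      using k cl by (simp add: c1_def entry_add entry_mat_mult_entry matrix_ring_entry_closed l_minus minus_eq)
    moreover have "a2 $$ (k, k) = a1 $$ (k, k) \<oplus> c1 $$ (k, k)"
      using k cl by (simp add: a2_def entry_add entry_mat_mult_entry matrix_ring_entry_closed)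
    ultimately have "a2 $$ (k, k) = (?x \<oplus> ?y) \<oplus> (?y \<ominus> (?x \<oplus> ?y))" by simp
    also have "\<dots> = ?y" using xy by algebra
    finally show ?thesis
      using w 1(1) 2(1) 3 by (intro exI[of _ a2] exI[of _ c1])
        (auto intro: converse_rtranclp_into_rtranclp)
  qed
qed

text \<open>If \<open>k\<close> is not the last column, there is another index \<open>l\<close> left. Row operations bring the
  entries \<open>y\<^sub>j\<close> of the column of \<open>c\<close> into \<open>J\<close> for all \<open>j \<noteq> l\<close>. The entries of the column then
  generate, modulo \<open>J\<close>, the same left ideal as the entries \<open>x\<^sub>j\<close> of the column of \<open>a\<close> and the single
  entry \<open>y\<^sub>l\<close>, so an element \<open>x\<^sub>k + \<Sum> t\<^sub>j x\<^sub>j + s y\<^sub>l\<close> is invertible modulo \<open>J\<close>. It is reached by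
  moves that do not interfere modulo \<open>J\<close>: adding multiples of the rows of \<open>a\<close> to its row \<open>k\<close> subtracts
  only multiples of \<open>y\<^sub>k \<in> J\<close> from the \<open>y\<^sub>j\<close>, and since \<open>l \<noteq> k\<close>, the coefficient \<open>s\<close> need not be
  symmetric.\<close>

lemma pivot_column:
  assumes iso: "A.isotropic a c" and so: "A.split_off (initial_mat R n k) a c" and not_last: "Suc k < n"
  shows "\<exists>a' c'. (A.move scalars)\<^sup>*\<^sup>* (a, c) (a', c') \<and> A.split_off (initial_mat R n k) a' c' \<and>
    (\<exists>w\<in>carrier R. w \<otimes> a' $$ (k, k) \<ominus> \<one> \<in> J)"
proof -
  define l where "l = Suc k"
  have kl: "k < n" "l < n" "k \<le> l" "l \<noteq> k" using not_last by (simp_all add: l_def)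
  note ac = isotropic_closed[OF iso]
  have cl: "x $$ (i, j) \<in> carrier R" if "x \<in> carrier M" "i < n" "j < n" for x i j
    using that by (rule matrix_ring_entry_closed)

  \<comment> \<open>First, row \<open>l\<close> of \<open>c\<close> is changed so that the entry \<open>z\<close> in column \<open>k\<close> generates the column modulo \<open>J\<close>.\<close>
  define y where "y i = c $$ (i, k)" for i
  have y: "y i \<in> carrier R" if "i < n" for i using that kl ac by (simp add: y_def cl)
  define I where "I = {k..<n} - {l}"
  have "I \<subseteq> {..<n}" by (auto simp: I_def)
  then have fam: "\<exists>t. (\<forall>i. t i \<in> carrier R) \<and> (\<forall>i. i \<notin> I \<longrightarrow> t i = \<zero>) \<and>
      y l \<in> gen (y l \<oplus> (\<Oplus>i\<in>{..<n}. t i \<otimes> y i)) \<and> (\<forall>i\<in>I. y i \<in> gen (y l \<oplus> (\<Oplus>i\<in>{..<n}. t i \<otimes> y i)))"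
    using y kl(2) by (intro common_generator_family) simp_all
  obtain t where t: "\<And>i. t i \<in> carrier R" "\<And>i. i \<notin> I \<Longrightarrow> t i = \<zero>"
    "\<And>i. i \<in> I \<Longrightarrow> y i \<in> gen (y l \<oplus> (\<Oplus>i\<in>{..<n}. t i \<otimes> y i))"
    using fam by blast
  define z where "z = y l \<oplus> (\<Oplus>i\<in>{..<n}. t i \<otimes> y i)"
  have z: "z \<in> carrier R" using t(1) y kl by (auto simp: z_def intro!: finsum_closed)
  have t0: "t l = \<zero>" "\<forall>i<k. t i = \<zero>" using t(2) by (auto simp: I_def)
  define a1 c1 where "a1 = a \<ominus>\<^bsub>M\<^esub> col_mat R n l (\<lambda>i. star (t i)) \<otimes>\<^bsub>M\<^esub> a"
    and "c1 = c \<oplus>\<^bsub>M\<^esub> row_mat R n l t \<otimes>\<^bsub>M\<^esub> c"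
  note 1 = row_move(3,4)[OF iso so kl(1), where t = t and l = l, OF t(1) t0 kl(3), folded a1_def c1_def]
  have iso1: "A.isotropic a1 c1" by (rule A.isotropic_move[OF 1(1) iso scalars_projection])
  note ac1 = isotropic_closed[OF iso1]
  have y1: "c1 $$ (i, k) = (if i = l then z else y i)" if "i < n" for i
    using that kl ac t(1) y by (simp add: c1_def entry_add row_mat_mult_entry z_def y_def)

  \<comment> \<open>The other entries \<open>y\<^sub>i\<close> are congruent to \<open>r\<^sub>iz\<close>, and subtracting \<open>r\<^sub>iz\<close> leaves elements of \<open>J\<close>.\<close>
  define r where "r i = (if i \<in> I then SOME r. r \<in> carrier R \<and> y i \<ominus> r \<otimes> z \<in> J else \<zero>)" for i
  have rI: "r i \<in> carrier R \<and> y i \<ominus> r i \<otimes> z \<in> J" if "i \<in> I" for i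
  proof -
    have "\<exists>r. r \<in> carrier R \<and> y i \<ominus> r \<otimes> z \<in> J"
      using t(3)[OF that] unfolding z_def[symmetric] gen_def by blast
    from someI_ex[OF this] show ?thesis using that by (simp add: r_def)
  qed
  have r: "\<And>i. r i \<in> carrier R" "\<And>i. i \<in> I \<Longrightarrow> y i \<ominus> r i \<otimes> z \<in> J" "\<And>i. i \<notin> I \<Longrightarrow> r i = \<zero>"
    using rI by (auto simp: r_def)
  define s where "s i = star (\<ominus> r i)" for i
  have s: "\<And>i. s i \<in> carrier R" "s l = \<zero>" "\<And>i. i < k \<Longrightarrow> s i = \<zero>" "\<And>i. star (s i) = \<ominus> r i"
    using r by (simp_all add: s_def star_closed star_star I_def)
  define a2 c2 where "a2 = a1 \<oplus>\<^bsub>M\<^esub> row_mat R n l (\<lambda>i. \<ominus> s i) \<otimes>\<^bsub>M\<^esub> a1"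
    and "c2 = c1 \<ominus>\<^bsub>M\<^esub> col_mat R n l (\<lambda>i. star (\<ominus> s i)) \<otimes>\<^bsub>M\<^esub> c1"
  have s': "\<And>i. \<ominus> s i \<in> carrier R" "\<ominus> s l = \<zero>" "\<forall>i<k. \<ominus> s i = \<zero>"
    using s by simp_all
  note 2 = row_move(1,2)[OF iso1 1(2) kl(1), where t = "\<lambda>i. \<ominus> s i" and l = l, OF s' kl(3), folded a2_def c2_def]
  have iso2: "A.isotropic a2 c2" by (rule A.isotropic_move[OF 2(1) iso1 scalars_projection])
  note ac2 = isotropic_closed[OF iso2]
  have y2: "c2 $$ (i, k) = (if i = l then z else y i \<ominus> r i \<otimes> z)" if "i < n" for i
  proof -
    have "c2 $$ (i, k) = c1 $$ (i, k) \<ominus> star (\<ominus> s i) \<otimes> c1 $$ (l, k)"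
      using that kl ac1 s'(1) unfolding c2_def
      by (simp add: matrix_minus_entry elementary_closed star_closed col_mat_mult_entry)
    moreover have "star (\<ominus> s i) = r i"
      using s(4) s(1) r(1) by (simp add: star_uminus)
    ultimately show ?thesis
      using that kl z r y by (simp add: y1 I_def minus_eq)
  qed
  have y2J: "c2 $$ (i, k) \<in> J" if "i < n" "i \<noteq> l" for i
  proof (cases "k \<le> i")
    case True
    then show ?thesis using that y2 r(2)[of i] by (auto simp: I_def)
  next
    case False
    then show ?thesis using split_off_entry(2)[OF 2(2) ac2, of i k] that kl J_zero by simp
  qed

  \<comment> \<open>The element \<open>h = x\<^sub>k + \<Sum> p\<^sub>ix\<^sub>i + qz\<close> generates the unit ideal modulo \<open>J\<close>.\<close>
  define x where "x i = a2 $$ (i, k)" for i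
  have x: "x i \<in> carrier R" if "i < n" for i using that kl ac2 by (simp add: x_def cl)
  define K where "K = {Suc k..<n}"
  have "K \<subseteq> {..<n}" by (auto simp: K_def)
  then have famx: "\<exists>t. (\<forall>i. t i \<in> carrier R) \<and> (\<forall>i. i \<notin> K \<longrightarrow> t i = \<zero>) \<and>
      x k \<in> gen (x k \<oplus> (\<Oplus>i\<in>{..<n}. t i \<otimes> x i)) \<and> (\<forall>i\<in>K. x i \<in> gen (x k \<oplus> (\<Oplus>i\<in>{..<n}. t i \<otimes> x i)))"
    using x kl(1) by (intro common_generator_family) simp_all
  obtain p where p: "\<And>i. p i \<in> carrier R" "\<And>i. i \<notin> K \<Longrightarrow> p i = \<zero>"
    "x k \<in> gen (x k \<oplus> (\<Oplus>i\<in>{..<n}. p i \<otimes> x i))"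
    "\<And>i. i \<in> K \<Longrightarrow> x i \<in> gen (x k \<oplus> (\<Oplus>i\<in>{..<n}. p i \<otimes> x i))"
    using famx by blast
  define g where "g = x k \<oplus> (\<Oplus>i\<in>{..<n}. p i \<otimes> x i)"
  have g: "g \<in> carrier R" using p(1) x kl by (auto simp: g_def intro!: finsum_closed)
  obtain q r' where q: "q \<in> carrier R" "r' \<in> carrier R" "z \<ominus> r' \<otimes> (g \<oplus> q \<otimes> z) \<in> J"
    using common_generator[OF g z] by blast
  define h where "h = g \<oplus> q \<otimes> z"
  have h: "h \<in> carrier R" using g q z by (simp add: h_def)
  have zh: "z \<in> gen h" using q z by (auto simp: h_def intro: genI)
  have "g = h \<ominus> q \<otimes> z" unfolding h_def using g q(1) z by algebra
  then have gh: "g \<in> gen h" using gen_minus[OF h gen_self[OF h] gen_left[OF h zh q(1)]] by simp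
  have xh: "x i \<in> gen h" if "i < n" for i
  proof -
    have "i < k \<or> i = k \<or> i \<in> K" using that by (auto simp: K_def)
    then consider "i < k" | "i = k" | "i \<in> K" by blast
    then show ?thesis
    proof cases
      case 1
      then show ?thesis
        using split_off_entry(1)[OF 2(2) ac2, of i k] kl J_zero gen_J[OF h] by (simp add: x_def)
    qed (use p(3,4) gh h gen_trans in \<open>unfold g_def[symmetric], blast+\<close>)
  qed
  have "\<one> \<in> gen h"
  proof -
    obtain u v where uv: "u \<in> carrier M" "v \<in> carrier M" "u \<otimes>\<^bsub>M\<^esub> a2 \<oplus>\<^bsub>M\<^esub> v \<otimes>\<^bsub>M\<^esub> c2 = \<one>\<^bsub>M\<^esub>"
      using iso2 by (auto simp: A.isotropic_def)
    have "(\<Oplus>m\<in>{..<n}. u $$ (k, m) \<otimes> a2 $$ (m, k)) \<oplus> (\<Oplus>m\<in>{..<n}. v $$ (k, m) \<otimes> c2 $$ (m, k))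
        = (u \<otimes>\<^bsub>M\<^esub> a2 \<oplus>\<^bsub>M\<^esub> v \<otimes>\<^bsub>M\<^esub> c2) $$ (k, k)"
      using kl by (simp add: matrix_ring_entry(1,2))
    also have "\<dots> = \<one>" unfolding uv(3) using kl by (simp add: matrix_ring_entry(4))
    finally have "(\<Oplus>m\<in>{..<n}. u $$ (k, m) \<otimes> a2 $$ (m, k)) \<oplus> (\<Oplus>m\<in>{..<n}. v $$ (k, m) \<otimes> c2 $$ (m, k)) = \<one>" .
    moreover have "u $$ (k, m) \<otimes> a2 $$ (m, k) \<in> gen h" if "m \<in> {..<n}" for m
      using xh[of m] that uv kl gen_left[OF h] cl[OF uv(1)] by (simp add: x_def)
    moreover have "v $$ (k, m) \<otimes> c2 $$ (m, k) \<in> gen h" if "m \<in> {..<n}" for m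
    proof (cases "m = l")
      case True
      then show ?thesis using gen_left[OF h zh cl[OF uv(2)]] kl by (simp add: y2)
    next
      case False
      then show ?thesis using gen_left[OF h gen_J[OF h y2J] cl[OF uv(2)]] kl that by simp
    qed
    ultimately show ?thesis
      using gen_add[OF h gen_finsum[OF h, of "{..<n}"] gen_finsum[OF h, of "{..<n}"],
          of "\<lambda>m. u $$ (k, m) \<otimes> a2 $$ (m, k)" "\<lambda>m. v $$ (k, m) \<otimes> c2 $$ (m, k)"] by auto
  qed
  then obtain w where w: "w \<in> carrier R" "w \<otimes> h \<ominus> \<one> \<in> J" using gen_one_inverse h by blast

  have p0: "p k = \<zero>" "\<forall>i<k. p i = \<zero>" using p(2) by (auto simp: K_def)
  \<comment> \<open>Now \<open>h\<close> has to be produced as a diagonal entry, up to an element of \<open>J\<close>.\<close>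
  define a3 c3 where "a3 = a2 \<oplus>\<^bsub>M\<^esub> row_mat R n k p \<otimes>\<^bsub>M\<^esub> a2"
    and "c3 = c2 \<ominus>\<^bsub>M\<^esub> col_mat R n k (\<lambda>i. star (p i)) \<otimes>\<^bsub>M\<^esub> c2"
  note 3 = row_move(1,2)[OF iso2 2(2) kl(1), where t = p and l = k, OF p(1) p0 order_refl, folded a3_def c3_def]
  have iso3: "A.isotropic a3 c3" by (rule A.isotropic_move[OF 3(1) iso2 scalars_projection])
  note ac3 = isotropic_closed[OF iso3]
  have x3: "a3 $$ (k, k) = g"
    using kl ac2 p(1) by (simp add: a3_def entry_add row_mat_mult_entry g_def x_def)
  define d where "d = star (p l) \<otimes> c2 $$ (k, k)"
  have dJ: "d \<in> J" using y2J[of k] kl p(1) J_left star_closed by (simp add: d_def)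
  have y3: "c3 $$ (l, k) = z \<ominus> d"
    using kl ac2 p(1) y2[OF kl(2)] unfolding c3_def d_def
    by (simp add: matrix_minus_entry elementary_closed star_closed col_mat_mult_entry)

  \<comment> \<open>A symmetric matrix whose entry in place \<open>(k,l)\<close> is \<open>q\<close>.\<close>
  define b where "b = mat n n (\<lambda>(i, j). if i = k \<and> j = l then q else if i = l \<and> j = k then star q else \<zero>)"
  have b: "b \<in> carrier M" using q by (auto simp: b_def star_closed intro!: mat_in_matrix_ring)
  have "matrix_star star b = b"
    using b q kl by (auto intro!: matrix_ring_eqI[where n = n and R = R] simp: matrix_star_closed matrix_star_entry)
      (auto simp: b_def star_star)
  moreover have "\<forall>i<n. \<forall>j<n. i < k \<or> j < k \<longrightarrow> b $$ (i, j) = \<zero>"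
    using kl by (auto simp: b_def)
  ultimately have 4: "A.move scalars (a3, c3) (a3 \<oplus>\<^bsub>M\<^esub> b \<otimes>\<^bsub>M\<^esub> c3, c3)"
      "A.split_off (initial_mat R n k) (a3 \<oplus>\<^bsub>M\<^esub> b \<otimes>\<^bsub>M\<^esub> c3) c3"
    using upper_move(1,2)[OF iso3 3(2) kl(1) b] by blast+
  have "(b \<otimes>\<^bsub>M\<^esub> c3) $$ (k, k) = b $$ (k, l) \<otimes> c3 $$ (l, k)"
    unfolding matrix_ring_entry(1)[OF kl(1,1)]
    using kl q cl[OF ac3(2)] by (intro finsum_single) (auto simp: b_def)
  then have x4: "(a3 \<oplus>\<^bsub>M\<^esub> b \<otimes>\<^bsub>M\<^esub> c3) $$ (k, k) = g \<oplus> q \<otimes> (z \<ominus> d)"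
    using kl by (simp add: entry_add x3 y3) (simp add: b_def)
  have "w \<otimes> (g \<oplus> q \<otimes> (z \<ominus> d)) \<ominus> \<one> = (w \<otimes> (g \<oplus> q \<otimes> z) \<ominus> \<one>) \<ominus> w \<otimes> (q \<otimes> d)"
    using w(1) g q(1) z J_closed[OF dJ] by algebra
  then have "w \<otimes> (g \<oplus> q \<otimes> (z \<ominus> d)) \<ominus> \<one> \<in> J"
    using w dJ J_left q(1) by (simp add: h_def J_minus)
  then show ?thesis
    using 1(1) 2(1) 3(1) 4 w(1)
    by (intro exI[of _ "a3 \<oplus>\<^bsub>M\<^esub> b \<otimes>\<^bsub>M\<^esub> c3"] exI[of _ c3])
      (auto simp: x4 intro: converse_rtranclp_into_rtranclp)
qed

lemma initial_mat_Suc: "k < n \<Longrightarrow> initial_mat R n (Suc k) = initial_mat R n k \<oplus>\<^bsub>M\<^esub> entry_mat R n k \<one>"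
  by (rule matrix_ring_eqI[where n = n and R = R])
    (auto simp: elementary_closed elementary_entry entry_add less_Suc_eq)

lemma eliminate_column:
  assumes iso: "A.isotropic a c" and so: "A.split_off (initial_mat R n k) a c" and k: "k < n"
  shows "\<exists>a' c'. (A.move scalars)\<^sup>*\<^sup>* (a, c) (a', c') \<and> A.split_off (initial_mat R n (Suc k)) a' c'"
proof -
  have "Suc k < n \<or> Suc k = n" using k by auto
  then obtain a1 c1 w where 1: "(A.move scalars)\<^sup>*\<^sup>* (a, c) (a1, c1)" "A.split_off (initial_mat R n k) a1 c1"
    and w: "w \<in> carrier R" "w \<otimes> a1 $$ (k, k) \<ominus> \<one> \<in> J"
    using pivot_column[OF iso so] pivot_last_column[OF iso so] by blast
  have iso1: "A.isotropic a1 c1" by (rule A.isotropic_moves[OF 1(1) iso scalars_projection])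
  note ac1 = isotropic_closed[OF iso1]
  define x where "x = a1 $$ (k, k)"
  have x: "x \<in> carrier R" using ac1 k by (simp add: x_def matrix_ring_entry_closed)
  obtain e v where e: "e \<in> E" and v: "v \<in> carrier R" "x \<otimes> v = e" "v \<otimes> x = e"
    using local_inverse[OF x w(1)] w(2) by (auto simp: x_def)
  note ep = E_projection[OF e]
  note eD = central_projectionD(1,2)[OF ep]
  let ?e = "scalar_matrix n R e"
  have eS: "?e \<in> scalars" using e by (simp add: scalars_def)
  define a2 c2 where "a2 = A.localise ?e a1" and "c2 = ?e \<otimes>\<^bsub>M\<^esub> c1"
  have m2: "A.move scalars (a1, c1) (a2, c2)" unfolding a2_def c2_def by (rule A.move.local[OF eS])
  have so2: "A.split_off (initial_mat R n k) a2 c2"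
    unfolding a2_def c2_def
    by (rule A.split_off_localise[OF elementary_closed(3) elementary_star(3) ac1 1(2) scalars_projection[OF eS]])
  have iso2: "A.isotropic a2 c2" by (rule A.isotropic_move[OF m2 iso1 scalars_projection])
  note ac2 = isotropic_closed[OF iso2]
  define v' x' where "v' = localise e v" and "x' = localise e x"
  have x': "a2 $$ (k, k) = x'"
    using ac1 k eD by (simp add: a2_def c2_def x'_def x_def localise_scalar_entry)
  have "localise e e = \<one>" using eD by (simp add: localise_def minus_eq) (metis r_neg2 a_comm add.inv_closed one_closed)
  then have vx: "v' \<in> carrier R" "x' \<in> carrier R" "v' \<otimes> x' = \<one>" "x' \<otimes> v' = \<one>"
    using v x by (simp_all add: v'_def x'_def localise_mult[OF ep] localise_closed[OF ep])
  let ?p = "entry_mat R n k \<one>" and ?v = "entry_mat R n k v'"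
  have p: "?p \<in> carrier M" "?v \<in> carrier M" using vx by (simp_all add: elementary_closed)
  have mult: "entry_mat R n k r \<otimes>\<^bsub>M\<^esub> entry_mat R n k s = entry_mat R n k (r \<otimes> s)"
    if "r \<in> carrier R" "s \<in> carrier R" for r s
    using that k by (intro matrix_ring_eqI[where n = n and R = R])
      (auto simp: elementary_closed entry_mat_mult_entry elementary_entry)
  have pap: "?p \<otimes>\<^bsub>M\<^esub> a2 \<otimes>\<^bsub>M\<^esub> ?p = entry_mat R n k x'"
    using ac2 k vx x' by (intro matrix_ring_eqI[where n = n and R = R])
      (auto simp: elementary_closed entry_mat_mult_entry elementary_entry)
  have fp: "initial_mat R n k \<otimes>\<^bsub>M\<^esub> ?p = \<zero>\<^bsub>M\<^esub>" "?p \<otimes>\<^bsub>M\<^esub> initial_mat R n k = \<zero>\<^bsub>M\<^esub>"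
    by (rule initial_mat_orthogonal; auto simp: elementary_closed elementary_entry)+
  have "\<exists>a' c'. (A.move scalars)\<^sup>*\<^sup>* (a2, c2) (a', c') \<and> A.split_off (initial_mat R n k \<oplus>\<^bsub>M\<^esub> ?p) a' c'"
    using A.split_off_pivot[OF scalars_projection elementary_closed(3) elementary_star(3) p(1) _ _ fp iso2 so2 p(2)]
      vx by (simp add: mult pap elementary_star)
  then show ?thesis
    using 1(1) m2 unfolding initial_mat_Suc[OF k] by (meson rtranclp.rtrancl_into_rtrancl rtranclp_trans)
qed

theorem bruhat_column_local:
  assumes "A.isotropic a c"
  shows "\<exists>e\<in>E. A.bruhat_column (A.localise (scalar_matrix n R e) a) (scalar_matrix n R e \<otimes>\<^bsub>M\<^esub> c)"
proof -
  note ac = isotropic_closed[OF assms]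
  have "\<exists>a' c'. (A.move scalars)\<^sup>*\<^sup>* (a, c) (a', c') \<and> A.split_off (initial_mat R n k) a' c'" if "k \<le> n" for k
    using that
  proof (induction k)
    case 0
    have "initial_mat R n 0 = \<zero>\<^bsub>M\<^esub>"
      by (rule matrix_ring_eqI[where n = n and R = R]) (auto simp: elementary_closed elementary_entry matrix_ring_entry(3))
    then show ?case using ac by (intro exI[of _ a] exI[of _ c]) (simp add: A.split_off_def)
  next
    case (Suc k)
    then obtain a1 c1 where 1: "(A.move scalars)\<^sup>*\<^sup>* (a, c) (a1, c1)" "A.split_off (initial_mat R n k) a1 c1" by auto
    have "A.isotropic a1 c1" by (rule A.isotropic_moves[OF 1(1) assms scalars_projection])
    from eliminate_column[OF this 1(2)] Suc 1(1) show ?case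
      by (meson Suc_le_lessD rtranclp_trans)
  qed
  from this[of n] obtain a1 c1 where 1: "(A.move scalars)\<^sup>*\<^sup>* (a, c) (a1, c1)" "A.split_off (initial_mat R n n) a1 c1"
    by auto
  have "initial_mat R n n = \<one>\<^bsub>M\<^esub>"
    by (rule matrix_ring_eqI[where n = n and R = R]) (auto simp: elementary_closed elementary_entry matrix_ring_entry(4))
  moreover have "a1 \<in> carrier M" "c1 \<in> carrier M"
    using isotropic_closed[OF A.isotropic_moves[OF 1(1) assms scalars_projection]] by blast+
  ultimately have "a1 = \<one>\<^bsub>M\<^esub>" "c1 = \<zero>\<^bsub>M\<^esub>"
    using 1(2) by (simp_all add: A.split_off_def)
  then have "A.bruhat_column (A.localise \<one>\<^bsub>M\<^esub> a1) (\<one>\<^bsub>M\<^esub> \<otimes>\<^bsub>M\<^esub> c1)"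
    using A.bruhat_column_one by (simp add: A.localise_one[OF A.central_projection_one])
  then have "\<exists>f\<in>scalars. A.bruhat_column (A.localise f a) (f \<otimes>\<^bsub>M\<^esub> c)"
    using scalars_one by (intro A.bruhat_column_moves[OF 1(1) assms _ scalars_projection scalars_mult]) blast+
  then show ?thesis by (auto simp: scalars_def)
qed

end

end

section \<open>Star-local rings\<close>

lemma (in ring) minus_flip: "\<lbrakk>x \<in> carrier R; y \<in> carrier R\<rbrakk> \<Longrightarrow> \<ominus> (x \<ominus> y) = y \<ominus> x"
  by (simp add: minus_eq minus_add a_comm)

lemma (in ring) add_minus_cancel:
  assumes "x \<in> carrier R" "y \<in> carrier R"
  shows "x \<oplus> y \<ominus> x = y" "x \<oplus> y \<ominus> y = x" "x \<ominus> (x \<ominus> y) = y" "(x \<ominus> y) \<oplus> y = x" "y \<oplus> (x \<ominus> y) = x"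
proof -
  show 1: "x \<oplus> y \<ominus> y = x" using assms by (simp add: minus_eq a_assoc r_neg)
  show "x \<oplus> y \<ominus> x = y" unfolding a_comm[OF assms] using assms by (simp add: minus_eq a_assoc r_neg)
  show 2: "(x \<ominus> y) \<oplus> y = x" using assms by (simp add: minus_eq a_assoc l_neg)
  then show "y \<oplus> (x \<ominus> y) = x" using assms by (simp add: a_comm)
  have "\<ominus> (x \<ominus> y) = y \<ominus> x" using assms by (rule minus_flip)
  then show "x \<ominus> (x \<ominus> y) = y"
    using assms by (simp add: minus_eq[of x "x \<ominus> y"]) (simp add: minus_eq a_lcomm[of x y] r_neg)
qed

lemma left_idealI:
  assumes "ring R" "I \<subseteq> carrier R" "\<zero>\<^bsub>R\<^esub> \<in> I"
    and "\<And>x y. x \<in> I \<Longrightarrow> y \<in> I \<Longrightarrow> x \<oplus>\<^bsub>R\<^esub> y \<in> I"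
    and "\<And>r x. r \<in> carrier R \<Longrightarrow> x \<in> I \<Longrightarrow> r \<otimes>\<^bsub>R\<^esub> x \<in> I"
  shows "left_ideal I R"
proof -
  interpret ring R by fact
  have "\<ominus>\<^bsub>R\<^esub> x \<in> I" if "x \<in> I" for x
    using assms(5)[of "\<ominus>\<^bsub>R\<^esub> \<one>\<^bsub>R\<^esub>" x] that assms(2) by (auto simp: l_minus)
  then have "subgroup I (add_monoid R)"
    using assms(2-4) by unfold_locales (auto simp: a_inv_def)
  then show ?thesis
    using assms(5) by (auto simp: left_ideal_def additive_subgroup_def)
qed

lemma left_idealD:
  assumes "left_ideal I R"
  shows "x \<in> I \<Longrightarrow> x \<in> carrier R" "\<zero>\<^bsub>R\<^esub> \<in> I" "\<lbrakk>x \<in> I; y \<in> I\<rbrakk> \<Longrightarrow> x \<oplus>\<^bsub>R\<^esub> y \<in> I"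
    "\<lbrakk>r \<in> carrier R; x \<in> I\<rbrakk> \<Longrightarrow> r \<otimes>\<^bsub>R\<^esub> x \<in> I"
proof -
  interpret additive_subgroup I R using assms by (simp add: left_ideal_def)
  show "x \<in> I \<Longrightarrow> x \<in> carrier R" "\<zero>\<^bsub>R\<^esub> \<in> I" "\<lbrakk>x \<in> I; y \<in> I\<rbrakk> \<Longrightarrow> x \<oplus>\<^bsub>R\<^esub> y \<in> I"
    by (auto simp: a_Hcarr)
  show "\<lbrakk>r \<in> carrier R; x \<in> I\<rbrakk> \<Longrightarrow> r \<otimes>\<^bsub>R\<^esub> x \<in> I"
    using assms by (simp add: left_ideal_def)
qed

lemma (in ring) left_ideal_one: "left_ideal I R \<Longrightarrow> \<one> \<in> I \<longleftrightarrow> I = carrier R"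
  using left_idealD(1)[of I R] left_idealD(4)[of I R _ \<one>] by auto

lemma (in ring) maximal_left_ideal_exists:
  assumes I: "left_ideal I R" "\<one> \<notin> I"
  shows "\<exists>M. maximal_left_ideal M R \<and> I \<subseteq> M"
proof -
  define \<A> where "\<A> = {K. left_ideal K R \<and> \<one> \<notin> K \<and> I \<subseteq> K}"
  have "\<exists>M\<in>\<A>. \<forall>K\<in>\<A>. M \<subseteq> K \<longrightarrow> K = M"
  proof (rule subset_Zorn)
    fix C assume C: "subset.chain \<A> C"
    show "\<exists>U\<in>\<A>. \<forall>K\<in>C. K \<subseteq> U"
    proof (cases "C = {}")
      case True
      then show ?thesis using I by (auto simp: \<A>_def)
    next
      case False
      then obtain K0 where K0: "K0 \<in> C" by blast
      have CA: "K \<in> \<A>" if "K \<in> C" for K using C that by (auto simp: subset.chain_def)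
      have lin: "K \<subseteq> L \<or> L \<subseteq> K" if "K \<in> C" "L \<in> C" for K L
        using C that by (auto simp: subset_chain_def)
      have "left_ideal (\<Union>C) R"
      proof (rule left_idealI[OF ring_axioms])
        have CL: "left_ideal K R" if "K \<in> C" for K using CA[OF that] by (simp add: \<A>_def)
        show "\<Union>C \<subseteq> carrier R" using left_idealD(1)[OF CL] by blast
        show "\<zero> \<in> \<Union>C" using left_idealD(2)[OF CL[OF K0]] K0 by blast
        show "x \<oplus> y \<in> \<Union>C" if "x \<in> \<Union>C" "y \<in> \<Union>C" for x y
        proof -
          obtain K L where KL: "x \<in> K" "K \<in> C" "y \<in> L" "L \<in> C" using \<open>x \<in> \<Union>C\<close> \<open>y \<in> \<Union>C\<close> by blast
          then have "\<exists>N\<in>C. x \<in> N \<and> y \<in> N" using lin[OF KL(2,4)] by blast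
          then show ?thesis using left_idealD(3)[OF CL] by blast
        qed
        show "r \<otimes> x \<in> \<Union>C" if "r \<in> carrier R" "x \<in> \<Union>C" for r x
          using that left_idealD(4)[OF CL] by blast
      qed
      then have "\<Union>C \<in> \<A>" using CA K0 by (auto simp: \<A>_def)
      then show ?thesis by blast
    qed
  qed
  then obtain M where M0: "M \<in> \<A>" "\<forall>K\<in>\<A>. M \<subseteq> K \<longrightarrow> K = M" by (elim bexE)
  have M: "left_ideal M R" "\<one> \<notin> M" "I \<subseteq> M" "\<And>K. K \<in> \<A> \<Longrightarrow> M \<subseteq> K \<Longrightarrow> K = M"
    using M0(1) M0(2)[rule_format] by (simp_all add: \<A>_def)
  have "K = M \<or> K = carrier R" if K: "left_ideal K R" "M \<subseteq> K" for K
    using M(3) M(4)[of K] K left_ideal_one[OF K(1)] by (auto simp: \<A>_def)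
  note max = this
  have proper: "M \<noteq> carrier R" using M(2) one_closed by metis
  have "maximal_left_ideal M R"
    unfolding maximal_left_ideal_def
  proof (intro conjI allI impI)
    fix K assume "left_ideal K R \<and> M \<subseteq> K"
    then show "K = M \<or> K = carrier R" using max[of K] by simp
  qed (rule M(1), rule proper)
  with M(3) show ?thesis by blast
qed

lemma (in ring) maximal_left_ideal_comaximal:
  assumes M: "maximal_left_ideal M R" and x: "x \<in> carrier R" "x \<notin> M"
  shows "\<exists>m\<in>M. \<exists>y\<in>carrier R. \<one> = m \<oplus> y \<otimes> x"
proof -
  note l = left_idealD[OF M[unfolded maximal_left_ideal_def, THEN conjunct1]]
  define K where "K = {m \<oplus> y \<otimes> x | m y. m \<in> M \<and> y \<in> carrier R}"
  have KI: "m \<oplus> y \<otimes> x \<in> K" if "m \<in> M" "y \<in> carrier R" for m y using that by (auto simp: K_def)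
  have "left_ideal K R"
  proof (rule left_idealI[OF ring_axioms])
    show "K \<subseteq> carrier R" using l(1) x by (auto simp: K_def)
    show "\<zero> \<in> K" using KI[OF l(2) zero_closed] x by simp
    fix u v assume "u \<in> K" "v \<in> K"
    then obtain m y m' y' where *: "u = m \<oplus> y \<otimes> x" "v = m' \<oplus> y' \<otimes> x" "m \<in> M" "m' \<in> M" "y \<in> carrier R" "y' \<in> carrier R"
      by (auto simp: K_def)
    have "u \<oplus> v = (m \<oplus> m') \<oplus> (y \<oplus> y') \<otimes> x"
      using * l(1)[OF *(3)] l(1)[OF *(4)] x by (simp add: l_distr a_ac)
    then show "u \<oplus> v \<in> K" using KI[of "m \<oplus> m'" "y \<oplus> y'"] * l(3) by simp
  next
    fix r u assume r: "r \<in> carrier R" and "u \<in> K"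
    then obtain m y where *: "u = m \<oplus> y \<otimes> x" "m \<in> M" "y \<in> carrier R" by (auto simp: K_def)
    have "r \<otimes> u = r \<otimes> m \<oplus> (r \<otimes> y) \<otimes> x"
      using * l(1)[OF *(2)] r x by (simp add: r_distr m_assoc)
    then show "r \<otimes> u \<in> K" using KI[of "r \<otimes> m" "r \<otimes> y"] * l(4) r by simp
  qed
  moreover have "M \<subseteq> K"
  proof
    fix m assume "m \<in> M"
    then show "m \<in> K" using KI[of m \<zero>] l(1) x by simp
  qed
  moreover have "x \<in> K" using KI[OF l(2) one_closed] x by simp
  ultimately have "K = carrier R"
    using M x(2) unfolding maximal_left_ideal_def by blast
  then show ?thesis
    using one_closed unfolding K_def by blast
qed

lemma (in ring) maximal_left_ideal_inverse:
  assumes M: "maximal_left_ideal M R" and x: "x \<in> carrier R" "x \<notin> M"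
  shows "\<exists>y\<in>carrier R. y \<otimes> x \<ominus> \<one> \<in> M"
proof -
  note l = left_idealD[OF M[unfolded maximal_left_ideal_def, THEN conjunct1]]
  obtain m y where my: "\<one> = m \<oplus> y \<otimes> x" "m \<in> M" "y \<in> carrier R"
    using maximal_left_ideal_comaximal[OF assms] by blast
  have mc: "m \<in> carrier R" by (rule l(1)[OF my(2)])
  have "m \<oplus> y \<otimes> x \<ominus> y \<otimes> x = m" using mc my(3) x(1) by (intro add_minus_cancel) simp_all
  then have "\<ominus> (y \<otimes> x \<ominus> \<one>) = m" using my(3) x(1) by (simp add: minus_flip my(1)[symmetric])
  then have "y \<otimes> x \<ominus> \<one> = \<ominus> \<one> \<otimes> m" using my(3) x(1) mc by (metis l_minus l_one m_closed minus_closed minus_minus one_closed)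
  then show ?thesis using my(2) l(4)[of "\<ominus> \<one>" m] by (intro bexI[OF _ my(3)]) simp
qed

text \<open>The situation modulo a stable ideal \<open>p \<inter> p\<^sup>*\<close> for which \<open>R/p\<close> is a division ring: the quotient
  is \<open>R/p\<close> itself or the product of \<open>R/p\<close> and its opposite, exchanged by the involution.\<close>

locale division_ideal = involution_ring R star for R (structure) and star +
  fixes p
  assumes p_closed: "x \<in> p \<Longrightarrow> x \<in> carrier R"
    and p_zero: "\<zero> \<in> p"
    and p_add: "\<lbrakk>x \<in> p; y \<in> p\<rbrakk> \<Longrightarrow> x \<oplus> y \<in> p"
    and p_left: "\<lbrakk>r \<in> carrier R; x \<in> p\<rbrakk> \<Longrightarrow> r \<otimes> x \<in> p"
    and p_right: "\<lbrakk>r \<in> carrier R; x \<in> p\<rbrakk> \<Longrightarrow> x \<otimes> r \<in> p"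
    and p_proper: "\<one> \<notin> p"
    and p_division: "\<lbrakk>x \<in> carrier R; x \<notin> p\<rbrakk> \<Longrightarrow> \<exists>y\<in>carrier R. y \<otimes> x \<ominus> \<one> \<in> p"
begin

definition p_star where "p_star = {x \<in> carrier R. star x \<in> p}"

lemma p_uminus: "x \<in> p \<Longrightarrow> \<ominus> x \<in> p"
  using p_left[of "\<ominus> \<one>" x] p_closed[of x] by (simp add: l_minus)

lemma p_minus: "\<lbrakk>x \<in> p; y \<in> p\<rbrakk> \<Longrightarrow> x \<ominus> y \<in> p"
  by (simp add: minus_eq p_add p_uminus)

lemma p_add_cancel:
  assumes "x \<oplus> y \<in> p" "x \<in> carrier R" "y \<in> carrier R"
  shows "x \<in> p \<Longrightarrow> y \<in> p" "y \<in> p \<Longrightarrow> x \<in> p"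
proof -
  show "x \<in> p \<Longrightarrow> y \<in> p" "y \<in> p \<Longrightarrow> x \<in> p"
    using p_minus[OF assms(1), of x] p_minus[OF assms(1), of y] assms(2,3) by (simp_all add: add_minus_cancel)
qed

lemma p_sym: "\<lbrakk>x \<ominus> y \<in> p; x \<in> carrier R; y \<in> carrier R\<rbrakk> \<Longrightarrow> y \<ominus> x \<in> p"
  using p_uminus by (metis minus_flip)

lemma p_trans:
  assumes "x \<ominus> y \<in> p" "y \<ominus> z \<in> p" "x \<in> carrier R" "y \<in> carrier R" "z \<in> carrier R"
  shows "x \<ominus> z \<in> p"
proof -
  have "(x \<ominus> y) \<oplus> (y \<ominus> z) = x \<ominus> z"
    using assms(3-5) by (simp add: minus_eq a_assoc r_neg1)
  then show ?thesis using p_add[OF assms(1,2)] by simp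
qed

lemma p_right_inverse:
  assumes y: "y \<in> carrier R" "y \<notin> p"
  shows "\<exists>z\<in>carrier R. y \<otimes> z \<ominus> \<one> \<in> p"
proof -
  obtain z where z: "z \<in> carrier R" "z \<otimes> y \<ominus> \<one> \<in> p" using p_division[OF y] by blast
  have "z \<notin> p"
  proof
    assume "z \<in> p"
    then have "z \<otimes> y \<ominus> (z \<otimes> y \<ominus> \<one>) \<in> p" using z y p_right p_minus by blast
    moreover have "z \<otimes> y \<ominus> (z \<otimes> y \<ominus> \<one>) = \<one>" using z(1) y(1) by (simp add: add_minus_cancel)
    ultimately show False using p_proper by simp
  qed
  then obtain z' where z': "z' \<in> carrier R" "z' \<otimes> z \<ominus> \<one> \<in> p" using p_division[OF z(1)] by blast
  have "z' \<otimes> z \<otimes> y \<ominus> y = (z' \<otimes> z \<ominus> \<one>) \<otimes> y" "z' \<otimes> z \<otimes> y \<ominus> z' = z' \<otimes> (z \<otimes> y \<ominus> \<one>)"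
    using z(1) z'(1) y(1) by (simp_all add: minus_eq l_distr r_distr l_minus r_minus m_assoc)
  then have "z' \<otimes> z \<otimes> y \<ominus> y \<in> p" "z' \<otimes> z \<otimes> y \<ominus> z' \<in> p"
    using z z' y p_left p_right by simp_all
  then have "y \<ominus> z' \<in> p" using p_trans[OF p_sym] z(1) z'(1) y(1) by blast
  moreover have "y \<otimes> z \<ominus> z' \<otimes> z = (y \<ominus> z') \<otimes> z"
    using z(1) z'(1) y(1) by (simp add: minus_eq l_distr l_minus)
  ultimately have "y \<otimes> z \<ominus> z' \<otimes> z \<in> p" using z(1) p_right by simp
  then have "y \<otimes> z \<ominus> \<one> \<in> p" using p_trans z' z(1) y(1) by blast
  then show ?thesis using z(1) by blast
qed

lemma p_prime:
  assumes "x \<otimes> y \<in> p" "x \<in> carrier R" "y \<in> carrier R"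
  shows "x \<in> p \<or> y \<in> p"
proof (rule disjCI)
  assume "y \<notin> p"
  then obtain z where z: "z \<in> carrier R" "y \<otimes> z \<ominus> \<one> \<in> p" using p_right_inverse assms(3) by blast
  have "x = x \<otimes> y \<otimes> z \<ominus> x \<otimes> (y \<otimes> z \<ominus> \<one>)"
  proof -
    have "x \<otimes> (y \<otimes> z \<ominus> \<one>) = x \<otimes> y \<otimes> z \<ominus> x"
      using assms(2,3) z(1) by (simp add: minus_eq r_distr r_minus m_assoc)
    then show ?thesis using assms(2,3) z(1) by (simp add: add_minus_cancel)
  qed
  then show "x \<in> p" using p_minus[OF p_right[OF z(1) assms(1)] p_left[OF assms(2) z(2)]] by metis
qed

lemma p_star_iff: "x \<in> carrier R \<Longrightarrow> x \<in> p_star \<longleftrightarrow> star x \<in> p"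
  by (simp add: p_star_def)

lemma p_star_closed: "x \<in> p_star \<Longrightarrow> x \<in> carrier R"
  by (simp add: p_star_def)

lemma p_star_zero: "\<zero> \<in> p_star"
  by (simp add: p_star_def p_zero)

lemma p_star_add: "\<lbrakk>x \<in> p_star; y \<in> p_star\<rbrakk> \<Longrightarrow> x \<oplus> y \<in> p_star"
  by (simp add: p_star_def star_add p_add)

lemma p_star_left: "\<lbrakk>r \<in> carrier R; x \<in> p_star\<rbrakk> \<Longrightarrow> r \<otimes> x \<in> p_star"
  by (simp add: p_star_def star_mult star_closed p_right)

lemma p_star_right: "\<lbrakk>r \<in> carrier R; x \<in> p_star\<rbrakk> \<Longrightarrow> x \<otimes> r \<in> p_star"
  by (simp add: p_star_def star_mult star_closed p_left)

lemma p_star_division: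
  assumes x: "x \<in> carrier R" "x \<notin> p_star"
  shows "\<exists>y\<in>carrier R. y \<otimes> x \<ominus> \<one> \<in> p_star"
proof -
  obtain z where z: "z \<in> carrier R" "star x \<otimes> z \<ominus> \<one> \<in> p"
    using p_right_inverse[of "star x"] x by (auto simp: p_star_iff star_closed)
  have "star (star z \<otimes> x \<ominus> \<one>) = star x \<otimes> z \<ominus> \<one>"
    using z x by (simp add: star_minus star_mult star_closed star_star)
  then show ?thesis
    using z x by (intro bexI[of _ "star z"]) (simp_all add: p_star_def star_closed)
qed

lemma opposite_division_ideal: "division_ideal R star p_star"
proof
  show "\<one> \<notin> p_star" using p_proper by (simp add: p_star_def)
qed (rule p_star_closed p_star_zero p_star_add p_star_left p_star_right p_star_division; assumption)+

text \<open>If \<open>x\<close> lies in \<open>p\<close> then \<open>y\<close> does not, and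
  \<open>x\<^sup>*y = y\<^sup>*x\<close> forces \<open>x\<close> into \<open>p\<^sup>*\<close> as well, so that \<open>y\<close> does not lie in \<open>p\<^sup>*\<close> either.\<close>

lemma isotropic_entry:
  assumes "isotropic x y"
  shows "x \<notin> p \<and> x \<notin> p_star \<or> y \<notin> p \<and> y \<notin> p_star"
proof -
  obtain u v where cl: "x \<in> carrier R" "y \<in> carrier R" "u \<in> carrier R" "v \<in> carrier R"
    and uv: "u \<otimes> x \<oplus> v \<otimes> y = \<one>" and sym: "star y \<otimes> x = star x \<otimes> y"
    using assms by (auto simp: isotropic_def sym_elements_def star_mult star_star star_closed)
  have 1: "\<not> (x \<in> p \<and> y \<in> p)" using uv p_add p_left cl p_proper by metis
  have 2: "\<not> (x \<in> p_star \<and> y \<in> p_star)"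
  proof
    assume "x \<in> p_star \<and> y \<in> p_star"
    then have "\<one> \<in> p_star" using uv p_star_add p_star_left cl by metis
    then show False using p_proper by (simp add: p_star_iff)
  qed
  have 3: "x \<in> p_star" if "x \<in> p"
  proof -
    have "star x \<otimes> y \<in> p" using that p_left[of "star y" x] cl by (simp add: sym star_closed)
    then show ?thesis using p_prime[of "star x" y] 1 that cl by (auto simp: p_star_iff star_closed)
  qed
  have 4: "x \<in> p" if "x \<in> p_star"
  proof -
    have "star y \<otimes> x \<in> p" using that p_right[of y "star x"] cl by (simp add: sym p_star_iff)
    then show ?thesis using p_prime[of "star y" x] 2 that cl by (auto simp: p_star_iff star_closed)
  qed
  show ?thesis using 1 2 3 4 by blast
qed

context
  assumes comaximal: "p_star = p \<or> (\<exists>u\<in>p. \<one> \<ominus> u \<in> p_star)"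
begin

text \<open>Modulo \<open>p \<inter> p\<^sup>*\<close>, elements can be prescribed modulo \<open>p\<close> and modulo \<open>p\<^sup>*\<close> separately.\<close>

lemma combine:
  assumes "x \<in> carrier R" "y \<in> carrier R"
    and "\<exists>r\<in>carrier R. y \<ominus> r \<otimes> x \<in> p" "\<exists>r\<in>carrier R. y \<ominus> r \<otimes> x \<in> p_star"
  shows "\<exists>r\<in>carrier R. y \<ominus> r \<otimes> x \<in> p \<inter> p_star"
proof (cases "p_star = p")
  case True
  then show ?thesis using assms(3) by simp
next
  case False
  then obtain u where u: "u \<in> p" "\<one> \<ominus> u \<in> p_star" using comaximal by blast
  note uc = p_closed[OF u(1)]
  obtain r where r: "r \<in> carrier R" "y \<ominus> r \<otimes> x \<in> p" using assms(3) by blast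
  obtain s where s: "s \<in> carrier R" "y \<ominus> s \<otimes> x \<in> p_star" using assms(4) by blast
  define t where "t = (\<one> \<ominus> u) \<otimes> r \<oplus> u \<otimes> s"
  have t: "t \<in> carrier R" using uc r s by (simp add: t_def)
  have "(\<one> \<ominus> u) \<otimes> (y \<ominus> r \<otimes> x) \<oplus> u \<otimes> (y \<ominus> s \<otimes> x) = ((\<one> \<ominus> u) \<otimes> y \<oplus> u \<otimes> y) \<ominus> t \<otimes> x"
  proof -
    have "w \<otimes> (y \<ominus> r \<otimes> x) \<oplus> u \<otimes> (y \<ominus> s \<otimes> x) = (w \<otimes> y \<oplus> u \<otimes> y) \<ominus> (w \<otimes> r \<oplus> u \<otimes> s) \<otimes> x"
      if "w \<in> carrier R" for w
      using that assms(1,2) uc r(1) s(1)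
      by (simp add: minus_eq r_distr l_distr r_minus minus_add m_assoc a_ac)
    then show ?thesis using uc by (simp add: t_def)
  qed
  moreover have "(\<one> \<ominus> u) \<otimes> y \<oplus> u \<otimes> y = y"
    using uc assms(2) by (simp add: minus_eq l_distr l_minus a_assoc l_neg)
  ultimately have "y \<ominus> t \<otimes> x = (\<one> \<ominus> u) \<otimes> (y \<ominus> r \<otimes> x) \<oplus> u \<otimes> (y \<ominus> s \<otimes> x)"
    by simp
  moreover have "\<dots> \<in> p" using u r s uc assms by (intro p_add p_left p_right) auto
  moreover have "(\<one> \<ominus> u) \<otimes> (y \<ominus> r \<otimes> x) \<oplus> u \<otimes> (y \<ominus> s \<otimes> x) \<in> p_star"
    using u r s uc assms by (intro p_star_add p_star_left[of u] p_star_right) auto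
  ultimately show ?thesis by (intro bexI[OF _ t] IntI) simp_all
qed

lemma separating_element:
  assumes x: "x \<in> carrier R"
  shows "\<exists>t\<in>carrier R. (x \<notin> p \<longrightarrow> t \<in> p) \<and> (x \<in> p \<longrightarrow> \<one> \<ominus> t \<in> p) \<and>
    (x \<notin> p_star \<longrightarrow> t \<in> p_star) \<and> (x \<in> p_star \<longrightarrow> \<one> \<ominus> t \<in> p_star)"
proof -
  have z: "\<one> \<ominus> \<one> = \<zero>" "\<one> \<ominus> \<zero> = \<one>" by (simp_all add: minus_eq r_neg)
  show ?thesis
  proof (cases "p_star = p")
    case True
    show ?thesis
    proof (cases "x \<in> p")
      case True
      moreover have "\<one> \<ominus> \<one> \<in> p" unfolding z by (rule p_zero)
      ultimately show ?thesis unfolding \<open>p_star = p\<close> by (intro bexI[OF _ one_closed]) blast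
    next
      case False
      then show ?thesis using p_zero unfolding \<open>p_star = p\<close> by (intro bexI[OF _ zero_closed]) blast
    qed
  next
    case False
    then obtain u where u: "u \<in> p" "\<one> \<ominus> u \<in> p_star" using comaximal by blast
    note uc = p_closed[OF u(1)]
    have u': "\<one> \<ominus> (\<one> \<ominus> u) = u" using uc by (simp add: add_minus_cancel)
    consider "x \<in> p" "x \<in> p_star" | "x \<in> p" "x \<notin> p_star" | "x \<notin> p" "x \<in> p_star" | "x \<notin> p" "x \<notin> p_star" by blast
    then show ?thesis
    proof cases
      case 1
      moreover have "\<one> \<ominus> \<one> \<in> p" "\<one> \<ominus> \<one> \<in> p_star" unfolding z by (rule p_zero, rule p_star_zero)
      ultimately show ?thesis by blast
    next
      case 2
      then show ?thesis using u u' uc by (intro bexI[of _ "\<one> \<ominus> u"]) simp_all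
    next
      case 3
      then show ?thesis using u uc by (intro bexI[of _ u]) simp_all
    next
      case 4
      then show ?thesis using p_zero p_star_zero by (intro bexI[of _ \<zero>]) simp_all
    qed
  qed
qed

lemma division_local_pivoting:
  assumes E: "\<And>e. e \<in> E \<Longrightarrow> central_projection e" "\<one> \<in> E" "\<And>e f. \<lbrakk>e \<in> E; f \<in> E\<rbrakk> \<Longrightarrow> e \<otimes> f \<in> E"
    and inv: "\<And>z w. \<lbrakk>z \<in> carrier R; w \<in> carrier R; w \<otimes> z \<ominus> \<one> \<in> p \<inter> p_star\<rbrakk> \<Longrightarrow>
      \<exists>e\<in>E. \<exists>z'\<in>carrier R. z \<otimes> z' = e \<and> z' \<otimes> z = e"
  shows "local_pivoting R star (p \<inter> p_star) E"
proof -
  have unit: "\<exists>w\<in>carrier R. w \<otimes> z \<ominus> \<one> \<in> p \<inter> p_star" if "z \<in> carrier R" "z \<notin> p" "z \<notin> p_star" for z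
  proof -
    have flip: "\<one> \<ominus> r \<otimes> z = \<ominus> (r \<otimes> z \<ominus> \<one>)" if "r \<in> carrier R" for r
      using that \<open>z \<in> carrier R\<close> by (simp add: minus_flip)
    have "\<exists>r\<in>carrier R. \<one> \<ominus> r \<otimes> z \<in> p" "\<exists>r\<in>carrier R. \<one> \<ominus> r \<otimes> z \<in> p_star"
      using p_division[OF that(1,2)] p_star_division[OF that(1,3)] p_uminus
        division_ideal.p_uminus[OF opposite_division_ideal] flip by metis+
    from combine[OF that(1) one_closed this] obtain r where r: "r \<in> carrier R" "\<one> \<ominus> r \<otimes> z \<in> p" "\<one> \<ominus> r \<otimes> z \<in> p_star"
      by blast
    have "r \<otimes> z \<ominus> \<one> = \<ominus> (\<one> \<ominus> r \<otimes> z)"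
      using r(1) that(1) by (simp add: minus_flip)
    then show ?thesis
      using r p_uminus division_ideal.p_uminus[OF opposite_division_ideal] by (intro bexI[OF _ r(1)]) simp
  qed
  have gen: "\<exists>t\<in>carrier R. \<exists>r\<in>carrier R. y \<ominus> r \<otimes> (x \<oplus> t \<otimes> y) \<in> p \<inter> p_star"
    if xy: "x \<in> carrier R" "y \<in> carrier R" for x y
  proof -
    obtain t where t: "t \<in> carrier R" "x \<notin> p \<Longrightarrow> t \<in> p" "x \<in> p \<Longrightarrow> \<one> \<ominus> t \<in> p"
      "x \<notin> p_star \<Longrightarrow> t \<in> p_star" "x \<in> p_star \<Longrightarrow> \<one> \<ominus> t \<in> p_star"
      using separating_element[OF xy(1)] by blast
    define z where "z = x \<oplus> t \<otimes> y"
    have z: "z \<in> carrier R" using xy t by (simp add: z_def)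
    have main: "\<exists>r\<in>carrier R. y \<ominus> r \<otimes> z \<in> q"
      if q: "division_ideal R star q" and tq: "x \<notin> q \<Longrightarrow> t \<in> q" "x \<in> q \<Longrightarrow> \<one> \<ominus> t \<in> q" for q
    proof -
      interpret q: division_ideal R star q by (rule q)
      show ?thesis
      proof (cases "z \<in> q")
        case True
        have "x \<in> q"
          using q.p_add_cancel(2)[OF True[unfolded z_def]] xy t(1) q.p_right[OF xy(2)] tq(1) by auto
        then have "t \<otimes> y \<in> q" "(\<one> \<ominus> t) \<otimes> y \<in> q"
          using q.p_add_cancel(1)[OF True[unfolded z_def]] xy t(1) q.p_right[OF xy(2)] tq(2) by auto
        moreover have "y = t \<otimes> y \<oplus> (\<one> \<ominus> t) \<otimes> y"
          using xy t(1) by (simp add: l_distr[symmetric] add_minus_cancel)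
        ultimately have "y \<in> q" using q.p_add by metis
        then show ?thesis using z xy by (intro bexI[of _ \<zero>]) (simp_all add: minus_eq)
      next
        case False
        then obtain w where w: "w \<in> carrier R" "w \<otimes> z \<ominus> \<one> \<in> q" using q.p_division[OF z] by blast
        have "y \<ominus> (y \<otimes> w) \<otimes> z = \<ominus> y \<otimes> (w \<otimes> z \<ominus> \<one>)"
          using xy w(1) z by (simp add: minus_eq r_distr r_minus l_minus m_assoc a_comm)
        then show ?thesis using w xy q.p_left by (intro bexI[of _ "y \<otimes> w"]) auto
      qed
    qed
    show ?thesis
      using combine[OF z xy(2) main[OF division_ideal_axioms t(2,3)] main[OF opposite_division_ideal t(4,5)]] t(1)
      unfolding z_def by blast
  qed
  have pivot: "(\<exists>s\<in>sym_elements R star. \<exists>w\<in>carrier R. w \<otimes> (x \<oplus> s \<otimes> y) \<ominus> \<one> \<in> p \<inter> p_star) \<or>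
      (\<exists>w\<in>carrier R. w \<otimes> y \<ominus> \<one> \<in> p \<inter> p_star)" if "isotropic x y" for x y
  proof -
    have cl: "x \<in> carrier R" "y \<in> carrier R" using that by (auto simp: isotropic_def)
    have "\<zero> \<in> sym_elements R star" "x \<oplus> \<zero> \<otimes> y = x" using cl by (simp_all add: sym_elements_def)
    then show ?thesis
      using isotropic_entry[OF that] unit[OF cl(1)] unit[OF cl(2)] by metis
  qed
  show ?thesis
  proof
    show "x \<in> carrier R" if "x \<in> p \<inter> p_star" for x using that p_closed by simp
    show "\<zero> \<in> p \<inter> p_star" using p_zero p_star_zero by simp
    show "x \<oplus> y \<in> p \<inter> p_star" if "x \<in> p \<inter> p_star" "y \<in> p \<inter> p_star" for x y
      using that p_add p_star_add by simp
    show "r \<otimes> x \<in> p \<inter> p_star" if "r \<in> carrier R" "x \<in> p \<inter> p_star" for r x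
      using that p_left p_star_left by simp
  qed (rule E inv gen pivot; assumption)+
qed

end

end

text \<open>Every maximal left ideal \<open>L\<close> of a star-local ring satisfies \<open>L \<inter> L\<^sup>* = m\<close>, the unique stable
  maximal ideal: a stable ideal that contains \<open>L \<inter> L\<^sup>*\<close> but is not contained in \<open>L\<close> is comaximal with
  \<open>L\<close> and with \<open>L\<^sup>*\<close>, hence with \<open>LL\<^sup>*\<close>. So \<open>m\<close> is the radical.\<close>

lemma star_local_pivoting:
  fixes R (structure)
  assumes inv: "involution_ring R star" and loc: "star_local_ring R star"
  shows "\<exists>J. local_pivoting R star J {\<one>}"
proof -
  interpret involution_ring R star by (rule inv)
  have lmax: "ideal L R" if "maximal_left_ideal L R" for L
    using loc that by (simp add: star_local_ring_def l_maximal_def)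
  obtain m where m: "stable_maximal_ideal m R star" "\<And>K. stable_maximal_ideal K R star \<Longrightarrow> K = m"
    using loc by (auto simp: star_local_ring_def)
  have div: "division_ideal R star L" if L: "maximal_left_ideal L R" for L
  proof -
    interpret L: ideal L R by (rule lmax[OF L])
    have "left_ideal L R" "L \<noteq> carrier R" using L by (auto simp: maximal_left_ideal_def)
    then have "\<one> \<notin> L" using left_ideal_one by blast
    then show ?thesis
      using maximal_left_ideal_inverse[OF L] L.I_l_closed L.I_r_closed L.a_Hcarr
      by unfold_locales (simp_all add: L.a_closed)
  qed
  have rad: "L \<inter> division_ideal.p_star R star L = m" if L: "maximal_left_ideal L R" for L
  proof (rule m(2))
    interpret L: division_ideal R star L by (rule div[OF L])
    let ?K = "L \<inter> L.p_star"
    have id: "ideal ?K R"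
    proof (rule idealI)
      show "ring R" by (rule ring_axioms)
      show "subgroup ?K (add_monoid R)"
      proof (rule add.subgroupI)
        show "?K \<subseteq> carrier R" using L.p_closed by blast
        show "?K \<noteq> {}" using L.p_zero L.p_star_zero by blast
        show "\<ominus> x \<in> ?K" if "x \<in> ?K" for x
          using that L.p_uminus division_ideal.p_uminus[OF L.opposite_division_ideal] by blast
        show "x \<oplus> y \<in> ?K" if "x \<in> ?K" "y \<in> ?K" for x y
          using that L.p_add L.p_star_add by blast
      qed
    qed (use L.p_left L.p_right L.p_star_left L.p_star_right in auto)
    have "star ` ?K = ?K"
    proof
      show "star ` ?K \<subseteq> ?K" using L.p_closed by (auto simp: L.p_star_iff star_closed star_star)
      show "?K \<subseteq> star ` ?K"
      proof
        fix x assume "x \<in> ?K"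
        then have "star x \<in> ?K" "x = star (star x)"
          using L.p_closed by (auto simp: L.p_star_iff star_closed star_star)
        then show "x \<in> star ` ?K" by blast
      qed
    qed
    moreover have "?K \<noteq> carrier R" using L.p_proper by auto
    moreover have "K = ?K \<or> K = carrier R" if K: "stable_ideal K R star" "?K \<subseteq> K" for K
    proof (cases "K \<subseteq> L")
      case True
      have sK: "star ` K = K" using K(1) by (simp add: stable_ideal_def)
      have "x \<in> ?K" if x: "x \<in> K" for x
      proof -
        have "star x \<in> K" using imageI[OF x, of star] sK by simp
        then have "star x \<in> L" using True by blast
        moreover have "x \<in> L" using x True by blast
        ultimately show ?thesis using L.p_closed L.p_star_iff by blast
      qed
      then show ?thesis using K(2) by blast
    next
      case False
      interpret K: ideal K R using K(1) by (simp add: stable_ideal_def)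
      obtain k where k: "k \<in> K" "k \<notin> L" using False by blast
      obtain y where y: "y \<in> carrier R" "y \<otimes> k \<ominus> \<one> \<in> L" using L.p_division[OF K.a_Hcarr[OF k(1)] k(2)] by blast
      define k' l where "k' = y \<otimes> k" and "l = \<one> \<ominus> k'"
      have k': "k' \<in> K" "k' \<in> carrier R" using k y K.I_l_closed K.a_Hcarr by (auto simp: k'_def)
      have "l = \<ominus> (k' \<ominus> \<one>)" using k' by (simp add: l_def minus_flip)
      then have l: "l \<in> L" using L.p_uminus y by (simp add: k'_def)
      have lc: "l \<in> carrier R" using k' by (simp add: l_def)
      have sk: "star k' \<in> K" "star k' \<in> carrier R" using K(1) k' by (auto simp: stable_ideal_def star_closed)
      have sl: "star l \<in> L.p_star" "star l = \<one> \<ominus> star k'"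
        using l lc k' by (simp_all add: L.p_star_iff star_closed star_star l_def star_minus)
      have "l \<otimes> star l \<in> K"
        using K(2) L.p_right[OF star_closed[OF lc] l] L.p_star_left[OF lc sl(1)] by blast
      moreover have "\<one> = l \<otimes> star l \<oplus> (l \<otimes> star k' \<oplus> k')"
      proof -
        have "l \<otimes> star l = l \<ominus> l \<otimes> star k'"
          using lc sk by (simp add: sl(2) minus_eq r_distr r_minus)
        then have "l \<otimes> star l \<oplus> l \<otimes> star k' = l"
          using lc sk by (simp add: add_minus_cancel)
        moreover have "l \<oplus> k' = \<one>" using k' by (simp add: l_def add_minus_cancel)
        ultimately show ?thesis
          using lc sk(2) k'(2) star_closed[OF lc] by (simp add: a_assoc[symmetric])
      qed
      moreover have "l \<otimes> star k' \<oplus> k' \<in> K" using sk k' lc K.I_l_closed K.a_closed by blast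
      ultimately have "\<one> \<in> K" using K.a_closed by metis
      then show ?thesis using K.one_imp_carrier by blast
    qed
    ultimately show "stable_maximal_ideal ?K R star"
      using id by (auto simp: stable_maximal_ideal_def stable_ideal_def)
  qed
  have m_ideal: "ideal m R" "m \<noteq> carrier R" using m(1) by (auto simp: stable_maximal_ideal_def stable_ideal_def)
  have "\<one> \<noteq> \<zero>"
  proof
    assume "\<one> = \<zero>"
    then have "\<one> \<in> m" using additive_subgroup.zero_closed[OF ideal.axioms(1)[OF m_ideal(1)]] by simp
    then show False using ideal.one_imp_carrier[OF m_ideal(1)] m_ideal(2) by blast
  qed
  then have "\<one> \<notin> {\<zero>}" "left_ideal {\<zero>} R" by (auto intro!: left_idealI[OF ring_axioms])
  then obtain p where p: "maximal_left_ideal p R" using maximal_left_ideal_exists by blast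
  interpret p: division_ideal R star p by (rule div[OF p])
  have pm: "p \<inter> p.p_star = m" by (rule rad[OF p])
  have left_inv: "\<exists>y\<in>carrier R. y \<otimes> z = \<one>"
    if z: "z \<in> carrier R" and avoid: "\<And>L. maximal_left_ideal L R \<Longrightarrow> z \<notin> L" for z
  proof (rule ccontr)
    assume no: "\<not> ?thesis"
    let ?I = "{y \<otimes> z | y. y \<in> carrier R}"
    have "left_ideal ?I R"
    proof (rule left_idealI[OF ring_axioms])
      show "\<zero> \<in> ?I" using z by (auto intro!: exI[of _ \<zero>])
      show "x \<oplus> y \<in> ?I" if xy: "x \<in> ?I" "y \<in> ?I" for x y
      proof -
        obtain u v where "x = u \<otimes> z" "y = v \<otimes> z" "u \<in> carrier R" "v \<in> carrier R" using xy by blast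
        then show ?thesis using z l_distr by (metis (mono_tags, lifting) a_closed mem_Collect_eq)
      qed
      show "r \<otimes> x \<in> ?I" if rx: "r \<in> carrier R" "x \<in> ?I" for r x
      proof -
        obtain u where "x = u \<otimes> z" "u \<in> carrier R" using rx by blast
        then show ?thesis using z rx(1) m_assoc by (metis (mono_tags, lifting) m_closed mem_Collect_eq)
      qed
    qed (use z in auto)
    moreover have "\<one> \<notin> ?I" using no by force
    ultimately obtain L where L: "maximal_left_ideal L R" "?I \<subseteq> L" using maximal_left_ideal_exists by blast
    have "\<one> \<otimes> z \<in> ?I" by blast
    then have "z \<in> L" using L(2) z by auto
    then show False using avoid[OF L(1)] by simp
  qed
  have "local_pivoting R star (p \<inter> p.p_star) {\<one>}"
  proof (rule p.division_local_pivoting)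
    show "p.p_star = p \<or> (\<exists>u\<in>p. \<one> \<ominus> u \<in> p.p_star)"
    proof (cases "p.p_star \<subseteq> p")
      case True
      have "x \<in> p.p_star" if "x \<in> p" for x
      proof -
        have "star x \<in> p.p_star" using that p.p_closed by (simp add: p.p_star_iff star_closed star_star)
        then show ?thesis using True that p.p_closed by (auto simp: p.p_star_iff)
      qed
      then show ?thesis using True by blast
    next
      case False
      then obtain x where x: "x \<in> p.p_star" "x \<notin> p" by blast
      obtain y where y: "y \<in> carrier R" "y \<otimes> x \<ominus> \<one> \<in> p" using p.p_division[OF p.p_star_closed[OF x(1)] x(2)] by blast
      have xc: "x \<in> carrier R" by (rule p.p_star_closed[OF x(1)])
      have "\<one> \<ominus> y \<otimes> x = \<ominus> (y \<otimes> x \<ominus> \<one>)" "\<one> \<ominus> (\<one> \<ominus> y \<otimes> x) = y \<otimes> x"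
        using xc y(1) by (simp_all add: minus_flip add_minus_cancel)
      then have "\<one> \<ominus> y \<otimes> x \<in> p" "\<one> \<ominus> (\<one> \<ominus> y \<otimes> x) \<in> p.p_star"
        using p.p_uminus[OF y(2)] p.p_star_left[OF y(1) x(1)] by simp_all
      then show ?thesis by blast
    qed
    fix z w assume zw: "z \<in> carrier R" "w \<in> carrier R" "w \<otimes> z \<ominus> \<one> \<in> p \<inter> p.p_star"
    have "z \<notin> L" if L: "maximal_left_ideal L R" for L
    proof
      interpret L: division_ideal R star L by (rule div[OF L])
      assume "z \<in> L"
      moreover have "w \<otimes> z \<ominus> \<one> \<in> L" using zw(3) pm rad[OF L] by blast
      ultimately have "w \<otimes> z \<ominus> (w \<otimes> z \<ominus> \<one>) \<in> L" using L.p_minus L.p_left zw(2) by blast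
      moreover have "w \<otimes> z \<ominus> (w \<otimes> z \<ominus> \<one>) = \<one>" using zw(1,2) by (simp add: add_minus_cancel)
      ultimately show False using L.p_proper by simp
    qed
    then obtain y where y: "y \<in> carrier R" "y \<otimes> z = \<one>" using left_inv[OF zw(1)] by blast
    have "y \<notin> L" if L: "maximal_left_ideal L R" for L
      using y division_ideal.p_right[OF div[OF L] zw(1), of y] division_ideal.p_proper[OF div[OF L]] by auto
    then obtain x where x: "x \<in> carrier R" "x \<otimes> y = \<one>" using left_inv[OF y(1)] by blast
    have "x = x \<otimes> (y \<otimes> z)" using x(1) y(2) by simp
    also have "\<dots> = (x \<otimes> y) \<otimes> z" using x(1) y(1) zw(1) by (simp only: m_assoc)
    also have "\<dots> = z" using x(2) zw(1) by simp
    finally show "\<exists>e\<in>{\<one>}. \<exists>z'\<in>carrier R. z \<otimes> z' = e \<and> z' \<otimes> z = e" using x y by auto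
  qed (simp_all add: central_projection_one)
  then show ?thesis by blast
qed

section \<open>Patching over the idempotents of an exchange ring\<close>

context involution_ring
begin

text \<open>The product of two elements of the Bruhat group that live in the factors \<open>eA\<close> and \<open>fA\<close>; each of them
  is the identity where the other one lives.\<close>

lemma bruhat_column_join:
  assumes e: "central_projection e" and f: "central_projection f" and ef: "e \<otimes> f = \<zero>"
    and cl: "a \<in> carrier R" "c \<in> carrier R"
    and e_col: "bruhat_column (localise e a) (e \<otimes> c)" and f_col: "bruhat_column (localise f a) (f \<otimes> c)"
  shows "bruhat_column (localise (e \<oplus> f) a) ((e \<oplus> f) \<otimes> c)"
proof -
  note eD = central_projectionD(1,2)[OF e] and fD = central_projectionD(1,2)[OF f]
  have fe: "f \<otimes> e = \<zero>" using central_projectionD(4)[OF e fD(1)] ef by simp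
  obtain b d where "mat2 (localise e a) b (e \<otimes> c) d \<in> bruhat_group"
    using e_col by (auto simp: bruhat_column_def)
  then have g: "mat2 (localise e (localise e a)) (e \<otimes> b) (e \<otimes> (e \<otimes> c)) (localise e d) \<in> bruhat_group"
    and bd: "b \<in> carrier R" "d \<in> carrier R"
    using localise_bruhat_group[OF e] bruhat_group_in_SL by (auto simp: SL_mat2_iff)
  have cls: "localise e a \<in> carrier R" "localise f a \<in> carrier R" "localise e d \<in> carrier R"
    using cl bd by (simp_all add: localise_closed[OF e] localise_closed[OF f])
  have swap: "x \<otimes> (f \<otimes> y) = f \<otimes> (x \<otimes> y)" if "x \<in> carrier R" "y \<in> carrier R" for x y
    using central_projectionD(4)[OF f that(1)] that fD by (simp add: m_assoc[symmetric])
  have ef0: "(e \<otimes> x) \<otimes> (f \<otimes> y) = \<zero>" if "x \<in> carrier R" "y \<in> carrier R" for x y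
  proof -
    have "(e \<otimes> x) \<otimes> (f \<otimes> y) = (e \<otimes> f) \<otimes> (x \<otimes> y)"
      using swap[OF that] that eD(1) fD(1) by (simp add: m_assoc)
    then show ?thesis using that by (simp add: ef)
  qed
  have comp_f: "(e \<otimes> x) \<otimes> (\<one> \<ominus> f) = e \<otimes> x" if "x \<in> carrier R" for x
    using ef0[OF that one_closed] that eD(1) fD(1) by (simp add: minus_eq r_distr r_minus)
  have comp_e: "(\<one> \<ominus> e) \<otimes> (f \<otimes> x) = f \<otimes> x" if "x \<in> carrier R" for x
    using ef0[OF one_closed that] that eD(1) fD(1) by (simp add: minus_eq l_distr l_minus)
  have comp: "(\<one> \<ominus> e) \<otimes> (\<one> \<ominus> f) = \<one> \<ominus> (e \<oplus> f)"
    using eD(1) fD(1) by (simp add: minus_eq l_distr r_distr l_minus r_minus ef minus_add a_ac)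
  have 1: "localise e a \<otimes> localise f a = localise (e \<oplus> f) a"
  proof -
    have "localise e a \<otimes> localise f a =
        ((e \<otimes> a) \<otimes> (f \<otimes> a) \<oplus> (e \<otimes> a) \<otimes> (\<one> \<ominus> f)) \<oplus> ((\<one> \<ominus> e) \<otimes> (f \<otimes> a) \<oplus> (\<one> \<ominus> e) \<otimes> (\<one> \<ominus> f))"
      using cl eD(1) fD(1) unfolding localise_def by (simp add: l_distr r_distr a_ac)
    also have "\<dots> = e \<otimes> a \<oplus> (f \<otimes> a \<oplus> (\<one> \<ominus> (e \<oplus> f)))"
      using cl eD(1) fD(1) by (simp add: ef0 comp_f comp_e comp)
    finally show ?thesis using cl eD(1) fD(1) by (simp add: localise_def l_distr a_assoc)
  qed
  have 2: "(e \<otimes> c) \<otimes> localise f a = e \<otimes> c" "localise e d \<otimes> (f \<otimes> c) = f \<otimes> c"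
    using cl bd eD(1) fD(1) unfolding localise_def
    by (simp_all add: l_distr r_distr ef0 comp_f comp_e)
  have ee: "localise e (localise e a) = localise e a" "e \<otimes> (e \<otimes> c) = e \<otimes> c"
    using cl localise_localise[OF e e cl(1)] eD by (simp_all add: m_assoc[symmetric])
  show ?thesis
    using bruhat_column_mult[OF g f_col] cl eD(1) fD(1)
    by (simp add: ee 1 2 ef0 bd l_distr) (simp add: localise_def)
qed

text \<open>The first column determines an element of \<open>SL\<^sub>*(2,A)\<close> up to right multiplication by \<open>u\<^sub>b\<close>.\<close>

lemma bruhat_generation:
  assumes "\<And>a c. isotropic a c \<Longrightarrow> bruhat_column a c"
  shows "bruhat_group = carrier SL"
proof
  show "carrier SL \<subseteq> bruhat_group"
  proof
    fix g assume g: "g \<in> carrier SL"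
    then obtain a b c d where g_eq: "g = mat2 a b c d" by (rule SL_cases)
    have cl: "a \<in> carrier R" "b \<in> carrier R" "c \<in> carrier R" "d \<in> carrier R"
      and eq: "star a \<otimes> d \<ominus> star c \<otimes> b = \<one>" and sym: "star a \<otimes> c \<in> sym_elements R star"
      using g by (auto simp: g_eq SL_mat2_iff)
    have "star (star a \<otimes> d \<ominus> star c \<otimes> b) = star d \<otimes> a \<ominus> star b \<otimes> c"
      using cl by (simp add: star_minus star_mult star_closed star_star)
    then have "star d \<otimes> a \<oplus> (\<ominus> star b) \<otimes> c = \<one>"
      using cl eq by (simp add: star_closed l_minus minus_eq)
    then have "isotropic a c"
      using cl sym by (intro isotropicI[of a c "star d" "\<ominus> star b"]) (auto simp: star_closed sym_elements_def)
    then show "g \<in> bruhat_group"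
      using in_bruhat_group_if_column g assms unfolding g_eq by blast
  qed
qed (rule bruhat_group_in_SL)

end

text \<open>The last assumption says that the commutative ring \<open>S\<close> is an exchange ring. This is the property
  that idempotents can be used for localising: see \<open>local_unit\<close> below.\<close>

locale central_exchange = involution_ring R star for R (structure) and star +
  fixes S
  assumes S_closed: "s \<in> S \<Longrightarrow> s \<in> carrier R"
    and S_zero: "\<zero> \<in> S" and S_one: "\<one> \<in> S"
    and S_add: "\<lbrakk>s \<in> S; t \<in> S\<rbrakk> \<Longrightarrow> s \<oplus> t \<in> S"
    and S_uminus: "s \<in> S \<Longrightarrow> \<ominus> s \<in> S"
    and S_mult: "\<lbrakk>s \<in> S; t \<in> S\<rbrakk> \<Longrightarrow> s \<otimes> t \<in> S"
    and S_central: "\<lbrakk>s \<in> S; x \<in> carrier R\<rbrakk> \<Longrightarrow> x \<otimes> s = s \<otimes> x"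
    and S_star: "s \<in> S \<Longrightarrow> star s = s"
    and exchange: "s \<in> S \<Longrightarrow> \<exists>e\<in>S. e \<otimes> e = e \<and> (\<exists>a\<in>S. e = a \<otimes> s) \<and> (\<exists>b\<in>S. \<one> \<ominus> e = b \<otimes> (\<one> \<ominus> s))"
begin

lemma S_minus: "\<lbrakk>s \<in> S; t \<in> S\<rbrakk> \<Longrightarrow> s \<ominus> t \<in> S"
  by (simp add: minus_eq S_add S_uminus)

lemma S_left_commute: "\<lbrakk>s \<in> S; x \<in> carrier R; y \<in> carrier R\<rbrakk> \<Longrightarrow> x \<otimes> (s \<otimes> y) = s \<otimes> (x \<otimes> y)"
  using S_central[of s x] S_closed[of s] by (simp add: m_assoc[symmetric])

lemma S_projection: "\<lbrakk>e \<in> S; e \<otimes> e = e\<rbrakk> \<Longrightarrow> central_projection e"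
  using S_closed S_star S_central unfolding central_projection_def by blast

definition maximal_in_S :: "'a set \<Rightarrow> bool" where
  "maximal_in_S M \<longleftrightarrow> M \<subseteq> S \<and> \<zero> \<in> M \<and> (\<forall>x\<in>M. \<forall>y\<in>M. x \<oplus> y \<in> M) \<and> (\<forall>s\<in>S. \<forall>x\<in>M. s \<otimes> x \<in> M) \<and>
     \<one> \<notin> M \<and> (\<forall>s\<in>S - M. \<exists>m\<in>M. \<exists>a\<in>S. \<one> = m \<oplus> a \<otimes> s)"

text \<open>As \<open>S\<close> is commutative, its ideals are its left ideals, and the existence of maximal left ideals applies
  to the ring \<open>S\<close>.\<close>

lemma maximal_in_S_exists:
  assumes "I \<subseteq> S" "\<zero> \<in> I" "\<And>x y. \<lbrakk>x \<in> I; y \<in> I\<rbrakk> \<Longrightarrow> x \<oplus> y \<in> I" "\<And>s x. \<lbrakk>s \<in> S; x \<in> I\<rbrakk> \<Longrightarrow> s \<otimes> x \<in> I" "\<one> \<notin> I"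
  shows "\<exists>M. maximal_in_S M \<and> I \<subseteq> M"
proof -
  have "subring S R"
    using S_closed S_one S_uminus S_mult S_add by (intro subringI) auto
  then interpret S: ring "R\<lparr>carrier := S\<rparr>" by (rule subring_is_ring)
  have "left_ideal I (R\<lparr>carrier := S\<rparr>)"
    by (rule left_idealI[OF S.ring_axioms]) (use assms in auto)
  moreover have "\<one>\<^bsub>R\<lparr>carrier := S\<rparr>\<^esub> \<notin> I" using assms(5) by simp
  ultimately obtain M where M: "maximal_left_ideal M (R\<lparr>carrier := S\<rparr>)" "I \<subseteq> M"
    using S.maximal_left_ideal_exists by blast
  have l: "left_ideal M (R\<lparr>carrier := S\<rparr>)" "M \<noteq> S" using M(1) by (auto simp: maximal_left_ideal_def)
  note ld = left_idealD[OF l(1)]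
  have "\<one> \<notin> M" using S.left_ideal_one[OF l(1)] l(2) by simp
  moreover have "\<exists>m\<in>M. \<exists>a\<in>S. \<one> = m \<oplus> a \<otimes> s" if "s \<in> S - M" for s
    using S.maximal_left_ideal_comaximal[OF M(1), of s] that by simp
  moreover have "M \<subseteq> S" using ld(1) by auto
  ultimately have "maximal_in_S M"
    using ld(2-4) by (simp add: maximal_in_S_def)
  with M(2) show ?thesis by blast
qed

text \<open>The idempotents that are \<open>1\<close> at \<open>M\<close>.\<close>

definition idempotents_off :: "'a set \<Rightarrow> 'a set" where
  "idempotents_off M = {e \<in> S. e \<otimes> e = e \<and> e \<notin> M}"

context
  fixes M assumes M: "maximal_in_S M"
begin

lemma M_S: "m \<in> M \<Longrightarrow> m \<in> S" and M_zero: "\<zero> \<in> M"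
  and M_add: "\<lbrakk>x \<in> M; y \<in> M\<rbrakk> \<Longrightarrow> x \<oplus> y \<in> M" and M_mult: "\<lbrakk>s \<in> S; x \<in> M\<rbrakk> \<Longrightarrow> s \<otimes> x \<in> M"
  and M_proper: "\<one> \<notin> M" and M_comaximal: "\<lbrakk>s \<in> S; s \<notin> M\<rbrakk> \<Longrightarrow> \<exists>m\<in>M. \<exists>a\<in>S. \<one> = m \<oplus> a \<otimes> s"
  using M by (auto simp: maximal_in_S_def)

lemma M_closed: "m \<in> M \<Longrightarrow> m \<in> carrier R"
  by (rule S_closed[OF M_S])

lemma M_uminus: "m \<in> M \<Longrightarrow> \<ominus> m \<in> M"
  using M_mult[OF S_uminus[OF S_one], of m] M_closed[of m] by (simp add: l_minus)

lemma M_minus: "\<lbrakk>x \<in> M; y \<in> M\<rbrakk> \<Longrightarrow> x \<ominus> y \<in> M"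
  by (simp add: minus_eq M_add M_uminus)

lemma M_mult_right: "\<lbrakk>s \<in> S; x \<in> M\<rbrakk> \<Longrightarrow> x \<otimes> s \<in> M"
  using M_mult[of s x] S_central[of s x] M_closed[of x] by simp

lemma M_prime:
  assumes "s \<in> S" "t \<in> S" "s \<otimes> t \<in> M"
  shows "s \<in> M \<or> t \<in> M"
proof (rule disjCI)
  assume "t \<notin> M"
  then obtain m a where ma: "m \<in> M" "a \<in> S" "\<one> = m \<oplus> a \<otimes> t" using M_comaximal assms(2) by blast
  note cl = S_closed[OF assms(1)] S_closed[OF assms(2)] M_closed[OF ma(1)] S_closed[OF ma(2)]
  have "s = s \<otimes> (m \<oplus> a \<otimes> t)" using cl by (simp add: ma(3)[symmetric])
  also have "\<dots> = s \<otimes> m \<oplus> a \<otimes> (s \<otimes> t)"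
    using cl by (simp add: r_distr S_left_commute[OF ma(2)])
  finally show "s \<in> M" using M_add[OF M_mult[OF assms(1) ma(1)] M_mult[OF ma(2) assms(3)]] by simp
qed

lemma one_minus_M: "m \<in> M \<Longrightarrow> \<one> \<ominus> m \<notin> M"
  using M_add[of "\<one> \<ominus> m" m] M_proper M_closed[of m] by (auto simp: add_minus_cancel)

text \<open>An exchange idempotent \<open>e\<close> for \<open>as = 1 - m\<close> with \<open>m \<in> M\<close> is a multiple of \<open>s\<close>, and \<open>1 - e\<close> is a multiple
  of \<open>m\<close>, so that \<open>e\<close> lies outside \<open>M\<close>.\<close>

lemma local_unit:
  assumes s: "s \<in> S" "s \<notin> M"
  shows "\<exists>e\<in>idempotents_off M. \<exists>c\<in>S. c \<otimes> s = e"
proof -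
  obtain m a where ma: "m \<in> M" "a \<in> S" "\<one> = m \<oplus> a \<otimes> s" using M_comaximal[OF s] by blast
  note cl = S_closed[OF s(1)] M_closed[OF ma(1)] S_closed[OF ma(2)]
  obtain e b d where e: "e \<in> S" "e \<otimes> e = e" "b \<in> S" "e = b \<otimes> (a \<otimes> s)" "d \<in> S" "\<one> \<ominus> e = d \<otimes> (\<one> \<ominus> a \<otimes> s)"
    using exchange[OF S_mult[OF ma(2) s(1)]] by blast
  have "\<one> \<ominus> a \<otimes> s = m" using cl add_minus_cancel(2)[of m "a \<otimes> s"] by (simp add: ma(3)[symmetric])
  then have "\<one> \<ominus> e \<in> M" using M_mult[OF e(5) ma(1)] by (simp add: e(6))
  then have "e \<notin> M" using one_minus_M[of "\<one> \<ominus> e"] S_closed[OF e(1)] by (auto simp: add_minus_cancel)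
  then show ?thesis
    using e ma(2) cl S_closed[OF e(3)] by (intro bexI[of _ e] bexI[of _ "b \<otimes> a"]) (auto simp: idempotents_off_def S_mult m_assoc)
qed

lemma idempotents_off:
  "e \<in> idempotents_off M \<Longrightarrow> central_projection e" "\<one> \<in> idempotents_off M"
  "\<lbrakk>e \<in> idempotents_off M; f \<in> idempotents_off M\<rbrakk> \<Longrightarrow> e \<otimes> f \<in> idempotents_off M"
proof -
  show "e \<in> idempotents_off M \<Longrightarrow> central_projection e" by (auto simp: idempotents_off_def S_projection)
  show "\<one> \<in> idempotents_off M" using S_one M_proper by (simp add: idempotents_off_def)
  assume ef: "e \<in> idempotents_off M" "f \<in> idempotents_off M"
  then have "central_projection e" "central_projection f" by (auto simp: idempotents_off_def S_projection)
  then have "central_projection (e \<otimes> f)" by (rule central_projection_mult)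
  then show "e \<otimes> f \<in> idempotents_off M"
    using ef M_prime by (auto simp: idempotents_off_def S_mult central_projection_def)
qed

end

text \<open>If the pivots can be found at every maximal ideal of \<open>S\<close>, they can be found globally: the
  idempotents \<open>e\<close> over which a given column is reduced are closed under joins, and they lie in no
  common maximal ideal, so \<open>1\<close> is one of them.\<close>

lemma bruhat_column_patch:
  assumes piv: "\<And>M. maximal_in_S M \<Longrightarrow> \<exists>J. local_pivoting R star J (idempotents_off M)"
    and iso: "involution_ring.isotropic (matrix_ring n R) (matrix_star star) a c"
  shows "involution_ring.bruhat_column (matrix_ring n R) (matrix_star star) a c"
proof -
  interpret A: involution_ring "matrix_ring n R" "matrix_star star" by (rule matrix_involution_ring)
  let ?A = "matrix_ring n R" and ?s = "scalar_matrix n R"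
  have ac: "a \<in> carrier ?A" "c \<in> carrier ?A" using iso by (auto simp: A.isotropic_def)
  define good where "good e \<longleftrightarrow> A.bruhat_column (A.localise (?s e) a) (?s e \<otimes>\<^bsub>?A\<^esub> c)" for e
  define P where "P = {e \<in> S. e \<otimes> e = e}"
  have P: "central_projection e" "e \<in> carrier R" if "e \<in> P" for e
    using that by (auto simp: P_def S_projection S_closed)
  have sP: "A.central_projection (?s e)" if "e \<in> P" for e
    using P[OF that] by (simp add: scalar_matrix_projection)
  have restrict: "good (e \<otimes> f)" if "e \<in> P" "f \<in> P" "good f" for e f
  proof -
    obtain b d where "mat2 (A.localise (?s f) a) b (?s f \<otimes>\<^bsub>?A\<^esub> c) d \<in> A.bruhat_group"
      using \<open>good f\<close> by (auto simp: good_def A.bruhat_column_def)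
    from A.localise_bruhat_group[OF sP[OF that(1)] this]
    have "A.bruhat_column (A.localise (?s e) (A.localise (?s f) a)) (?s e \<otimes>\<^bsub>?A\<^esub> (?s f \<otimes>\<^bsub>?A\<^esub> c))"
      unfolding A.bruhat_column_def by blast
    moreover have "?s e \<in> carrier ?A" "?s f \<in> carrier ?A" using P that by (simp_all add: elementary_closed)
    ultimately show ?thesis
      using ac P(2) that by (simp add: good_def A.localise_localise[OF sP sP] A.m_assoc[symmetric] scalar_matrix_mult)
  qed
  have join: "\<exists>g\<in>P. good g \<and> e \<otimes> g = e \<and> f \<otimes> g = f" if ef: "e \<in> P" "f \<in> P" "good e" "good f" for e f
  proof -
    have cl: "e \<in> carrier R" "f \<in> carrier R" "e \<otimes> e = e" "f \<otimes> f = f" using ef P by (auto simp: P_def)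
    have ec: "\<one> \<ominus> e \<in> P"
      using ef(1) S_minus[OF S_one] central_projectionD(2)[OF central_projection_complement[OF P(1)[OF ef(1)]]]
      by (simp add: P_def)
    \<comment> \<open>The join \<open>e + (1 - e)f\<close> is an orthogonal sum.\<close>
    define h where "h = (\<one> \<ominus> e) \<otimes> f"
    have h: "h \<in> P" "good h"
      using restrict[OF ec ef(2,4)] ec ef(2)
        central_projectionD(2)[OF central_projection_mult[OF P(1)[OF ec] P(1)[OF ef(2)]]]
      by (simp_all add: h_def P_def S_mult)
    have hc: "h \<in> carrier R" using P(2)[OF h(1)] .
    have h_eq: "h = f \<ominus> e \<otimes> f" using cl by (simp add: h_def minus_eq l_distr l_minus)
    have fe: "f \<otimes> e = e \<otimes> f" using central_projectionD(4)[OF P(1)[OF ef(1)] cl(2)] .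
    have eh: "e \<otimes> h = \<zero>" 
      using cl by (simp add: h_eq minus_eq r_distr r_minus m_assoc[symmetric] r_neg)
    then have he: "h \<otimes> e = \<zero>" using central_projectionD(4)[OF P(1)[OF ef(1)] hc] by simp
    define g where "g = e \<oplus> h"
    have "g \<otimes> g = g" using cl hc h(1) by (simp add: g_def l_distr r_distr eh he P_def)
    then have gP: "g \<in> P" using ef(1) h(1) by (auto simp: g_def P_def S_add)
    have sg: "?s g = ?s e \<oplus>\<^bsub>?A\<^esub> ?s h"
      using cl hc by (intro matrix_ring_eqI[where n = n and R = R])
        (auto simp: elementary_closed elementary_entry matrix_ring_entry(2) g_def)
    have "?s e \<otimes>\<^bsub>?A\<^esub> ?s h = \<zero>\<^bsub>?A\<^esub>"
      unfolding scalar_matrix_mult[OF cl(1) hc] eh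
      by (intro matrix_ring_eqI[where n = n and R = R])
        (auto simp: elementary_closed elementary_entry matrix_ring_entry(3))
    then have "good g"
      using A.bruhat_column_join[OF sP[OF ef(1)] sP[OF h(1)] _ ac] ef(3) h(2) by (simp add: good_def sg)
    moreover have "e \<otimes> g = e" using cl hc by (simp add: g_def r_distr eh)
    moreover have "f \<otimes> g = f"
    proof -
      have "f \<otimes> h = f \<ominus> e \<otimes> f"
        using cl fe by (simp add: h_eq minus_eq r_distr r_minus m_assoc[symmetric]) (simp add: m_assoc)
      then have "f \<otimes> g = e \<otimes> f \<oplus> (f \<ominus> e \<otimes> f)" using cl hc fe by (simp add: g_def r_distr)
      also have "\<dots> = f" using cl by (simp add: add_minus_cancel)
      finally show ?thesis .
    qed
    ultimately show ?thesis using gP by blast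
  qed
  have good_zero: "good \<zero>"
  proof -
    have z: "?s \<zero> = \<zero>\<^bsub>?A\<^esub>"
      by (rule matrix_ring_eqI[where n = n and R = R]) (auto simp: elementary_closed elementary_entry matrix_ring_entry(3))
    have "A.localise \<zero>\<^bsub>?A\<^esub> a = \<one>\<^bsub>?A\<^esub>" using ac by (simp add: A.localise_def A.minus_eq)
    then show ?thesis using ac A.bruhat_column_one by (simp add: good_def z)
  qed
  define I where "I = {s \<in> S. \<exists>e\<in>P. good e \<and> s \<otimes> e = s}"
  have "\<one> \<in> I"
  proof (rule ccontr)
    assume "\<one> \<notin> I"
    have "\<exists>M. maximal_in_S M \<and> I \<subseteq> M"
    proof (rule maximal_in_S_exists)
      show "I \<subseteq> S" by (auto simp: I_def)
      show "\<zero> \<in> I" using S_zero good_zero by (auto simp: I_def P_def intro!: bexI[of _ \<zero>])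
      show "\<one> \<notin> I" by fact
      show "s \<otimes> x \<in> I" if "s \<in> S" "x \<in> I" for s x
      proof -
        obtain e where e: "e \<in> P" "good e" "x \<otimes> e = x" "x \<in> S" using \<open>x \<in> I\<close> by (auto simp: I_def)
        have "s \<otimes> x \<otimes> e = s \<otimes> x" using e S_closed \<open>s \<in> S\<close> P(2) by (simp add: m_assoc)
        then show ?thesis using e \<open>s \<in> S\<close> S_mult by (auto simp: I_def)
      qed
      show "x \<oplus> y \<in> I" if "x \<in> I" "y \<in> I" for x y
      proof -
        obtain e where e: "e \<in> P" "good e" "x \<otimes> e = x" "x \<in> S" using \<open>x \<in> I\<close> by (auto simp: I_def)
        obtain f where f: "f \<in> P" "good f" "y \<otimes> f = y" "y \<in> S" using \<open>y \<in> I\<close> by (auto simp: I_def)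
        obtain g where g: "g \<in> P" "good g" "e \<otimes> g = e" "f \<otimes> g = f" using join[OF e(1) f(1) e(2) f(2)] by blast
        note cl = S_closed[OF e(4)] S_closed[OF f(4)] P(2)[OF e(1)] P(2)[OF f(1)] P(2)[OF g(1)]
        have "x \<otimes> g = x \<otimes> (e \<otimes> g)" using e(3) cl by (simp add: m_assoc[symmetric])
        moreover have "y \<otimes> g = y \<otimes> (f \<otimes> g)" using f(3) cl by (simp add: m_assoc[symmetric])
        ultimately have "(x \<oplus> y) \<otimes> g = x \<oplus> y" using cl by (simp add: l_distr g e(3) f(3))
        then show ?thesis using e(4) f(4) g S_add by (auto simp: I_def)
      qed
    qed
    then obtain M where M: "maximal_in_S M" "I \<subseteq> M" by blast
    obtain J where "local_pivoting R star J (idempotents_off M)" using piv[OF M(1)] by blast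
    then obtain e where e: "e \<in> idempotents_off M" "good e"
      using local_pivoting.bruhat_column_local[OF _ iso] by (auto simp: good_def)
    then have "e \<in> I" by (auto simp: I_def P_def idempotents_off_def)
    then show False using e(1) M(2) by (auto simp: idempotents_off_def)
  qed
  then obtain e where "e \<in> P" "good e" "\<one> \<otimes> e = \<one>" by (auto simp: I_def)
  then have "good \<one>" using P(2) by simp
  then show ?thesis
    using ac by (simp add: good_def scalar_matrix_one A.localise_def A.minus_eq A.r_neg)
qed

end

section \<open>Pivots over commutative exchange rings and their quadratic algebras\<close>

text \<open>If \<open>S\<close> is the whole ring, \<open>S/M\<close> is a field with trivial involution.\<close>

lemma (in central_exchange) pivoting_trivial_involution:
  assumes M: "maximal_in_S M" and S: "S = carrier R"
  shows "\<exists>J. local_pivoting R star J (idempotents_off M)"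
proof -
  note Mc = M_closed[OF M]
  interpret D: division_ideal R star M
  proof
    show "x \<in> M \<Longrightarrow> x \<in> carrier R" for x by (rule Mc)
    show "\<zero> \<in> M" by (rule M_zero[OF M])
    show "\<lbrakk>x \<in> M; y \<in> M\<rbrakk> \<Longrightarrow> x \<oplus> y \<in> M" for x y by (rule M_add[OF M])
    show "\<lbrakk>r \<in> carrier R; x \<in> M\<rbrakk> \<Longrightarrow> r \<otimes> x \<in> M" for r x using M_mult[OF M] by (simp add: S)
    show "\<lbrakk>r \<in> carrier R; x \<in> M\<rbrakk> \<Longrightarrow> x \<otimes> r \<in> M" for r x using M_mult_right[OF M] by (simp add: S)
    show "\<one> \<notin> M" by (rule M_proper[OF M])
    show "\<exists>y\<in>carrier R. y \<otimes> x \<ominus> \<one> \<in> M" if x: "x \<in> carrier R" "x \<notin> M" for x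
    proof -
      obtain m a where ma: "m \<in> M" "a \<in> carrier R" "\<one> = m \<oplus> a \<otimes> x" using M_comaximal[OF M, of x] x by (auto simp: S)
      have "\<one> \<ominus> a \<otimes> x = m" using ma Mc x add_minus_cancel(2)[of m "a \<otimes> x"] by simp
      moreover have "a \<otimes> x \<ominus> \<one> = \<ominus> (\<one> \<ominus> a \<otimes> x)" using ma(2) x(1) by (simp add: minus_flip)
      ultimately have "a \<otimes> x \<ominus> \<one> = \<ominus> m" by simp
      then show ?thesis using M_uminus[OF M ma(1)] by (intro bexI[OF _ ma(2)]) simp
    qed
  qed
  have "D.p_star = M" using Mc S_star by (auto simp: D.p_star_def S)
  moreover have "\<exists>e\<in>idempotents_off M. \<exists>z'\<in>carrier R. z \<otimes> z' = e \<and> z' \<otimes> z = e"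
    if z: "z \<in> carrier R" "w \<in> carrier R" "w \<otimes> z \<ominus> \<one> \<in> M" for z w
  proof -
    have "z \<notin> M"
    proof
      assume "z \<in> M"
      then have "w \<otimes> z \<ominus> (w \<otimes> z \<ominus> \<one>) \<in> M" using D.p_minus D.p_left z by blast
      then show False using z M_proper[OF M] by (simp add: add_minus_cancel)
    qed
    then obtain e c where "e \<in> idempotents_off M" "c \<in> S" "c \<otimes> z = e"
      using local_unit[OF M, of z] z by (auto simp: S)
    then show ?thesis using S_central[of c z] z by (auto simp: S)
  qed
  ultimately show ?thesis
    using D.division_local_pivoting[of "idempotents_off M"] idempotents_off[OF M] by auto
qed

text \<open>Separable quadratic extensions and quaternion algebras in characteristic 2, over an exchange ring: every
  element \<open>x\<close> satisfies \<open>x\<^sup>2 - tr(x)x + N(x) = 0\<close>.\<close>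

locale quadratic_exchange = central_exchange +
  assumes trace_S: "x \<in> carrier R \<Longrightarrow> x \<oplus> star x \<in> S"
    and norm_S: "x \<in> carrier R \<Longrightarrow> x \<otimes> star x \<in> S"
    and trace_one: "\<exists>\<theta>\<in>carrier R. \<theta> \<oplus> star \<theta> = \<one>"
    and commutative_or_char_2: "(\<forall>x\<in>carrier R. \<forall>y\<in>carrier R. x \<otimes> y = y \<otimes> x) \<or> \<one> \<oplus> \<one> = \<zero>"
begin

definition trace where "trace x = x \<oplus> star x"

definition norm where "norm x = x \<otimes> star x"

lemma trace_in_S: "x \<in> carrier R \<Longrightarrow> trace x \<in> S"
  by (simp add: trace_def trace_S)

lemma norm_in_S: "x \<in> carrier R \<Longrightarrow> norm x \<in> S"
  by (simp add: norm_def norm_S)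

lemma trace_closed: "x \<in> carrier R \<Longrightarrow> trace x \<in> carrier R" and norm_closed: "x \<in> carrier R \<Longrightarrow> norm x \<in> carrier R"
  using S_closed trace_in_S norm_in_S by blast+

lemma star_eq_trace: "x \<in> carrier R \<Longrightarrow> star x = trace x \<ominus> x"
  using add_minus_cancel(1)[of x "star x"] by (simp add: trace_def star_closed)

lemma trace_add: "\<lbrakk>x \<in> carrier R; y \<in> carrier R\<rbrakk> \<Longrightarrow> trace (x \<oplus> y) = trace x \<oplus> trace y"
  by (simp add: trace_def star_add star_closed a_ac)

lemma trace_scalar: "\<lbrakk>s \<in> S; x \<in> carrier R\<rbrakk> \<Longrightarrow> trace (s \<otimes> x) = s \<otimes> trace x"
  using S_central[of s "star x"] S_closed[of s] by (simp add: trace_def star_mult star_closed S_star r_distr)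

lemma trace_uminus: "x \<in> carrier R \<Longrightarrow> trace (\<ominus> x) = \<ominus> trace x"
  by (simp add: trace_def star_uminus minus_add star_closed)

lemma trace_minus: "\<lbrakk>x \<in> carrier R; y \<in> carrier R\<rbrakk> \<Longrightarrow> trace (x \<ominus> y) = trace x \<ominus> trace y"
  by (simp add: minus_eq trace_add trace_uminus)

lemma trace_star: "x \<in> carrier R \<Longrightarrow> trace (star x) = trace x"
  by (simp add: trace_def star_closed star_star a_comm)

lemma trace_commute:
  assumes x: "x \<in> carrier R" and y: "y \<in> carrier R"
  shows "trace (x \<otimes> y) = trace (y \<otimes> x)"
proof -
  define a b where "a = trace x" and "b = trace y"
  have ab: "a \<in> S" "b \<in> S" "a \<in> carrier R" "b \<in> carrier R" "star x = a \<ominus> x" "star y = b \<ominus> y"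
    using x y by (simp_all add: a_def b_def trace_in_S trace_closed star_eq_trace)
  have c: "u \<otimes> a = a \<otimes> u" "u \<otimes> b = b \<otimes> u" if "u \<in> carrier R" for u
    using S_central ab that by blast+
  have "trace (x \<otimes> y) = x \<otimes> y \<oplus> (y \<otimes> x \<oplus> (a \<otimes> b \<oplus> (\<ominus> (a \<otimes> y) \<oplus> \<ominus> (b \<otimes> x))))"
    unfolding trace_def star_mult[OF x y] ab(5,6)
    using x y ab(3,4) by (simp add: minus_eq l_distr r_distr l_minus r_minus minus_add c(1)[OF y] c(1)[OF ab(4)] a_ac)
  also have "\<dots> = trace (y \<otimes> x)"
    unfolding trace_def star_mult[OF y x] ab(5,6)
    using x y ab(3,4) by (simp add: minus_eq l_distr r_distr l_minus r_minus minus_add c(2)[OF x] a_ac)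
  finally show ?thesis .
qed

lemma norm_eq: assumes x: "x \<in> carrier R" shows "star x \<otimes> x = norm x"
proof -
  have "trace x \<otimes> x = x \<otimes> trace x" using S_central[OF trace_in_S[OF x] x] by simp
  then show ?thesis
    using x trace_closed[OF x] unfolding norm_def star_eq_trace[OF x]
    by (simp add: minus_eq l_distr r_distr l_minus r_minus)
qed

lemma norm_star: "x \<in> carrier R \<Longrightarrow> norm (star x) = norm x"
  using norm_eq by (simp add: norm_def star_star)

lemma norm_mult:
  assumes x: "x \<in> carrier R" and y: "y \<in> carrier R"
  shows "norm (x \<otimes> y) = norm x \<otimes> norm y"
proof -
  have "norm (x \<otimes> y) = x \<otimes> (norm y \<otimes> star x)"
    using x y by (simp add: norm_def star_mult star_closed m_assoc)
  also have "\<dots> = norm y \<otimes> norm x"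
    using S_left_commute[OF norm_in_S[OF y] x star_closed[OF x]] by (simp add: norm_def)
  also have "\<dots> = norm x \<otimes> norm y" using S_central[OF norm_in_S[OF y] norm_closed[OF x]] by simp
  finally show ?thesis .
qed

text \<open>The norm is a quadratic form whose polar form is given by the trace.\<close>

lemma norm_add:
  assumes x: "x \<in> carrier R" and y: "y \<in> carrier R"
  shows "norm (x \<oplus> y) = norm x \<oplus> norm y \<oplus> trace (x \<otimes> star y)"
  using x y by (simp add: norm_def trace_def star_add star_mult star_closed star_star l_distr r_distr a_ac)

context
  fixes M assumes M: "maximal_in_S M"
begin

text \<open>The radical of the trace form modulo \<open>M\<close>. It stands in for \<open>MR\<close>: since \<open>1\<close> is a trace, it does
  not meet \<open>S\<close> outside \<open>M\<close>, whether or not the trace form is regular.\<close>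

definition trace_radical :: "'a set" where
  "trace_radical = {z \<in> carrier R. \<forall>t\<in>carrier R. trace (t \<otimes> z) \<in> M}"

lemmas Mc = M_closed[OF M]

lemma radical_closed: "z \<in> trace_radical \<Longrightarrow> z \<in> carrier R"
  by (simp add: trace_radical_def)

lemma radical_trace: "\<lbrakk>z \<in> trace_radical; t \<in> carrier R\<rbrakk> \<Longrightarrow> trace (t \<otimes> z) \<in> M"
  by (simp add: trace_radical_def)

lemma radicalI: "\<lbrakk>z \<in> carrier R; \<And>t. t \<in> carrier R \<Longrightarrow> trace (t \<otimes> z) \<in> M\<rbrakk> \<Longrightarrow> z \<in> trace_radical"
  by (simp add: trace_radical_def)

lemma radical_zero: "\<zero> \<in> trace_radical"
  using M_zero[OF M] by (auto intro!: radicalI simp: trace_def)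

lemma radical_add: "\<lbrakk>x \<in> trace_radical; y \<in> trace_radical\<rbrakk> \<Longrightarrow> x \<oplus> y \<in> trace_radical"
  using M_add[OF M] by (auto simp: trace_radical_def r_distr trace_add)

lemma radical_left: "\<lbrakk>r \<in> carrier R; x \<in> trace_radical\<rbrakk> \<Longrightarrow> r \<otimes> x \<in> trace_radical"
  using radical_trace radical_closed by (intro radicalI) (simp_all add: m_assoc[symmetric])

lemma radical_right:
  assumes "r \<in> carrier R" "x \<in> trace_radical"
  shows "x \<otimes> r \<in> trace_radical"
proof (rule radicalI)
  note x = radical_closed[OF assms(2)]
  fix t assume t: "t \<in> carrier R"
  have "trace (t \<otimes> (x \<otimes> r)) = trace (r \<otimes> t \<otimes> x)"
    using trace_commute[of "t \<otimes> x" r] assms(1) x t by (simp add: m_assoc)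
  then show "trace (t \<otimes> (x \<otimes> r)) \<in> M" using radical_trace[OF assms(2)] assms(1) t by simp
qed (use assms radical_closed in simp)

lemma radical_uminus: "x \<in> trace_radical \<Longrightarrow> \<ominus> x \<in> trace_radical"
  using radical_left[of "\<ominus> \<one>" x] radical_closed[of x] by (simp add: l_minus)

lemma radical_star:
  assumes "x \<in> trace_radical" shows "star x \<in> trace_radical"
proof (rule radicalI)
  note x = radical_closed[OF assms]
  fix t assume t: "t \<in> carrier R"
  have "trace (t \<otimes> star x) = trace (star (x \<otimes> star t))"
    using x t by (simp add: star_mult star_closed star_star)
  also have "\<dots> = trace (star t \<otimes> x)"
    using x t trace_star[of "x \<otimes> star t"] trace_commute[of x "star t"] by (simp add: star_closed)
  finally show "trace (t \<otimes> star x) \<in> M" using radical_trace[OF assms] t by (simp add: star_closed)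
qed (use assms radical_closed star_closed in simp)

lemma radical_M:
  assumes "m \<in> M" shows "m \<in> trace_radical"
proof (rule radicalI)
  fix t assume t: "t \<in> carrier R"
  have "trace (t \<otimes> m) = m \<otimes> trace t"
    using trace_scalar[OF M_S[OF M assms] t] S_central[OF M_S[OF M assms] t] by simp
  then show "trace (t \<otimes> m) \<in> M" using M_mult_right[OF M trace_in_S[OF t] assms] by simp
qed (rule Mc[OF assms])

lemma radical_S:
  assumes "s \<in> S" "s \<in> trace_radical" shows "s \<in> M"
proof -
  obtain \<theta> where \<theta>: "\<theta> \<in> carrier R" "trace \<theta> = \<one>" using trace_one by (auto simp: trace_def)
  have "trace (\<theta> \<otimes> s) = s"
    using trace_scalar[OF assms(1) \<theta>(1)] S_central[OF assms(1) \<theta>(1)] S_closed[OF assms(1)] by (simp add: \<theta>(2))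
  then show ?thesis using radical_trace[OF assms(2) \<theta>(1)] by simp
qed

lemma radical_norm: "x \<in> trace_radical \<Longrightarrow> norm x \<in> M"
  using radical_right[of "star x" x] radical_closed[of x]
  by (intro radical_S norm_in_S) (simp_all add: norm_def star_closed)

lemma radical_norm_one_add:
  assumes "x \<in> trace_radical" shows "norm (\<one> \<oplus> x) \<notin> M"
proof
  note x = radical_closed[OF assms]
  assume *: "norm (\<one> \<oplus> x) \<in> M"
  have "norm (\<one> \<oplus> x) = \<one> \<oplus> (norm x \<oplus> trace x)"
    using x trace_star[OF x] by (simp add: norm_add star_closed norm_closed trace_closed a_assoc) (simp add: norm_def)
  moreover have m: "norm x \<oplus> trace x \<in> M"
    using radical_norm[OF assms] radical_trace[OF assms one_closed] x M_add[OF M] by simp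
  ultimately have "\<one> \<oplus> (norm x \<oplus> trace x) \<ominus> (norm x \<oplus> trace x) \<in> M"
    using M_minus[OF M *] by simp
  then show False using M_proper[OF M] Mc[OF m] by (simp only: add_minus_cancel one_closed)
qed

lemma norm_of_inverse:
  assumes z: "z \<in> carrier R" "w \<in> carrier R" "w \<otimes> z \<ominus> \<one> \<in> trace_radical"
  shows "norm z \<notin> M"
proof
  assume "norm z \<in> M"
  then have "norm (w \<otimes> z) \<in> M" using z M_mult[OF M norm_in_S[OF z(2)]] by (simp add: norm_mult)
  moreover have "\<one> \<oplus> (w \<otimes> z \<ominus> \<one>) = w \<otimes> z" using z by (simp add: add_minus_cancel)
  ultimately show False using radical_norm_one_add[OF z(3)] by simp
qed

lemma inverse_of_norm:
  assumes z: "z \<in> carrier R" "norm z \<notin> M"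
  shows "\<exists>w\<in>carrier R. w \<otimes> z \<ominus> \<one> \<in> trace_radical"
proof -
  obtain m a where ma: "m \<in> M" "a \<in> S" "\<one> = m \<oplus> a \<otimes> norm z"
    using M_comaximal[OF M norm_in_S[OF z(1)] z(2)] by blast
  note ac = S_closed[OF ma(2)]
  have "\<one> \<ominus> a \<otimes> norm z = m" using ma Mc ac norm_closed[OF z(1)] add_minus_cancel(2)[of m "a \<otimes> norm z"] by simp
  then have "a \<otimes> star z \<otimes> z \<ominus> \<one> = \<ominus> m"
    using minus_flip[of \<one> "a \<otimes> norm z"] z ac norm_closed by (simp add: m_assoc star_closed norm_eq)
  then show ?thesis
    using radical_uminus[OF radical_M[OF ma(1)]] z ac by (intro bexI[of _ "a \<otimes> star z"]) (simp_all add: star_closed)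
qed

text \<open>The norm of \<open>z\<close> is a unit at \<open>M\<close>, and a multiple of \<open>z\<^sup>*\<close> is a two-sided inverse over an idempotent.\<close>

lemma quadratic_local_inverse:
  assumes z: "z \<in> carrier R" "w \<in> carrier R" "w \<otimes> z \<ominus> \<one> \<in> trace_radical"
  shows "\<exists>e\<in>idempotents_off M. \<exists>z'\<in>carrier R. z \<otimes> z' = e \<and> z' \<otimes> z = e"
proof -
  obtain e c where e: "e \<in> idempotents_off M" and c: "c \<in> S" "c \<otimes> norm z = e"
    using local_unit[OF M norm_in_S[OF z(1)] norm_of_inverse[OF z]] by blast
  have "z \<otimes> (c \<otimes> star z) = c \<otimes> norm z"
    using S_left_commute[OF c(1) z(1) star_closed[OF z(1)]] by (simp add: norm_def)
  moreover have "c \<otimes> star z \<otimes> z = c \<otimes> norm z"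
    using S_closed[OF c(1)] z(1) by (simp add: m_assoc star_closed norm_eq)
  ultimately show ?thesis
    using e c S_closed[OF c(1)] z(1) by (intro bexI[OF _ e] bexI[of _ "c \<otimes> star z"]) (simp_all add: star_closed)
qed

text \<open>If neither \<open>x\<close> nor \<open>y\<close> is invertible modulo the radical, the norm of \<open>x + ty\<close> is the trace of
  \<open>tyx\<^sup>*\<close>. Either this is a unit for some \<open>t\<close>, or \<open>yx\<^sup>*\<close> lies in the radical, and then \<open>y\<close> is a
  multiple of \<open>x\<close>: if \<open>t\<^sub>0x + x\<^sup>*t\<^sub>0\<^sup>* = 1\<close> then \<open>y = yt\<^sub>0x + yx\<^sup>*t\<^sub>0\<^sup>*\<close>.\<close>

lemma quadratic_common_generator:
  assumes x: "x \<in> carrier R" and y: "y \<in> carrier R"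
  shows "\<exists>t\<in>carrier R. \<exists>r\<in>carrier R. y \<ominus> r \<otimes> (x \<oplus> t \<otimes> y) \<in> trace_radical"
proof -
  have unit: ?thesis if t: "t \<in> carrier R" and n: "norm (x \<oplus> t \<otimes> y) \<notin> M" for t
  proof -
    have z: "x \<oplus> t \<otimes> y \<in> carrier R" using x y t by simp
    obtain w where w: "w \<in> carrier R" "w \<otimes> (x \<oplus> t \<otimes> y) \<ominus> \<one> \<in> trace_radical" using inverse_of_norm[OF z n] by blast
    have "y \<ominus> y \<otimes> w \<otimes> (x \<oplus> t \<otimes> y) = \<ominus> y \<otimes> (w \<otimes> (x \<oplus> t \<otimes> y) \<ominus> \<one>)"
      using y z w(1) by (simp only: minus_eq r_distr r_minus l_minus m_assoc m_closed a_inv_closed a_closed one_closed)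
        (simp add: minus_add a_comm y z w(1))
    then show ?thesis using radical_left[OF _ w(2), of "\<ominus> y"] t y w(1) by (intro bexI[OF _ t] bexI[of _ "y \<otimes> w"]) simp_all
  qed
  show ?thesis
  proof (cases "x \<in> trace_radical")
    case True
    have "x \<oplus> y \<ominus> y = x" using x y by (simp add: add_minus_cancel)
    then have "y \<ominus> (x \<oplus> y) = \<ominus> x" using minus_flip[of "x \<oplus> y" y] x y by simp
    then show ?thesis
      using radical_uminus[OF True] x y by (intro bexI[OF _ one_closed]) simp
  next
    case False
    then obtain t0 where t0: "t0 \<in> carrier R" "trace (t0 \<otimes> x) \<notin> M" using x by (auto simp: trace_radical_def)
    consider "norm x \<notin> M" | "norm y \<notin> M" | t where "t \<in> carrier R" "norm x \<in> M" "norm y \<in> M" "trace (t \<otimes> (y \<otimes> star x)) \<notin> M"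
      | "\<And>t. t \<in> carrier R \<Longrightarrow> trace (t \<otimes> (y \<otimes> star x)) \<in> M"
      by blast
    then show ?thesis
    proof cases
      case 1
      then show ?thesis using unit[OF zero_closed] x y by simp
    next
      case 2
      then obtain w where w: "w \<in> carrier R" "w \<otimes> y \<ominus> \<one> \<in> trace_radical" using inverse_of_norm[OF y] by blast
      define t where "t = (\<one> \<ominus> x) \<otimes> w"
      have t: "t \<in> carrier R" using x w by (simp add: t_def)
      have "\<one> \<oplus> (\<one> \<ominus> x) \<otimes> (w \<otimes> y \<ominus> \<one>) = \<one> \<oplus> ((\<one> \<ominus> x) \<otimes> (w \<otimes> y) \<ominus> (\<one> \<ominus> x))"
        using x y w(1) by (simp add: minus_eq[of "w \<otimes> y"] r_distr r_minus) (simp add: minus_eq)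
      also have "\<dots> = x \<oplus> t \<otimes> y"
      proof -
        have "\<one> \<oplus> (u \<ominus> (\<one> \<ominus> x)) = x \<oplus> u" if "u \<in> carrier R" for u
          using x that by (simp add: minus_eq minus_add a_ac r_neg1 r_neg2 r_neg)
        then show ?thesis using x y w(1) by (simp add: t_def m_assoc)
      qed
      finally have "norm (x \<oplus> t \<otimes> y) \<notin> M"
        using radical_norm_one_add[OF radical_left[OF _ w(2), of "\<one> \<ominus> x"]] x by simp
      then show ?thesis by (rule unit[OF t])
    next
      case (3 t)
      have "trace (x \<otimes> star (t \<otimes> y)) = trace (t \<otimes> (y \<otimes> star x))"
        using trace_star[of "t \<otimes> (y \<otimes> star x)"] x y 3(1) by (simp add: star_mult star_closed star_star m_assoc)
      then have eq: "norm (x \<oplus> t \<otimes> y) = norm x \<oplus> norm t \<otimes> norm y \<oplus> trace (t \<otimes> (y \<otimes> star x))"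
        using x y 3(1) by (simp add: norm_add norm_mult)
      have m: "norm x \<oplus> norm t \<otimes> norm y \<in> M"
        using 3 M_add[OF M] M_mult[OF M] norm_in_S by simp
      have "norm (x \<oplus> t \<otimes> y) \<notin> M"
      proof
        assume "norm (x \<oplus> t \<otimes> y) \<in> M"
        then have "(norm x \<oplus> norm t \<otimes> norm y) \<oplus> trace (t \<otimes> (y \<otimes> star x)) \<ominus> (norm x \<oplus> norm t \<otimes> norm y) \<in> M"
          using M_minus[OF M _ m] by (simp add: eq)
        then show False
          using 3(4) Mc[OF m] trace_closed[of "t \<otimes> (y \<otimes> star x)"] x y 3(1)
          by (simp only: add_minus_cancel m_closed star_closed)
      qed
      then show ?thesis by (rule unit[OF 3(1)])
    next
      case 4
      then have yx: "y \<otimes> star x \<in> trace_radical" using x y by (intro radicalI) (simp_all add: star_closed)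
      obtain m a where ma: "m \<in> M" "a \<in> S" "\<one> = m \<oplus> a \<otimes> trace (t0 \<otimes> x)"
        using M_comaximal[OF M trace_in_S t0(2)] t0(1) x by blast
      note cl = x y t0(1) star_closed[OF x] star_closed[OF t0(1)] S_closed[OF ma(2)] Mc[OF ma(1)]
      have tr: "trace (t0 \<otimes> x) = t0 \<otimes> x \<oplus> star x \<otimes> star t0" using x t0 by (simp add: trace_def star_mult)
      have "y = y \<otimes> (m \<oplus> a \<otimes> trace (t0 \<otimes> x))" using y by (simp add: ma(3)[symmetric])
      also have "\<dots> = y \<otimes> m \<oplus> a \<otimes> (y \<otimes> trace (t0 \<otimes> x))"
        using cl by (simp add: r_distr S_left_commute[OF ma(2) y] trace_closed)
      also have "\<dots> = (y \<otimes> m \<oplus> a \<otimes> (y \<otimes> star x \<otimes> star t0)) \<oplus> a \<otimes> y \<otimes> t0 \<otimes> x"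
        unfolding tr using cl by (simp add: r_distr m_assoc a_ac)
      finally have y_eq: "(y \<otimes> m \<oplus> a \<otimes> (y \<otimes> star x \<otimes> star t0)) \<oplus> a \<otimes> y \<otimes> t0 \<otimes> x = y" by simp
      have "(y \<otimes> m \<oplus> a \<otimes> (y \<otimes> star x \<otimes> star t0)) \<oplus> a \<otimes> y \<otimes> t0 \<otimes> x \<ominus> a \<otimes> y \<otimes> t0 \<otimes> x
          = y \<otimes> m \<oplus> a \<otimes> (y \<otimes> star x \<otimes> star t0)"
        using cl by (intro add_minus_cancel) simp_all
      then have "y \<ominus> a \<otimes> y \<otimes> t0 \<otimes> x = y \<otimes> m \<oplus> a \<otimes> (y \<otimes> star x \<otimes> star t0)"
        unfolding y_eq .
      moreover have "y \<otimes> m \<oplus> a \<otimes> (y \<otimes> star x \<otimes> star t0) \<in> trace_radical"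
        using cl radical_add[OF radical_left[OF y radical_M[OF ma(1)]] radical_left[OF cl(6) radical_right[OF cl(5) yx]]] by simp
      ultimately have "y \<ominus> (a \<otimes> y \<otimes> t0) \<otimes> (x \<oplus> \<zero> \<otimes> y) \<in> trace_radical"
        using cl by simp
      then show ?thesis using cl by (intro bexI[OF _ zero_closed] bexI[of _ "a \<otimes> y \<otimes> t0"]) simp_all
    qed
  qed
qed

text \<open>An isotropic pair of non-invertible elements does not exist if the ring is commutative, since
  \<open>1 = N(px + qy)\<close> would then be a multiple of the nilpotent \<open>x\<^sup>*y\<close>. In characteristic 2, the
  elements of trace zero are symmetric, so that the norm \<open>tr(syx\<^sup>*)\<close> of \<open>x + sy\<close> can be made a unit by
  a symmetric \<open>s\<close> unless \<open>yx\<^sup>*\<close> is a scalar modulo the radical; this scalar has norm \<open>0\<close> and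
  vanishes, and then \<open>x\<^sup>* = (px + qy)x\<^sup>*\<close> vanishes too.\<close>

lemma quadratic_isotropic_pivot:
  assumes iso: "isotropic x y"
  shows "(\<exists>s\<in>sym_elements R star. \<exists>w\<in>carrier R. w \<otimes> (x \<oplus> s \<otimes> y) \<ominus> \<one> \<in> trace_radical) \<or>
    (\<exists>w\<in>carrier R. w \<otimes> y \<ominus> \<one> \<in> trace_radical)"
proof (rule ccontr)
  assume contra: "\<not> ?thesis"
  obtain p q where cl: "x \<in> carrier R" "y \<in> carrier R" "p \<in> carrier R" "q \<in> carrier R"
    and pq: "p \<otimes> x \<oplus> q \<otimes> y = \<one>" and sym: "star y \<otimes> x = star x \<otimes> y"
    using iso by (auto simp: isotropic_def sym_elements_def star_mult star_star star_closed)
  note cls = star_closed[OF cl(1)] star_closed[OF cl(2)] star_closed[OF cl(3)] star_closed[OF cl(4)]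
  have no_unit: "norm (x \<oplus> s \<otimes> y) \<in> M" if "s \<in> carrier R" "star s = s" for s
    using contra that cl inverse_of_norm[of "x \<oplus> s \<otimes> y"] by (auto simp: sym_elements_def)
  have ny: "norm y \<in> M" using contra inverse_of_norm[OF cl(2)] by blast
  have nx: "norm x \<in> M" using no_unit[of \<zero>] cl by simp
  from commutative_or_char_2 show False
  proof
    assume "\<forall>x\<in>carrier R. \<forall>y\<in>carrier R. x \<otimes> y = y \<otimes> x"
    then have comm: "u \<otimes> v = v \<otimes> u" if "u \<in> carrier R" "v \<in> carrier R" for u v using that by blast
    define z k where "z = x \<otimes> star y" and "k = p \<otimes> star q"
    have zk: "z \<in> carrier R" "k \<in> carrier R" using cl cls by (simp_all add: z_def k_def)
    have sz: "star z = z" using cl cls comm[of "star y" x] comm[of y "star x"] sym by (simp add: z_def star_mult star_star)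
    have "p \<otimes> x \<otimes> star (q \<otimes> y) = p \<otimes> (z \<otimes> star q)" using cl cls by (simp add: star_mult z_def m_assoc)
    also have "\<dots> = p \<otimes> (star q \<otimes> z)" using comm[OF zk(1) cls(4)] by simp
    also have "\<dots> = k \<otimes> z" using cl cls zk by (simp add: k_def m_assoc)
    finally have "trace (p \<otimes> x \<otimes> star (q \<otimes> y)) = k \<otimes> z \<oplus> z \<otimes> star k"
      using zk sz by (simp add: trace_def star_mult)
    also have "\<dots> = trace k \<otimes> z"
      using zk comm[OF zk(1) star_closed[OF zk(2)]] by (simp add: trace_def l_distr star_closed)
    finally have tr: "trace (p \<otimes> x \<otimes> star (q \<otimes> y)) = trace k \<otimes> z" .
    define m where "m = norm p \<otimes> norm x \<oplus> norm q \<otimes> norm y"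
    have m: "m \<in> M" using nx ny cl M_add[OF M] M_mult[OF M] norm_in_S by (simp add: m_def)
    have "m \<oplus> trace k \<otimes> z = norm \<one>"
      unfolding m_def tr[symmetric] using cl by (simp add: norm_mult[symmetric] norm_add[symmetric] pq)
    then have one: "m \<oplus> trace k \<otimes> z = \<one>" by (simp add: norm_def)
    then have eq: "trace k \<otimes> z = \<one> \<ominus> m"
      using add_minus_cancel(1)[of m "trace k \<otimes> z"] Mc[OF m] zk trace_closed[OF zk(2)] by simp
    have "(\<one> \<ominus> m) \<otimes> (\<one> \<ominus> m) = (trace k \<otimes> z) \<otimes> star (trace k \<otimes> z)"
      using zk trace_closed[OF zk(2)] sz S_star[OF trace_in_S[OF zk(2)]] comm[OF zk(1) trace_closed[OF zk(2)]]
      by (simp add: eq[symmetric] star_mult)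
    also have "\<dots> = norm (trace k) \<otimes> (norm x \<otimes> norm y)"
      using zk trace_closed[OF zk(2)] norm_mult[of "trace k" z] cl cls
      by (simp add: norm_def[of "trace k \<otimes> z", symmetric]) (simp add: z_def norm_mult norm_star)
    also have "\<dots> \<in> M"
      using M_mult[OF M norm_in_S[OF trace_closed[OF zk(2)]] M_mult[OF M norm_in_S[OF cl(1)] ny]] .
    finally have "\<one> \<ominus> m \<in> M"
      using M_prime[OF M, of "\<one> \<ominus> m" "\<one> \<ominus> m"] S_minus[OF S_one M_S[OF M m]] by blast
    then show False using one_minus_M[OF M m] by simp
  next
    assume char2: "\<one> \<oplus> \<one> = \<zero>"
    have two: "u \<oplus> u = \<zero>" if "u \<in> carrier R" for u
      using that l_distr[of \<one> \<one> u] char2 by simp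
    have neg: "\<ominus> u = u" if "u \<in> carrier R" for u
      using that two[OF that] by (simp add: minus_equality)
    obtain \<theta> where \<theta>: "\<theta> \<in> carrier R" "trace \<theta> = \<one>" using trace_one by (auto simp: trace_def)
    define v where "v = y \<otimes> star x"
    have v: "v \<in> carrier R" using cl cls by (simp add: v_def)
    have sym_trace: "trace (s \<otimes> v) \<in> M" if s: "s \<in> carrier R" "star s = s" for s
    proof -
      have "trace (x \<otimes> star (s \<otimes> y)) = trace (s \<otimes> v)"
        using trace_star[of "s \<otimes> v"] cl cls s by (simp add: v_def star_mult star_star m_assoc)
      then have eq: "norm (x \<oplus> s \<otimes> y) = (norm x \<oplus> norm s \<otimes> norm y) \<oplus> trace (s \<otimes> v)"
        using cl s by (simp add: norm_add norm_mult)
      have m: "norm x \<oplus> norm s \<otimes> norm y \<in> M" using nx ny s M_add[OF M] M_mult[OF M] norm_in_S by simp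
      have "(norm x \<oplus> norm s \<otimes> norm y) \<oplus> trace (s \<otimes> v) \<ominus> (norm x \<oplus> norm s \<otimes> norm y) \<in> M"
        using M_minus[OF M no_unit[OF s] m] by (simp add: eq)
      then show ?thesis using Mc[OF m] trace_closed[of "s \<otimes> v"] s v by (simp only: add_minus_cancel m_closed)
    qed
    define l where "l = trace (\<theta> \<otimes> v)"
    have l: "l \<in> S" "l \<in> carrier R" using \<theta> v by (simp_all add: l_def trace_in_S trace_closed)
    have j: "v \<ominus> l \<in> trace_radical"
    proof (rule radicalI)
      fix t assume t: "t \<in> carrier R"
      define s where "s = t \<ominus> trace t \<otimes> \<theta>"
      have tt: "trace t \<in> S" "trace t \<in> carrier R" using t by (simp_all add: trace_in_S trace_closed)
      have s: "s \<in> carrier R" using t tt \<theta> by (simp add: s_def)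
      have "trace s = \<zero>"
        using t tt \<theta> by (simp add: s_def trace_minus trace_scalar)
      then have "star s = s"
        using star_eq_trace[OF s] s neg[OF s] by (simp add: minus_eq)
      then have "trace (s \<otimes> v) \<in> M" by (rule sym_trace[OF s])
      moreover have "s \<otimes> v = t \<otimes> v \<ominus> trace t \<otimes> (\<theta> \<otimes> v)"
        using t tt(2) \<theta>(1) v by (simp add: s_def minus_eq l_distr l_minus m_assoc)
      moreover have "t \<otimes> (v \<ominus> l) = t \<otimes> v \<ominus> l \<otimes> t"
        using t v l S_central[OF l(1) t] by (simp add: minus_eq r_distr r_minus)
      moreover have "trace t \<otimes> l = l \<otimes> trace t" by (rule S_central[OF l(1) tt(2)])
      ultimately show "trace (t \<otimes> (v \<ominus> l)) \<in> M"
        using t tt \<theta> v l by (simp add: trace_minus trace_scalar l_def[symmetric])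
    qed (use v l in simp)
    note jc = radical_closed[OF j]
    have v_eq: "v = l \<oplus> (v \<ominus> l)" using v l by (simp add: add_minus_cancel)
    have "norm v = norm l \<oplus> norm (v \<ominus> l) \<oplus> trace (l \<otimes> star (v \<ominus> l))"
      using norm_add[OF l(2) jc] v_eq by simp
    moreover have "norm v \<in> M"
      using cl cls M_mult[OF M norm_in_S[OF cl(2)] nx] by (simp add: v_def norm_mult norm_star)
    moreover have m1: "norm (v \<ominus> l) \<in> M" by (rule radical_norm[OF j])
    moreover have m2: "trace (l \<otimes> star (v \<ominus> l)) \<in> M" by (rule radical_trace[OF radical_star[OF j] l(2)])
    ultimately have "norm l \<oplus> norm (v \<ominus> l) \<oplus> trace (l \<otimes> star (v \<ominus> l)) \<ominus> trace (l \<otimes> star (v \<ominus> l)) \<ominus> norm (v \<ominus> l) \<in> M"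
      using M_minus[OF M] by simp
    then have "norm l \<in> M"
      using add_minus_cancel(2)[of "norm l \<oplus> norm (v \<ominus> l)" "trace (l \<otimes> star (v \<ominus> l))"]
        add_minus_cancel(2)[of "norm l" "norm (v \<ominus> l)"] norm_closed[OF l(2)] Mc[OF m1] Mc[OF m2] by simp
    then have "l \<in> M" using M_prime[OF M l(1) l(1)] by (simp add: norm_def S_star[OF l(1)])
    then have v_rad: "v \<in> trace_radical"
      using radical_add[OF radical_M j] v_eq by metis
    have "star x = (p \<otimes> x \<oplus> q \<otimes> y) \<otimes> star x" using cls by (simp add: pq)
    also have "\<dots> = p \<otimes> norm x \<oplus> q \<otimes> v" using cl cls by (simp add: l_distr m_assoc norm_def v_def)
    finally have "star x \<in> trace_radical"
      using radical_add[OF radical_left[OF cl(3) radical_M[OF nx]] radical_left[OF cl(4) v_rad]] by simp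
    then have x_rad: "x \<in> trace_radical" using radical_star star_star[OF cl(1)] by metis
    have "p \<otimes> x \<oplus> q \<otimes> y \<ominus> q \<otimes> y = p \<otimes> x" using cl by (simp add: add_minus_cancel)
    then have "q \<otimes> y \<ominus> \<one> = \<ominus> (p \<otimes> x)" using minus_flip[of \<one> "q \<otimes> y"] cl by (simp add: pq)
    then show False
      using norm_of_inverse[OF cl(2,4)] ny radical_uminus[OF radical_left[OF cl(3) x_rad]] by simp
  qed
qed

lemma pivoting_quadratic: "local_pivoting R star trace_radical (idempotents_off M)"
proof
  show "\<zero> \<in> trace_radical" by (rule radical_zero)
  show "\<one> \<in> idempotents_off M" by (rule idempotents_off(2)[OF M])
qed (rule radical_closed radical_add radical_left idempotents_off(1)[OF M] idempotents_off(3)[OF M]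
  quadratic_local_inverse quadratic_common_generator quadratic_isotropic_pivot; assumption)+

end

end

section \<open>Completions and adeles\<close>

locale valued_field = field F for F (structure) +
  fixes a :: "'a \<Rightarrow> real"
  assumes abs_value: "nontrivial_abs_value F a"
begin

lemma abs_nonneg: "x \<in> carrier F \<Longrightarrow> 0 \<le> a x"
  and abs_zero_iff: "x \<in> carrier F \<Longrightarrow> a x = 0 \<longleftrightarrow> x = \<zero>"
  and abs_mult: "\<lbrakk>x \<in> carrier F; y \<in> carrier F\<rbrakk> \<Longrightarrow> a (x \<otimes> y) = a x * a y"
  and abs_triangle: "\<lbrakk>x \<in> carrier F; y \<in> carrier F\<rbrakk> \<Longrightarrow> a (x \<oplus> y) \<le> a x + a y"
  using abs_value by (auto simp: nontrivial_abs_value_def)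

lemma abs_zero: "a \<zero> = 0"
  by (simp add: abs_zero_iff)

lemma abs_one: "a \<one> = 1"
  using abs_mult[of \<one> \<one>] abs_zero_iff[of \<one>] by simp

lemma abs_uminus: "x \<in> carrier F \<Longrightarrow> a (\<ominus> x) = a x"
proof -
  assume x: "x \<in> carrier F"
  have "a (\<ominus> \<one>) * a (\<ominus> \<one>) = a (\<ominus> \<one> \<otimes> \<ominus> \<one>)" using abs_mult by simp
  then have "a (\<ominus> \<one>) * a (\<ominus> \<one>) = 1" by (simp add: l_minus abs_one)
  then have "a (\<ominus> \<one>) = 1" using abs_nonneg[of "\<ominus> \<one>"] by (simp add: square_eq_1_iff)
  moreover have "\<ominus> x = \<ominus> \<one> \<otimes> x" using x by (simp add: l_minus)
  ultimately show ?thesis using x by (simp add: abs_mult)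
qed

lemma abs_diff: "\<lbrakk>x \<in> carrier F; y \<in> carrier F\<rbrakk> \<Longrightarrow> \<bar>a x - a y\<bar> \<le> a (x \<ominus> y)"
proof -
  assume xy: "x \<in> carrier F" "y \<in> carrier F"
  have "a x \<le> a (x \<ominus> y) + a y" using abs_triangle[of "x \<ominus> y" y] xy by (simp add: add_minus_cancel)
  moreover have "a y \<le> a (y \<ominus> x) + a x" using abs_triangle[of "y \<ominus> x" x] xy by (simp add: add_minus_cancel)
  moreover have "a (y \<ominus> x) = a (x \<ominus> y)" using abs_uminus[of "x \<ominus> y"] xy by (simp add: minus_flip)
  ultimately show ?thesis by simp
qed

lemma abs_inverse: "\<lbrakk>x \<in> carrier F; x \<noteq> \<zero>\<rbrakk> \<Longrightarrow> a (inv x) = inverse (a x)"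
proof -
  assume x: "x \<in> carrier F" "x \<noteq> \<zero>"
  then have u: "x \<in> Units F" by (simp add: field_Units)
  then have "a x * a (inv x) = 1" using abs_mult[of x "inv x"] by (simp add: abs_one Units_closed)
  then show ?thesis by (simp add: inverse_unique)
qed

abbreviation C where "C \<equiv> cauchy_ring F a"

lemma cauchy_iff:
  "s \<in> carrier C \<longleftrightarrow> (\<forall>n. s n \<in> carrier F) \<and> (\<forall>\<epsilon>>0. \<exists>N. \<forall>m\<ge>N. \<forall>n\<ge>N. a (s m \<ominus> s n) < \<epsilon>)"
  by (auto simp: cauchy_ring_def)

lemma cauchy_closed: "s \<in> carrier C \<Longrightarrow> s n \<in> carrier F"
  by (simp add: cauchy_iff)

lemma cauchyI:
  assumes "\<And>n. s n \<in> carrier F" "\<And>\<epsilon>. 0 < \<epsilon> \<Longrightarrow> \<exists>N. \<forall>m\<ge>N. \<forall>n\<ge>N. a (s m \<ominus> s n) < \<epsilon>"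
  shows "s \<in> carrier C"
  using assms by (simp add: cauchy_iff)

lemma cauchyE:
  assumes "s \<in> carrier C" "0 < \<epsilon>"
  obtains N where "\<And>m n. \<lbrakk>N \<le> m; N \<le> n\<rbrakk> \<Longrightarrow> a (s m \<ominus> s n) < \<epsilon>"
proof -
  obtain N where "\<forall>m\<ge>N. \<forall>n\<ge>N. a (s m \<ominus> s n) < \<epsilon>"
    using assms unfolding cauchy_iff by blast
  then show ?thesis using that[of N] by blast
qed

lemma cauchy_simps:
  "(s \<otimes>\<^bsub>C\<^esub> t) n = s n \<otimes> t n" "(s \<oplus>\<^bsub>C\<^esub> t) n = s n \<oplus> t n" "\<one>\<^bsub>C\<^esub> n = \<one>" "\<zero>\<^bsub>C\<^esub> n = \<zero>"
  by (simp_all add: cauchy_ring_def)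

lemma cauchy_abs_convergent:
  assumes s: "s \<in> carrier C"
  shows "convergent (\<lambda>n. a (s n))"
proof -
  have "Cauchy (\<lambda>n. a (s n))"
  proof (rule metric_CauchyI)
    fix e :: real assume "0 < e"
    with s obtain N where N: "\<And>m n. \<lbrakk>N \<le> m; N \<le> n\<rbrakk> \<Longrightarrow> a (s m \<ominus> s n) < e" by (rule cauchyE) blast
    have "dist (a (s m)) (a (s n)) < e" if "N \<le> m" "N \<le> n" for m n
      using N[OF that] abs_diff[of "s m" "s n"] cauchy_closed[OF s] by (simp add: dist_real_def)
    then show "\<exists>N. \<forall>m\<ge>N. \<forall>n\<ge>N. dist (a (s m)) (a (s n)) < e" by blast
  qed
  then show ?thesis by (rule Cauchy_convergent)
qed

lemma cauchy_bounded:
  assumes "s \<in> carrier C"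
  obtains B where "0 < B" "\<And>n. a (s n) \<le> B"
proof -
  have "Bseq (\<lambda>n. a (s n))" by (rule convergent_imp_Bseq[OF cauchy_abs_convergent[OF assms]])
  then obtain B where "0 < B" "\<And>n. norm (a (s n)) \<le> B" by (auto simp: Bseq_def)
  then show ?thesis using that[of B] abs_nonneg cauchy_closed[OF assms] by simp
qed

lemma cauchy_add:
  assumes s: "s \<in> carrier C" and t: "t \<in> carrier C"
  shows "(\<lambda>n. s n \<oplus> t n) \<in> carrier C"
proof (rule cauchyI)
  note cl = cauchy_closed[OF s] cauchy_closed[OF t]
  show "s n \<oplus> t n \<in> carrier F" for n using cl by simp
  fix e :: real assume "0 < e"
  then have e: "0 < e / 2" by simp
  obtain N where N: "\<And>m n. \<lbrakk>N \<le> m; N \<le> n\<rbrakk> \<Longrightarrow> a (s m \<ominus> s n) < e / 2" by (rule cauchyE[OF s e]) blast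
  obtain K where K: "\<And>m n. \<lbrakk>K \<le> m; K \<le> n\<rbrakk> \<Longrightarrow> a (t m \<ominus> t n) < e / 2" by (rule cauchyE[OF t e]) blast
  have "a ((s m \<oplus> t m) \<ominus> (s n \<oplus> t n)) < e" if "max N K \<le> m" "max N K \<le> n" for m n
  proof -
    have "(s m \<oplus> t m) \<ominus> (s n \<oplus> t n) = (s m \<ominus> s n) \<oplus> (t m \<ominus> t n)"
      using cl by (simp add: minus_eq minus_add a_ac)
    then show ?thesis
      using abs_triangle[of "s m \<ominus> s n" "t m \<ominus> t n"] N[of m n] K[of m n] that cl by simp
  qed
  then show "\<exists>N. \<forall>m\<ge>N. \<forall>n\<ge>N. a ((s m \<oplus> t m) \<ominus> (s n \<oplus> t n)) < e" by blast
qed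

lemma cauchy_mult:
  assumes s: "s \<in> carrier C" and t: "t \<in> carrier C"
  shows "(\<lambda>n. s n \<otimes> t n) \<in> carrier C"
proof (rule cauchyI)
  note cl = cauchy_closed[OF s] cauchy_closed[OF t]
  show "s n \<otimes> t n \<in> carrier F" for n using cl by simp
  obtain A where A: "0 < A" "\<And>n. a (s n) \<le> A" by (rule cauchy_bounded[OF s]) blast
  obtain B where B: "0 < B" "\<And>n. a (t n) \<le> B" by (rule cauchy_bounded[OF t]) blast
  fix e :: real assume "0 < e"
  then have e: "0 < e / (2 * B)" "0 < e / (2 * A)" using A B by simp_all
  obtain N where N: "\<And>m n. \<lbrakk>N \<le> m; N \<le> n\<rbrakk> \<Longrightarrow> a (s m \<ominus> s n) < e / (2 * B)" by (rule cauchyE[OF s e(1)]) blast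
  obtain K where K: "\<And>m n. \<lbrakk>K \<le> m; K \<le> n\<rbrakk> \<Longrightarrow> a (t m \<ominus> t n) < e / (2 * A)" by (rule cauchyE[OF t e(2)]) blast
  have "a (s m \<otimes> t m \<ominus> s n \<otimes> t n) < e" if "max N K \<le> m" "max N K \<le> n" for m n
  proof -
    have "(s m \<ominus> s n) \<otimes> t m \<oplus> s n \<otimes> (t m \<ominus> t n) = (s m \<otimes> t m \<ominus> s n \<otimes> t m) \<oplus> (s n \<otimes> t m \<ominus> s n \<otimes> t n)"
      using cl by (simp add: minus_eq l_distr r_distr l_minus r_minus)
    also have "\<dots> = s m \<otimes> t m \<ominus> s n \<otimes> t n"
      using cl by (simp add: minus_eq a_assoc r_neg1)
    finally have "a (s m \<otimes> t m \<ominus> s n \<otimes> t n) \<le> a (s m \<ominus> s n) * a (t m) + a (s n) * a (t m \<ominus> t n)"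
      using abs_triangle[of "(s m \<ominus> s n) \<otimes> t m" "s n \<otimes> (t m \<ominus> t n)"] cl by (simp add: abs_mult)
    also have "\<dots> \<le> a (s m \<ominus> s n) * B + A * a (t m \<ominus> t n)"
      using A B cl abs_nonneg by (intro add_mono mult_mono) auto
    also have "\<dots> < e / (2 * B) * B + A * (e / (2 * A))"
      using A B N[of m n] K[of m n] that by (intro add_strict_mono mult_strict_right_mono mult_strict_left_mono) auto
    also have "\<dots> = e" using A B by simp
    finally show ?thesis .
  qed
  then show "\<exists>N. \<forall>m\<ge>N. \<forall>n\<ge>N. a (s m \<otimes> t m \<ominus> s n \<otimes> t n) < e" by blast
qed

lemma cauchy_uminus:
  assumes s: "s \<in> carrier C"
  shows "(\<lambda>n. \<ominus> s n) \<in> carrier C"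
proof (rule cauchyI)
  note cl = cauchy_closed[OF s]
  show "\<ominus> s n \<in> carrier F" for n using cl by simp
  fix e :: real assume "0 < e"
  with s obtain N where N: "\<And>m n. \<lbrakk>N \<le> m; N \<le> n\<rbrakk> \<Longrightarrow> a (s m \<ominus> s n) < e" by (rule cauchyE) blast
  have "a (\<ominus> s m \<ominus> \<ominus> s n) = a (s m \<ominus> s n)" for m n
    using abs_uminus[of "s m \<ominus> s n"] cl by (simp add: minus_eq minus_add)
  then show "\<exists>N. \<forall>m\<ge>N. \<forall>n\<ge>N. a (\<ominus> s m \<ominus> \<ominus> s n) < e" using N by (intro exI[of _ N]) simp
qed

lemma cauchy_const: "x \<in> carrier F \<Longrightarrow> (\<lambda>_. x) \<in> carrier C"
  by (rule cauchyI) (auto simp: minus_eq r_neg abs_zero)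

lemma cauchy_cring: "cring C"
proof (rule cringI)
  have closed: "s \<oplus>\<^bsub>C\<^esub> t \<in> carrier C" "s \<otimes>\<^bsub>C\<^esub> t \<in> carrier C" if "s \<in> carrier C" "t \<in> carrier C" for s t
    using cauchy_add[OF that] cauchy_mult[OF that] by (simp_all add: cauchy_ring_def)
  have unit_zero: "\<zero>\<^bsub>C\<^esub> \<in> carrier C" "\<one>\<^bsub>C\<^esub> \<in> carrier C"
    using cauchy_const[OF zero_closed] cauchy_const[OF one_closed] by (simp_all add: cauchy_ring_def)
  show "abelian_group C"
  proof (rule abelian_groupI)
    fix s assume s: "s \<in> carrier C"
    have "(\<lambda>n. \<ominus> s n) \<oplus>\<^bsub>C\<^esub> s = \<zero>\<^bsub>C\<^esub>"
      using cauchy_closed[OF s] by (auto simp: cauchy_simps l_neg)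
    then show "\<exists>t\<in>carrier C. t \<oplus>\<^bsub>C\<^esub> s = \<zero>\<^bsub>C\<^esub>" using cauchy_uminus[OF s] by blast
  qed (use closed unit_zero in \<open>auto simp: fun_eq_iff cauchy_simps cauchy_closed a_ac\<close>)
  show "comm_monoid C"
    by (rule comm_monoidI) (use closed unit_zero in \<open>auto simp: fun_eq_iff cauchy_simps cauchy_closed m_ac\<close>)
qed (auto simp: fun_eq_iff cauchy_simps cauchy_closed l_distr)

abbreviation N where "N \<equiv> null_sequences F a"

lemma null_iff: "s \<in> N \<longleftrightarrow> s \<in> carrier C \<and> (\<lambda>n. a (s n)) \<longlonglongrightarrow> 0"
  by (simp add: null_sequences_def)

lemma null_if_dominated:
  assumes "t \<in> carrier C" "\<And>n. a (t n) \<le> f n" "f \<longlonglongrightarrow> 0"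
  shows "t \<in> N"
proof -
  have "(\<lambda>n. a (t n)) \<longlonglongrightarrow> 0"
    using assms abs_nonneg cauchy_closed[OF assms(1)]
    by (intro tendsto_sandwich[of "\<lambda>_. 0" "\<lambda>n. a (t n)" sequentially f 0]) auto
  then show ?thesis using assms(1) by (simp add: null_iff)
qed

lemma null_ideal: "ideal N C"
proof -
  interpret C: cring C by (rule cauchy_cring)
  have mult: "s \<otimes>\<^bsub>C\<^esub> t \<in> N" if s: "s \<in> carrier C" and t: "t \<in> N" for s t
  proof -
    obtain B where B: "0 < B" "\<And>n. a (s n) \<le> B" by (rule cauchy_bounded[OF s]) blast
    have tC: "t \<in> carrier C" and tl: "(\<lambda>n. a (t n)) \<longlonglongrightarrow> 0" using t by (simp_all add: null_iff)
    show ?thesis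
    proof (rule null_if_dominated)
      show "s \<otimes>\<^bsub>C\<^esub> t \<in> carrier C" using s tC by simp
      show "a ((s \<otimes>\<^bsub>C\<^esub> t) n) \<le> B * a (t n)" for n
        using B cauchy_closed[OF s] cauchy_closed[OF tC] abs_nonneg
        by (auto simp: cauchy_simps abs_mult intro: mult_right_mono)
      show "(\<lambda>n. B * a (t n)) \<longlonglongrightarrow> 0" using tendsto_mult_left[OF tl, of B] by simp
    qed
  qed
  show ?thesis
  proof (rule idealI)
    show "ring C" by (rule C.ring_axioms)
    show "subgroup N (add_monoid C)"
    proof (rule C.add.subgroupI)
      show "N \<subseteq> carrier C" by (auto simp: null_iff)
      have "\<zero>\<^bsub>C\<^esub> \<in> N" by (auto simp: null_iff cauchy_simps abs_zero)
      then show "N \<noteq> {}" by blast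
      show "\<ominus>\<^bsub>C\<^esub> s \<in> N" if "s \<in> N" for s
        using mult[of "\<ominus>\<^bsub>C\<^esub> \<one>\<^bsub>C\<^esub>" s] that by (simp add: C.l_minus null_iff)
      show "s \<oplus>\<^bsub>C\<^esub> t \<in> N" if s: "s \<in> N" and t: "t \<in> N" for s t
      proof (rule null_if_dominated)
        show "s \<oplus>\<^bsub>C\<^esub> t \<in> carrier C" using s t by (simp add: null_iff)
        show "a ((s \<oplus>\<^bsub>C\<^esub> t) n) \<le> a (s n) + a (t n)" for n
          using s t abs_triangle cauchy_closed by (simp add: null_iff cauchy_simps)
        show "(\<lambda>n. a (s n) + a (t n)) \<longlonglongrightarrow> 0"
          using s t tendsto_add[of "\<lambda>n. a (s n)" 0 sequentially "\<lambda>n. a (t n)" 0] by (simp add: null_iff)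
      qed
    qed
    show "s \<otimes>\<^bsub>C\<^esub> t \<in> N" "t \<otimes>\<^bsub>C\<^esub> s \<in> N" if "t \<in> N" "s \<in> carrier C" for s t
      using mult[OF that(2,1)] that C.m_comm[of t s] by (simp_all add: null_iff)
  qed
qed

abbreviation K where "K \<equiv> completion F a"

lemma completion_cring: "cring K"
  unfolding completion_def by (rule ideal.quotient_is_cring[OF null_ideal cauchy_cring])

definition limit :: "(nat \<Rightarrow> 'a) \<Rightarrow> (nat \<Rightarrow> 'a) set" where
  "limit s = N +>\<^bsub>C\<^esub> s"

lemma limit_hom: "limit \<in> ring_hom C K"
  unfolding limit_def completion_def by (rule ideal.rcos_ring_hom[OF null_ideal])

lemmas limit_simps = ring_hom_closed[OF limit_hom] ring_hom_mult[OF limit_hom] ring_hom_add[OF limit_hom] ring_hom_one[OF limit_hom]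

lemma completion_cases:
  assumes "Z \<in> carrier K"
  obtains s where "s \<in> carrier C" "Z = limit s"
  using assms by (auto simp: completion_def FactRing_def A_RCOSETS_def' limit_def)

lemma limit_null: assumes "s \<in> N" shows "limit s = \<zero>\<^bsub>K\<^esub>"
proof -
  interpret I: ideal N C by (rule null_ideal)
  show ?thesis
    using I.a_rcos_const[OF assms] by (simp add: limit_def completion_def FactRing_def)
qed

text \<open>The absolute value on the completion is computed from a chosen representative; any other one differs
  from it by a null sequence.\<close>

lemma limit_abs:
  assumes s: "s \<in> carrier C"
  shows "(\<lambda>n. a (s n)) \<longlonglongrightarrow> completion_abs a (limit s)"
proof -
  interpret I: ideal N C by (rule null_ideal)
  define t where "t = (SOME t. t \<in> limit s)"
  have "s \<in> limit s" unfolding limit_def by (rule I.a_rcos_self[OF s])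
  then have "t \<in> limit s" unfolding t_def by (rule someI[of "\<lambda>t. t \<in> limit s"])
  then obtain h where h: "h \<in> N" "t = h \<oplus>\<^bsub>C\<^esub> s" by (auto simp: limit_def a_r_coset_def')
  have hC: "h \<in> carrier C" using h(1) by (simp add: null_iff)
  have "(\<lambda>n. a (t n) - a (s n)) \<longlonglongrightarrow> 0"
  proof (rule tendsto_rabs_zero_cancel, rule tendsto_sandwich)
    show "\<forall>\<^sub>F n in sequentially. 0 \<le> \<bar>a (t n) - a (s n)\<bar>" by simp
    show "\<forall>\<^sub>F n in sequentially. \<bar>a (t n) - a (s n)\<bar> \<le> a (h n)"
    proof (intro always_eventually allI)
      fix n
      have "t n \<ominus> s n = h n"
        using cauchy_closed[OF hC] cauchy_closed[OF s] by (simp add: h cauchy_simps add_minus_cancel)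
      then show "\<bar>a (t n) - a (s n)\<bar> \<le> a (h n)"
        using abs_diff[of "t n" "s n"] cauchy_closed[OF hC] cauchy_closed[OF s] by (simp add: h cauchy_simps)
    qed
    show "(\<lambda>_. 0) \<longlonglongrightarrow> (0::real)" by simp
    show "(\<lambda>n. a (h n)) \<longlonglongrightarrow> 0" using h(1) by (simp add: null_iff)
  qed
  moreover obtain L where L: "(\<lambda>n. a (s n)) \<longlonglongrightarrow> L"
    using cauchy_abs_convergent[OF s] by (auto simp: convergent_def)
  ultimately have "(\<lambda>n. a (t n)) \<longlonglongrightarrow> L"
    using tendsto_add[of "\<lambda>n. a (t n) - a (s n)" 0 sequentially "\<lambda>n. a (s n)" L] by simp
  then have "completion_abs a (limit s) = L" by (simp add: completion_abs_def t_def[symmetric] limI)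
  with L show ?thesis by simp
qed

lemma completion_abs_eq: "\<lbrakk>s \<in> carrier C; (\<lambda>n. a (s n)) \<longlonglongrightarrow> L\<rbrakk> \<Longrightarrow> completion_abs a (limit s) = L"
  using limit_abs LIMSEQ_unique by blast

text \<open>A Cauchy sequence without the limit \<open>0\<close> is bounded away from \<open>0\<close> from some point on, and can be inverted
  there.\<close>

lemma completion_inverse:
  assumes Z: "Z \<in> carrier K" and nz: "completion_abs a Z \<noteq> 0"
  shows "\<exists>Y\<in>carrier K. Y \<otimes>\<^bsub>K\<^esub> Z = \<one>\<^bsub>K\<^esub> \<and> completion_abs a Y = inverse (completion_abs a Z)"
proof -
  interpret C: cring C by (rule cauchy_cring)
  interpret K: cring K by (rule completion_cring)
  obtain s where s: "s \<in> carrier C" and Zs: "Z = limit s" using Z by (rule completion_cases)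
  note cl = cauchy_closed[OF s]
  define L where "L = completion_abs a Z"
  have lim: "(\<lambda>n. a (s n)) \<longlonglongrightarrow> L" using limit_abs[OF s] by (simp add: L_def Zs)
  have "0 \<le> L" using lim abs_nonneg cl by (intro LIMSEQ_le_const) auto
  then have L: "0 < L" using nz by (simp add: L_def)
  then have "\<forall>\<^sub>F n in sequentially. L / 2 < a (s n)" using lim by (intro order_tendstoD) auto
  then obtain N0 where N0: "\<And>n. N0 \<le> n \<Longrightarrow> L / 2 < a (s n)" by (auto simp: eventually_sequentially)
  have s0: "s n \<noteq> \<zero>" if "N0 \<le> n" for n using N0[OF that] L abs_zero by auto
  define t where "t n = (if N0 \<le> n then inv (s n) else \<zero>)" for n
  have tn: "t n \<in> carrier F" for n using cl s0 by (auto simp: t_def field_Units)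
  have tC: "t \<in> carrier C"
  proof (rule cauchyI[OF tn])
    fix e :: real assume "0 < e"
    then have e': "0 < e * (L / 2 * (L / 2))" using L by simp
    obtain N1 where N1: "\<And>m n. \<lbrakk>N1 \<le> m; N1 \<le> n\<rbrakk> \<Longrightarrow> a (s m \<ominus> s n) < e * (L / 2 * (L / 2))"
      by (rule cauchyE[OF s e']) blast
    have "a (t m \<ominus> t n) < e" if "max N0 N1 \<le> m" "max N0 N1 \<le> n" for m n
    proof -
      have u: "s m \<in> Units F" "s n \<in> Units F" using cl s0 that by (simp_all add: field_Units)
      have "s m \<otimes> s n \<otimes> (t m \<ominus> t n) = (s m \<otimes> inv (s m)) \<otimes> s n \<ominus> s m \<otimes> (s n \<otimes> inv (s n))"
        using cl u that by (simp add: t_def minus_eq r_distr r_minus m_ac del: Units_r_inv Units_l_inv)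
      also have "\<dots> = s n \<ominus> s m" using u cl by simp
      finally have "a (s m) * a (s n) * a (t m \<ominus> t n) = a (s n \<ominus> s m)"
        using cl tn by (simp add: abs_mult[symmetric])
      moreover have "L / 2 * (L / 2) < a (s m) * a (s n)"
        using N0[of m] N0[of n] that L by (intro mult_strict_mono) auto
      moreover have "a (s n \<ominus> s m) < e * (L / 2 * (L / 2))" using N1[of n m] that by simp
      ultimately have "(L / 2 * (L / 2)) * a (t m \<ominus> t n) < (L / 2 * (L / 2)) * e"
        using abs_nonneg[of "t m \<ominus> t n"] tn
        by (smt (verit) mult.commute mult_right_mono minus_closed)
      then show ?thesis using L by simp
    qed
    then show "\<exists>N. \<forall>m\<ge>N. \<forall>n\<ge>N. a (t m \<ominus> t n) < e" by blast
  qed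
  have t_lim: "(\<lambda>n. a (t n)) \<longlonglongrightarrow> inverse L"
  proof (rule Lim_transform_eventually)
    show "(\<lambda>n. inverse (a (s n))) \<longlonglongrightarrow> inverse L" using lim L by (intro tendsto_inverse) auto
    show "\<forall>\<^sub>F n in sequentially. inverse (a (s n)) = a (t n)"
      using eventually_ge_at_top[of N0] by eventually_elim (use cl s0 in \<open>simp add: t_def abs_inverse\<close>)
  qed
  have "t \<otimes>\<^bsub>C\<^esub> s \<ominus>\<^bsub>C\<^esub> \<one>\<^bsub>C\<^esub> \<in> N"
  proof -
    have d: "t \<otimes>\<^bsub>C\<^esub> s \<ominus>\<^bsub>C\<^esub> \<one>\<^bsub>C\<^esub> \<in> carrier C" using tC s by simp
    have "(t \<otimes>\<^bsub>C\<^esub> s \<ominus>\<^bsub>C\<^esub> \<one>\<^bsub>C\<^esub>) n = \<zero>" if "N0 \<le> n" for n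
    proof -
      have "(t \<otimes>\<^bsub>C\<^esub> s \<ominus>\<^bsub>C\<^esub> \<one>\<^bsub>C\<^esub>) n \<oplus> \<one> = ((t \<otimes>\<^bsub>C\<^esub> s \<ominus>\<^bsub>C\<^esub> \<one>\<^bsub>C\<^esub>) \<oplus>\<^bsub>C\<^esub> \<one>\<^bsub>C\<^esub>) n"
        by (simp add: cauchy_simps)
      also have "\<dots> = (t \<otimes>\<^bsub>C\<^esub> s) n" using tC s by (simp only: C.add_minus_cancel C.m_closed C.one_closed)
      also have "\<dots> = \<one>" using cl s0[OF that] that by (simp add: cauchy_simps t_def field_Units)
      finally show ?thesis
        using cauchy_closed[OF d, of n] by (metis add.r_cancel_one one_closed)
    qed
    then have "\<forall>\<^sub>F n in sequentially. a ((t \<otimes>\<^bsub>C\<^esub> s \<ominus>\<^bsub>C\<^esub> \<one>\<^bsub>C\<^esub>) n) = 0"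
      using abs_zero by (auto simp: eventually_sequentially intro!: exI[of _ N0])
    then show ?thesis using d by (simp add: null_iff tendsto_eventually)
  qed
  then have "limit (t \<otimes>\<^bsub>C\<^esub> s \<ominus>\<^bsub>C\<^esub> \<one>\<^bsub>C\<^esub>) = \<zero>\<^bsub>K\<^esub>" by (rule limit_null)
  moreover have "t \<otimes>\<^bsub>C\<^esub> s = (t \<otimes>\<^bsub>C\<^esub> s \<ominus>\<^bsub>C\<^esub> \<one>\<^bsub>C\<^esub>) \<oplus>\<^bsub>C\<^esub> \<one>\<^bsub>C\<^esub>"
    using tC s by (simp only: C.add_minus_cancel C.m_closed C.one_closed)
  ultimately have "limit (t \<otimes>\<^bsub>C\<^esub> s) = \<one>\<^bsub>K\<^esub>"
    using limit_simps(3)[of "t \<otimes>\<^bsub>C\<^esub> s \<ominus>\<^bsub>C\<^esub> \<one>\<^bsub>C\<^esub>" "\<one>\<^bsub>C\<^esub>"] tC s by (simp add: limit_simps(4))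
  then have "limit t \<otimes>\<^bsub>K\<^esub> Z = \<one>\<^bsub>K\<^esub>" using tC s by (simp add: Zs limit_simps)
  then show ?thesis
    using limit_simps(1)[OF tC] completion_abs_eq[OF tC t_lim] by (auto simp: L_def)
qed

lemma completion_abs_zero_imp: "\<lbrakk>Z \<in> carrier K; completion_abs a Z = 0\<rbrakk> \<Longrightarrow> Z = \<zero>\<^bsub>K\<^esub>"
  using limit_abs limit_null by (metis completion_cases null_iff)

lemma completion_abs_const: "completion_abs a \<zero>\<^bsub>K\<^esub> = 0" "completion_abs a \<one>\<^bsub>K\<^esub> = 1"
proof -
  interpret C: cring C by (rule cauchy_cring)
  have "\<zero>\<^bsub>C\<^esub> \<in> N" by (auto simp: null_iff cauchy_simps abs_zero)
  then show "completion_abs a \<zero>\<^bsub>K\<^esub> = 0"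
    using completion_abs_eq[of "\<zero>\<^bsub>C\<^esub>" 0] by (simp add: limit_null cauchy_simps abs_zero)
  show "completion_abs a \<one>\<^bsub>K\<^esub> = 1"
    using completion_abs_eq[of "\<one>\<^bsub>C\<^esub>" 1] by (simp add: limit_simps(4) cauchy_simps abs_one)
qed

lemma completion_integersI: "\<lbrakk>Z \<in> carrier K; completion_abs a Z \<le> 1\<rbrakk> \<Longrightarrow> Z \<in> completion_integers F a"
  by (simp add: completion_integers_def)

lemma completion_integers_closed:
  assumes na: "nonarchimedean F a" and Z: "Z \<in> completion_integers F a" and Y: "Y \<in> completion_integers F a"
  shows "Z \<oplus>\<^bsub>K\<^esub> Y \<in> completion_integers F a" "Z \<otimes>\<^bsub>K\<^esub> Y \<in> completion_integers F a"
    "\<ominus>\<^bsub>K\<^esub> Z \<in> completion_integers F a"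
proof -
  interpret C: cring C by (rule cauchy_cring)
  interpret K: cring K by (rule completion_cring)
  have mult: "P \<otimes>\<^bsub>K\<^esub> Q \<in> completion_integers F a" 
    if P: "P \<in> completion_integers F a" and Q: "Q \<in> completion_integers F a" for P Q
  proof -
    obtain s where s: "s \<in> carrier C" "P = limit s" using P completion_cases by (auto simp: completion_integers_def)
    obtain t where t: "t \<in> carrier C" "Q = limit t" using Q completion_cases by (auto simp: completion_integers_def)
    have "(\<lambda>n. a ((s \<otimes>\<^bsub>C\<^esub> t) n)) \<longlonglongrightarrow> completion_abs a P * completion_abs a Q"
      using tendsto_mult[OF limit_abs[OF s(1)] limit_abs[OF t(1)]] cauchy_closed s t
      by (simp add: cauchy_simps abs_mult)
    then have "completion_abs a (P \<otimes>\<^bsub>K\<^esub> Q) = completion_abs a P * completion_abs a Q"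
      using completion_abs_eq s t by (simp add: limit_simps(2)[symmetric])
    moreover have "0 \<le> completion_abs a P" "0 \<le> completion_abs a Q"
      using limit_abs[OF s(1)] limit_abs[OF t(1)] abs_nonneg cauchy_closed s t
      by (auto intro!: LIMSEQ_le_const)
    ultimately show ?thesis
      using P Q by (auto simp: completion_integers_def mult_le_one)
  qed
  show "Z \<otimes>\<^bsub>K\<^esub> Y \<in> completion_integers F a" by (rule mult[OF Z Y])
  have "(\<lambda>n. a ((\<ominus>\<^bsub>C\<^esub> \<one>\<^bsub>C\<^esub>) n)) \<longlonglongrightarrow> 1"
  proof -
    have "\<ominus>\<^bsub>C\<^esub> \<one>\<^bsub>C\<^esub> = (\<lambda>n. \<ominus> \<one>)"
      using cauchy_const[of "\<ominus> \<one>"] by (intro C.minus_equality) (auto simp: fun_eq_iff cauchy_simps l_neg)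
    then show ?thesis by (simp add: abs_uminus abs_one)
  qed
  then have "completion_abs a (limit (\<ominus>\<^bsub>C\<^esub> \<one>\<^bsub>C\<^esub>)) = 1" by (intro completion_abs_eq) simp_all
  then have "limit (\<ominus>\<^bsub>C\<^esub> \<one>\<^bsub>C\<^esub>) \<in> completion_integers F a"
    by (intro completion_integersI) (simp_all add: limit_simps(1))
  moreover have "limit (\<ominus>\<^bsub>C\<^esub> \<one>\<^bsub>C\<^esub>) = \<ominus>\<^bsub>K\<^esub> \<one>\<^bsub>K\<^esub>"
  proof -
    have "limit (\<ominus>\<^bsub>C\<^esub> \<one>\<^bsub>C\<^esub>) \<oplus>\<^bsub>K\<^esub> \<one>\<^bsub>K\<^esub> = limit (\<ominus>\<^bsub>C\<^esub> \<one>\<^bsub>C\<^esub> \<oplus>\<^bsub>C\<^esub> \<one>\<^bsub>C\<^esub>)"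
      by (simp add: limit_simps(3,4) del: C.l_neg)
    also have "\<dots> = \<zero>\<^bsub>K\<^esub>"
      using limit_null[OF additive_subgroup.zero_closed[OF ideal.axioms(1)[OF null_ideal]]] by (simp add: C.l_neg)
    finally show ?thesis by (simp add: K.minus_equality limit_simps(1))
  qed
  ultimately show "\<ominus>\<^bsub>K\<^esub> Z \<in> completion_integers F a"
    using mult[of "\<ominus>\<^bsub>K\<^esub> \<one>\<^bsub>K\<^esub>" Z] Z by (simp add: K.l_minus completion_integers_def)
  obtain s where s: "s \<in> carrier C" "Z = limit s" using Z completion_cases by (auto simp: completion_integers_def)
  obtain t where t: "t \<in> carrier C" "Y = limit t" using Y completion_cases by (auto simp: completion_integers_def)
  have ZY: "Z \<oplus>\<^bsub>K\<^esub> Y = limit (s \<oplus>\<^bsub>C\<^esub> t)" using s t by (simp add: limit_simps)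
  have "completion_abs a (Z \<oplus>\<^bsub>K\<^esub> Y) \<le> max (completion_abs a Z) (completion_abs a Y)"
  proof (rule LIMSEQ_le)
    show "(\<lambda>n. a ((s \<oplus>\<^bsub>C\<^esub> t) n)) \<longlonglongrightarrow> completion_abs a (Z \<oplus>\<^bsub>K\<^esub> Y)"
      unfolding ZY using s t by (intro limit_abs) simp
    show "(\<lambda>n. max (a (s n)) (a (t n))) \<longlonglongrightarrow> max (completion_abs a Z) (completion_abs a Y)"
      using limit_abs[OF s(1)] limit_abs[OF t(1)] s t by (intro tendsto_max) simp_all
    show "\<exists>N. \<forall>n\<ge>N. a ((s \<oplus>\<^bsub>C\<^esub> t) n) \<le> max (a (s n)) (a (t n))"
      using na cauchy_closed[OF s(1)] cauchy_closed[OF t(1)] by (auto simp: nonarchimedean_def cauchy_simps)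
  qed
  then show "Z \<oplus>\<^bsub>K\<^esub> Y \<in> completion_integers F a"
    using Z Y by (auto simp: completion_integers_def)
qed

text \<open>If \<open>\<bar>s\<bar> < 1\<close> then \<open>\<bar>1 - s\<bar> = 1\<close> by the ultrametric inequality.\<close>

lemma completion_abs_one_minus:
  assumes na: "nonarchimedean F a" and Z: "Z \<in> carrier K" "completion_abs a Z < 1"
  shows "completion_abs a (\<one>\<^bsub>K\<^esub> \<ominus>\<^bsub>K\<^esub> Z) = 1"
proof -
  interpret C: cring C by (rule cauchy_cring)
  interpret K: cring K by (rule completion_cring)
  obtain s where s: "s \<in> carrier C" "Z = limit s" using Z(1) by (rule completion_cases)
  note cl = cauchy_closed[OF s(1)]
  define t where "t n = \<one> \<ominus> s n" for n
  have tC: "t \<in> carrier C"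
    using cauchy_add[OF cauchy_const[OF one_closed] cauchy_uminus[OF s(1)]]
    unfolding t_def[abs_def] minus_eq .
  have "t \<oplus>\<^bsub>C\<^esub> s = \<one>\<^bsub>C\<^esub>" using cl by (auto simp: fun_eq_iff cauchy_simps t_def add_minus_cancel)
  then have "limit t \<oplus>\<^bsub>K\<^esub> Z = \<one>\<^bsub>K\<^esub>" using limit_simps(3)[OF tC s(1)] s(2) limit_simps(4) by simp
  then have eq: "\<one>\<^bsub>K\<^esub> \<ominus>\<^bsub>K\<^esub> Z = limit t"
    using K.add_minus_cancel(2)[OF limit_simps(1)[OF tC] Z(1)] by simp
  have "\<forall>\<^sub>F n in sequentially. a (s n) < 1"
    using limit_abs[OF s(1)] Z(2) s(2) by (intro order_tendstoD) auto
  then have "\<forall>\<^sub>F n in sequentially. a (t n) = 1"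
  proof eventually_elim
    case (elim n)
    have "a (t n) \<le> max 1 (a (s n))"
      using na cl[of n] abs_uminus[OF cl[of n]] abs_one unfolding nonarchimedean_def t_def minus_eq
      by (metis a_inv_closed one_closed)
    moreover have "a (t n \<oplus> s n) \<le> max (a (t n)) (a (s n))"
      using na cl[of n] cauchy_closed[OF tC, of n] by (simp add: nonarchimedean_def)
    moreover have "t n \<oplus> s n = \<one>" using cl[of n] by (simp add: t_def add_minus_cancel)
    ultimately show ?case using elim abs_one by auto
  qed
  then show ?thesis
    unfolding eq by (intro completion_abs_eq[OF tC]) (simp add: tendsto_eventually)
qed

text \<open>At a nonarchimedean place \<open>e\<close> is \<open>0\<close> or \<open>1\<close> according as \<open>\<bar>Z\<bar> < 1\<close> or \<open>\<bar>Z\<bar> \<ge> 1\<close>, so that the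
  inverse of \<open>1 - Z\<close> or of \<open>Z\<close> that is needed is integral.\<close>

lemma completion_exchange:
  assumes Z: "Z \<in> carrier K"
  shows "\<exists>e\<in>carrier K. \<exists>P\<in>carrier K. \<exists>Q\<in>carrier K. e \<otimes>\<^bsub>K\<^esub> e = e \<and> e = P \<otimes>\<^bsub>K\<^esub> Z \<and>
    \<one>\<^bsub>K\<^esub> \<ominus>\<^bsub>K\<^esub> e = Q \<otimes>\<^bsub>K\<^esub> (\<one>\<^bsub>K\<^esub> \<ominus>\<^bsub>K\<^esub> Z) \<and>
    (nonarchimedean F a \<longrightarrow> {e, P, Q} \<subseteq> completion_integers F a)"
proof -
  interpret K: cring K by (rule completion_cring)
  have int: "\<zero>\<^bsub>K\<^esub> \<in> completion_integers F a" "\<one>\<^bsub>K\<^esub> \<in> completion_integers F a"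
    by (simp_all add: completion_integers_def completion_abs_const)
  have m: "\<one>\<^bsub>K\<^esub> \<ominus>\<^bsub>K\<^esub> \<zero>\<^bsub>K\<^esub> = \<one>\<^bsub>K\<^esub>" "\<one>\<^bsub>K\<^esub> \<ominus>\<^bsub>K\<^esub> \<one>\<^bsub>K\<^esub> = \<zero>\<^bsub>K\<^esub>" by (simp_all add: K.minus_eq K.r_neg)
  consider "nonarchimedean F a" "completion_abs a Z < 1" | "\<not> (nonarchimedean F a \<and> completion_abs a Z < 1)" "completion_abs a Z \<noteq> 0"
    | "\<not> nonarchimedean F a" "completion_abs a Z = 0" by force
  then show ?thesis
  proof cases
    case 1
    have "completion_abs a (\<one>\<^bsub>K\<^esub> \<ominus>\<^bsub>K\<^esub> Z) = 1" by (rule completion_abs_one_minus[OF 1(1) Z 1(2)])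
    then obtain Q where "Q \<in> carrier K" "Q \<otimes>\<^bsub>K\<^esub> (\<one>\<^bsub>K\<^esub> \<ominus>\<^bsub>K\<^esub> Z) = \<one>\<^bsub>K\<^esub>" "completion_abs a Q = 1"
      using completion_inverse[of "\<one>\<^bsub>K\<^esub> \<ominus>\<^bsub>K\<^esub> Z"] Z by auto
    then show ?thesis
      using Z int m completion_integersI[of Q]
      by (intro bexI[of _ "\<zero>\<^bsub>K\<^esub>"] bexI[of _ Q]) simp_all
  next
    case 2
    then obtain P where P: "P \<in> carrier K" "P \<otimes>\<^bsub>K\<^esub> Z = \<one>\<^bsub>K\<^esub>" "completion_abs a P = inverse (completion_abs a Z)"
      using completion_inverse[OF Z] by blast
    have "P \<in> completion_integers F a" if "nonarchimedean F a"
      using that 2 P by (intro completion_integersI) (auto simp: inverse_le_1_iff)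
    then show ?thesis
      using Z int m P by (intro bexI[of _ "\<one>\<^bsub>K\<^esub>"] bexI[OF _ P(1)] bexI[of _ "\<zero>\<^bsub>K\<^esub>"]) simp_all
  next
    case 3
    then have "Z = \<zero>\<^bsub>K\<^esub>" using completion_abs_zero_imp Z by blast
    then show ?thesis
      using 3 m by (intro bexI[of _ "\<zero>\<^bsub>K\<^esub>"] bexI[of _ "\<one>\<^bsub>K\<^esub>"]) simp_all
  qed
qed

end

lemma place_abs_value:
  assumes "v \<in> places F"
  shows "nontrivial_abs_value F (place_abs v)"
proof -
  obtain b where b: "nontrivial_abs_value F b" "v = abs_value_equiv F `` {b}"
    using assms by (auto simp: places_def quotient_def)
  have "b x = b x powr 1" if "x \<in> carrier F" for x
    using b(1) that by (auto simp: nontrivial_abs_value_def)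
  then have "(b, b) \<in> abs_value_equiv F"
    using b(1) unfolding abs_value_equiv_def by (auto intro!: exI[of _ "1::real"])
  then have "b \<in> v" by (simp add: b(2))
  then have "place_abs v \<in> v" unfolding place_abs_def by (rule someI[of "\<lambda>a. a \<in> v"])
  then show ?thesis by (auto simp: b(2) abs_value_equiv_def)
qed

text \<open>For commutative rings this is equivalent to the lifting of idempotents modulo every ideal.\<close>

definition exchange_ring :: "('a, 'm) ring_scheme \<Rightarrow> bool" where
  "exchange_ring A \<longleftrightarrow> cring A \<and> (\<forall>x\<in>carrier A. \<exists>e\<in>carrier A. \<exists>p\<in>carrier A. \<exists>q\<in>carrier A.
     e \<otimes>\<^bsub>A\<^esub> e = e \<and> e = p \<otimes>\<^bsub>A\<^esub> x \<and> \<one>\<^bsub>A\<^esub> \<ominus>\<^bsub>A\<^esub> e = q \<otimes>\<^bsub>A\<^esub> (\<one>\<^bsub>A\<^esub> \<ominus>\<^bsub>A\<^esub> x))"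

context
  fixes F :: "('a, 'm) ring_scheme"
  assumes F: "field F"
begin

lemma valued: "v \<in> places F \<Longrightarrow> valued_field F (place_abs v)"
  using F place_abs_value by (simp add: valued_field_def valued_field_axioms_def)

abbreviation Kv where "Kv v \<equiv> completion F (place_abs v)"

abbreviation Ov where "Ov v \<equiv> completion_integers F (place_abs v)"

abbreviation bad where "bad x \<equiv> {v \<in> places F. nonarchimedean F (place_abs v) \<and> x v \<notin> Ov v}"

lemma Kv_cring: "v \<in> places F \<Longrightarrow> cring (Kv v)"
  by (rule valued_field.completion_cring[OF valued])

lemma adele_iff: "x \<in> carrier (adele_ring F) \<longleftrightarrow> x \<in> (\<Pi>\<^sub>E v\<in>places F. carrier (Kv v)) \<and> finite (bad x)"
  by (simp add: adele_ring_def)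

lemma adele_component: "\<lbrakk>x \<in> carrier (adele_ring F); v \<in> places F\<rbrakk> \<Longrightarrow> x v \<in> carrier (Kv v)"
  by (auto simp: adele_iff)

lemma adele_simps:
  "x \<otimes>\<^bsub>adele_ring F\<^esub> y = (\<lambda>v\<in>places F. x v \<otimes>\<^bsub>Kv v\<^esub> y v)"
  "x \<oplus>\<^bsub>adele_ring F\<^esub> y = (\<lambda>v\<in>places F. x v \<oplus>\<^bsub>Kv v\<^esub> y v)"
  "\<one>\<^bsub>adele_ring F\<^esub> = (\<lambda>v\<in>places F. \<one>\<^bsub>Kv v\<^esub>)" "\<zero>\<^bsub>adele_ring F\<^esub> = (\<lambda>v\<in>places F. \<zero>\<^bsub>Kv v\<^esub>)"
  by (simp_all add: adele_ring_def)

lemma adele_eqI: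
  assumes "x \<in> carrier (adele_ring F)" "y \<in> carrier (adele_ring F)" "\<And>v. v \<in> places F \<Longrightarrow> x v = y v"
  shows "x = y"
  using assms by (auto simp: adele_iff intro: PiE_ext)

lemma adeleI:
  assumes "\<And>v. v \<in> places F \<Longrightarrow> f v \<in> carrier (Kv v)" "finite B"
    "\<And>v. \<lbrakk>v \<in> places F; nonarchimedean F (place_abs v); v \<notin> B\<rbrakk> \<Longrightarrow> f v \<in> Ov v"
  shows "(\<lambda>v\<in>places F. f v) \<in> carrier (adele_ring F)"
proof -
  have "bad (\<lambda>v\<in>places F. f v) \<subseteq> B" using assms(3) by auto
  then have "finite (bad (\<lambda>v\<in>places F. f v))" by (rule finite_subset[OF _ assms(2)])
  then show ?thesis using assms(1) unfolding adele_iff by auto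
qed

lemma adele_closed:
  assumes x: "x \<in> carrier (adele_ring F)" and y: "y \<in> carrier (adele_ring F)"
  shows "x \<otimes>\<^bsub>adele_ring F\<^esub> y \<in> carrier (adele_ring F)" "x \<oplus>\<^bsub>adele_ring F\<^esub> y \<in> carrier (adele_ring F)"
    "(\<lambda>v\<in>places F. \<ominus>\<^bsub>Kv v\<^esub> x v) \<in> carrier (adele_ring F)"
proof -
  have fin: "finite (bad x \<union> bad y)" using x y by (simp add: adele_iff)
  note K = cring.axioms(1)[OF Kv_cring]
  note c = valued_field.completion_integers_closed[OF valued]
  show "x \<otimes>\<^bsub>adele_ring F\<^esub> y \<in> carrier (adele_ring F)"
    unfolding adele_simps using adele_component[OF x] adele_component[OF y] K c
    by (intro adeleI[OF _ fin]) (auto intro: ring.ring_simprules)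
  show "x \<oplus>\<^bsub>adele_ring F\<^esub> y \<in> carrier (adele_ring F)"
    unfolding adele_simps using adele_component[OF x] adele_component[OF y] K c
    by (intro adeleI[OF _ fin]) (auto intro: ring.ring_simprules)
  show "(\<lambda>v\<in>places F. \<ominus>\<^bsub>Kv v\<^esub> x v) \<in> carrier (adele_ring F)"
    using adele_component[OF x] K c
    by (intro adeleI[OF _ fin]) (auto intro: ring.ring_simprules)
qed

lemma adele_const: "\<one>\<^bsub>adele_ring F\<^esub> \<in> carrier (adele_ring F)" "\<zero>\<^bsub>adele_ring F\<^esub> \<in> carrier (adele_ring F)"
proof -
  have "\<one>\<^bsub>Kv v\<^esub> \<in> carrier (Kv v)" "\<zero>\<^bsub>Kv v\<^esub> \<in> carrier (Kv v)" if "v \<in> places F" for v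
    using cring.axioms(1)[OF Kv_cring[OF that]] ring.ring_simprules(2,6) by blast+
  then show "\<one>\<^bsub>adele_ring F\<^esub> \<in> carrier (adele_ring F)" "\<zero>\<^bsub>adele_ring F\<^esub> \<in> carrier (adele_ring F)"
    unfolding adele_simps using valued_field.completion_abs_const[OF valued]
    by (intro adeleI[of _ "{}"]; simp add: completion_integers_def)+
qed

lemma adele_cring: "cring (adele_ring F)"
proof (rule cringI)
  have K: "cring (Kv v)" if "v \<in> places F" for v by (rule Kv_cring[OF that])
  note R = cring.axioms(1)[OF K]
  show "abelian_group (adele_ring F)"
  proof (rule abelian_groupI)
    fix x y z assume xyz: "x \<in> carrier (adele_ring F)" "y \<in> carrier (adele_ring F)" "z \<in> carrier (adele_ring F)"
    note c = adele_component[OF xyz(1)] adele_component[OF xyz(2)] adele_component[OF xyz(3)]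
    show "x \<oplus>\<^bsub>adele_ring F\<^esub> y \<oplus>\<^bsub>adele_ring F\<^esub> z = x \<oplus>\<^bsub>adele_ring F\<^esub> (y \<oplus>\<^bsub>adele_ring F\<^esub> z)"
      using c R by (intro adele_eqI adele_closed xyz) (simp add: adele_simps ring.ring_simprules(7))
  next
    fix x y assume xy: "x \<in> carrier (adele_ring F)" "y \<in> carrier (adele_ring F)"
    note c = adele_component[OF xy(1)] adele_component[OF xy(2)]
    show "x \<oplus>\<^bsub>adele_ring F\<^esub> y = y \<oplus>\<^bsub>adele_ring F\<^esub> x"
      using c R by (intro adele_eqI adele_closed xy) (simp add: adele_simps ring.ring_simprules(10))
  next
    fix x assume x: "x \<in> carrier (adele_ring F)"
    note c = adele_component[OF x]
    show "\<zero>\<^bsub>adele_ring F\<^esub> \<oplus>\<^bsub>adele_ring F\<^esub> x = x"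
      using c R by (intro adele_eqI adele_closed adele_const x) (simp add: adele_simps ring.ring_simprules(8))
    have "(\<lambda>v\<in>places F. \<ominus>\<^bsub>Kv v\<^esub> x v) \<oplus>\<^bsub>adele_ring F\<^esub> x = \<zero>\<^bsub>adele_ring F\<^esub>"
      using c R by (intro adele_eqI[OF adele_closed(2)[OF adele_closed(3)[OF x x] x] adele_const(2)])
        (simp add: adele_simps ring.ring_simprules(9))
    then show "\<exists>y\<in>carrier (adele_ring F). y \<oplus>\<^bsub>adele_ring F\<^esub> x = \<zero>\<^bsub>adele_ring F\<^esub>"
      using adele_closed(3)[OF x x] by blast
  qed (simp_all add: adele_closed adele_const)
  show "comm_monoid (adele_ring F)"
  proof (rule comm_monoidI)
    fix x y z assume xyz: "x \<in> carrier (adele_ring F)" "y \<in> carrier (adele_ring F)" "z \<in> carrier (adele_ring F)"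
    note c = adele_component[OF xyz(1)] adele_component[OF xyz(2)] adele_component[OF xyz(3)]
    show "x \<otimes>\<^bsub>adele_ring F\<^esub> y \<otimes>\<^bsub>adele_ring F\<^esub> z = x \<otimes>\<^bsub>adele_ring F\<^esub> (y \<otimes>\<^bsub>adele_ring F\<^esub> z)"
      using c R by (intro adele_eqI adele_closed xyz) (simp add: adele_simps ring.ring_simprules(11))
  next
    fix x y assume xy: "x \<in> carrier (adele_ring F)" "y \<in> carrier (adele_ring F)"
    note c = adele_component[OF xy(1)] adele_component[OF xy(2)]
    show "x \<otimes>\<^bsub>adele_ring F\<^esub> y = y \<otimes>\<^bsub>adele_ring F\<^esub> x"
      using c K by (intro adele_eqI adele_closed xy) (simp add: adele_simps cring.cring_simprules(14))
  next
    fix x assume x: "x \<in> carrier (adele_ring F)"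
    note c = adele_component[OF x]
    show "\<one>\<^bsub>adele_ring F\<^esub> \<otimes>\<^bsub>adele_ring F\<^esub> x = x"
      using c R by (intro adele_eqI adele_closed adele_const x) (simp add: adele_simps ring.ring_simprules(12))
  qed (simp_all add: adele_closed adele_const)
  fix x y z assume xyz: "x \<in> carrier (adele_ring F)" "y \<in> carrier (adele_ring F)" "z \<in> carrier (adele_ring F)"
  note c = adele_component[OF xyz(1)] adele_component[OF xyz(2)] adele_component[OF xyz(3)]
  show "(x \<oplus>\<^bsub>adele_ring F\<^esub> y) \<otimes>\<^bsub>adele_ring F\<^esub> z = x \<otimes>\<^bsub>adele_ring F\<^esub> z \<oplus>\<^bsub>adele_ring F\<^esub> y \<otimes>\<^bsub>adele_ring F\<^esub> z"
    using c R by (intro adele_eqI adele_closed xyz) (simp add: adele_simps ring.ring_simprules(13))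
qed

lemma adele_minus_component:
  assumes x: "x \<in> carrier (adele_ring F)" and y: "y \<in> carrier (adele_ring F)" and v: "v \<in> places F"
  shows "(x \<ominus>\<^bsub>adele_ring F\<^esub> y) v = x v \<ominus>\<^bsub>Kv v\<^esub> y v"
proof -
  interpret A: cring "adele_ring F" by (rule adele_cring)
  interpret K: cring "Kv v" by (rule Kv_cring[OF v])
  have d: "x \<ominus>\<^bsub>adele_ring F\<^esub> y \<in> carrier (adele_ring F)" using x y by simp
  have "(x \<ominus>\<^bsub>adele_ring F\<^esub> y \<oplus>\<^bsub>adele_ring F\<^esub> y) v = x v" using x y by (simp add: A.add_minus_cancel)
  then have "(x \<ominus>\<^bsub>adele_ring F\<^esub> y) v \<oplus>\<^bsub>Kv v\<^esub> y v = x v" using v by (simp add: adele_simps)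
  then show ?thesis
    using K.add_minus_cancel(2)[OF adele_component[OF d v] adele_component[OF y v]] by simp
qed

text \<open>The witnesses are chosen place by place; as they are integral at every nonarchimedean place, they
  form adeles.\<close>

theorem adele_exchange_ring: "exchange_ring (adele_ring F)"
  unfolding exchange_ring_def
proof (intro conjI ballI adele_cring)
  interpret A: cring "adele_ring F" by (rule adele_cring)
  fix x assume x: "x \<in> carrier (adele_ring F)"
  have "\<forall>v\<in>places F. \<exists>w. fst w \<in> carrier (Kv v) \<and> fst (snd w) \<in> carrier (Kv v) \<and> snd (snd w) \<in> carrier (Kv v) \<and>
      fst w \<otimes>\<^bsub>Kv v\<^esub> fst w = fst w \<and> fst w = fst (snd w) \<otimes>\<^bsub>Kv v\<^esub> x v \<and>
      \<one>\<^bsub>Kv v\<^esub> \<ominus>\<^bsub>Kv v\<^esub> fst w = snd (snd w) \<otimes>\<^bsub>Kv v\<^esub> (\<one>\<^bsub>Kv v\<^esub> \<ominus>\<^bsub>Kv v\<^esub> x v) \<and>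
      (nonarchimedean F (place_abs v) \<longrightarrow> {fst w, fst (snd w), snd (snd w)} \<subseteq> Ov v)"
  proof
    fix v assume v: "v \<in> places F"
    obtain e P Q where "e \<in> carrier (Kv v)" "P \<in> carrier (Kv v)" "Q \<in> carrier (Kv v)"
      "e \<otimes>\<^bsub>Kv v\<^esub> e = e" "e = P \<otimes>\<^bsub>Kv v\<^esub> x v" "\<one>\<^bsub>Kv v\<^esub> \<ominus>\<^bsub>Kv v\<^esub> e = Q \<otimes>\<^bsub>Kv v\<^esub> (\<one>\<^bsub>Kv v\<^esub> \<ominus>\<^bsub>Kv v\<^esub> x v)"
      "nonarchimedean F (place_abs v) \<longrightarrow> {e, P, Q} \<subseteq> Ov v"
      using valued_field.completion_exchange[OF valued[OF v] adele_component[OF x v]]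
      by (elim bexE conjE) (rule that; assumption)
    then show "\<exists>w. fst w \<in> carrier (Kv v) \<and> fst (snd w) \<in> carrier (Kv v) \<and> snd (snd w) \<in> carrier (Kv v) \<and>
      fst w \<otimes>\<^bsub>Kv v\<^esub> fst w = fst w \<and> fst w = fst (snd w) \<otimes>\<^bsub>Kv v\<^esub> x v \<and>
      \<one>\<^bsub>Kv v\<^esub> \<ominus>\<^bsub>Kv v\<^esub> fst w = snd (snd w) \<otimes>\<^bsub>Kv v\<^esub> (\<one>\<^bsub>Kv v\<^esub> \<ominus>\<^bsub>Kv v\<^esub> x v) \<and>
      (nonarchimedean F (place_abs v) \<longrightarrow> {fst w, fst (snd w), snd (snd w)} \<subseteq> Ov v)"
      by (intro exI[of _ "(e, P, Q)"]) simp
  qed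
  from bchoice[OF this] obtain w where all: "\<forall>v\<in>places F. fst (w v) \<in> carrier (Kv v) \<and> fst (snd (w v)) \<in> carrier (Kv v) \<and> snd (snd (w v)) \<in> carrier (Kv v) \<and>
      fst (w v) \<otimes>\<^bsub>Kv v\<^esub> fst (w v) = fst (w v) \<and> fst (w v) = fst (snd (w v)) \<otimes>\<^bsub>Kv v\<^esub> x v \<and>
      \<one>\<^bsub>Kv v\<^esub> \<ominus>\<^bsub>Kv v\<^esub> fst (w v) = snd (snd (w v)) \<otimes>\<^bsub>Kv v\<^esub> (\<one>\<^bsub>Kv v\<^esub> \<ominus>\<^bsub>Kv v\<^esub> x v) \<and>
      (nonarchimedean F (place_abs v) \<longrightarrow> {fst (w v), fst (snd (w v)), snd (snd (w v))} \<subseteq> Ov v)"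
    by (rule exE)
  have w: "fst (w v) \<in> carrier (Kv v)" "fst (snd (w v)) \<in> carrier (Kv v)" "snd (snd (w v)) \<in> carrier (Kv v)"
      "fst (w v) \<otimes>\<^bsub>Kv v\<^esub> fst (w v) = fst (w v)" "fst (w v) = fst (snd (w v)) \<otimes>\<^bsub>Kv v\<^esub> x v"
      "\<one>\<^bsub>Kv v\<^esub> \<ominus>\<^bsub>Kv v\<^esub> fst (w v) = snd (snd (w v)) \<otimes>\<^bsub>Kv v\<^esub> (\<one>\<^bsub>Kv v\<^esub> \<ominus>\<^bsub>Kv v\<^esub> x v)"
      "nonarchimedean F (place_abs v) \<longrightarrow> {fst (w v), fst (snd (w v)), snd (snd (w v))} \<subseteq> Ov v"
    if "v \<in> places F" for v using bspec[OF all that] by - (elim conjE, assumption)+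
  define e p q where "e = (\<lambda>v\<in>places F. fst (w v))" and "p = (\<lambda>v\<in>places F. fst (snd (w v)))"
    and "q = (\<lambda>v\<in>places F. snd (snd (w v)))"
  have epq: "e \<in> carrier (adele_ring F)" "p \<in> carrier (adele_ring F)" "q \<in> carrier (adele_ring F)"
    unfolding e_def p_def q_def by (rule adeleI[of _ "{}"]; use w(1-3,7) in simp)+
  have "e \<otimes>\<^bsub>adele_ring F\<^esub> e = e"
    by (rule adele_eqI[OF adele_closed(1)[OF epq(1) epq(1)] epq(1)]) (simp add: adele_simps(1) e_def w(4))
  moreover have "e = p \<otimes>\<^bsub>adele_ring F\<^esub> x"
    by (rule adele_eqI[OF epq(1) adele_closed(1)[OF epq(2) x]]) (simp add: adele_simps(1) e_def p_def w(5))
  moreover have "\<one>\<^bsub>adele_ring F\<^esub> \<ominus>\<^bsub>adele_ring F\<^esub> e = q \<otimes>\<^bsub>adele_ring F\<^esub> (\<one>\<^bsub>adele_ring F\<^esub> \<ominus>\<^bsub>adele_ring F\<^esub> x)"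
  proof (rule adele_eqI)
    fix v assume v: "v \<in> places F"
    show "(\<one>\<^bsub>adele_ring F\<^esub> \<ominus>\<^bsub>adele_ring F\<^esub> e) v = (q \<otimes>\<^bsub>adele_ring F\<^esub> (\<one>\<^bsub>adele_ring F\<^esub> \<ominus>\<^bsub>adele_ring F\<^esub> x)) v"
      using v epq x w(6)[OF v]
      by (simp add: adele_simps(1) adele_minus_component) (simp add: adele_simps(3) e_def q_def)
  qed (use epq x in simp_all)
  ultimately show "\<exists>e\<in>carrier (adele_ring F). \<exists>p\<in>carrier (adele_ring F). \<exists>q\<in>carrier (adele_ring F).
     e \<otimes>\<^bsub>adele_ring F\<^esub> e = e \<and> e = p \<otimes>\<^bsub>adele_ring F\<^esub> x \<and>
     \<one>\<^bsub>adele_ring F\<^esub> \<ominus>\<^bsub>adele_ring F\<^esub> e = q \<otimes>\<^bsub>adele_ring F\<^esub> (\<one>\<^bsub>adele_ring F\<^esub> \<ominus>\<^bsub>adele_ring F\<^esub> x)"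
    using epq by blast
qed

end

section \<open>Tensor products with quadratic algebras\<close>

lemma central_exchange_image:
  assumes R: "involution_ring R star" and A: "exchange_ring A" and \<psi>: "\<psi> \<in> ring_hom A R"
    and central: "\<And>s x. \<lbrakk>s \<in> carrier A; x \<in> carrier R\<rbrakk> \<Longrightarrow> x \<otimes>\<^bsub>R\<^esub> \<psi> s = \<psi> s \<otimes>\<^bsub>R\<^esub> x"
    and fixed: "\<And>s. s \<in> carrier A \<Longrightarrow> star (\<psi> s) = \<psi> s"
  shows "central_exchange R star (\<psi> ` carrier A)"
proof -
  interpret R: involution_ring R star by (rule R)
  interpret A: cring A using A by (simp add: exchange_ring_def)
  interpret h: ring_hom_ring A R \<psi>
    by (rule ring_hom_ringI2[OF A.ring_axioms R.ring_axioms \<psi>])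
  have hom_minus: "\<psi> (x \<ominus>\<^bsub>A\<^esub> y) = \<psi> x \<ominus>\<^bsub>R\<^esub> \<psi> y" if "x \<in> carrier A" "y \<in> carrier A" for x y
    using that by (simp add: A.minus_eq R.minus_eq)
  show ?thesis
  proof
    fix s assume "s \<in> \<psi> ` carrier A"
    then obtain x where x: "x \<in> carrier A" "s = \<psi> x" by blast
    have "\<forall>x\<in>carrier A. \<exists>e\<in>carrier A. \<exists>p\<in>carrier A. \<exists>q\<in>carrier A.
        e \<otimes>\<^bsub>A\<^esub> e = e \<and> e = p \<otimes>\<^bsub>A\<^esub> x \<and> \<one>\<^bsub>A\<^esub> \<ominus>\<^bsub>A\<^esub> e = q \<otimes>\<^bsub>A\<^esub> (\<one>\<^bsub>A\<^esub> \<ominus>\<^bsub>A\<^esub> x)"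
      using A unfolding exchange_ring_def by (rule conjunct2)
    from bspec[OF this x(1)] obtain e p q where epq: "e \<in> carrier A" "p \<in> carrier A" "q \<in> carrier A"
      "e \<otimes>\<^bsub>A\<^esub> e = e" "e = p \<otimes>\<^bsub>A\<^esub> x" "\<one>\<^bsub>A\<^esub> \<ominus>\<^bsub>A\<^esub> e = q \<otimes>\<^bsub>A\<^esub> (\<one>\<^bsub>A\<^esub> \<ominus>\<^bsub>A\<^esub> x)"
      by (elim bexE conjE) (rule that; assumption)
    have "\<psi> e \<otimes>\<^bsub>R\<^esub> \<psi> e = \<psi> e" using epq(1,4) h.hom_mult[of e e] by simp
    moreover have "\<psi> e = \<psi> p \<otimes>\<^bsub>R\<^esub> s" using epq(2,5) x h.hom_mult[of p x] by simp
    moreover have "\<one>\<^bsub>R\<^esub> \<ominus>\<^bsub>R\<^esub> \<psi> e = \<psi> q \<otimes>\<^bsub>R\<^esub> (\<one>\<^bsub>R\<^esub> \<ominus>\<^bsub>R\<^esub> s)"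
      using hom_minus[OF A.one_closed epq(1)] h.hom_mult[of q "\<one>\<^bsub>A\<^esub> \<ominus>\<^bsub>A\<^esub> x"]
        hom_minus[OF A.one_closed x(1)] epq(3,6) x by simp
    ultimately show "\<exists>e\<in>\<psi> ` carrier A. e \<otimes>\<^bsub>R\<^esub> e = e \<and> (\<exists>a\<in>\<psi> ` carrier A. e = a \<otimes>\<^bsub>R\<^esub> s) \<and>
        (\<exists>b\<in>\<psi> ` carrier A. \<one>\<^bsub>R\<^esub> \<ominus>\<^bsub>R\<^esub> e = b \<otimes>\<^bsub>R\<^esub> (\<one>\<^bsub>R\<^esub> \<ominus>\<^bsub>R\<^esub> s))"
      using epq(1-3) by blast
  next
    show "\<zero>\<^bsub>R\<^esub> \<in> \<psi> ` carrier A" using h.hom_zero A.zero_closed by (metis imageI)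
    show "\<one>\<^bsub>R\<^esub> \<in> \<psi> ` carrier A" using h.hom_one A.one_closed by (metis imageI)
    show "s \<oplus>\<^bsub>R\<^esub> t \<in> \<psi> ` carrier A" if st: "s \<in> \<psi> ` carrier A" "t \<in> \<psi> ` carrier A" for s t
    proof -
      obtain x where "s = \<psi> x" "x \<in> carrier A" using st(1) by (rule imageE)
      moreover obtain y where "t = \<psi> y" "y \<in> carrier A" using st(2) by (rule imageE)
      ultimately show ?thesis using h.hom_add[of x y] by (intro image_eqI[of _ _ "x \<oplus>\<^bsub>A\<^esub> y"]) simp_all
    qed
    show "s \<otimes>\<^bsub>R\<^esub> t \<in> \<psi> ` carrier A" if st: "s \<in> \<psi> ` carrier A" "t \<in> \<psi> ` carrier A" for s t
    proof -
      obtain x where "s = \<psi> x" "x \<in> carrier A" using st(1) by (rule imageE)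
      moreover obtain y where "t = \<psi> y" "y \<in> carrier A" using st(2) by (rule imageE)
      ultimately show ?thesis using h.hom_mult[of x y] by (intro image_eqI[of _ _ "x \<otimes>\<^bsub>A\<^esub> y"]) simp_all
    qed
    show "\<ominus>\<^bsub>R\<^esub> s \<in> \<psi> ` carrier A" if st: "s \<in> \<psi> ` carrier A" for s
    proof -
      obtain x where "s = \<psi> x" "x \<in> carrier A" using st by (rule imageE)
      then show ?thesis by (intro image_eqI[of _ _ "\<ominus>\<^bsub>A\<^esub> x"]) simp_all
    qed
    show "s \<in> carrier R" if "s \<in> \<psi> ` carrier A" for s using that by auto
    show "x \<otimes>\<^bsub>R\<^esub> s = s \<otimes>\<^bsub>R\<^esub> x" if "s \<in> \<psi> ` carrier A" "x \<in> carrier R" for s x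
      using that central by blast
    show "star s = s" if "s \<in> \<psi> ` carrier A" for s using that fixed by blast
  qed
qed

text \<open>Here \<open>K\<close> is the image of the ground field in \<open>B\<close>. The last clause covers quadratic extensions and
  quaternion algebras in characteristic 2.\<close>

definition quadratic_algebra :: "('b, 'm) ring_scheme \<Rightarrow> 'b set \<Rightarrow> ('b \<Rightarrow> 'b) \<Rightarrow> bool" where
  "quadratic_algebra B K \<sigma> \<longleftrightarrow> ring B \<and> \<sigma> \<one>\<^bsub>B\<^esub> = \<one>\<^bsub>B\<^esub> \<and>
     (\<forall>b\<in>carrier B. \<sigma> b \<in> carrier B \<and> b \<oplus>\<^bsub>B\<^esub> \<sigma> b \<in> K \<and> b \<otimes>\<^bsub>B\<^esub> \<sigma> b \<in> K) \<and>
     (\<exists>\<theta>\<in>carrier B. \<theta> \<oplus>\<^bsub>B\<^esub> \<sigma> \<theta> = \<one>\<^bsub>B\<^esub>) \<and>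
     ((\<forall>x\<in>carrier B. \<forall>y\<in>carrier B. x \<otimes>\<^bsub>B\<^esub> y = y \<otimes>\<^bsub>B\<^esub> x) \<or> \<one>\<^bsub>B\<^esub> \<oplus>\<^bsub>B\<^esub> \<one>\<^bsub>B\<^esub> = \<zero>\<^bsub>B\<^esub>)"

text \<open>The ring is spanned by the pure tensors \<open>p b c\<close>. A scalar of \<open>B\<close> can be moved across the tensor sign;
  it is enough to know that this ends in some element of \<open>C\<close>.\<close>

locale tensor_presentation = involution_ring R star for R (structure) and star +
  fixes B :: "('d, 'm) ring_scheme" and C :: "('c, 'n) ring_scheme" and p K \<sigma>
  assumes B: "ring B" and C: "cring C"
    and p_closed: "\<lbrakk>b \<in> carrier B; c \<in> carrier C\<rbrakk> \<Longrightarrow> p b c \<in> carrier R"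
    and p_add_left: "\<lbrakk>b \<in> carrier B; b' \<in> carrier B; c \<in> carrier C\<rbrakk> \<Longrightarrow> p (b \<oplus>\<^bsub>B\<^esub> b') c = p b c \<oplus> p b' c"
    and p_add_right: "\<lbrakk>b \<in> carrier B; c \<in> carrier C; c' \<in> carrier C\<rbrakk> \<Longrightarrow> p b (c \<oplus>\<^bsub>C\<^esub> c') = p b c \<oplus> p b c'"
    and p_mult: "\<lbrakk>b \<in> carrier B; b' \<in> carrier B; c \<in> carrier C; c' \<in> carrier C\<rbrakk> \<Longrightarrow>
      p b c \<otimes> p b' c' = p (b \<otimes>\<^bsub>B\<^esub> b') (c \<otimes>\<^bsub>C\<^esub> c')"
    and p_one: "p \<one>\<^bsub>B\<^esub> \<one>\<^bsub>C\<^esub> = \<one>"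
    and p_star: "\<lbrakk>b \<in> carrier B; c \<in> carrier C\<rbrakk> \<Longrightarrow> star (p b c) = p (\<sigma> b) c"
    and p_scalar: "\<lbrakk>k \<in> K; c \<in> carrier C\<rbrakk> \<Longrightarrow> \<exists>d\<in>carrier C. p k c = p \<one>\<^bsub>B\<^esub> d"
    and p_induct: "\<lbrakk>x \<in> carrier R; \<And>b c. \<lbrakk>b \<in> carrier B; c \<in> carrier C\<rbrakk> \<Longrightarrow> P (p b c);
      \<And>x y. \<lbrakk>x \<in> carrier R; y \<in> carrier R; P x; P y\<rbrakk> \<Longrightarrow> P (x \<oplus> y)\<rbrakk> \<Longrightarrow> P x"
begin

lemmas tensor_induct = p_induct [consumes 1, case_names pure add]

text \<open>Traces are additive, and norms are quadratic with polar form a trace, so it is enough that the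
  traces and norms of pure tensors are scalars.\<close>

lemma quadratic_exchange:
  assumes C_exchange: "exchange_ring C" and quad: "quadratic_algebra B K \<sigma>"
  shows "quadratic_exchange R star (p \<one>\<^bsub>B\<^esub> ` carrier C)"
proof -
  interpret B: ring B by (rule B)
  interpret C: cring C by (rule C)
  have \<sigma>: "\<sigma> \<one>\<^bsub>B\<^esub> = \<one>\<^bsub>B\<^esub>" "\<And>b. b \<in> carrier B \<Longrightarrow> \<sigma> b \<in> carrier B"
    "\<And>b. b \<in> carrier B \<Longrightarrow> b \<oplus>\<^bsub>B\<^esub> \<sigma> b \<in> K" "\<And>b. b \<in> carrier B \<Longrightarrow> b \<otimes>\<^bsub>B\<^esub> \<sigma> b \<in> K"
    using quad by (simp_all add: quadratic_algebra_def)
  interpret S: central_exchange R star "p \<one>\<^bsub>B\<^esub> ` carrier C"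
  proof (rule central_exchange_image[OF involution_ring_axioms C_exchange])
    show "p \<one>\<^bsub>B\<^esub> \<in> ring_hom C R"
      by (rule ring_hom_memI) (simp_all add: p_closed p_mult p_add_right p_one)
    show "star (p \<one>\<^bsub>B\<^esub> s) = p \<one>\<^bsub>B\<^esub> s" if "s \<in> carrier C" for s using that by (simp add: p_star \<sigma>)
    show "x \<otimes> p \<one>\<^bsub>B\<^esub> s = p \<one>\<^bsub>B\<^esub> s \<otimes> x" if s: "s \<in> carrier C" and x: "x \<in> carrier R" for s x
      using x
    proof (induction rule: tensor_induct)
      case (pure b c)
      then show ?case using s by (simp add: p_mult C.m_comm[of c s])
    next
      case (add x y)
      then show ?case using s by (simp add: l_distr r_distr p_closed)
    qed
  qed
  have scalar: "p k c \<in> p \<one>\<^bsub>B\<^esub> ` carrier C" if "k \<in> K" "c \<in> carrier C" for k c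
    using p_scalar[OF that] by blast
  have trace: "x \<oplus> star x \<in> p \<one>\<^bsub>B\<^esub> ` carrier C" if "x \<in> carrier R" for x
    using that
  proof (induction rule: tensor_induct)
    case (pure b c)
    then show ?case using scalar[OF \<sigma>(3) pure(2)] pure by (simp add: p_star p_add_left \<sigma>)
  next
    case (add x y)
    have "x \<oplus> y \<oplus> star (x \<oplus> y) = (x \<oplus> star x) \<oplus> (y \<oplus> star y)"
      using add.hyps by (simp add: star_add star_closed a_ac)
    then show ?case using S.S_add[OF add.IH] by simp
  qed
  have norm: "x \<otimes> star x \<in> p \<one>\<^bsub>B\<^esub> ` carrier C" if "x \<in> carrier R" for x
    using that
  proof (induction rule: tensor_induct)
    case (pure b c)
    then show ?case using scalar[OF \<sigma>(4)[OF pure(1)], of "c \<otimes>\<^bsub>C\<^esub> c"] pure by (simp add: p_star p_mult \<sigma>)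
  next
    case (add x y)
    have "star (x \<otimes> star y) = y \<otimes> star x" using add.hyps by (simp add: star_mult star_closed star_star)
    then have "(x \<oplus> y) \<otimes> star (x \<oplus> y) =
        (x \<otimes> star x \<oplus> y \<otimes> star y) \<oplus> (x \<otimes> star y \<oplus> star (x \<otimes> star y))"
      using add.hyps by (simp add: star_add star_closed l_distr r_distr a_ac)
    then show ?case using S.S_add[OF S.S_add[OF add.IH] trace[of "x \<otimes> star y"]] add.hyps by (simp add: star_closed)
  qed
  have trace_one: "\<exists>\<theta>\<in>carrier R. \<theta> \<oplus> star \<theta> = \<one>"
  proof -
    obtain \<theta> where \<theta>: "\<theta> \<in> carrier B" "\<theta> \<oplus>\<^bsub>B\<^esub> \<sigma> \<theta> = \<one>\<^bsub>B\<^esub>" using quad by (auto simp: quadratic_algebra_def)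
    have "p \<theta> \<one>\<^bsub>C\<^esub> \<oplus> star (p \<theta> \<one>\<^bsub>C\<^esub>) = \<one>"
      using \<theta> p_add_left[of \<theta> "\<sigma> \<theta>" "\<one>\<^bsub>C\<^esub>"] by (simp add: p_star \<sigma> p_one)
    then show ?thesis using p_closed[OF \<theta>(1) C.one_closed] by blast
  qed
  have comm: "(\<forall>x\<in>carrier R. \<forall>y\<in>carrier R. x \<otimes> y = y \<otimes> x) \<or> \<one> \<oplus> \<one> = \<zero>"
  proof (cases "\<forall>x\<in>carrier B. \<forall>y\<in>carrier B. x \<otimes>\<^bsub>B\<^esub> y = y \<otimes>\<^bsub>B\<^esub> x")
    case True
    have "x \<otimes> y = y \<otimes> x" if x: "x \<in> carrier R" and y: "y \<in> carrier R" for x y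
      using x
    proof (induction rule: tensor_induct)
      case (pure b c)
      show ?case using y
      proof (induction rule: tensor_induct)
        case (pure b' c')
        then show ?case
          using \<open>b \<in> carrier B\<close> \<open>c \<in> carrier C\<close> bspec[OF bspec[OF True, of b], of b'] C.m_comm[of c c']
          by (simp add: p_mult)
      next
        case (add x y)
        then show ?case using \<open>b \<in> carrier B\<close> \<open>c \<in> carrier C\<close> by (simp add: l_distr r_distr p_closed)
      qed
    next
      case (add x x')
      then show ?case using y by (simp add: l_distr r_distr)
    qed
    then show ?thesis by blast
  next
    case False
    have "(\<forall>x\<in>carrier B. \<forall>y\<in>carrier B. x \<otimes>\<^bsub>B\<^esub> y = y \<otimes>\<^bsub>B\<^esub> x) \<or> \<one>\<^bsub>B\<^esub> \<oplus>\<^bsub>B\<^esub> \<one>\<^bsub>B\<^esub> = \<zero>\<^bsub>B\<^esub>"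
      using quad unfolding quadratic_algebra_def by (elim conjE)
    from this[unfolded disj_imp, THEN mp, OF False] have two: "\<one>\<^bsub>B\<^esub> \<oplus>\<^bsub>B\<^esub> \<one>\<^bsub>B\<^esub> = \<zero>\<^bsub>B\<^esub>" .
    have "p \<zero>\<^bsub>B\<^esub> \<one>\<^bsub>C\<^esub> \<oplus> p \<zero>\<^bsub>B\<^esub> \<one>\<^bsub>C\<^esub> = p \<zero>\<^bsub>B\<^esub> \<one>\<^bsub>C\<^esub>"
      using p_add_left[of "\<zero>\<^bsub>B\<^esub>" "\<zero>\<^bsub>B\<^esub>" "\<one>\<^bsub>C\<^esub>"] by simp
    then have "p \<zero>\<^bsub>B\<^esub> \<one>\<^bsub>C\<^esub> = \<zero>" using p_closed[of "\<zero>\<^bsub>B\<^esub>" "\<one>\<^bsub>C\<^esub>"] by simp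
    then show ?thesis using p_add_left[of "\<one>\<^bsub>B\<^esub>" "\<one>\<^bsub>B\<^esub>" "\<one>\<^bsub>C\<^esub>"] two by (simp add: p_one)
  qed
  show ?thesis by unfold_locales (rule trace norm trace_one comm; assumption?)+
qed

end

lemma quadratic_exchange_zero_ring:
  assumes R: "involution_ring R star" and zero: "carrier R = {\<zero>\<^bsub>R\<^esub>}"
  shows "quadratic_exchange R star (carrier R)"
proof -
  interpret R: involution_ring R star by (rule R)
  have eq: "x = y" if "x \<in> carrier R" "y \<in> carrier R" for x y
    using that zero by (metis singletonD)
  interpret central_exchange R star "carrier R"
  proof
    fix s x assume sx: "s \<in> carrier R" "x \<in> carrier R"
    show "x \<otimes>\<^bsub>R\<^esub> s = s \<otimes>\<^bsub>R\<^esub> x" by (rule eq) (use sx in simp_all)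
  next
    fix s assume s: "s \<in> carrier R"
    show "star s = s" by (rule eq) (use s R.star_closed in simp_all)
    show "\<exists>e\<in>carrier R. e \<otimes>\<^bsub>R\<^esub> e = e \<and> (\<exists>a\<in>carrier R. e = a \<otimes>\<^bsub>R\<^esub> s) \<and> (\<exists>b\<in>carrier R. \<one>\<^bsub>R\<^esub> \<ominus>\<^bsub>R\<^esub> e = b \<otimes>\<^bsub>R\<^esub> (\<one>\<^bsub>R\<^esub> \<ominus>\<^bsub>R\<^esub> s))"
      by (intro bexI[of _ s] conjI eq) (use s in simp_all)
  qed simp_all
  show ?thesis
  proof
    show "\<exists>\<theta>\<in>carrier R. \<theta> \<oplus>\<^bsub>R\<^esub> star \<theta> = \<one>\<^bsub>R\<^esub>"
      by (intro bexI[of _ "\<one>\<^bsub>R\<^esub>"] eq) (simp_all add: R.star_closed)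
    show "(\<forall>x\<in>carrier R. \<forall>y\<in>carrier R. x \<otimes>\<^bsub>R\<^esub> y = y \<otimes>\<^bsub>R\<^esub> x) \<or> \<one>\<^bsub>R\<^esub> \<oplus>\<^bsub>R\<^esub> \<one>\<^bsub>R\<^esub> = \<zero>\<^bsub>R\<^esub>"
      by (rule disjI2, rule eq) simp_all
  qed (simp_all add: R.star_closed)
qed

context
  fixes B :: "('b, 'm) ring_scheme" and C :: "('c, 'n) ring_scheme"
  assumes B: "ring B" and C: "ring C"
begin

abbreviation P where "P \<equiv> pair_ring B C"

lemma pair_ring_simps:
  "x \<in> carrier P \<longleftrightarrow> Poly_Mapping.keys x \<subseteq> carrier B \<times> carrier C"
  "x \<oplus>\<^bsub>P\<^esub> y = x + y" "\<zero>\<^bsub>P\<^esub> = 0" "\<one>\<^bsub>P\<^esub> = frag_of (\<one>\<^bsub>B\<^esub>, \<one>\<^bsub>C\<^esub>)"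
  by (simp_all add: pair_ring_def)

lemma pair_mult_of: "frag_of (b, c) \<otimes>\<^bsub>P\<^esub> frag_of (b', c') = frag_of (b \<otimes>\<^bsub>B\<^esub> b', c \<otimes>\<^bsub>C\<^esub> c')"
  by (simp add: pair_ring_def)

lemma pair_mult_add: "(x + y) \<otimes>\<^bsub>P\<^esub> z = x \<otimes>\<^bsub>P\<^esub> z + y \<otimes>\<^bsub>P\<^esub> z"
  and pair_mult_diff: "(x - y) \<otimes>\<^bsub>P\<^esub> z = x \<otimes>\<^bsub>P\<^esub> z - y \<otimes>\<^bsub>P\<^esub> z"
  and pair_mult_zero: "0 \<otimes>\<^bsub>P\<^esub> z = 0"
  by (simp_all add: pair_ring_def frag_extend_add frag_extend_diff)

lemma pair_mult_add_right: "x \<otimes>\<^bsub>P\<^esub> (y + z) = x \<otimes>\<^bsub>P\<^esub> y + x \<otimes>\<^bsub>P\<^esub> z"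
  by (induction x rule: frag_induction[OF subset_UNIV])
    (auto simp: pair_ring_def frag_extend_add frag_extend_diff split: prod.splits)

lemma pair_mult_diff_right: "x \<otimes>\<^bsub>P\<^esub> (y - z) = x \<otimes>\<^bsub>P\<^esub> y - x \<otimes>\<^bsub>P\<^esub> z"
  by (induction x rule: frag_induction[OF subset_UNIV])
    (auto simp: pair_ring_def frag_extend_diff split: prod.splits)

lemma pair_mult_zero_right: "x \<otimes>\<^bsub>P\<^esub> 0 = 0"
  using pair_mult_diff_right[of x 0 0] by simp

lemmas pair_mult_linear = pair_mult_diff pair_mult_diff_right pair_mult_zero pair_mult_zero_right

lemma pair_ring_diff_closed: "\<lbrakk>x \<in> carrier P; y \<in> carrier P\<rbrakk> \<Longrightarrow> x - y \<in> carrier P"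
  using keys_diff[of x y] by (auto simp: pair_ring_simps(1))

lemma pair_ring_induct [consumes 1, case_names zero pair diff]:
  assumes "x \<in> carrier P" and "Q 0" and "\<And>b c. \<lbrakk>b \<in> carrier B; c \<in> carrier C\<rbrakk> \<Longrightarrow> Q (frag_of (b, c))"
    and "\<And>x y. \<lbrakk>Q x; Q y\<rbrakk> \<Longrightarrow> Q (x - y)"
  shows "Q x"
  using assms(1) unfolding pair_ring_simps(1)
  by (induction x rule: frag_induction) (use assms(2-4) in auto)

lemma pair_ring_ring: "ring P"
proof -
  interpret B: ring B by (rule B)
  interpret C: ring C by (rule C)
  have of: "frag_of (b, c) \<in> carrier P" if "b \<in> carrier B" "c \<in> carrier C" for b c
    using that by (simp add: pair_ring_simps(1))
  have closed: "x \<otimes>\<^bsub>P\<^esub> y \<in> carrier P" if x: "x \<in> carrier P" and y: "y \<in> carrier P" for x y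
    using x
  proof (induction rule: pair_ring_induct)
    case (pair b c)
    show ?case using y
      by (induction rule: pair_ring_induct)
        (simp_all add: pair_mult_linear pair_mult_of pair_ring_diff_closed pair of, simp add: pair_ring_simps(1))
  qed (simp_all add: pair_mult_linear pair_ring_diff_closed, simp add: pair_ring_simps(1))
  have assoc: "x \<otimes>\<^bsub>P\<^esub> y \<otimes>\<^bsub>P\<^esub> z = x \<otimes>\<^bsub>P\<^esub> (y \<otimes>\<^bsub>P\<^esub> z)"
    if x: "x \<in> carrier P" and y: "y \<in> carrier P" and z: "z \<in> carrier P" for x y z
    using x
  proof (induction rule: pair_ring_induct)
    case (pair b c)
    note bc = pair
    show ?case using y
    proof (induction rule: pair_ring_induct)
      case (pair b' c')
      show ?case using z
        by (induction rule: pair_ring_induct)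
          (simp_all add: pair_mult_linear pair_mult_of bc pair B.m_assoc C.m_assoc)
    qed (simp_all add: pair_mult_linear)
  qed (simp_all add: pair_mult_linear)
  have one: "\<one>\<^bsub>P\<^esub> \<otimes>\<^bsub>P\<^esub> x = x" "x \<otimes>\<^bsub>P\<^esub> \<one>\<^bsub>P\<^esub> = x" if "x \<in> carrier P" for x
    unfolding pair_ring_simps(4) using that
    by (induction rule: pair_ring_induct) (simp_all add: pair_mult_linear pair_mult_of)
  show ?thesis
  proof (rule ringI)
    show "abelian_group P"
    proof (rule abelian_groupI)
      fix x assume x: "x \<in> carrier P"
      then show "\<exists>y\<in>carrier P. y \<oplus>\<^bsub>P\<^esub> x = \<zero>\<^bsub>P\<^esub>"
        by (intro bexI[of _ "- x"]) (simp_all add: pair_ring_simps)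
    next
      fix x y assume xy: "x \<in> carrier P" "y \<in> carrier P"
      then show "x \<oplus>\<^bsub>P\<^esub> y \<in> carrier P"
        using Poly_Mapping.keys_add[of x y] by (auto simp: pair_ring_simps(1,2))
    qed (simp_all add: pair_ring_simps algebra_simps)
    show "monoid P"
      by (rule monoidI) (use closed assoc one in \<open>simp_all add: of pair_ring_simps(4)\<close>)
  qed (simp_all add: pair_ring_simps(2) pair_mult_add pair_mult_add_right)
qed

text \<open>If one of the relations is not an element of the ring of pairs, which depends on the values of \<open>\<kappa>\<close>,
  there is no ideal that contains it, the intersection of all such ideals is everything, and the tensor product is zero.
  Otherwise it is spanned by the classes of pairs, subject to the usual rules.\<close>

lemma tensor_presentation_exists:
  fixes R :: "('r, 'k) ring_scheme"
  assumes R: "involution_ring R star" and C': "cring C"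
    and \<sigma>: "\<And>b. b \<in> carrier B \<Longrightarrow> \<sigma> b \<in> carrier B" and \<iota>: "\<iota> ` carrier F \<subseteq> carrier B"
    and iso: "involution_ring_iso R star (tensor_ring F B \<iota> C \<kappa>) (tensor_map F B \<iota> C \<kappa> \<sigma>)"
  shows "carrier R = {\<zero>\<^bsub>R\<^esub>} \<or> (\<exists>p. tensor_presentation R star B C p (\<iota> ` carrier F) \<sigma>)"
proof -
  interpret R: involution_ring R star by (rule R)
  interpret B: ring B by (rule B)
  interpret C: ring C by (rule C)
  interpret P: ring P by (rule pair_ring_ring)
  define I where "I = tensor_ideal F B \<iota> C \<kappa>"
  define T where "T = tensor_ring F B \<iota> C \<kappa>"
  define tmap where "tmap = tensor_map F B \<iota> C \<kappa> \<sigma>"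
  have T_I: "T = P Quot I" by (simp add: T_def I_def tensor_ring_def)
  obtain \<phi> where \<phi>: "\<phi> \<in> ring_iso R T" "\<And>x. x \<in> carrier R \<Longrightarrow> \<phi> (star x) = tmap (\<phi> x)"
    using iso by (auto simp: involution_ring_iso_def T_def tmap_def)
  have \<phi>_bij: "bij_betw \<phi> (carrier R) (carrier T)" using \<phi>(1) by (simp add: ring_iso_def)
  have coset_in_T: "I +>\<^bsub>P\<^esub> x \<in> carrier T" if "x \<in> carrier P" for x
    using that by (auto simp: T_I FactRing_def A_RCOSETS_def')
  have T_cases: "\<exists>x\<in>carrier P. Z = I +>\<^bsub>P\<^esub> x" if "Z \<in> carrier T" for Z
    using that by (auto simp: T_I FactRing_def A_RCOSETS_def')
  show ?thesis
  proof (cases "tensor_relations F B \<iota> C \<kappa> \<subseteq> carrier P")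
    case False
    have "{J. ideal J P \<and> tensor_relations F B \<iota> C \<kappa> \<subseteq> J} = {}"
      using False additive_subgroup.a_subset[OF ideal.axioms(1)] by blast
    then have I: "I = UNIV" unfolding I_def tensor_ideal_def genideal_def by (simp only: Inter_empty)
    have "y \<in> I +>\<^bsub>P\<^esub> x" for x y
      unfolding I a_r_coset_def' by (simp add: pair_ring_simps(2)) (metis diff_add_cancel)
    then have "Z = UNIV" if "Z \<in> carrier T" for Z using T_cases[OF that] by blast
    then have "x = \<zero>\<^bsub>R\<^esub>" if "x \<in> carrier R" for x
      using \<phi>_bij that R.zero_closed by (metis bij_betw_apply bij_betw_imp_inj_on inj_on_eq_iff)
    then show ?thesis using R.zero_closed by blast
  next
    case True
    have I_ideal: "ideal I P" unfolding I_def tensor_ideal_def by (rule P.genideal_ideal[OF True])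
    interpret I: ideal I P by (rule I_ideal)
    have rel_I: "tensor_relations F B \<iota> C \<kappa> \<subseteq> I" unfolding I_def tensor_ideal_def by (rule P.genideal_self[OF True])
    define \<psi> where "\<psi> = inv_into (carrier R) \<phi>"
    have \<psi>: "\<psi> \<in> ring_iso T R" unfolding \<psi>_def by (rule ring_iso_set_sym[OF R.ring_axioms \<phi>(1)])
    have \<phi>_\<psi>: "\<phi> (\<psi> Z) = Z" if "Z \<in> carrier T" for Z
      using that \<phi>_bij by (simp add: \<psi>_def bij_betw_inv_into_right)
    have \<psi>_\<phi>: "\<psi> (\<phi> x) = x" if "x \<in> carrier R" for x
      using that \<phi>_bij by (simp add: \<psi>_def bij_betw_inv_into_left)
    define q where "q x = \<psi> (I +>\<^bsub>P\<^esub> x)" for x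
    have "\<psi> \<in> ring_hom (P Quot I) R" using \<psi> by (simp add: ring_iso_def T_I)
    from ring_hom_trans[OF I.rcos_ring_hom this] have q_hom: "q \<in> ring_hom P R" by (simp add: q_def[abs_def] comp_def)
    interpret q: ring_hom_ring P R q by (rule ring_hom_ringI2[OF P.ring_axioms R.ring_axioms q_hom])
    have q_closed: "q x \<in> carrier R" if "x \<in> carrier P" for x using that by simp
    have q_add: "q (x + y) = q x \<oplus>\<^bsub>R\<^esub> q y" if "x \<in> carrier P" "y \<in> carrier P" for x y
      using that q.hom_add[of x y] by (simp add: pair_ring_simps(2))
    have q_zero: "q 0 = \<zero>\<^bsub>R\<^esub>" using q.hom_zero by (simp add: pair_ring_simps(3))
    have q_I: "q i = \<zero>\<^bsub>R\<^esub>" if "i \<in> I" for i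
      using I.a_rcos_const[OF that] I.a_rcos_const[OF I.zero_closed] q_zero by (simp add: q_def pair_ring_simps(3))
    have q_eq: "q x = q y" if "x - y \<in> I" "y \<in> carrier P" for x y
    proof -
      have "q (x - y + y) = q (x - y) \<oplus>\<^bsub>R\<^esub> q y" using that I.a_subset by (intro q_add) auto
      then show ?thesis using that q_I by simp
    qed
    have of: "frag_of (b, c) \<in> carrier P" if "b \<in> carrier B" "c \<in> carrier C" for b c
      using that by (simp add: pair_ring_simps(1))
    have P_add: "x + y \<in> carrier P" if "x \<in> carrier P" "y \<in> carrier P" for x y
      using P.add.m_closed[OF that] by (simp add: pair_ring_simps(2))
    define p where "p b c = q (frag_of (b, c))" for b c
    have p_closed: "p b c \<in> carrier R" if "b \<in> carrier B" "c \<in> carrier C" for b c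
      using that by (simp add: p_def q_closed of)
    have p_add_left: "p (b \<oplus>\<^bsub>B\<^esub> b') c = p b c \<oplus>\<^bsub>R\<^esub> p b' c"
      if "b \<in> carrier B" "b' \<in> carrier B" "c \<in> carrier C" for b b' c
    proof -
      have "frag_of (b \<oplus>\<^bsub>B\<^esub> b', c) - frag_of (b, c) - frag_of (b', c) \<in> tensor_relations F B \<iota> C \<kappa>"
        unfolding tensor_relations_def using that by blast
      then have "frag_of (b \<oplus>\<^bsub>B\<^esub> b', c) - (frag_of (b, c) + frag_of (b', c)) \<in> I"
        using rel_I by (auto simp: diff_diff_eq)
      then show ?thesis
        using q_eq P_add[OF of of] q_add[OF of of] that by (simp add: p_def)
    qed
    have p_add_right: "p b (c \<oplus>\<^bsub>C\<^esub> c') = p b c \<oplus>\<^bsub>R\<^esub> p b c'"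
      if "b \<in> carrier B" "c \<in> carrier C" "c' \<in> carrier C" for b c c'
    proof -
      have "frag_of (b, c \<oplus>\<^bsub>C\<^esub> c') - frag_of (b, c) - frag_of (b, c') \<in> tensor_relations F B \<iota> C \<kappa>"
        unfolding tensor_relations_def using that by blast
      then have "frag_of (b, c \<oplus>\<^bsub>C\<^esub> c') - (frag_of (b, c) + frag_of (b, c')) \<in> I"
        using rel_I by (auto simp: diff_diff_eq)
      then show ?thesis
        using q_eq P_add[OF of of] q_add[OF of of] that by (simp add: p_def)
    qed
    have p_scalar: "\<exists>d\<in>carrier C. p k c = p \<one>\<^bsub>B\<^esub> d" if k: "k \<in> \<iota> ` carrier F" and c: "c \<in> carrier C" for k c
    proof -
      obtain r where r: "r \<in> carrier F" "k = \<iota> r" using k by blast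
      then have kB: "k \<in> carrier B" using \<iota> by blast
      have "frag_of (k \<otimes>\<^bsub>B\<^esub> \<one>\<^bsub>B\<^esub>, c) - frag_of (\<one>\<^bsub>B\<^esub>, \<kappa> r \<otimes>\<^bsub>C\<^esub> c) \<in> tensor_relations F B \<iota> C \<kappa>"
        unfolding tensor_relations_def r(2) using r(1) c B.one_closed by blast
      then have rel: "frag_of (k, c) - frag_of (\<one>\<^bsub>B\<^esub>, \<kappa> r \<otimes>\<^bsub>C\<^esub> c) \<in> I" using rel_I kB by auto
      then have "frag_of (k, c) - (frag_of (k, c) - frag_of (\<one>\<^bsub>B\<^esub>, \<kappa> r \<otimes>\<^bsub>C\<^esub> c)) \<in> carrier P"
        using of[OF kB c] I.a_subset pair_ring_diff_closed by blast
      then have d: "\<kappa> r \<otimes>\<^bsub>C\<^esub> c \<in> carrier C" by (simp add: pair_ring_simps(1))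
      then show ?thesis using q_eq[OF rel of] by (auto simp: p_def)
    qed
    have p_star: "star (p b c) = p (\<sigma> b) c" if "b \<in> carrier B" "c \<in> carrier C" for b c
    proof -
      define Z where "Z = I +>\<^bsub>P\<^esub> frag_of (b, c)"
      have Z: "Z \<in> carrier T" unfolding Z_def using that by (intro coset_in_T of)
      have pZ: "p b c = \<psi> Z" by (simp add: p_def q_def Z_def)
      have eq: "\<phi> (star (p b c)) = tmap Z" using \<phi>(2)[OF p_closed[OF that]] \<phi>_\<psi>[OF Z] by (simp add: pZ)
      then have "tmap Z \<in> carrier T"
        using bij_betw_apply[OF \<phi>_bij R.star_closed[OF p_closed[OF that]]] by simp
      then obtain y where y: "y \<in> carrier P" "tmap Z = I +>\<^bsub>P\<^esub> y" using T_cases by blast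
      \<comment> \<open>Both sides are cosets, and \<open>(\<sigma> b, c)\<close> lies in both of them.\<close>
      have "frag_of (b, c) \<in> Z" unfolding Z_def by (rule I.a_rcos_self[OF of[OF that]])
      then have "I +>\<^bsub>P\<^esub> frag_extend (\<lambda>(b, c). frag_of (\<sigma> b, c)) (frag_of (b, c)) \<subseteq> tmap Z"
        unfolding tmap_def tensor_map_def I_def by blast
      then have "frag_of (\<sigma> b, c) \<in> I +>\<^bsub>P\<^esub> y"
        using I.a_rcos_self[OF of[OF \<sigma>[OF that(1)] that(2)]] y(2) by auto
      then have "tmap Z = I +>\<^bsub>P\<^esub> frag_of (\<sigma> b, c)"
        using I.a_repr_independence'[OF _ y(1)] y(2) by simp
      then show ?thesis
        using \<psi>_\<phi>[OF R.star_closed[OF p_closed[OF that]]] eq by (simp add: p_def q_def)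
    qed
    have p_induct: "Q x" if x: "x \<in> carrier R"
      and gen: "\<And>b c. \<lbrakk>b \<in> carrier B; c \<in> carrier C\<rbrakk> \<Longrightarrow> Q (p b c)"
      and add: "\<And>x y. \<lbrakk>x \<in> carrier R; y \<in> carrier R; Q x; Q y\<rbrakk> \<Longrightarrow> Q (x \<oplus>\<^bsub>R\<^esub> y)" for Q x
    proof -
      obtain y where y: "y \<in> carrier P" "\<phi> x = I +>\<^bsub>P\<^esub> y"
        using T_cases[OF bij_betw_apply[OF \<phi>_bij x]] by blast
      have p_zero: "p \<zero>\<^bsub>B\<^esub> c = \<zero>\<^bsub>R\<^esub>" if "c \<in> carrier C" for c
      proof -
        have "p \<zero>\<^bsub>B\<^esub> c \<oplus>\<^bsub>R\<^esub> p \<zero>\<^bsub>B\<^esub> c = p \<zero>\<^bsub>B\<^esub> c"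
          using p_add_left[of "\<zero>\<^bsub>B\<^esub>" "\<zero>\<^bsub>B\<^esub>" c] that by simp
        then show ?thesis using p_closed[of "\<zero>\<^bsub>B\<^esub>" c] that by simp
      qed
      have neg: "q (- frag_of (b, c)) = p (\<ominus>\<^bsub>B\<^esub> b) c" if "b \<in> carrier B" "c \<in> carrier C" for b c
      proof -
        have m: "- frag_of (b, c) \<in> carrier P" using of[OF that] by (simp add: pair_ring_simps(1))
        have "q (- frag_of (b, c)) \<oplus>\<^bsub>R\<^esub> p b c = \<zero>\<^bsub>R\<^esub>" using q_add[OF m of[OF that]] q_zero by (simp add: p_def)
        moreover have "p (\<ominus>\<^bsub>B\<^esub> b) c \<oplus>\<^bsub>R\<^esub> p b c = \<zero>\<^bsub>R\<^esub>"
          using p_add_left[of "\<ominus>\<^bsub>B\<^esub> b" b c] that p_zero by (simp add: B.l_neg)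
        ultimately show ?thesis
          using q_closed[OF m] p_closed that by (metis B.a_inv_closed R.add.r_cancel)
      qed
      have "y \<in> carrier P \<and> Q (q y) \<and> Q (q (- y))" using y(1)
      proof (induction rule: pair_ring_induct)
        case zero
        then show ?case using gen[of "\<zero>\<^bsub>B\<^esub>" "\<zero>\<^bsub>C\<^esub>"] by (simp add: p_zero q_zero pair_ring_simps(1))
      next
        case (pair b c)
        then show ?case using gen[of b c] gen[of "\<ominus>\<^bsub>B\<^esub> b" c] of[of b c] by (simp add: neg p_def[symmetric])
      next
        case (diff x y)
        have m: "- x \<in> carrier P" "- y \<in> carrier P" using diff by (simp_all add: pair_ring_simps(1))
        have "q (x - y) = q x \<oplus>\<^bsub>R\<^esub> q (- y)" "q (- (x - y)) = q y \<oplus>\<^bsub>R\<^esub> q (- x)"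
          using q_add[of x "- y"] q_add[of y "- x"] diff m by simp_all
        then show ?case using diff m add q_closed pair_ring_diff_closed by simp
      qed
      moreover have "q y = x" using \<psi>_\<phi>[OF x] y(2) by (simp add: q_def)
      ultimately show ?thesis by simp
    qed
    have "tensor_presentation R star B C p (\<iota> ` carrier F) \<sigma>"
    proof (intro tensor_presentation.intro[OF R] tensor_presentation_axioms.intro)
      show "p b c \<otimes>\<^bsub>R\<^esub> p b' c' = p (b \<otimes>\<^bsub>B\<^esub> b') (c \<otimes>\<^bsub>C\<^esub> c')"
        if "b \<in> carrier B" "b' \<in> carrier B" "c \<in> carrier C" "c' \<in> carrier C" for b b' c c'
        using that q.hom_mult[OF of of, of b c b' c'] by (simp add: p_def pair_mult_of)
      show "p \<one>\<^bsub>B\<^esub> \<one>\<^bsub>C\<^esub> = \<one>\<^bsub>R\<^esub>" using q.hom_one by (simp add: p_def pair_ring_simps(4))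
    qed (fact B C' p_closed p_add_left p_add_right p_star p_scalar p_induct)+
    then show ?thesis by blast
  qed
qed

end

corollary quadratic_tensor_exchange:
  assumes R: "involution_ring R star" and C: "exchange_ring C" and \<iota>: "\<iota> \<in> ring_hom F B"
    and quad: "quadratic_algebra B (\<iota> ` carrier F) \<sigma>"
    and iso: "involution_ring_iso R star (tensor_ring F B \<iota> C \<kappa>) (tensor_map F B \<iota> C \<kappa> \<sigma>)"
  shows "\<exists>S. quadratic_exchange R star S"
proof -
  have B: "ring B" and \<sigma>: "\<And>b. b \<in> carrier B \<Longrightarrow> \<sigma> b \<in> carrier B"
    using quad by (simp_all add: quadratic_algebra_def)
  have C': "cring C" using C by (simp add: exchange_ring_def)
  have "\<iota> ` carrier F \<subseteq> carrier B" using ring_hom_closed[OF \<iota>] by blast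
  from tensor_presentation_exists[OF B cring.axioms(1)[OF C'] R C' \<sigma> this iso]
  show ?thesis
    using quadratic_exchange_zero_ring[OF R] tensor_presentation.quadratic_exchange[OF _ C quad] by blast
qed


section \<open>Separable quadratic extensions and quaternion algebras\<close>

lemma image_subfield:
  assumes F: "field F" and H: "ring H" and \<iota>: "\<iota> \<in> ring_hom F H" and one: "\<one>\<^bsub>H\<^esub> \<noteq> \<zero>\<^bsub>H\<^esub>"
  shows "subfield (\<iota> ` carrier F) H"
proof -
  interpret F: field F by (rule F)
  interpret h: ring_hom_ring F H \<iota> by (rule ring_hom_ringI2[OF F.ring_axioms H \<iota>])
  show ?thesis by (rule h.img_is_subfield(2)[OF F.carrier_is_subfield one])
qed

text \<open>For \<open>t\<close> outside \<open>K\<close> with \<open>t\<^sup>2 = u t + v\<close> the conjugate of \<open>t\<close> is \<open>u - t\<close>, and \<open>1\<close>, \<open>t\<close> is a basis.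
  The trace form does not vanish: otherwise \<open>\<alpha> = -1\<close>, which fixes \<open>1\<close> only if \<open>-1 = 1\<close>, and then \<open>\<alpha> = 1\<close>.\<close>

lemma quadratic_extension_algebra:
  fixes E (structure)
  assumes ext: "separable_quadratic_extension F E \<iota>" and \<alpha>: "\<alpha> \<in> galois_group F E \<iota>"
    and moved: "\<exists>x\<in>carrier E. \<alpha> x \<noteq> x"
  shows "quadratic_algebra E (\<iota> ` carrier F) \<alpha>"
proof -
  define K where "K = \<iota> ` carrier F"
  have F: "field F" and E: "field E" and \<iota>: "\<iota> \<in> ring_hom F E" and dim: "ring.dimension E 2 K (carrier E)"
    using ext by (simp_all add: separable_quadratic_extension_def K_def)
  interpret E: field E by (rule E)
  have K: "subfield K E" unfolding K_def by (rule image_subfield[OF F E.ring_axioms \<iota> E.one_not_zero])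
  have Kc: "k \<in> carrier E" if "k \<in> K" for k using subfieldE(3)[OF K] that by blast
  note Kr = subfieldE(1)[OF K]
  have K_closed: "k \<oplus> l \<in> K" "k \<otimes> l \<in> K" "\<ominus> k \<in> K" if "k \<in> K" "l \<in> K" for k l
    using that subringE(5,6,7)[OF Kr] by blast+
  have K_one: "\<one> \<in> K" by (rule subringE(3)[OF Kr])
  have \<alpha>_hom: "\<alpha> \<in> ring_hom E E" and \<alpha>_K: "\<And>k. k \<in> K \<Longrightarrow> \<alpha> k = k"
    using \<alpha> by (auto simp: galois_group_def ring_iso_def K_def)
  note \<alpha>_simps = ring_hom_mult[OF \<alpha>_hom] ring_hom_add[OF \<alpha>_hom] ring_hom_one[OF \<alpha>_hom]
  have \<alpha>_closed: "\<alpha> x \<in> carrier E" if "x \<in> carrier E" for x using ring_hom_closed[OF \<alpha>_hom that] .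
  obtain t where t: "t \<in> carrier E" "\<alpha> t \<noteq> t" using moved by blast
  have tK: "t \<notin> K" using \<alpha>_K t(2) by blast
  have span_one: "E.Span K [\<one>] = K"
    using Kc by (auto simp: E.line_extension_mem_iff)
  have "E.independent K [\<one>]" by (rule E.li_Cons) auto
  then have "E.independent K [t, \<one>]" using t(1) tK span_one by (intro E.li_Cons) auto
  then have span: "E.Span K [t, \<one>] = carrier E"
    using E.independent_length_eq_dimension[OF K dim, of "[t, \<one>]"] t(1) by auto
  have rep: "\<exists>k\<in>K. \<exists>l\<in>K. x = k \<otimes> t \<oplus> l" if "x \<in> carrier E" for x
  proof -
    have "x \<in> E.line_extension K t (E.Span K [\<one>])" using that span by simp
    then show ?thesis unfolding span_one E.line_extension_mem_iff by blast
  qed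
  obtain u v where uv: "u \<in> K" "v \<in> K" "t \<otimes> t = u \<otimes> t \<oplus> v" using rep[of "t \<otimes> t"] t(1) by auto
  note cl = t(1) Kc[OF uv(1)] Kc[OF uv(2)] \<alpha>_closed[OF t(1)]
  have \<alpha>t: "\<alpha> t \<otimes> \<alpha> t = u \<otimes> \<alpha> t \<oplus> v"
    using arg_cong[OF uv(3), of \<alpha>] cl by (simp add: \<alpha>_simps \<alpha>_K uv(1,2))
  have "(t \<ominus> \<alpha> t) \<otimes> (t \<oplus> \<alpha> t \<ominus> u) = (t \<otimes> t \<ominus> u \<otimes> t) \<ominus> (\<alpha> t \<otimes> \<alpha> t \<ominus> u \<otimes> \<alpha> t)"
    using cl by algebra
  also have "\<dots> = \<zero>" using cl by (simp add: uv(3) \<alpha>t E.add_minus_cancel E.r_right_minus_eq)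
  finally have "t \<ominus> \<alpha> t = \<zero> \<or> t \<oplus> \<alpha> t \<ominus> u = \<zero>" using cl E.integral by blast
  then have sum: "t \<oplus> \<alpha> t = u" using cl t(2) by (auto simp: E.r_right_minus_eq)
  have "t \<otimes> \<alpha> t = t \<otimes> (t \<oplus> \<alpha> t) \<ominus> t \<otimes> t" using cl by algebra
  also have "\<dots> = \<ominus> v" unfolding sum uv(3) using cl by algebra
  finally have prod: "t \<otimes> \<alpha> t = \<ominus> v" .
  have tn: "x \<oplus> \<alpha> x \<in> K \<and> x \<otimes> \<alpha> x \<in> K" if x: "x \<in> carrier E" for x
  proof -
    obtain k l where kl: "k \<in> K" "l \<in> K" "x = k \<otimes> t \<oplus> l" using rep[OF x] by blast
    have \<alpha>x: "\<alpha> x = k \<otimes> \<alpha> t \<oplus> l" using kl Kc cl by (simp add: \<alpha>_simps \<alpha>_K)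
    have "x \<oplus> \<alpha> x = k \<otimes> (t \<oplus> \<alpha> t) \<oplus> (l \<oplus> l)" unfolding \<alpha>x unfolding kl(3) using Kc[OF kl(1)] Kc[OF kl(2)] cl by algebra
    moreover have "x \<otimes> \<alpha> x = k \<otimes> k \<otimes> (t \<otimes> \<alpha> t) \<oplus> k \<otimes> l \<otimes> (t \<oplus> \<alpha> t) \<oplus> l \<otimes> l"
      unfolding \<alpha>x unfolding kl(3) using Kc[OF kl(1)] Kc[OF kl(2)] cl by algebra
    ultimately show ?thesis unfolding sum prod using K_closed kl(1,2) uv(1,2) by simp
  qed
  have "\<exists>x\<in>carrier E. x \<oplus> \<alpha> x \<noteq> \<zero>"
  proof (rule ccontr)
    assume "\<not> ?thesis"
    then have z: "x \<oplus> \<alpha> x = \<zero>" if "x \<in> carrier E" for x using that by blast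
    have "\<alpha> t \<oplus> \<alpha> t = (\<one> \<oplus> \<one>) \<otimes> \<alpha> t" using cl by (simp only: E.l_distr E.one_closed E.l_one)
    then have "\<alpha> t \<oplus> \<alpha> t = \<zero>" using z[OF E.one_closed] cl by (simp add: \<alpha>_simps)
    moreover have "t \<ominus> \<alpha> t = (t \<oplus> \<alpha> t) \<ominus> (\<alpha> t \<oplus> \<alpha> t)" using cl by algebra
    ultimately have "t \<ominus> \<alpha> t = \<zero>" using z[OF t(1)] by simp
    then show False using t(2) cl by (simp add: E.r_right_minus_eq)
  qed
  then obtain x where x: "x \<in> carrier E" "x \<oplus> \<alpha> x \<noteq> \<zero>" by blast
  define y where "y = inv (x \<oplus> \<alpha> x)"
  have yK: "y \<in> K" unfolding y_def using E.subfield_m_inv(1)[OF K] tn[OF x(1)] x(2) by blast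
  have "x \<otimes> y \<oplus> \<alpha> (x \<otimes> y) = (x \<oplus> \<alpha> x) \<otimes> y"
    using x Kc[OF yK] \<alpha>_closed by (simp add: \<alpha>_simps \<alpha>_K[OF yK] E.l_distr)
  also have "\<dots> = \<one>" unfolding y_def using x \<alpha>_closed by (simp add: E.field_Units)
  finally have "\<exists>\<theta>\<in>carrier E. \<theta> \<oplus> \<alpha> \<theta> = \<one>" using x(1) Kc[OF yK] by (intro bexI[of _ "x \<otimes> y"]) simp_all
  then show ?thesis
    using tn \<alpha>_closed E.m_comm by (simp add: quadratic_algebra_def E.ring_axioms \<alpha>_simps K_def)
qed

text \<open>The \<open>k\<close> with \<open>k 1 = 0\<close> are the multiples of the least positive one, which is therefore their gcd.\<close>

lemma ring_characteristic_two:
  assumes F: "ring F" and char: "ring_characteristic F = 2"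
  shows "\<one>\<^bsub>F\<^esub> \<oplus>\<^bsub>F\<^esub> \<one>\<^bsub>F\<^esub> = \<zero>\<^bsub>F\<^esub>"
proof -
  interpret F: ring F by (rule F)
  define S where "S = {k :: nat. add_pow F k \<one>\<^bsub>F\<^esub> = \<zero>\<^bsub>F\<^esub>}"
  have gcd: "Gcd S = 2" using char by (simp add: ring_characteristic_def S_def)
  have "\<exists>k. 0 < k \<and> k \<in> S"
  proof (rule ccontr)
    assume "\<not> ?thesis"
    then have "S \<subseteq> {0}" by auto
    then have "Gcd S = 0" by (simp add: Gcd_0_iff)
    then show False using gcd by simp
  qed
  define m where "m = (LEAST k. 0 < k \<and> k \<in> S)"
  have m: "0 < m" "m \<in> S" using LeastI_ex[OF \<open>\<exists>k. 0 < k \<and> k \<in> S\<close>] by (simp_all add: m_def)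
  have "m dvd k" if "k \<in> S" for k
  proof -
    have "add_pow F (m * (k div m)) \<one>\<^bsub>F\<^esub> = \<zero>\<^bsub>F\<^esub>"
      using F.add.nat_pow_pow[of "\<one>\<^bsub>F\<^esub>" "k div m" m] m(2) by (simp add: S_def mult.commute)
    then have "add_pow F (m * (k div m) + k mod m) \<one>\<^bsub>F\<^esub> = add_pow F (k mod m) \<one>\<^bsub>F\<^esub>"
      using F.add.nat_pow_mult[of "\<one>\<^bsub>F\<^esub>" "m * (k div m)" "k mod m"] by simp
    then have "k mod m \<in> S" using that by (simp add: S_def)
    then have "\<not> 0 < k mod m"
      using not_less_Least[of "k mod m" "\<lambda>k. 0 < k \<and> k \<in> S"] m(1) by (auto simp: m_def[symmetric])
    then show ?thesis by (simp add: mod_eq_0_iff_dvd)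
  qed
  then have "m = 2" using gcd m(2) by (metis Gcd_dvd Gcd_greatest dvd_antisym)
  then show ?thesis using m(2) by (simp add: S_def numeral_2_eq_2)
qed

lemma split_star_mat2:
  fixes F (structure)
  assumes F: "field F" and cl: "a \<in> carrier F" "b \<in> carrier F" "c \<in> carrier F" "d \<in> carrier F"
  shows "split_star F (mat2 a b c d) = mat2 d (\<ominus> b) (\<ominus> c) a"
proof -
  interpret F: field F by (rule F)
  interpret M: ring "matrix_ring 2 F" by (rule F.matrix_ring_ring)
  have J: "inv\<^bsub>matrix_ring 2 F\<^esub> (mat2 \<zero> \<one> (\<ominus> \<one>) \<zero>) = mat2 \<zero> (\<ominus> \<one>) \<one> \<zero>"
    by (rule M.inv_unique'[symmetric]) (simp_all add: mat2_closed_iff F.mat2_mult mat2_one F.l_minus F.r_minus)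
  have "transpose_mat (mat2 a b c d) = mat2 a c b d"
    by (rule eq_mat2I) (simp_all add: mat2_def)
  then show ?thesis
    unfolding split_star_def Let_def J using cl by (simp add: F.mat2_mult F.l_minus F.r_minus)
qed

text \<open>In the split case traces and norms are matrix traces and determinants. In a division algebra of
  characteristic \<open>2\<close> with vanishing traces the involution would be trivial, and the algebra
  commutative.\<close>

lemma quaternion_quadratic_algebra:
  fixes H (structure)
  assumes quat: "quaternion_algebra F H \<iota>" and inv: "quaternionic_involution F H \<iota> \<sigma>"
    and char: "ring_characteristic F = 2"
  shows "quadratic_algebra H (\<iota> ` carrier F) \<sigma>"
proof -
  have F: "field F" and H: "ring H" and alg: "algebra_map F H \<iota>"
    and cases: "(\<exists>\<phi>. split_by F H \<iota> \<phi>) \<or> quaternion_division_algebra F H \<iota>"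
    using quat by (simp_all add: quaternion_algebra_def)
  have "involution_ring H \<sigma>" using inv by (simp add: quaternionic_involution_def)
  interpret H: involution_ring H \<sigma> by fact
  interpret F: field F by (rule F)
  have \<iota>: "\<iota> \<in> ring_hom F H" using alg by (simp add: algebra_map_def)
  interpret h: ring_hom_ring F H \<iota> by (rule ring_hom_ringI2[OF F.ring_axioms H \<iota>])
  have central: "\<iota> r \<otimes> x = x \<otimes> \<iota> r" if "r \<in> carrier F" "x \<in> carrier H" for r x
    using alg that by (auto simp: algebra_map_def center_def)
  have fixed: "\<sigma> (\<iota> r) = \<iota> r" if "r \<in> carrier F" for r using inv that by (simp add: quaternionic_involution_def)
  have two: "\<one> \<oplus> \<one> = \<zero>"
    using h.hom_add[of "\<one>\<^bsub>F\<^esub>" "\<one>\<^bsub>F\<^esub>"] ring_characteristic_two[OF F.ring_axioms char] by simp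
  have "(\<forall>x\<in>carrier H. x \<oplus> \<sigma> x \<in> \<iota> ` carrier F \<and> x \<otimes> \<sigma> x \<in> \<iota> ` carrier F) \<and> (\<exists>\<theta>\<in>carrier H. \<theta> \<oplus> \<sigma> \<theta> = \<one>)"
    using cases
  proof
    assume "\<exists>\<phi>. split_by F H \<iota> \<phi>"
    then obtain \<phi> where \<phi>: "split_by F H \<iota> \<phi>" by blast
    let ?M = "matrix_ring 2 F"
    interpret M: ring ?M by (rule F.matrix_ring_ring)
    have \<phi>_iso: "\<phi> \<in> ring_iso H ?M" and \<phi>_\<iota>: "\<And>r. r \<in> carrier F \<Longrightarrow> \<phi> (\<iota> r) = scalar_matrix 2 F r"
      using \<phi> by (auto simp: split_by_def)
    have \<phi>_\<sigma>: "\<phi> (\<sigma> x) = split_star F (\<phi> x)" if "x \<in> carrier H" for x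
      using inv \<phi> that by (auto simp: quaternionic_involution_def)
    have \<phi>_bij: "bij_betw \<phi> (carrier H) (carrier ?M)" and \<phi>_hom: "\<phi> \<in> ring_hom H ?M"
      using \<phi>_iso by (simp_all add: ring_iso_def)
    have \<phi>_inj: "x = y" if "\<phi> x = \<phi> y" "x \<in> carrier H" "y \<in> carrier H" for x y
      using that bij_betw_imp_inj_on[OF \<phi>_bij] by (simp add: inj_on_eq_iff)
    have mat2_add: "mat2 a b c d \<oplus>\<^bsub>?M\<^esub> mat2 a' b' c' d' = mat2 (a \<oplus>\<^bsub>F\<^esub> a') (b \<oplus>\<^bsub>F\<^esub> b') (c \<oplus>\<^bsub>F\<^esub> c') (d \<oplus>\<^bsub>F\<^esub> d')"
      for a b c d a' b' c' d' by (rule eq_mat2I) (simp_all add: matrix_ring_def)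
    have scalar: "scalar_matrix 2 F r = mat2 r \<zero>\<^bsub>F\<^esub> \<zero>\<^bsub>F\<^esub> r" for r
      by (rule eq_mat2I) (simp_all add: scalar_matrix_def)
    show ?thesis
    proof (intro conjI ballI)
      fix x assume x: "x \<in> carrier H"
      have "\<phi> x \<in> carrier ?M" using bij_betw_apply[OF \<phi>_bij x] .
      then obtain a b c d where abcd: "\<phi> x = mat2 a b c d" "a \<in> carrier F" "b \<in> carrier F" "c \<in> carrier F" "d \<in> carrier F"
        by (rule mat2_cases)
      have \<sigma>x: "\<phi> (\<sigma> x) = mat2 d (\<ominus>\<^bsub>F\<^esub> b) (\<ominus>\<^bsub>F\<^esub> c) a"
        using \<phi>_\<sigma>[OF x] abcd by (simp add: split_star_mat2[OF F])
      have "\<phi> (x \<oplus> \<sigma> x) = \<phi> (\<iota> (a \<oplus>\<^bsub>F\<^esub> d))"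
        using x abcd by (simp add: ring_hom_add[OF \<phi>_hom] H.star_closed \<sigma>x \<phi>_\<iota> scalar mat2_add F.r_neg F.a_comm)
      from \<phi>_inj[OF this] show "x \<oplus> \<sigma> x \<in> \<iota> ` carrier F"
        using x abcd by (simp add: H.star_closed del: h.hom_add)
      have "a \<otimes>\<^bsub>F\<^esub> \<ominus>\<^bsub>F\<^esub> b \<oplus>\<^bsub>F\<^esub> b \<otimes>\<^bsub>F\<^esub> a = \<zero>\<^bsub>F\<^esub>" "c \<otimes>\<^bsub>F\<^esub> d \<oplus>\<^bsub>F\<^esub> d \<otimes>\<^bsub>F\<^esub> \<ominus>\<^bsub>F\<^esub> c = \<zero>\<^bsub>F\<^esub>"
        using abcd(2-5) by (simp_all add: F.r_minus F.m_comm[of a b] F.m_comm[of c d] F.l_neg F.r_neg)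
      moreover have "a \<otimes>\<^bsub>F\<^esub> d \<oplus>\<^bsub>F\<^esub> b \<otimes>\<^bsub>F\<^esub> \<ominus>\<^bsub>F\<^esub> c = c \<otimes>\<^bsub>F\<^esub> \<ominus>\<^bsub>F\<^esub> b \<oplus>\<^bsub>F\<^esub> d \<otimes>\<^bsub>F\<^esub> a"
        using abcd(2-5) by (simp add: F.r_minus F.m_comm[of a d] F.m_comm[of b c] F.a_comm)
      ultimately have "\<phi> (x \<otimes> \<sigma> x) = \<phi> (\<iota> (a \<otimes>\<^bsub>F\<^esub> d \<oplus>\<^bsub>F\<^esub> b \<otimes>\<^bsub>F\<^esub> \<ominus>\<^bsub>F\<^esub> c))"
        using x abcd by (simp add: ring_hom_mult[OF \<phi>_hom] H.star_closed \<sigma>x \<phi>_\<iota> scalar F.mat2_mult del: h.hom_add)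
      from \<phi>_inj[OF this] show "x \<otimes> \<sigma> x \<in> \<iota> ` carrier F"
        using x abcd by (simp add: H.star_closed del: h.hom_add)
    next
      have e: "mat2 \<one>\<^bsub>F\<^esub> \<zero>\<^bsub>F\<^esub> \<zero>\<^bsub>F\<^esub> \<zero>\<^bsub>F\<^esub> \<in> carrier ?M" by (simp add: mat2_closed_iff)
      then have "mat2 \<one>\<^bsub>F\<^esub> \<zero>\<^bsub>F\<^esub> \<zero>\<^bsub>F\<^esub> \<zero>\<^bsub>F\<^esub> \<in> \<phi> ` carrier H" by (simp only: bij_betw_imp_surj_on[OF \<phi>_bij])
      then obtain \<theta> where "mat2 \<one>\<^bsub>F\<^esub> \<zero>\<^bsub>F\<^esub> \<zero>\<^bsub>F\<^esub> \<zero>\<^bsub>F\<^esub> = \<phi> \<theta>" "\<theta> \<in> carrier H" by (rule imageE)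
      then have \<theta>: "\<theta> \<in> carrier H" "\<phi> \<theta> = mat2 \<one>\<^bsub>F\<^esub> \<zero>\<^bsub>F\<^esub> \<zero>\<^bsub>F\<^esub> \<zero>\<^bsub>F\<^esub>" by simp_all
      have "\<phi> (\<theta> \<oplus> \<sigma> \<theta>) = \<phi> \<one>"
        using \<theta> by (simp add: ring_hom_add[OF \<phi>_hom] ring_hom_one[OF \<phi>_hom] H.star_closed \<phi>_\<sigma> split_star_mat2[OF F] mat2_add mat2_one)
      then show "\<exists>\<theta>\<in>carrier H. \<theta> \<oplus> \<sigma> \<theta> = \<one>" using \<phi>_inj \<theta>(1) H.star_closed by blast
    qed
  next
    assume div: "quaternion_division_algebra F H \<iota>"
    then have tn: "x \<oplus> \<sigma> x \<in> \<iota> ` carrier F \<and> x \<otimes> \<sigma> x \<in> \<iota> ` carrier F" if "x \<in> carrier H" for x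
      using inv that by (simp add: quaternionic_involution_def)
    have units: "Units H = carrier H - {\<zero>}" and center: "\<iota> ` carrier F = center H"
      and dim: "ring.dimension H 4 (\<iota> ` carrier F) (carrier H)"
      using div[unfolded quaternion_division_algebra_def] by blast+
    have "\<one> \<noteq> \<zero>" using H.Units_one_closed units by auto
    have K: "subfield (\<iota> ` carrier F) H" by (rule image_subfield[OF F H \<iota> \<open>\<one> \<noteq> \<zero>\<close>])
    have "\<exists>x\<in>carrier H. x \<oplus> \<sigma> x \<noteq> \<zero>"
    proof (rule ccontr)
      assume "\<not> ?thesis"
      then have z: "x \<oplus> \<sigma> x = \<zero>" if "x \<in> carrier H" for x using that by blast
      have \<sigma>_id: "\<sigma> x = x" if "x \<in> carrier H" for x
      proof -
        have "x \<oplus> x = (\<one> \<oplus> \<one>) \<otimes> x" using that by (simp only: H.l_distr H.one_closed H.l_one)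
        then have "x \<oplus> x = x \<oplus> \<sigma> x" using two that z by simp
        then show ?thesis using that H.star_closed by simp
      qed
      have "x \<otimes> y = y \<otimes> x" if "x \<in> carrier H" "y \<in> carrier H" for x y
        using H.star_mult[OF that] that by (simp add: \<sigma>_id)
      then have "center H = carrier H" by (auto simp: center_def)
      then have "H.dimension 4 (\<iota> ` carrier F) (\<iota> ` carrier F)" using dim center by simp
      then show False using H.dimension_is_inj[OF K _ H.dimension_one[OF K]] by fastforce
    qed
    then obtain x where x: "x \<in> carrier H" "x \<oplus> \<sigma> x \<noteq> \<zero>" by blast
    obtain r where r: "r \<in> carrier F" "x \<oplus> \<sigma> x = \<iota> r" using tn[OF x(1)] by blast
    have "r \<noteq> \<zero>\<^bsub>F\<^esub>" using x(2) r(2) by auto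
    then have rU: "r \<in> Units F" using r(1) by (simp add: F.field_Units)
    define s where "s = inv\<^bsub>F\<^esub> r"
    have s: "s \<in> carrier F" "r \<otimes>\<^bsub>F\<^esub> s = \<one>\<^bsub>F\<^esub>" using rU by (simp_all add: s_def)
    have "x \<otimes> \<iota> s \<oplus> \<sigma> (x \<otimes> \<iota> s) = (x \<oplus> \<sigma> x) \<otimes> \<iota> s"
      using x(1) s(1) central[of s "\<sigma> x"] by (simp add: H.star_mult fixed H.l_distr H.star_closed)
    also have "\<dots> = \<one>" using h.hom_mult[OF r(1) s(1)] s(2) by (simp add: r(2))
    finally show ?thesis using tn x(1) s(1) by (intro conjI ballI bexI[of _ "x \<otimes> \<iota> s"]) simp_all
  qed
  moreover have "\<sigma> \<one> = \<one>" using fixed[OF F.one_closed] by simp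
  ultimately show ?thesis using two H by (simp add: quadratic_algebra_def H.star_closed)
qed

section \<open>Generation by Bruhat elements\<close>

lemma (in involution_ring) bruhat_generation_star_local:
  assumes "star_local_ring R star"
  shows "generate (SL_star (matrix_ring n R) (matrix_star star)) (bruhat_elements (matrix_ring n R) (matrix_star star)) =
    carrier (SL_star (matrix_ring n R) (matrix_star star))"
proof -
  interpret A: involution_ring "matrix_ring n R" "matrix_star star" by (rule matrix_involution_ring)
  obtain J where J: "local_pivoting R star J {\<one>}" using star_local_pivoting[OF involution_ring_axioms assms] by blast
  show ?thesis
  proof (rule A.bruhat_generation)
    fix a c assume iso: "A.isotropic a c"
    then have "a \<in> carrier (matrix_ring n R)" "c \<in> carrier (matrix_ring n R)" by (auto simp: A.isotropic_def)
    then show "A.bruhat_column a c"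
      using local_pivoting.bruhat_column_local[OF J iso]
      by (simp add: scalar_matrix_one A.localise_def A.minus_eq A.r_neg)
  qed
qed

lemma (in central_exchange) bruhat_generation_exchange:
  assumes "\<And>M. maximal_in_S M \<Longrightarrow> \<exists>J. local_pivoting R star J (idempotents_off M)"
  shows "generate (SL_star (matrix_ring n R) (matrix_star star)) (bruhat_elements (matrix_ring n R) (matrix_star star)) =
    carrier (SL_star (matrix_ring n R) (matrix_star star))"
proof -
  interpret A: involution_ring "matrix_ring n R" "matrix_star star" by (rule matrix_involution_ring)
  show ?thesis by (rule A.bruhat_generation) (rule bruhat_column_patch[OF assms])
qed

lemma central_exchange_adeles:
  assumes R: "involution_ring R star" and F: "field F"
    and iso: "involution_ring_iso R star (adele_ring F) (\<lambda>x. x)"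
  shows "central_exchange R star (carrier R)"
proof -
  interpret R: involution_ring R star by (rule R)
  obtain \<phi> where \<phi>: "\<phi> \<in> ring_iso R (adele_ring F)" "\<And>x. x \<in> carrier R \<Longrightarrow> \<phi> (star x) = \<phi> x"
    using iso by (auto simp: involution_ring_iso_def)
  interpret A: cring "adele_ring F" by (rule adele_cring[OF F])
  have bij: "bij_betw \<phi> (carrier R) (carrier (adele_ring F))" using \<phi>(1) by (simp add: ring_iso_def)
  have inj: "x = y" if "\<phi> x = \<phi> y" "x \<in> carrier R" "y \<in> carrier R" for x y
    using that bij_betw_imp_inj_on[OF bij] by (simp add: inj_on_eq_iff)
  have star: "star x = x" if "x \<in> carrier R" for x
    by (rule inj) (use that \<phi>(2) R.star_closed in simp_all)
  have comm: "x \<otimes>\<^bsub>R\<^esub> y = y \<otimes>\<^bsub>R\<^esub> x" if "x \<in> carrier R" "y \<in> carrier R" for x y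
    using R.star_mult[OF that] that by (simp add: star)
  define \<psi> where "\<psi> = inv_into (carrier R) \<phi>"
  have \<psi>: "\<psi> \<in> ring_iso (adele_ring F) R" unfolding \<psi>_def by (rule ring_iso_set_sym[OF R.ring_axioms \<phi>(1)])
  then have image: "\<psi> ` carrier (adele_ring F) = carrier R" by (simp add: ring_iso_def bij_betw_def)
  have "central_exchange R star (\<psi> ` carrier (adele_ring F))"
  proof (rule central_exchange_image[OF R adele_exchange_ring[OF F]])
    show "\<psi> \<in> ring_hom (adele_ring F) R" using \<psi> by (simp add: ring_iso_def)
  qed (use image star comm in blast)+
  then show ?thesis by (simp only: image)
qed

theorem theorem4p3p1:
  fixes R :: "'r ring" and star :: "'r \<Rightarrow> 'r" and n :: nat
  assumes "involution_ring R star"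
    and "star_local_ring R star \<or>
      (\<exists>F :: 'f ring. global_field F \<and> involution_ring_iso R star (adele_ring F) (\<lambda>x. x)) \<or>
      (\<exists>(F :: 'g ring) (E :: 'e ring) \<iota> \<alpha>.
         global_field F \<and> global_field E \<and> separable_quadratic_extension F E \<iota> \<and>
         \<alpha> \<in> galois_group F E \<iota> \<and> (\<exists>x \<in> carrier E. \<alpha> x \<noteq> x) \<and>
         involution_ring_iso R star (adele_algebra F E \<iota>) (adele_algebra_star F E \<iota> \<alpha>)) \<or>
      (\<exists>(F :: 'k ring) (H :: 'h ring) \<iota> \<sigma>.
         global_field F \<and> ring_characteristic F = 2 \<and>
         quaternion_algebra F H \<iota> \<and> quaternionic_involution F H \<iota> \<sigma> \<and>
         involution_ring_iso R star (adele_algebra F H \<iota>) (adele_algebra_star F H \<iota> \<sigma>))"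
    and "n \<ge> 1"
  shows "generate (SL_star (matrix_ring n R) (matrix_star star))
           (bruhat_elements (matrix_ring n R) (matrix_star star)) =
         carrier (SL_star (matrix_ring n R) (matrix_star star))"
proof -
  interpret R: involution_ring R star by (rule assms(1))
  have quadratic: ?thesis if "\<exists>S. quadratic_exchange R star S"
  proof -
    from that obtain S where "quadratic_exchange R star S" by blast
    then interpret quadratic_exchange R star S .
    show ?thesis by (rule bruhat_generation_exchange) (use pivoting_quadratic in blast)
  qed
  from assms(2) show ?thesis
  proof (elim disjE exE conjE)
    assume "star_local_ring R star"
    then show ?thesis by (rule R.bruhat_generation_star_local)
  next
    fix F :: "'f ring"
    assume "global_field F" and iso: "involution_ring_iso R star (adele_ring F) (\<lambda>x. x)"
    then have F: "field F" by (auto simp: global_field_def number_field_def finite_function_field_def)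
    interpret central_exchange R star "carrier R" by (rule central_exchange_adeles[OF assms(1) F iso])
    show ?thesis by (rule bruhat_generation_exchange[OF pivoting_trivial_involution]) simp_all
  next
    fix F :: "'g ring" and E :: "'e ring" and \<iota> \<alpha>
    assume ext: "separable_quadratic_extension F E \<iota>" "\<alpha> \<in> galois_group F E \<iota>" "\<exists>x\<in>carrier E. \<alpha> x \<noteq> x"
      and iso: "involution_ring_iso R star (adele_algebra F E \<iota>) (adele_algebra_star F E \<iota> \<alpha>)"
    have "field F" "\<iota> \<in> ring_hom F E" using ext(1) by (simp_all add: separable_quadratic_extension_def)
    then show ?thesis
      using quadratic_tensor_exchange[OF assms(1) adele_exchange_ring _ quadratic_extension_algebra[OF ext]]
        iso unfolding adele_algebra_def adele_algebra_star_def by (intro quadratic) blast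
  next
    fix F :: "'k ring" and H :: "'h ring" and \<iota> \<sigma>
    assume quat: "quaternion_algebra F H \<iota>" "quaternionic_involution F H \<iota> \<sigma>" "ring_characteristic F = 2"
      and iso: "involution_ring_iso R star (adele_algebra F H \<iota>) (adele_algebra_star F H \<iota> \<sigma>)"
    have "field F" "\<iota> \<in> ring_hom F H" using quat(1) by (simp_all add: quaternion_algebra_def algebra_map_def)
    then show ?thesis
      using quadratic_tensor_exchange[OF assms(1) adele_exchange_ring _ quaternion_quadratic_algebra[OF quat]]
        iso unfolding adele_algebra_def adele_algebra_star_def by (intro quadratic) blast
  qed
qed

end
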